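(* Let $\lambda,\mu,\theta\in(0,\infty)$, $T\in(0,\infty)$, and let $(X^n,Y^n)$, $n\in\mathbb{N}$, be the rescaled number-in-system and reneging-count processes on $[0,T]$ of the $n$-th M/M/1+M system defined in the context, with $(X^n(0),Y^n(0))=(x_n,0)$ and $x_n\to x_0$ as $n\to\infty$. Then the sequence $\{(X^n,Y^n)\}_{n\in\mathbb{N}}$ satisfies a large deviation principle (with speed $n$) on $\mathcal{D}([0,T]:\mathbb{R}_+^2)$ with rate function $I_T$ defined in the context.
   Context: $\mathcal{D}([0,T]:\mathbb{R}^d)$ (resp. $\mathcal{C}([0,T]:\mathbb{R}^d)$) is the space of right continuous functions with left limits (resp. continuous functions) from $[0,T]$ to $\mathbb{R}^d$, with the Skorohod (resp. uniform) topology. A function $I:\mathcal{E}\to[0,\infty]$ on a Polish space $\mathcal{E}$ is called a rate function if $\{x: I(x)\le m\}$ is compact for every $m<\infty$. Processes. For each $n$ let $N_1^n,N_2^n,N_3^n$ be mutually independent Poisson random measures on $[0,T]$, $[0,T]$, $[0,T]\times\mathbb{R}_+$ with intensities $n\lambda\,ds$, $n\mu\,ds$, $n\theta\,ds\,dy$ respectively. Let $x_n\ge 0$ with $nx_n\in\mathbb{Z}_+$, and $x_n\to x_0\in\mathbb{R}_+$. The processes $(X^n,Y^n)$ are given by $$X^{n}(t)=x_{n}+\frac1n\int_{[0,t]}N_{1}^{n}(ds)-\frac1n\int_{[0,t]}\mathbf{1}_{\{X^{n}(s-)\neq 0\}}N_{2}^{n}(ds)-Y^n(t),$$ $$Y^{n}(t)=\frac1n\int_{[0,t]\times\mathbb{R}_+}\mathbf{1}_{[0,(X^{n}(s-)-\frac1n)^{+}]}(y)\,N_{3}^{n}(ds\,dy),\quad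 t\in[0,T].$$ (That is, $nX^n$ is the number of customers in a single server queue with arrival rate $\lambda n$, service rate $\mu n$ and per-customer reneging rate $\theta$ for customers waiting in the queue; $nY^n$ is the cumulative number of reneging customers.) Rate function. Let $\ell(x)=x\log x-x+1$ for $x\ge 0$ (with $\ell(0)=1$), and let $\Gamma$ be the one-dimensional Skorohod map $\Gamma(\psi)(t)=\psi(t)-\inf_{0\le s\le t}[\psi(s)\wedge 0]$. For $(\xi,\zeta)\in\mathcal{C}([0,T]:\mathbb{R}_+^2)$ let $\mathcal{U}(\xi,\zeta)$ be the collection of all $\varphi=(\varphi_1,\varphi_2,\varphi_3)$ of measurable maps $\varphi_i:[0,T]\to\mathbb{R}_+$ such that for all $t\in[0,T]$ $$\xi(t)=\Gamma\Big(x_0+\lambda\int_0^{\cdot}\varphi_1(s)ds-\mu\int_0^{\cdot}\varphi_2(s)ds-\theta\int_0^{\cdot}\varphi_3(s)\xi(s)ds\Big)(t),\qquad \zeta(t)=\theta\int_0^t\varphi_3(s)\xi(s)ds.$$ Define $$I_T(\xi,\zeta)=\inf_{\varphi\in\mathcal{U}(\xi,\zeta)}\Big\{\lambda\int_0^T\ell(\varphi_1(s))ds+\mu\int_0^T\ell(\varphi_2(s))ds+\theta\int_0^T\xi(s)\ell(\varphi_3(s))ds\Big\},$$ with $I_T(\xi,\zeta)=\infty$ if $\mathcal{U}(\xi,\zeta)=\emptyset$ or $(\xi,\zeta)\in\mathcal{D}([0,T]:\mathbb{R}_+^2)\setminus\mathcal{C}([0,T]:\mathbb{R}_+^2)$.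 *)

theory Defs
  imports "HOL-Probability.Probability"
begin

section \<open>Cadlag paths and the Skorohod topology\<close>

text \<open>Paths on \<open>[0,T]\<close> are extensional functions, so that equality of paths is equality of
  functions.\<close>

definition cadlag_space :: "real \<Rightarrow> 'a::topological_space set \<Rightarrow> (real \<Rightarrow> 'a) set" where
  "cadlag_space T S =
     {f \<in> {0..T} \<rightarrow>\<^sub>E S.
        (\<forall>t\<in>{0..<T}. (f \<longlongrightarrow> f t) (at_right t)) \<and>
        (\<forall>t\<in>{0<..T}. \<exists>l\<in>S. (f \<longlongrightarrow> l) (at_left t))}"

text \<open>Monotone surjections of an interval are automatically continuous.\<close>

definition time_changes :: "real \<Rightarrow> (real \<Rightarrow> real) set" where
  "time_changes T = {\<gamma>. strict_mono_on {0..T} \<gamma> \<and> \<gamma> ` {0..T} = {0..T}}"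

text \<open>Skorohod's \<open>J\<^sub>1\<close> metric (the incomplete version): the infimum over time changes \<open>\<gamma>\<close> of
  the larger of the sup distances of \<open>\<gamma>\<close> from the identity and of \<open>f\<close> from \<open>g \<circ> \<gamma>\<close>.\<close>

definition skorohod_edist :: "real \<Rightarrow> (real \<Rightarrow> 'a::metric_space) \<Rightarrow> (real \<Rightarrow> 'a) \<Rightarrow> ennreal" where
  "skorohod_edist T f g =
     (INF \<gamma>\<in>time_changes T. SUP t\<in>{0..T}. ennreal (max \<bar>\<gamma> t - t\<bar> (dist (f t) (g (\<gamma> t)))))"

definition skorohod_dist :: "real \<Rightarrow> (real \<Rightarrow> 'a::metric_space) \<Rightarrow> (real \<Rightarrow> 'a) \<Rightarrow> real" where
  "skorohod_dist T f g = enn2real (skorohod_edist T f g)"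

definition skorohod_topology :: "real \<Rightarrow> 'a::metric_space set \<Rightarrow> (real \<Rightarrow> 'a) topology" where
  "skorohod_topology T S = Metric_space.mtopology (cadlag_space T S) (skorohod_dist T)"

lemma id_time_change: "(\<lambda>t. t) \<in> time_changes T"
  by (auto simp: time_changes_def strict_mono_on_def)

lemma time_change_mem: "\<gamma> \<in> time_changes T \<Longrightarrow> t \<in> {0..T} \<Longrightarrow> \<gamma> t \<in> {0..T}"
  by (auto simp: time_changes_def)

lemma time_change_comp:
  assumes "\<gamma> \<in> time_changes T" "\<delta> \<in> time_changes T"
  shows "(\<lambda>t. \<gamma> (\<delta> t)) \<in> time_changes T"
proof -
  have "strict_mono_on {0..T} (\<lambda>t. \<gamma> (\<delta> t))"
  proof (rule strict_mono_onI)
    fix r s assume rs: "r \<in> {0..T}" "s \<in> {0..T}" "r < s"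
    have "\<delta> r < \<delta> s"
      using assms(2) rs unfolding time_changes_def by (blast dest: strict_mono_onD)
    then show "\<gamma> (\<delta> r) < \<gamma> (\<delta> s)"
      using assms(1) time_change_mem[OF assms(2) rs(1)] time_change_mem[OF assms(2) rs(2)]
      unfolding time_changes_def by (blast dest: strict_mono_onD)
  qed
  moreover have "(\<lambda>t. \<gamma> (\<delta> t)) ` {0..T} = {0..T}"
    using assms image_image[of \<gamma> \<delta> "{0..T}"] by (simp add: time_changes_def)
  ultimately show ?thesis by (simp add: time_changes_def)
qed

lemma time_change_inv:
  assumes "\<gamma> \<in> time_changes T"
  shows "inv_into {0..T} \<gamma> \<in> time_changes T"
    and "\<And>t. t \<in> {0..T} \<Longrightarrow> \<gamma> (inv_into {0..T} \<gamma> t) = t"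
    and "\<And>t. t \<in> {0..T} \<Longrightarrow> inv_into {0..T} \<gamma> (\<gamma> t) = t"
proof -
  have sm: "strict_mono_on {0..T} \<gamma>" and im: "\<gamma> ` {0..T} = {0..T}"
    using assms by (auto simp: time_changes_def)
  have inj: "inj_on \<gamma> {0..T}"
    using sm by (rule strict_mono_on_imp_inj_on)
  show r: "\<gamma> (inv_into {0..T} \<gamma> t) = t" if "t \<in> {0..T}" for t
    using that im by (intro f_inv_into_f) auto
  show l: "inv_into {0..T} \<gamma> (\<gamma> t) = t" if "t \<in> {0..T}" for t
    using that inj by (rule inv_into_f_f[rotated])
  have mem: "inv_into {0..T} \<gamma> t \<in> {0..T}" if "t \<in> {0..T}" for t
    using that im by (intro inv_into_into) auto
  have "inv_into {0..T} \<gamma> s < inv_into {0..T} \<gamma> t"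
    if "s \<in> {0..T}" "t \<in> {0..T}" "s < t" for s t
  proof (rule ccontr)
    assume "\<not> ?thesis"
    then have "inv_into {0..T} \<gamma> t \<le> inv_into {0..T} \<gamma> s" by simp
    then have "\<gamma> (inv_into {0..T} \<gamma> t) \<le> \<gamma> (inv_into {0..T} \<gamma> s)"
      using sm mem[OF that(1)] mem[OF that(2)]
      by (metis strict_mono_on_leD)
    then show False using r that by simp
  qed
  then have "strict_mono_on {0..T} (inv_into {0..T} \<gamma>)"
    by (auto simp: strict_mono_on_def)
  moreover have "inv_into {0..T} \<gamma> ` {0..T} = {0..T}"
  proof
    show "inv_into {0..T} \<gamma> ` {0..T} \<subseteq> {0..T}" using mem by blast
    show "{0..T} \<subseteq> inv_into {0..T} \<gamma> ` {0..T}"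
    proof
      fix t assume "t \<in> {0..T}"
      then show "t \<in> inv_into {0..T} \<gamma> ` {0..T}"
        using l[of t] time_change_mem[OF assms, of t] by (metis image_eqI)
    qed
  qed
  ultimately show "inv_into {0..T} \<gamma> \<in> time_changes T"
    by (simp add: time_changes_def)
qed

lemma skorohod_edist_lessE:
  assumes "skorohod_edist T f g < ennreal e"
  obtains \<gamma> where "\<gamma> \<in> time_changes T"
    "\<And>t. t \<in> {0..T} \<Longrightarrow> \<bar>\<gamma> t - t\<bar> < e" "\<And>t. t \<in> {0..T} \<Longrightarrow> dist (f t) (g (\<gamma> t)) < e"
proof -
  obtain \<gamma> where g: "\<gamma> \<in> time_changes T"
    and l: "(SUP t\<in>{0..T}. ennreal (max \<bar>\<gamma> t - t\<bar> (dist (f t) (g (\<gamma> t))))) < ennreal e"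
    using assms unfolding skorohod_edist_def INF_less_iff by blast
  have "max \<bar>\<gamma> t - t\<bar> (dist (f t) (g (\<gamma> t))) < e" if "t \<in> {0..T}" for t
  proof -
    have "ennreal (max \<bar>\<gamma> t - t\<bar> (dist (f t) (g (\<gamma> t)))) < ennreal e"
      using l that by (meson SUP_upper le_less_trans)
    then show ?thesis by (subst (asm) ennreal_less_iff) auto
  qed
  with g show ?thesis by (intro that[of \<gamma>]) auto
qed

lemma skorohod_edist_leI:
  assumes "\<gamma> \<in> time_changes T"
    "\<And>t. t \<in> {0..T} \<Longrightarrow> \<bar>\<gamma> t - t\<bar> \<le> e" "\<And>t. t \<in> {0..T} \<Longrightarrow> dist (f t) (g (\<gamma> t)) \<le> e"
  shows "skorohod_edist T f g \<le> ennreal e"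
  unfolding skorohod_edist_def
  by (rule INF_lower2[OF assms(1)]) (auto intro!: SUP_least ennreal_leI assms(2,3))

lemma skorohod_edist_le_swap: "skorohod_edist T f g \<le> skorohod_edist T g f"
proof -
  have "skorohod_edist T f g \<le>
      (SUP t\<in>{0..T}. ennreal (max \<bar>\<gamma> t - t\<bar> (dist (g t) (f (\<gamma> t)))))" (is "_ \<le> ?S")
    if g: "\<gamma> \<in> time_changes T" for \<gamma>
    unfolding skorohod_edist_def
  proof (rule INF_lower2[OF time_change_inv(1)[OF g]], rule SUP_least)
    fix t assume t: "t \<in> {0..T}"
    let ?s = "inv_into {0..T} \<gamma> t"
    have s: "?s \<in> {0..T}" using time_change_mem[OF time_change_inv(1)[OF g] t] .
    have "ennreal (max \<bar>\<gamma> ?s - ?s\<bar> (dist (g ?s) (f (\<gamma> ?s)))) \<le> ?S"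
      using s by (intro SUP_upper)
    then show "ennreal (max \<bar>?s - t\<bar> (dist (f t) (g ?s))) \<le> ?S"
      using time_change_inv(2)[OF g t] by (simp add: dist_commute abs_minus_commute)
  qed
  then show ?thesis
    unfolding skorohod_edist_def[of T g f] by (intro INF_greatest)
qed

lemma cadlag_bounded:
  fixes f :: "real \<Rightarrow> 'a::metric_space"
  assumes f: "f \<in> cadlag_space T S" and T: "0 \<le> T"
  shows "bounded (f ` {0..T})"
proof -
  have "bounded (f ` ({0..T} \<inter> {0..T}))"
    using T
  proof (induction rule: Bolzano[where P="\<lambda>a b. bounded (f ` ({a..b} \<inter> {0..T}))"])
    case (trans a b c)
    have "f ` ({a..c} \<inter> {0..T}) \<subseteq> f ` ({a..b} \<inter> {0..T}) \<union> f ` ({b..c} \<inter> {0..T})"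
      unfolding image_Un[symmetric] by (rule image_mono) auto
    then show ?case using trans(1,2) bounded_subset bounded_Un by metis
  next
    case (local x)
    obtain d1 where d1: "d1 > 0" "\<And>s. s \<in> {0..T} \<Longrightarrow> x < s \<Longrightarrow> s < x + d1 \<Longrightarrow> dist (f s) (f x) < 1"
    proof (cases "x < T")
      case True
      then have "(f \<longlongrightarrow> f x) (at_right x)" using f local by (auto simp: cadlag_space_def)
      then have "\<forall>\<^sub>F s in at_right x. dist (f s) (f x) < 1" by (rule tendstoD) simp
      then obtain b where "b > x" "\<And>s. x < s \<Longrightarrow> s < b \<Longrightarrow> dist (f s) (f x) < 1"
        unfolding eventually_at_right_field by auto
      then show ?thesis by (intro that[of "b - x"]) auto
    qed (use that[of 1] in auto)
    obtain d2 l where d2: "d2 > 0" "\<And>s. s \<in> {0..T} \<Longrightarrow> s < x \<Longrightarrow> x - d2 < s \<Longrightarrow> dist (f s) l < 1"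
    proof (cases "0 < x")
      case True
      then have "x \<in> {0<..T}" using local by simp
      then obtain l where "(f \<longlongrightarrow> l) (at_left x)" using f unfolding cadlag_space_def by blast
      then have "\<forall>\<^sub>F s in at_left x. dist (f s) l < 1" by (rule tendstoD) simp
      then obtain b where "b < x" "\<And>s. b < s \<Longrightarrow> s < x \<Longrightarrow> dist (f s) l < 1"
        unfolding eventually_at_left_field by auto
      then show ?thesis by (intro that[of "x - b" l]) auto
    qed (use that[of 1] in auto)
    show ?case
    proof (intro exI[of _ "min d1 d2"] conjI allI impI)
      show "0 < min d1 d2" using d1 d2 by simp
      fix a b assume ab: "a \<le> x \<and> x \<le> b \<and> b - a < min d1 d2"
      have "f ` ({a..b} \<inter> {0..T}) \<subseteq> ball (f x) 1 \<union> ball l 1 \<union> {f x}"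
      proof
        fix y assume "y \<in> f ` ({a..b} \<inter> {0..T})"
        then obtain s where s: "y = f s" "a \<le> s" "s \<le> b" "s \<in> {0..T}" by auto
        consider "s < x" | "s = x" | "x < s" by linarith
        then show "y \<in> ball (f x) 1 \<union> ball l 1 \<union> {f x}"
        proof cases
          case 1 then show ?thesis using d2(2)[of s] ab s by (auto simp: dist_commute)
        next
          case 3 then show ?thesis using d1(2)[of s] ab s by (auto simp: dist_commute)
        qed (use s in auto)
      qed
      then show "bounded (f ` ({a..b} \<inter> {0..T}))"
        by (rule bounded_subset[rotated]) simp
    qed
  qed
  then show ?thesis by simp
qed

lemma skorohod_edist_finite:
  assumes "f \<in> cadlag_space T S" "g \<in> cadlag_space T S" "0 \<le> T"
  shows "skorohod_edist T f g < \<infinity>"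
proof -
  have "bounded (f ` {0..T} \<union> g ` {0..T})"
    using assms by (simp add: cadlag_bounded)
  then obtain e where e: "\<And>x y. x \<in> f ` {0..T} \<union> g ` {0..T} \<Longrightarrow> y \<in> f ` {0..T} \<union> g ` {0..T} \<Longrightarrow> dist x y \<le> e"
    unfolding bounded_two_points by blast
  have "skorohod_edist T f g \<le> ennreal (max 0 e)"
    by (rule skorohod_edist_leI[OF id_time_change]) (auto intro!: e max.coboundedI2)
  then show ?thesis by (simp add: le_less_trans)
qed

lemma Metric_space_skorohod:
  assumes T: "0 \<le> T"
  shows "Metric_space (cadlag_space T S) (skorohod_dist T)"
proof
  fix f g :: "real \<Rightarrow> 'a"
  show "0 \<le> skorohod_dist T f g" by (simp add: skorohod_dist_def)
  show "skorohod_dist T f g = skorohod_dist T g f"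
    by (simp add: skorohod_dist_def antisym[OF skorohod_edist_le_swap skorohod_edist_le_swap])
next
  fix f g assume f: "f \<in> cadlag_space T S" and g: "g \<in> cadlag_space T S"
  show "skorohod_dist T f g = 0 \<longleftrightarrow> f = g"
  proof
    assume "f = g"
    then have "skorohod_edist T f g \<le> ennreal 0"
      by (intro skorohod_edist_leI[OF id_time_change]) auto
    then show "skorohod_dist T f g = 0" by (simp add: skorohod_dist_def)
  next
    assume "skorohod_dist T f g = 0"
    then have z: "skorohod_edist T f g = 0"
      using skorohod_edist_finite[OF f g T] by (auto simp: skorohod_dist_def enn2real_eq_0_iff)
    have near: "\<exists>\<gamma>\<in>time_changes T. (\<forall>t\<in>{0..T}. \<bar>\<gamma> t - t\<bar> < e \<and> dist (f t) (g (\<gamma> t)) < e)"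
      if "e > 0" for e
      using skorohod_edist_lessE[of T f g e] z that by (metis ennreal_less_zero_iff)
    have eq: "f t = g t" if t: "t \<in> {0..<T}" for t
    proof -
      have "dist (f t) (g t) \<le> e" if e: "e > 0" for e
      proof -
        have "(f \<longlongrightarrow> f t) (at_right t)" "(g \<longlongrightarrow> g t) (at_right t)"
          using f g t by (auto simp: cadlag_space_def)
        then have "\<forall>\<^sub>F s in at_right t. dist (f s) (f t) < e/3" "\<forall>\<^sub>F s in at_right t. dist (g s) (g t) < e/3"
          using e by (simp_all only: tendsto_iff divide_pos_pos zero_less_numeral)
        then have "\<forall>\<^sub>F s in at_right t. dist (f s) (f t) < e/3 \<and> dist (g s) (g t) < e/3"
          by (rule eventually_conj)
        then obtain b where b: "b > t" "\<And>s. t < s \<Longrightarrow> s < b \<Longrightarrow> dist (f s) (f t) < e/3 \<and> dist (g s) (g t) < e/3"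
          unfolding eventually_at_right_field by auto
        define d where "d = (min b T - t) / 2"
        have d: "d > 0" using b t by (auto simp: d_def)
        have s: "t < t + d" "t + d < b" "t + d \<in> {0..T}" "t + 2 * d \<le> b"
          using b t by (auto simp: d_def min_def field_simps split: if_splits)
        obtain \<gamma> where ga: "\<bar>\<gamma> (t+d) - (t+d)\<bar> < min d (e/3)" "dist (f (t+d)) (g (\<gamma> (t+d))) < min d (e/3)"
        proof -
          have "0 < min d (e/3)" using d e by simp
          then show ?thesis using near[of "min d (e/3)"] s(3) that by blast
        qed
        have "t < \<gamma> (t+d)" "\<gamma> (t+d) < b" using ga(1) s by (auto simp: abs_less_iff)
        then have "dist (g (\<gamma> (t+d))) (g t) < e/3" using b by blast
        moreover have "dist (f (t+d)) (f t) < e/3" using b(2) s by blast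
        ultimately show ?thesis
          using ga(2) dist_triangle[of "f t" "g t" "g (\<gamma> (t+d))"]
            dist_triangle[of "f t" "g (\<gamma> (t+d))" "f (t+d)"]
          by (simp add: dist_commute)
      qed
      then show ?thesis using field_le_epsilon[of "dist (f t) (g t)" 0] by simp
    qed
    have eqT: "f T = g T"
    proof -
      have "\<gamma> T = T" if ch: "\<gamma> \<in> time_changes T" for \<gamma>
      proof -
        obtain s where s: "s \<in> {0..T}" "\<gamma> s = T"
          using time_change_inv(2)[OF ch, of T] time_change_mem[OF time_change_inv(1)[OF ch], of T] T
          by (meson atLeastAtMost_iff order_refl)
        have "\<gamma> s \<le> \<gamma> T"
          using ch s T by (auto simp: time_changes_def intro: strict_mono_on_leD)
        then show ?thesis using s time_change_mem[OF ch, of T] T by auto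
      qed
      then have "dist (f T) (g T) \<le> e" if "e > 0" for e
        using near[OF that] T by (metis atLeastAtMost_iff less_imp_le order_refl)
      then show ?thesis using field_le_epsilon[of "dist (f T) (g T)" 0] by simp
    qed
    show "f = g"
    proof
      fix t show "f t = g t"
      proof (cases "t \<in> {0..T}")
        case True then show ?thesis using eq[of t] eqT by (cases "t = T") auto
      next
        case False
        have "f \<in> extensional {0..T}" "g \<in> extensional {0..T}"
          using f g by (auto simp: cadlag_space_def PiE_def)
        then show ?thesis using False by (simp add: extensional_def)
      qed
    qed
  qed
next
  fix f g h assume fgh: "f \<in> cadlag_space T S" "g \<in> cadlag_space T S" "h \<in> cadlag_space T S"
  have fin: "skorohod_edist T f g < \<infinity>" "skorohod_edist T g h < \<infinity>"
    by (rule skorohod_edist_finite[OF fgh(1,2) T], rule skorohod_edist_finite[OF fgh(2,3) T])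
  have lt: "skorohod_edist T u v < ennreal (skorohod_dist T u v + e)"
    if "skorohod_edist T u v < \<infinity>" "e > 0" for u v :: "real \<Rightarrow> 'a" and e
  proof -
    have "skorohod_edist T u v = ennreal (skorohod_dist T u v)"
      using that by (simp add: skorohod_dist_def less_top)
    then show ?thesis using that by (simp add: ennreal_less_iff skorohod_dist_def)
  qed
  show "skorohod_dist T f h \<le> skorohod_dist T f g + skorohod_dist T g h"
  proof (rule field_le_epsilon)
    fix e :: real assume e: "e > 0"
    let ?a = "skorohod_dist T f g + e/2" and ?b = "skorohod_dist T g h + e/2"
    obtain \<gamma> where \<gamma>: "\<gamma> \<in> time_changes T" "\<And>t. t \<in> {0..T} \<Longrightarrow> \<bar>\<gamma> t - t\<bar> < ?a"
        "\<And>t. t \<in> {0..T} \<Longrightarrow> dist (f t) (g (\<gamma> t)) < ?a"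
      by (rule skorohod_edist_lessE[OF lt[OF fin(1) half_gt_zero[OF e]]]) blast
    obtain \<delta> where \<delta>: "\<delta> \<in> time_changes T" "\<And>t. t \<in> {0..T} \<Longrightarrow> \<bar>\<delta> t - t\<bar> < ?b"
        "\<And>t. t \<in> {0..T} \<Longrightarrow> dist (g t) (h (\<delta> t)) < ?b"
      by (rule skorohod_edist_lessE[OF lt[OF fin(2) half_gt_zero[OF e]]]) blast
    have "skorohod_edist T f h \<le> ennreal (?a + ?b)"
    proof (rule skorohod_edist_leI[OF time_change_comp[OF \<delta>(1) \<gamma>(1)]])
      fix t assume t: "t \<in> {0..T}"
      have t': "\<gamma> t \<in> {0..T}" using time_change_mem[OF \<gamma>(1) t] .
      show "\<bar>\<delta> (\<gamma> t) - t\<bar> \<le> ?a + ?b" using \<gamma>(2)[OF t] \<delta>(2)[OF t'] by linarith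
      show "dist (f t) (h (\<delta> (\<gamma> t))) \<le> ?a + ?b"
        using \<gamma>(3)[OF t] \<delta>(3)[OF t'] dist_triangle[of "f t" "h (\<delta> (\<gamma> t))" "g (\<gamma> t)"] by linarith
    qed
    then have "skorohod_dist T f h \<le> ?a + ?b"
      unfolding skorohod_dist_def[of T f h]
      using e by (intro enn2real_leI) (auto simp: skorohod_dist_def)
    then show "skorohod_dist T f h \<le> skorohod_dist T f g + skorohod_dist T g h + e" by simp
  qed
qed

section \<open>Large deviation principles\<close>

definition borel_of :: "'a topology \<Rightarrow> 'a measure" where
  "borel_of X = sigma (topspace X) {U. openin X U}"

definition rate_function :: "'a topology \<Rightarrow> ('a \<Rightarrow> ennreal) \<Rightarrow> bool" where
  "rate_function X I \<longleftrightarrow> (\<forall>m<\<infinity>. compactin X {x \<in> topspace X. I x \<le> m})"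

text \<open>The logarithm of a probability; note that \<^term>\<open>ln (0::real) = 0\<close> in the library.\<close>

definition elog :: "real \<Rightarrow> ereal" where
  "elog p = (if p = 0 then - \<infinity> else ereal (ln p))"

text \<open>Speed \<open>n\<close>. The random elements \<open>Z n\<close> may live on different probability spaces \<open>M n\<close>; only
  indices \<open>n \<ge> 1\<close> matter.\<close>

definition large_deviation_principle ::
  "'a topology \<Rightarrow> (nat \<Rightarrow> 'w measure) \<Rightarrow> (nat \<Rightarrow> 'w \<Rightarrow> 'a) \<Rightarrow> ('a \<Rightarrow> ennreal) \<Rightarrow> bool" where
  "large_deviation_principle X M Z I \<longleftrightarrow>
     rate_function X I \<and>
     (\<forall>F. closedin X F \<longrightarrow>
        limsup (\<lambda>n. ereal (1 / real n) * elog (measure (M n) {\<omega> \<in> space (M n). Z n \<omega> \<in> F}))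
          \<le> - (INF x\<in>F. enn2ereal (I x))) \<and>
     (\<forall>G. openin X G \<longrightarrow>
        - (INF x\<in>G. enn2ereal (I x))
          \<le> liminf (\<lambda>n. ereal (1 / real n) * elog (measure (M n) {\<omega> \<in> space (M n). Z n \<omega> \<in> G})))"

section \<open>Poisson random measures\<close>

definition poisson_random_measure :: "'w measure \<Rightarrow> 'a measure \<Rightarrow> ('w \<Rightarrow> 'a measure) \<Rightarrow> bool" where
  "poisson_random_measure M \<nu> N \<longleftrightarrow>
     (\<forall>\<omega>\<in>space M. sets (N \<omega>) = sets \<nu>) \<and>
     (\<forall>A\<in>sets \<nu>. (\<lambda>\<omega>. emeasure (N \<omega>) A) \<in> borel_measurable M) \<and>
     (\<forall>A\<in>sets \<nu>. emeasure \<nu> A < \<infinity> \<longrightarrow>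
        (\<forall>k::nat. measure M {\<omega> \<in> space M. emeasure (N \<omega>) A = of_nat k} =
           measure \<nu> A ^ k / fact k * exp (- measure \<nu> A))) \<and>
     (\<forall>(J::nat set) A. finite J \<longrightarrow> A ` J \<subseteq> sets \<nu> \<longrightarrow> disjoint_family_on A J \<longrightarrow>
        prob_space.indep_vars M (\<lambda>_. borel) (\<lambda>j \<omega>. emeasure (N \<omega>) (A j)) J)"

text \<open>The \<open>\<sigma>\<close>-algebra generated by a random measure with values in the measures on the
  measurable space of \<open>\<nu>\<close>.\<close>

definition random_measure_events :: "'w measure \<Rightarrow> 'a measure \<Rightarrow> ('w \<Rightarrow> 'a measure) \<Rightarrow> 'w set set" where
  "random_measure_events M \<nu> N =
     sigma_sets (space M) {{\<omega> \<in> space M. emeasure (N \<omega>) A \<in> B} | A B. A \<in> sets \<nu> \<and> B \<in> sets borel}"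

section \<open>The M/M/1+M queue\<close>

definition time_intensity :: "real \<Rightarrow> real \<Rightarrow> real measure" where
  "time_intensity c T = scale_measure (ennreal c) (restrict_space lborel {0..T})"

definition time_mark_intensity :: "real \<Rightarrow> real \<Rightarrow> (real \<times> real) measure" where
  "time_mark_intensity c T = scale_measure (ennreal c) (restrict_space lborel ({0..T} \<times> {0..}))"

definition mm1m_noise ::
  "'w measure \<Rightarrow> real \<Rightarrow> real \<Rightarrow> real \<Rightarrow> real \<Rightarrow> nat \<Rightarrow>
   ('w \<Rightarrow> real measure) \<Rightarrow> ('w \<Rightarrow> real measure) \<Rightarrow> ('w \<Rightarrow> (real \<times> real) measure) \<Rightarrow> bool" where
  "mm1m_noise M lam mu th T n N1 N2 N3 \<longleftrightarrow>
     poisson_random_measure M (time_intensity (real n * lam) T) N1 \<and>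
     poisson_random_measure M (time_intensity (real n * mu) T) N2 \<and>
     poisson_random_measure M (time_mark_intensity (real n * th) T) N3 \<and>
     prob_space.indep_sets M
       (\<lambda>i. [random_measure_events M (time_intensity (real n * lam) T) N1,
             random_measure_events M (time_intensity (real n * mu) T) N2,
             random_measure_events M (time_mark_intensity (real n * th) T) N3] ! i) {..<3}"

text \<open>The value at time \<open>0\<close> is a convention; the Poisson random measures almost surely do not charge
  that time.\<close>

definition left_limit :: "(real \<Rightarrow> real) \<Rightarrow> real \<Rightarrow> real" where
  "left_limit f s = (if s \<le> 0 then f 0 else Lim (at_left s) f)"

definition path_pair :: "real \<Rightarrow> (real \<Rightarrow> real) \<Rightarrow> (real \<Rightarrow> real) \<Rightarrow> real \<Rightarrow> real \<times> real" where
  "path_pair T f g = (\<lambda>t\<in>{0..T}. (f t, g t))"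

text \<open>The pathwise evolution equations; \<open>\<nu>1\<close>, \<open>\<nu>2\<close>, \<open>\<nu>3\<close> are realisations of the driving random
  measures and \<open>f\<close>, \<open>g\<close> the corresponding paths of \<open>X\<^sup>n\<close>, \<open>Y\<^sup>n\<close>.\<close>

definition mm1m_equations ::
  "real \<Rightarrow> nat \<Rightarrow> real \<Rightarrow> real measure \<Rightarrow> real measure \<Rightarrow> (real \<times> real) measure \<Rightarrow>
   (real \<Rightarrow> real) \<Rightarrow> (real \<Rightarrow> real) \<Rightarrow> bool" where
  "mm1m_equations T n xn \<nu>1 \<nu>2 \<nu>3 f g \<longleftrightarrow>
     (\<forall>t\<in>{0..T}.
        f t = xn + 1 / real n * (LINT s:{0..t}|\<nu>1. 1)
                 - 1 / real n * (LINT s:{0..t}|\<nu>2. indicator {s. left_limit f s \<noteq> 0} s) - g t \<and>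
        g t = 1 / real n * (LINT p:{0..t} \<times> {0..}|\<nu>3.
                 indicator {0..max 0 (left_limit f (fst p) - 1 / real n)} (snd p)))"

section \<open>The rate function\<close>

definition ell :: "real \<Rightarrow> real" where
  "ell x = x * ln x - x + 1"

lemma ell_0: "ell 0 = 1"
  by (simp add: ell_def)

definition skorohod_map :: "(real \<Rightarrow> real) \<Rightarrow> real \<Rightarrow> real" where
  "skorohod_map \<psi> t = \<psi> t - (INF s\<in>{0..t}. min (\<psi> s) 0)"

text \<open>The integrability conditions say that the integrals in the defining equations are meaningful;
  they must be explicit because the Bochner integral of a non-integrable function is \<open>0\<close>.\<close>

definition controls ::
  "real \<Rightarrow> real \<Rightarrow> real \<Rightarrow> real \<Rightarrow> real \<Rightarrow> (real \<Rightarrow> real) \<Rightarrow> (real \<Rightarrow> real) \<Rightarrow>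
   ((real \<Rightarrow> real) \<times> (real \<Rightarrow> real) \<times> (real \<Rightarrow> real)) set" where
  "controls lam mu th x0 T \<xi> \<zeta> =
     {(\<phi>1, \<phi>2, \<phi>3).
        (\<forall>\<phi>\<in>{\<phi>1, \<phi>2, \<phi>3}. \<phi> \<in> borel_measurable (restrict_space borel {0..T}) \<and> (\<forall>s\<in>{0..T}. 0 \<le> \<phi> s)) \<and>
        set_integrable lborel {0..T} \<phi>1 \<and>
        set_integrable lborel {0..T} \<phi>2 \<and>
        set_integrable lborel {0..T} (\<lambda>s. \<phi>3 s * \<xi> s) \<and>
        (\<forall>t\<in>{0..T}.
           \<xi> t = skorohod_map (\<lambda>r. x0 + lam * (LINT s:{0..r}|lborel. \<phi>1 s)
                                     - mu * (LINT s:{0..r}|lborel. \<phi>2 s)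
                                     - th * (LINT s:{0..r}|lborel. \<phi>3 s * \<xi> s)) t \<and>
           \<zeta> t = th * (LINT s:{0..t}|lborel. \<phi>3 s * \<xi> s))}"

definition control_cost ::
  "real \<Rightarrow> real \<Rightarrow> real \<Rightarrow> real \<Rightarrow> (real \<Rightarrow> real) \<Rightarrow>
   (real \<Rightarrow> real) \<times> (real \<Rightarrow> real) \<times> (real \<Rightarrow> real) \<Rightarrow> ennreal" where
  "control_cost lam mu th T \<xi> = (\<lambda>(\<phi>1, \<phi>2, \<phi>3).
     ennreal lam * (\<integral>\<^sup>+s\<in>{0..T}. ennreal (ell (\<phi>1 s)) \<partial>lborel) +
     ennreal mu * (\<integral>\<^sup>+s\<in>{0..T}. ennreal (ell (\<phi>2 s)) \<partial>lborel) +
     ennreal th * (\<integral>\<^sup>+s\<in>{0..T}. ennreal (\<xi> s * ell (\<phi>3 s)) \<partial>lborel))"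

definition mm1m_rate ::
  "real \<Rightarrow> real \<Rightarrow> real \<Rightarrow> real \<Rightarrow> real \<Rightarrow> (real \<Rightarrow> real \<times> real) \<Rightarrow> ennreal" where
  "mm1m_rate lam mu th x0 T z =
     (let \<xi> = (\<lambda>t. fst (z t)); \<zeta> = (\<lambda>t. snd (z t)) in
      if continuous_on {0..T} z
      then (INF \<phi>\<in>controls lam mu th x0 T \<xi> \<zeta>. control_cost lam mu th T \<xi> \<phi>)
      else \<infinity>)"

end

theory Submission
  imports Defs "HOL-Complex_Analysis.Great_Picard" "HOL-Real_Asymp.Real_Asymp"
begin

text \<open>
  \<open>X\<close> is the Skorohod reflection of \<open>x + A - S - Y\<close>, where \<open>A\<close>, \<open>S\<close>, \<open>Y\<close> are nondecreasing, and the cost of a path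
  is, by convex duality, the supremum over dyadic partitions of the relative entropies of the increments of
  \<open>(A, S, Y)\<close> with respect to \<open>(\<lambda> dt, \<mu> dt, \<theta> \<xi> dt)\<close>. A bound on these entropies makes the paths equicontinuous,
  passes to limits, and yields densities: the exponentials of minus one half of the dyadic densities are
  controlled in \<open>L\<^sup>2\<close> because the entropies increase along the partitions.

  Upper bound: the numbers of Poisson points in the cells of a space-time grid are independent, and the probability
  that their total entropy exceeds \<open>m\<close> is at most a power of \<open>n\<close> times \<open>exp (- n m)\<close>. Outside this event the
  path is close to a path of cost at most \<open>m\<close>, by compactness.

  Lower bound: prescribe the number of points in every cell, using only the marks below the target path when it is
  not small and forbidding all marks in a thin strip above. Where the target is small no customer reneges, which
  loses little reneging mass and can only push the queue upwards by that amount.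
\<close>

text \<open>The obstacle is that the reneging intensity \<open>th * \<xi>\<close> depends on the
  path: the marks that count lie below a moving level, and their number in a time cell is not
  Poisson. The upper bound therefore controls the entropy of all boxes of a deterministic grid. For
  a given realisation the boxes wholly below the level are selected, which only drops nonnegative
  terms; the boxes cut by the level form a strip of small measure, in which bounded entropy leaves
  few points.

  Entropy is used in the dual form \<open>b * x - (exp b - 1) * w\<close>, linear in the increment
  \<open>x\<close> and in the weight \<open>w\<close>. It passes to limits although the weight moves
  with the path, and it does not change when a test vector is copied to a finer grid. Tested with
  one large slope \<open>b\<close>, it yields equicontinuity, uniform integrability and the
  smallness of the strip.

  In the lower bound the tolerances are asymmetric: dropped reneging may lift the queue by
  \<open>\<kappa>\<close> above the target, but it falls short of it by at most
  \<open>\<eta>\<close>, which can be taken far smaller than the threshold \<open>\<delta>\<close>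
  below which reneging is dropped.\<close>

text \<open>At \<open>w = 0\<close> this has the right value only for \<open>x = 0\<close>, since \<open>x / 0 = 0\<close> and \<open>ln 0 = 0\<close>.\<close>

definition relent :: "real \<Rightarrow> real \<Rightarrow> real" where
  "relent x w = x * ln (x / w) - x + w"

text \<open>Legendre duality for the Poisson entropy: the bound \<open>exp u \<ge> 1 + u\<close> at
  \<open>u = b - ln (x / w)\<close>, multiplied by \<open>x\<close>. The last hypothesis excludes
  the pairs at which the true entropy is infinite while \<open>relent\<close> is finite.\<close>

lemma relent_dual:
  assumes "0 \<le> x" "0 \<le> w" "w = 0 \<Longrightarrow> x = 0"
  shows "b * x - w * (exp b - 1) \<le> relent x w"
proof (cases "x = 0")
  case True
  then show ?thesis using assms by (simp add: relent_def algebra_simps)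
next
  case False
  then have x: "0 < x" and w: "0 < w" using assms by (auto simp: less_le)
  define r where "r = ln (x / w)"
  have "w * exp b = x * exp (b - r)"
    using x w by (simp add: r_def exp_diff)
  moreover have "x * (1 + (b - r)) \<le> x * exp (b - r)"
    using x by (intro mult_left_mono exp_ge_add_one_self) auto
  ultimately show ?thesis
    by (simp add: relent_def r_def[symmetric] algebra_simps)
qed

lemma relent_nonneg: "0 \<le> x \<Longrightarrow> 0 < w \<Longrightarrow> 0 \<le> relent x w"
  using relent_dual[of x w 0] by simp

section \<open>Poisson estimates\<close>

definition poisson_weight :: "real \<Rightarrow> nat \<Rightarrow> real" where
  "poisson_weight c k = c ^ k / fact k * exp (- c)"

lemma poisson_weight_nonneg: "0 \<le> c \<Longrightarrow> 0 \<le> poisson_weight c k"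
  by (simp add: poisson_weight_def)

lemma poisson_weight_sums: "poisson_weight c sums 1"
proof -
  have "(\<lambda>k. c ^ k /\<^sub>R fact k) sums exp c" by (rule exp_converges)
  then have "(\<lambda>k. (c ^ k /\<^sub>R fact k) * exp (- c)) sums (exp c * exp (- c))"
    by (rule sums_mult2)
  then show ?thesis
    by (simp add: poisson_weight_def[abs_def] exp_minus divide_inverse mult.commute)
qed

text \<open>Half of Stirling's formula, with an error \<open>ln k + 1\<close> that disappears at
  speed \<open>n\<close>. The induction step rests on
  \<open>ln (k / (k + 1)) \<le> - 1 / (k + 1)\<close>.\<close>

lemma ln_fact_le: "ln (fact k) \<le> real k * ln k - k + ln k + 1"
proof (induction k)
  case (Suc k)
  show ?case
  proof (cases "k = 0")
    case False
    have "ln (real k / (real k + 1)) \<le> real k / (real k + 1) - 1"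
      using False by (intro ln_le_minus_one) auto
    then have "ln (real k) - ln (real k + 1) \<le> - 1 / (real k + 1)"
      using False by (simp add: ln_div field_simps)
    then have "(real k + 1) * (ln (real k) - ln (real k + 1)) \<le> (real k + 1) * (- 1 / (real k + 1))"
      by (intro mult_left_mono) auto
    then have *: "(real k + 1) * ln (real k) + 1 \<le> (real k + 1) * ln (real k + 1)"
      by (simp add: algebra_simps)
    have "ln (fact (Suc k)) = ln (real k + 1) + ln (fact k :: real)"
      by (simp add: ln_mult add.commute)
    then show ?thesis using Suc.IH * by (simp add: algebra_simps)
  qed simp
qed simp

text \<open>The other half of Stirling's formula: one term of the exponential series.\<close>

lemma power_div_fact_le_exp: "real k ^ k / fact k \<le> exp (real k)"
proof -
  have s: "(\<lambda>i. real k ^ i /\<^sub>R fact i) sums exp (real k)" by (rule exp_converges)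
  have "(\<Sum>i\<in>{k}. real k ^ i /\<^sub>R fact i) \<le> (\<Sum>i. real k ^ i /\<^sub>R fact i)"
    using s by (intro sum_le_suminf) (auto simp: sums_iff)
  then show ?thesis using s by (simp add: sums_iff divide_inverse mult.commute)
qed

text \<open>Chernoff's bound for a single value, without a prefactor because \<open>fact k\<close>
  is at least \<open>k ^ k * exp (- k)\<close>. Counts are rescaled by \<open>n\<close>, and
  \<open>\<nu>\<close> is the intensity before scaling.\<close>

lemma poisson_weight_upper:
  assumes "0 < n" "0 < \<nu>"
  shows "poisson_weight (real n * \<nu>) k \<le> exp (- (real n * relent (real k / n) \<nu>))"
proof (cases "k = 0")
  case True then show ?thesis by (simp add: poisson_weight_def relent_def)
next
  case False
  let ?c = "real n * \<nu>"
  have c: "0 < ?c" using assms by simp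
  have "poisson_weight ?c k = (?c / real k) ^ k * (real k ^ k / fact k) * exp (- ?c)"
    using False by (simp add: poisson_weight_def power_divide)
  also have "\<dots> \<le> (?c / real k) ^ k * exp (real k) * exp (- ?c)"
    using c by (intro mult_right_mono mult_left_mono power_div_fact_le_exp) auto
  also have "(?c / real k) ^ k = exp (real k * ln (?c / real k))"
    using c False by (subst exp_of_nat_mult) simp
  also have "exp (real k * ln (?c / real k)) * exp (real k) * exp (- ?c) =
      exp (- (real n * relent (real k / n) \<nu>))"
  proof -
    have "ln (?c / real k) = - ln (real k / n / \<nu>)"
      using assms False c by (simp add: ln_div ln_mult)
    then show ?thesis
      unfolding relent_def exp_add[symmetric] using assms by (simp add: field_simps)
  qed
  finally show ?thesis .
qed

lemma poisson_weight_lower: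
  assumes "0 < n" "0 < \<nu>"
  shows "exp (- (real n * relent (real k / n) \<nu>) - ln k - 1) \<le> poisson_weight (real n * \<nu>) k"
proof -
  let ?c = "real n * \<nu>"
  have c: "0 < ?c" using assms by simp
  have pos: "0 < poisson_weight ?c k" using c by (simp add: poisson_weight_def)
  have "ln (poisson_weight ?c k) = real k * ln ?c - ln (fact k) - ?c"
    using assms by (simp add: poisson_weight_def ln_mult ln_div ln_realpow)
  also have "\<dots> \<ge> real k * ln ?c - (real k * ln k - k + ln k + 1) - ?c"
    using ln_fact_le[of k] by simp
  also have "real k * ln ?c - (real k * ln k - k + ln k + 1) - ?c
      = - (real n * relent (real k / n) \<nu>) - ln k - 1"
    using assms by (cases "k = 0") (auto simp: relent_def ln_div ln_mult field_simps)
  finally show ?thesis using pos by (simp add: ln_ge_iff)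
qed

text \<open>Duality with slope 1 and \<open>exp 1 - 1 \<le> 2\<close> give a cost of at least
  \<open>x - 2 * \<nu>\<close> for the rescaled count \<open>x\<close>. The threshold on
  \<open>N\<close> is chosen so that the weight number \<open>k + Suc N\<close> is at most
  \<open>exp (- n * m) * exp (-1) ^ Suc k\<close>; the factor 2 bounds the geometric series.\<close>

lemma poisson_tail:
  assumes n: "0 < n" and \<nu>: "0 < \<nu>" and N: "real n * (m + 2 * \<nu>) \<le> real N"
  shows "1 - (\<Sum>k\<le>N. poisson_weight (real n * \<nu>) k) \<le> 2 * exp (- (real n * m))"
proof -
  let ?p = "poisson_weight (real n * \<nu>)"
  have s: "?p sums 1" by (rule poisson_weight_sums)
  then have sm: "summable ?p" and si: "suminf ?p = 1" by (auto simp: sums_iff)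
  have le: "?p (k + Suc N) \<le> exp (- (real n * m)) * exp (-1) ^ Suc k" for k
  proof -
    have e: "exp (1::real) - 1 \<le> 2" using exp_le by simp
    let ?x = "real (k + Suc N) / n"
    have "1 * ?x - \<nu> * (exp 1 - 1) \<le> relent ?x \<nu>" using \<nu> by (intro relent_dual) auto
    then have "?x - \<nu> * 2 \<le> relent ?x \<nu>"
      using mult_left_mono[OF e, of \<nu>] \<nu> by linarith
    then have "real n * (?x - \<nu> * 2) \<le> real n * relent ?x \<nu>" using n by simp
    moreover have "real n * (?x - \<nu> * 2) = real (k + Suc N) - real n * \<nu> * 2"
      using n by (simp add: right_diff_distrib)
    ultimately have "real (k + Suc N) - real n * \<nu> * 2 \<le> real n * relent ?x \<nu>" by simp
    then have "real n * m + real (Suc k) \<le> real n * relent ?x \<nu>"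
      using N by (simp add: algebra_simps)
    then have "exp (- (real n * relent ?x \<nu>)) \<le> exp (- (real n * m) - real (Suc k))" by simp
    also have "\<dots> = exp (- (real n * m)) * exp (-1) ^ Suc k"
      by (simp only: exp_of_nat_mult[symmetric] exp_add[symmetric]) simp
    finally show ?thesis using poisson_weight_upper[OF n \<nu>, of "k + Suc N"] by linarith
  qed
  have g: "(\<lambda>k. exp (-1::real) ^ Suc k) sums (exp (-1) * (1 / (1 - exp (-1))))"
    unfolding power_Suc by (intro sums_mult geometric_sums) simp
  have e2: "exp (-1::real) \<le> 1/2" using exp_ge_add_one_self[of "1::real"]
    by (simp add: exp_minus field_simps)
  have g2: "exp (-1::real) * (1 / (1 - exp (-1))) \<le> 2"
  proof -
    have "1 / (1 - exp (-1::real)) \<le> 1 / (1/2)"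
      using e2 by (intro divide_left_mono) auto
    then have "exp (-1::real) * (1 / (1 - exp (-1))) \<le> 1 * 2"
      using e2 by (intro mult_mono) auto
    then show ?thesis by simp
  qed
  have "1 - (\<Sum>k\<le>N. ?p k) = (\<Sum>k. ?p (k + Suc N))"
    using suminf_split_initial_segment[OF sm, of "Suc N"] si by (simp add: lessThan_Suc_atMost)
  also have "\<dots> \<le> (\<Sum>k. exp (- (real n * m)) * exp (-1) ^ Suc k)"
    using le sm g by (intro suminf_le) (auto intro: summable_mult summable_ignore_initial_segment[of ?p "Suc N", simplified] simp: sums_iff)
  also have "\<dots> = exp (- (real n * m)) * (exp (-1) * (1 / (1 - exp (-1))))"
    using sums_mult[OF g, of "exp (- (real n * m))"] by (simp add: sums_iff)
  also have "\<dots> \<le> exp (- (real n * m)) * 2" using g2 by (intro mult_left_mono) auto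
  finally show ?thesis by simp
qed

text \<open>A union bound over all vectors of counts. A coordinate beyond \<open>N\<close> is
  covered by \<open>poisson_tail\<close>; at most \<open>(N + 1) ^ card J\<close> vectors remain,
  and each of those with entropy at least \<open>m\<close> has probability at most
  \<open>exp (- n * m)\<close> by the product formula. The prefactor is polynomial in
  \<open>n\<close>, hence invisible at speed \<open>n\<close>.\<close>

lemma (in prob_space) poisson_family_upper:
  fixes K :: "'i \<Rightarrow> 'a \<Rightarrow> real" and \<nu> :: "'i \<Rightarrow> real"
  assumes J: "finite J" and n: "0 < n" and \<nu>: "\<And>j. j \<in> J \<Longrightarrow> 0 < \<nu> j"
    and K[measurable]: "\<And>j. j \<in> J \<Longrightarrow> K j \<in> borel_measurable M"
    and marg: "\<And>j k. j \<in> J \<Longrightarrow> prob {\<omega> \<in> space M. K j \<omega> = real k} = poisson_weight (real n * \<nu> j) k"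
    and joint: "\<And>\<kappa>. prob {\<omega> \<in> space M. \<forall>j\<in>J. K j \<omega> = real (\<kappa> j)} = (\<Prod>j\<in>J. poisson_weight (real n * \<nu> j) (\<kappa> j))"
  shows "prob {\<omega> \<in> space M. m \<le> (\<Sum>j\<in>J. relent (K j \<omega> / n) (\<nu> j))} \<le>
    (2 * card J + (real n * (\<bar>m\<bar> + 2 * (\<Sum>j\<in>J. \<nu> j)) + 2) ^ card J) * exp (- (real n * m))"
proof -
  define C where "C = \<bar>m\<bar> + 2 * (\<Sum>j\<in>J. \<nu> j)"
  have C0: "0 \<le> C" unfolding C_def using \<nu> by (intro add_nonneg_nonneg mult_nonneg_nonneg sum_nonneg) (auto intro: less_imp_le)
  define N where "N = nat \<lceil>real n * C\<rceil>"
  have N: "real n * C \<le> real N" unfolding N_def by linarith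
  have N2: "real N \<le> real n * C + 1" unfolding N_def using C0 n
    by (simp add: of_nat_nat)
  have NC: "real n * (m + 2 * \<nu> j) \<le> real N" if "j \<in> J" for j
  proof -
    have "\<nu> j \<le> (\<Sum>j\<in>J. \<nu> j)" using that J \<nu> by (intro member_le_sum) (auto intro: less_imp_le)
    then have "m + 2 * \<nu> j \<le> C" unfolding C_def by simp
    then have "real n * (m + 2 * \<nu> j) \<le> real n * C" using n by simp
    then show ?thesis using N by linarith
  qed
  \<comment> \<open>Besides large counts this event contains the outcomes whose count is not a
    natural number, such as the value -1 that \<open>box_count\<close> assigns to an infinite
    measure.\<close>
  define B where "B j = {\<omega> \<in> space M. \<not> (\<exists>k\<le>N. K j \<omega> = real k)}" for j
  have Bm: "B j \<in> events" if "j \<in> J" for j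
    unfolding B_def using K[OF that] by measurable
  have B: "prob (B j) \<le> 2 * exp (- (real n * m))" if j: "j \<in> J" for j
  proof -
    have sK: "{\<omega> \<in> space M. K j \<omega> = real k} \<in> events" for k using K[OF j] by measurable
    have "B j = space M - (\<Union>k\<le>N. {\<omega> \<in> space M. K j \<omega> = real k})" by (auto simp: B_def)
    then have "prob (B j) = 1 - prob (\<Union>k\<le>N. {\<omega> \<in> space M. K j \<omega> = real k})"
      using sK by (simp add: prob_compl)
    also have "prob (\<Union>k\<le>N. {\<omega> \<in> space M. K j \<omega> = real k}) = (\<Sum>k\<le>N. prob {\<omega> \<in> space M. K j \<omega> = real k})"
      using sK by (intro finite_measure_finite_Union) (auto simp: disjoint_family_on_def)
    also have "\<dots> = (\<Sum>k\<le>N. poisson_weight (real n * \<nu> j) k)" using marg[OF j] by simp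
    finally show ?thesis using poisson_tail[OF n \<nu>[OF j] NC[OF j]] by simp
  qed
  define P where "P = {\<kappa> \<in> J \<rightarrow>\<^sub>E {..N}. m \<le> (\<Sum>j\<in>J. relent (real (\<kappa> j) / n) (\<nu> j))}"
  have finP: "finite P" unfolding P_def using J by (simp add: finite_PiE)
  have cardP: "card P \<le> (N + 1) ^ card J"
  proof -
    have "card P \<le> card (J \<rightarrow>\<^sub>E {..N})" unfolding P_def using J by (intro card_mono) (auto simp: finite_PiE)
    also have "\<dots> = (N + 1) ^ card J" using J by (simp add: card_PiE)
    finally show ?thesis .
  qed
  define E where "E \<kappa> = {\<omega> \<in> space M. \<forall>j\<in>J. K j \<omega> = real (\<kappa> j)}" for \<kappa>
  have Em: "E \<kappa> \<in> events" for \<kappa>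
    unfolding E_def using J K by (intro sets.sets_Collect_finite_All) (auto intro: borel_measurable_eq)
  have Ep: "prob (E \<kappa>) \<le> exp (- (real n * m))" if "\<kappa> \<in> P" for \<kappa>
  proof -
    have "prob (E \<kappa>) = (\<Prod>j\<in>J. poisson_weight (real n * \<nu> j) (\<kappa> j))" unfolding E_def by (rule joint)
    also have "\<dots> \<le> (\<Prod>j\<in>J. exp (- (real n * relent (real (\<kappa> j) / n) (\<nu> j))))"
      using n \<nu> by (intro prod_mono conjI poisson_weight_upper poisson_weight_nonneg) (auto intro: less_imp_le)
    also have "\<dots> = exp (- (real n * (\<Sum>j\<in>J. relent (real (\<kappa> j) / n) (\<nu> j))))"
      using J by (simp add: exp_sum[symmetric] sum_negf sum_distrib_left)
    also have "\<dots> \<le> exp (- (real n * m))" using that by (auto simp: P_def intro!: mult_left_mono)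
    finally show ?thesis .
  qed
  have "{\<omega> \<in> space M. m \<le> (\<Sum>j\<in>J. relent (K j \<omega> / n) (\<nu> j))} \<subseteq> (\<Union>j\<in>J. B j) \<union> (\<Union>\<kappa>\<in>P. E \<kappa>)"
  proof
    fix \<omega> assume w: "\<omega> \<in> {\<omega> \<in> space M. m \<le> (\<Sum>j\<in>J. relent (K j \<omega> / n) (\<nu> j))}"
    show "\<omega> \<in> (\<Union>j\<in>J. B j) \<union> (\<Union>\<kappa>\<in>P. E \<kappa>)"
    proof (cases "\<omega> \<in> (\<Union>j\<in>J. B j)")
      case False
      then have "\<forall>j\<in>J. \<exists>k\<le>N. K j \<omega> = real k" using w by (auto simp: B_def)
      then obtain \<kappa> where k: "\<And>j. j \<in> J \<Longrightarrow> \<kappa> j \<le> N \<and> K j \<omega> = real (\<kappa> j)" by metis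
      have "restrict \<kappa> J \<in> P" using k w by (auto simp: P_def)
      moreover have "\<omega> \<in> E (restrict \<kappa> J)" using k w by (auto simp: E_def)
      ultimately show ?thesis by blast
    qed simp
  qed
  then have "prob {\<omega> \<in> space M. m \<le> (\<Sum>j\<in>J. relent (K j \<omega> / n) (\<nu> j))} \<le> prob ((\<Union>j\<in>J. B j) \<union> (\<Union>\<kappa>\<in>P. E \<kappa>))"
    using J Bm Em finP by (intro finite_measure_mono sets.Un sets.finite_UN) auto
  also have "\<dots> \<le> prob (\<Union>j\<in>J. B j) + prob (\<Union>\<kappa>\<in>P. E \<kappa>)"
    using J Bm Em finP by (intro measure_Un_le sets.finite_UN) auto
  also have "prob (\<Union>j\<in>J. B j) \<le> (\<Sum>j\<in>J. prob (B j))"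
    using J Bm by (intro measure_UNION_le) auto
  also have "(\<Sum>j\<in>J. prob (B j)) \<le> (\<Sum>j\<in>J. 2 * exp (- (real n * m)))" using B by (intro sum_mono)
  also have "prob (\<Union>\<kappa>\<in>P. E \<kappa>) \<le> (\<Sum>\<kappa>\<in>P. prob (E \<kappa>))"
    using finP Em by (intro measure_UNION_le) auto
  also have "(\<Sum>\<kappa>\<in>P. prob (E \<kappa>)) \<le> (\<Sum>\<kappa>\<in>P. exp (- (real n * m)))" using Ep by (intro sum_mono)
  also have "\<dots> = card P * exp (- (real n * m))" by simp
  also have "\<dots> \<le> real ((N + 1) ^ card J) * exp (- (real n * m))"
    using cardP by (intro mult_right_mono) (auto simp del: of_nat_power)
  also have "real ((N + 1) ^ card J) \<le> (real n * C + 2) ^ card J"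
    using N2 by (simp del: of_nat_add) (intro power_mono, auto)
  finally show ?thesis by (simp add: C_def algebra_simps)
qed

section \<open>Counts of independent Poisson random measures\<close>

lemma (in prob_space) random_measure_count_event:
  assumes J: "finite J" and A: "\<And>j. j \<in> J \<Longrightarrow> A j \<in> sets \<nu>"
  shows "{\<omega> \<in> space M. \<forall>j\<in>J. emeasure (N \<omega>) (A j) = of_nat (\<kappa> j)} \<in> random_measure_events M \<nu> N"
proof -
  have sub: "{{\<omega> \<in> space M. emeasure (N \<omega>) A \<in> B} | A B. A \<in> sets \<nu> \<and> B \<in> sets borel} \<subseteq> Pow (space M)"
    by auto
  interpret S: sigma_algebra "space M" "random_measure_events M \<nu> N"
    unfolding random_measure_events_def using sub by (rule sigma_algebra_sigma_sets)
  have "{\<omega> \<in> space M. emeasure (N \<omega>) (A j) = of_nat (\<kappa> j)} \<in> random_measure_events M \<nu> N" if "j \<in> J" for j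
  proof -
    have "{\<omega> \<in> space M. emeasure (N \<omega>) (A j) \<in> {of_nat (\<kappa> j)}} \<in> random_measure_events M \<nu> N"
      unfolding random_measure_events_def using A[OF that]
      by (intro sigma_sets.Basic CollectI exI[of _ "A j"] exI[of _ "{of_nat (\<kappa> j)}"]) auto
    then show ?thesis by simp
  qed
  then show ?thesis using J by (intro S.sets_Collect_finite_All) auto
qed

lemma (in prob_space) poisson_random_measure_joint:
  fixes A :: "nat \<Rightarrow> 'b set"
  assumes P: "poisson_random_measure M \<nu> N" and J: "finite J" and A: "\<And>j. j \<in> J \<Longrightarrow> A j \<in> sets \<nu>"
    and dis: "disjoint_family_on A J" and fin: "\<And>j. j \<in> J \<Longrightarrow> emeasure \<nu> (A j) < \<infinity>"
  shows "prob {\<omega> \<in> space M. \<forall>j\<in>J. emeasure (N \<omega>) (A j) = of_nat (\<kappa> j)} =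
    (\<Prod>j\<in>J. poisson_weight (measure \<nu> (A j)) (\<kappa> j))"
proof (cases "J = {}")
  case False
  have ind: "indep_vars (\<lambda>_. borel) (\<lambda>j \<omega>. emeasure (N \<omega>) (A j)) J"
    using P J A dis unfolding poisson_random_measure_def by (metis (no_types, lifting) image_subsetI)
  have "prob (\<Inter>j\<in>J. (\<lambda>\<omega>. emeasure (N \<omega>) (A j)) -` {of_nat (\<kappa> j)} \<inter> space M) =
     (\<Prod>j\<in>J. prob ((\<lambda>\<omega>. emeasure (N \<omega>) (A j)) -` {of_nat (\<kappa> j)} \<inter> space M))"
    using J False by (intro indep_varsD[OF ind]) auto
  also have "(\<Inter>j\<in>J. (\<lambda>\<omega>. emeasure (N \<omega>) (A j)) -` {of_nat (\<kappa> j)} \<inter> space M) =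
     {\<omega> \<in> space M. \<forall>j\<in>J. emeasure (N \<omega>) (A j) = of_nat (\<kappa> j)}" using False by auto
  also have "(\<Prod>j\<in>J. prob ((\<lambda>\<omega>. emeasure (N \<omega>) (A j)) -` {of_nat (\<kappa> j)} \<inter> space M)) =
     (\<Prod>j\<in>J. poisson_weight (measure \<nu> (A j)) (\<kappa> j))"
  proof (intro prod.cong refl)
    fix j assume j: "j \<in> J"
    have "(\<lambda>\<omega>. emeasure (N \<omega>) (A j)) -` {of_nat (\<kappa> j)} \<inter> space M = {\<omega> \<in> space M. emeasure (N \<omega>) (A j) = of_nat (\<kappa> j)}"
      by auto
    then show "prob ((\<lambda>\<omega>. emeasure (N \<omega>) (A j)) -` {of_nat (\<kappa> j)} \<inter> space M) = poisson_weight (measure \<nu> (A j)) (\<kappa> j)"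
      using P A[OF j] fin[OF j] by (simp add: poisson_random_measure_def poisson_weight_def)
  qed
  finally show ?thesis .
qed (simp add: prob_space)

text \<open>The notion \<open>poisson_random_measure\<close> does not demand integer values. They
  hold almost surely because the Poisson weights sum to 1, which leaves no probability for any other
  value, infinity included.\<close>

lemma (in prob_space) poisson_random_measure_AE:
  assumes P: "poisson_random_measure M \<nu> N" and A: "A \<in> sets \<nu>" "emeasure \<nu> A < \<infinity>"
  shows "AE \<omega> in M. \<exists>k::nat. emeasure (N \<omega>) A = of_nat k"
proof -
  have [measurable]: "(\<lambda>\<omega>. emeasure (N \<omega>) A) \<in> borel_measurable M"
    using P A by (auto simp: poisson_random_measure_def)
  have "(\<lambda>k. prob {\<omega> \<in> space M. emeasure (N \<omega>) A = of_nat k}) sums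
      prob (\<Union>k. {\<omega> \<in> space M. emeasure (N \<omega>) A = of_nat k})"
    by (intro finite_measure_UNION) (auto simp: disjoint_family_on_def)
  moreover have "(\<lambda>k. prob {\<omega> \<in> space M. emeasure (N \<omega>) A = of_nat k}) = poisson_weight (measure \<nu> A)"
    using P A by (auto simp: poisson_random_measure_def poisson_weight_def)
  ultimately have "prob (\<Union>k. {\<omega> \<in> space M. emeasure (N \<omega>) A = of_nat k}) = 1"
    using poisson_weight_sums[of "measure \<nu> A"] sums_unique2 by simp blast
  then have "AE \<omega> in M. \<omega> \<in> (\<Union>k. {\<omega> \<in> space M. emeasure (N \<omega>) A = of_nat k})"
    by (intro AE_prob_1) auto
  then show ?thesis by eventually_elim auto
qed

text \<open>Serves to discard time 0, where the value of \<open>left_limit\<close> is a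
  convention.\<close>

lemma (in prob_space) poisson_random_measure_null:
  assumes P: "poisson_random_measure M \<nu> N" and A: "A \<in> sets \<nu>" "emeasure \<nu> A = 0"
  shows "AE \<omega> in M. emeasure (N \<omega>) A = 0"
proof -
  have [measurable]: "(\<lambda>\<omega>. emeasure (N \<omega>) A) \<in> borel_measurable M"
    using P A by (auto simp: poisson_random_measure_def)
  have "prob {\<omega> \<in> space M. emeasure (N \<omega>) A = of_nat 0} = measure \<nu> A ^ 0 / fact 0 * exp (- measure \<nu> A)"
    using P A unfolding poisson_random_measure_def by (auto dest!: bspec[where x=A] spec[where x=0])
  then have "prob {\<omega> \<in> space M. emeasure (N \<omega>) A = 0} = 1"
    using A by (simp add: measure_def)
  then have "AE \<omega> in M. \<omega> \<in> {\<omega> \<in> space M. emeasure (N \<omega>) A = 0}"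
    by (intro AE_prob_1) auto
  then show ?thesis by eventually_elim auto
qed

text \<open>Two layers of independence are combined: that of disjoint sets within one random
  measure, and that of the sigma-algebras generated by the three measures.\<close>

lemma (in prob_space) mm1m_noise_joint:
  fixes A1 A2 :: "nat \<Rightarrow> real set" and A3 :: "nat \<Rightarrow> (real \<times> real) set"
  assumes noise: "mm1m_noise M lam mu th T n N1 N2 N3"
    and J1: "finite J1" "\<And>j. j \<in> J1 \<Longrightarrow> A1 j \<in> sets (time_intensity (real n * lam) T)" "disjoint_family_on A1 J1"
      "\<And>j. j \<in> J1 \<Longrightarrow> emeasure (time_intensity (real n * lam) T) (A1 j) < \<infinity>"
    and J2: "finite J2" "\<And>j. j \<in> J2 \<Longrightarrow> A2 j \<in> sets (time_intensity (real n * mu) T)" "disjoint_family_on A2 J2"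
      "\<And>j. j \<in> J2 \<Longrightarrow> emeasure (time_intensity (real n * mu) T) (A2 j) < \<infinity>"
    and J3: "finite J3" "\<And>j. j \<in> J3 \<Longrightarrow> A3 j \<in> sets (time_mark_intensity (real n * th) T)" "disjoint_family_on A3 J3"
      "\<And>j. j \<in> J3 \<Longrightarrow> emeasure (time_mark_intensity (real n * th) T) (A3 j) < \<infinity>"
  shows "prob {\<omega> \<in> space M. (\<forall>j\<in>J1. emeasure (N1 \<omega>) (A1 j) = of_nat (\<kappa>1 j)) \<and>
       (\<forall>j\<in>J2. emeasure (N2 \<omega>) (A2 j) = of_nat (\<kappa>2 j)) \<and> (\<forall>j\<in>J3. emeasure (N3 \<omega>) (A3 j) = of_nat (\<kappa>3 j))} =
    (\<Prod>j\<in>J1. poisson_weight (measure (time_intensity (real n * lam) T) (A1 j)) (\<kappa>1 j)) *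
    (\<Prod>j\<in>J2. poisson_weight (measure (time_intensity (real n * mu) T) (A2 j)) (\<kappa>2 j)) *
    (\<Prod>j\<in>J3. poisson_weight (measure (time_mark_intensity (real n * th) T) (A3 j)) (\<kappa>3 j))"
proof -
  let ?E1 = "{\<omega> \<in> space M. \<forall>j\<in>J1. emeasure (N1 \<omega>) (A1 j) = of_nat (\<kappa>1 j)}"
  let ?E2 = "{\<omega> \<in> space M. \<forall>j\<in>J2. emeasure (N2 \<omega>) (A2 j) = of_nat (\<kappa>2 j)}"
  let ?E3 = "{\<omega> \<in> space M. \<forall>j\<in>J3. emeasure (N3 \<omega>) (A3 j) = of_nat (\<kappa>3 j)}"
  define E where "E i = [?E1, ?E2, ?E3] ! i" for i :: nat
  have P: "poisson_random_measure M (time_intensity (real n * lam) T) N1"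
     "poisson_random_measure M (time_intensity (real n * mu) T) N2"
     "poisson_random_measure M (time_mark_intensity (real n * th) T) N3"
    and ind: "indep_sets
       (\<lambda>i. [random_measure_events M (time_intensity (real n * lam) T) N1,
             random_measure_events M (time_intensity (real n * mu) T) N2,
             random_measure_events M (time_mark_intensity (real n * th) T) N3] ! i) {..<3}"
    using noise by (auto simp: mm1m_noise_def)
  have L3: "{..<3} = {0, 1, 2::nat}" by auto
  have "prob (\<Inter>i\<in>{..<3}. E i) = (\<Prod>i\<in>{..<3}. prob (E i))"
  proof (rule indep_setsD[OF ind])
    show "\<forall>i\<in>{..<3}. E i \<in> [random_measure_events M (time_intensity (real n * lam) T) N1,
             random_measure_events M (time_intensity (real n * mu) T) N2,
             random_measure_events M (time_mark_intensity (real n * th) T) N3] ! i"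
      unfolding L3 E_def using J1 J2 J3 by (auto intro!: random_measure_count_event)
  qed (auto simp: L3)
  also have "(\<Inter>i\<in>{..<3}. E i) = {\<omega> \<in> space M. (\<forall>j\<in>J1. emeasure (N1 \<omega>) (A1 j) = of_nat (\<kappa>1 j)) \<and>
       (\<forall>j\<in>J2. emeasure (N2 \<omega>) (A2 j) = of_nat (\<kappa>2 j)) \<and> (\<forall>j\<in>J3. emeasure (N3 \<omega>) (A3 j) = of_nat (\<kappa>3 j))}"
    unfolding L3 E_def by auto
  also have "(\<Prod>i\<in>{..<3}. prob (E i)) = prob ?E1 * prob ?E2 * prob ?E3"
    unfolding L3 E_def by simp
  finally show ?thesis
    using poisson_random_measure_joint[OF P(1) J1] poisson_random_measure_joint[OF P(2) J2]
      poisson_random_measure_joint[OF P(3) J3] by simp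
qed

section \<open>Dyadic grids\<close>

definition tgrid :: "real \<Rightarrow> nat \<Rightarrow> nat \<Rightarrow> real" where
  "tgrid T q k = real k * T / 2 ^ q"

definition incr :: "real \<Rightarrow> (real \<Rightarrow> real) \<Rightarrow> nat \<Rightarrow> nat \<Rightarrow> real" where
  "incr T a q k = a (tgrid T q (Suc k)) - a (tgrid T q k)"

definition cell_index :: "real \<Rightarrow> nat \<Rightarrow> real \<Rightarrow> nat" where
  "cell_index T q t = nat \<lfloor>t * 2 ^ q / T\<rfloor>"

text \<open>The supremum over \<open>\<beta>\<close> is the relative entropy of the increments of
  \<open>a\<close> with respect to those of \<open>W\<close> on the grid of level \<open>q\<close>.
  For fixed \<open>\<beta>\<close> the expression is linear in \<open>a\<close> and
  \<open>W\<close>, hence continuous under pointwise convergence of both.\<close>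

definition dual_cost :: "real \<Rightarrow> (real \<Rightarrow> real) \<Rightarrow> (real \<Rightarrow> real) \<Rightarrow> nat \<Rightarrow> (nat \<Rightarrow> real) \<Rightarrow> real" where
  "dual_cost T a W q \<beta> = (\<Sum>k<2 ^ q. \<beta> k * incr T a q k - (exp (\<beta> k) - 1) * incr T W q k)"

lemma tgrid_0 [simp]: "tgrid T q 0 = 0"
  by (simp add: tgrid_def)

lemma tgrid_top [simp]: "tgrid T q (2 ^ q) = T"
  by (simp add: tgrid_def)

lemma tgrid_refine: "tgrid T (q + d) (k * 2 ^ d) = tgrid T q k"
  by (simp add: tgrid_def power_add)

lemma tgrid_Suc: "tgrid T q (Suc k) = tgrid T q k + T / 2 ^ q"
  by (simp add: tgrid_def add_divide_distrib ring_distribs)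

lemma tgrid_mono: "0 < T \<Longrightarrow> j \<le> k \<Longrightarrow> tgrid T q j \<le> tgrid T q k"
  by (simp add: tgrid_def divide_right_mono)

lemma tgrid_mem: "0 < T \<Longrightarrow> k \<le> 2 ^ q \<Longrightarrow> tgrid T q k \<in> {0..T}"
  using tgrid_mono[of T 0 k q] tgrid_mono[of T k "2^q" q] by simp

lemma sum_dyadic_group:
  fixes F :: "nat \<Rightarrow> 'a::comm_monoid_add"
  shows "(\<Sum>j<2 ^ (q + d). F j) = (\<Sum>k<2 ^ q. \<Sum>j\<in>{k * 2 ^ d..<k * 2 ^ d + 2 ^ d}. F j)"
  using sum.nat_group[of F "2 ^ d" "2 ^ q"] by (simp add: power_add)

lemma div_dyadic_block: "j \<in> {k * 2 ^ d..<k * 2 ^ d + 2 ^ d} \<Longrightarrow> j div 2 ^ d = (k::nat)"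
  by (intro div_nat_eqI) (auto simp: mult.commute)

lemma incr_block: "(\<Sum>j\<in>{k * 2 ^ d..<k * 2 ^ d + 2 ^ d}. incr T a (q + d) j) = incr T a q k"
proof -
  have "(\<Sum>j\<in>{k * 2 ^ d..<k * 2 ^ d + 2 ^ d}. incr T a (q + d) j) =
     a (tgrid T (q + d) (k * 2 ^ d + 2 ^ d)) - a (tgrid T (q + d) (k * 2 ^ d))"
    unfolding incr_def by (rule sum_Suc_diff') simp
  also have "tgrid T (q + d) (k * 2 ^ d + 2 ^ d) = tgrid T q (Suc k)"
    using tgrid_refine[of T q d "Suc k"] by (simp add: add.commute)
  finally show ?thesis unfolding tgrid_refine by (simp add: incr_def)
qed

text \<open>The increments of a coarse cell telescope. Applied to the identity in place of
  \<open>a\<close>, this says that the Riemann sum of a step function is unchanged by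
  refinement.\<close>

lemma incr_refine:
  "(\<Sum>j<2 ^ (q + d). g (j div 2 ^ d) * incr T a (q + d) j) = (\<Sum>k<2 ^ q. g k * incr T a q k)"
proof -
  have "(\<Sum>j<2 ^ (q + d). g (j div 2 ^ d) * incr T a (q + d) j) =
     (\<Sum>k<2 ^ q. \<Sum>j\<in>{k * 2 ^ d..<k * 2 ^ d + 2 ^ d}. g k * incr T a (q + d) j)"
    unfolding sum_dyadic_group by (intro sum.cong refl) (simp only: div_dyadic_block)
  then show ?thesis by (simp only: sum_distrib_left[symmetric] incr_block)
qed

text \<open>A test vector may be copied to the subcells without changing its value. Hence the
  entropies increase along the grids, and a bound at a fine level holds at all coarser
  levels.\<close>

lemma dual_cost_refine: "dual_cost T a W (q + d) (\<lambda>j. \<beta> (j div 2 ^ d)) = dual_cost T a W q \<beta>"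
  unfolding dual_cost_def sum_subtractf
  using incr_refine[of \<beta> d T a q] incr_refine[of "\<lambda>k. exp (\<beta> k) - 1" d T W q] by simp

lemma cell_indexI:
  assumes "0 < T" "tgrid T q k \<le> t" "t < tgrid T q (Suc k)"
  shows "cell_index T q t = k"
proof -
  have "real k \<le> t * 2 ^ q / T" "t * 2 ^ q / T < real k + 1"
    using assms by (auto simp: tgrid_def field_simps)
  then have "\<lfloor>t * 2 ^ q / T\<rfloor> = int k" by linarith
  then show ?thesis by (simp add: cell_index_def)
qed

lemma cell_index_bounds:
  assumes "0 < T" "0 \<le> t"
  shows "tgrid T q (cell_index T q t) \<le> t" "t < tgrid T q (Suc (cell_index T q t))"
proof -
  have "0 \<le> t * 2 ^ q / T" using assms by simp
  then have "real (cell_index T q t) = of_int \<lfloor>t * 2 ^ q / T\<rfloor>" by (simp add: cell_index_def)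
  then have "real (cell_index T q t) \<le> t * 2 ^ q / T" "t * 2 ^ q / T < real (cell_index T q t) + 1"
    by linarith+
  then show "tgrid T q (cell_index T q t) \<le> t" "t < tgrid T q (Suc (cell_index T q t))"
    using assms by (auto simp: tgrid_def field_simps)
qed

lemma cell_index_less: 
  assumes "0 < T" "0 \<le> t" "t < T"
  shows "cell_index T q t < 2 ^ q"
proof (rule ccontr)
  assume "\<not> ?thesis"
  then have "tgrid T q (2 ^ q) \<le> tgrid T q (cell_index T q t)" using assms by (intro tgrid_mono) auto
  then show False using cell_index_bounds[of T t q] assms by simp
qed

lemma cell_index_div:
  assumes "0 < T" "0 \<le> t"
  shows "cell_index T q t = cell_index T (q + d) t div 2 ^ d"
proof (rule cell_indexI[OF assms(1)])
  let ?j = "cell_index T (q + d) t"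
  have "?j div 2 ^ d * 2 ^ d \<le> ?j" by simp
  then have "tgrid T q (?j div 2 ^ d) \<le> tgrid T (q + d) ?j"
    using tgrid_mono[OF assms(1), of "?j div 2 ^ d * 2 ^ d" ?j "q + d"] by (simp only: tgrid_refine)
  then show "tgrid T q (?j div 2 ^ d) \<le> t" using cell_index_bounds[OF assms, of "q + d"] by simp
  have "?j < Suc (?j div 2 ^ d) * 2 ^ d" by (simp add: dividend_less_div_times)
  then have "tgrid T (q + d) (Suc ?j) \<le> tgrid T q (Suc (?j div 2 ^ d))"
    using tgrid_mono[OF assms(1), of "Suc ?j" "Suc (?j div 2 ^ d) * 2 ^ d" "q + d"]
    by (simp only: tgrid_refine Suc_le_eq)
  then show "t < tgrid T q (Suc (?j div 2 ^ d))" using cell_index_bounds[OF assms, of "q + d"] by simp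
qed

lemma measurable_cell_index [measurable]: "cell_index T q \<in> borel \<rightarrow>\<^sub>M count_space UNIV"
  unfolding cell_index_def by measurable

text \<open>The source of all explicit integrals below. The interval is half open because
  \<open>cell_index T q T = 2 ^ q\<close> is no longer the index of a cell.\<close>

lemma cell_step_integral:
  fixes g :: "nat \<Rightarrow> real"
  assumes T: "0 < T"
  shows "has_bochner_integral (restrict_space lborel {0..<T}) (\<lambda>t. g (cell_index T q t)) (\<Sum>k<2 ^ q. g k * (T / 2 ^ q))"
proof -
  let ?M = "restrict_space lborel {0..<T}"
  let ?c = "\<lambda>k. {tgrid T q k..<tgrid T q (Suc k)}"
  have sub: "?c k \<subseteq> {0..<T}" if "k < 2 ^ q" for k
    using tgrid_mem[OF T, of k q] tgrid_mem[OF T, of "Suc k" q] that by auto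
  have "has_bochner_integral ?M (\<lambda>t. \<Sum>k<2 ^ q. g k * indicator (?c k) t) (\<Sum>k<2 ^ q. g k * measure ?M (?c k))"
  proof (intro has_bochner_integral_sum has_bochner_integral_mult_right has_bochner_integral_real_indicator)
    fix k :: nat assume k: "k \<in> {..<2 ^ q}"
    show "?c k \<in> sets ?M" using sub k by (auto simp: sets_restrict_space_iff)
    show "emeasure ?M (?c k) < \<infinity>"
    proof -
      have "?c k \<subseteq> {0..<T}" using sub k by simp
      then show ?thesis using tgrid_mono[OF T, of k "Suc k" q] by (simp add: emeasure_restrict_space)
    qed
  qed
  also have "(\<Sum>k<2 ^ q. g k * measure ?M (?c k)) = (\<Sum>k<2 ^ q. g k * (T / 2 ^ q))"
    using sub T by (intro sum.cong refl) (simp add: measure_restrict_space tgrid_Suc)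
  finally have *: "has_bochner_integral ?M (\<lambda>t. \<Sum>k<2 ^ q. g k * indicator (?c k) t) (\<Sum>k<2 ^ q. g k * (T / 2 ^ q))" .
  have "(\<Sum>k<2 ^ q. g k * indicator (?c k) t) = g (cell_index T q t)" if "t \<in> space ?M" for t
  proof -
    have t: "0 \<le> t" "t < T" using that by (auto simp: space_restrict_space)
    have "(\<Sum>k<2 ^ q. g k * indicator (?c k) t) = (\<Sum>k<2 ^ q. if k = cell_index T q t then g k else 0)"
    proof (intro sum.cong refl)
      fix k
      have "t \<in> ?c k \<longleftrightarrow> k = cell_index T q t"
        using cell_indexI[OF T, of q k t] cell_index_bounds[OF T t(1), of q]
        by (metis atLeastLessThan_iff)
      then show "g k * indicator (?c k) t = (if k = cell_index T q t then g k else 0)"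
        by (simp add: indicator_def)
    qed
    then show ?thesis using cell_index_less[OF T t, of q] by simp
  qed
  then show ?thesis using * by (subst has_bochner_integral_cong[OF refl _ refl]) auto
qed

lemma incr_nonneg: "mono_on {0..T} a \<Longrightarrow> 0 < T \<Longrightarrow> k < 2 ^ q \<Longrightarrow> 0 \<le> incr T a q k"
  unfolding incr_def using tgrid_mem[of T k q] tgrid_mem[of T "Suc k" q] tgrid_mono[of T k "Suc k" q]
  by (auto intro: mono_onD)

lemma sum_incr: "(\<Sum>k<2 ^ q. incr T a q k) = a T - a 0"
  using sum_lessThan_telescope[of "\<lambda>k. a (tgrid T q k)" "2 ^ q"] by (simp add: incr_def)

lemma sum_incr_less: "(\<Sum>k<n. incr T a q k) = a (tgrid T q n) - a 0"
  using sum_lessThan_telescope[of "\<lambda>k. a (tgrid T q k)" n] by (simp add: incr_def)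

section \<open>Densities of paths with finite entropy\<close>

text \<open>Under Lebesgue measure these densities form a martingale along the dyadic partitions.
  What follows is an elementary proof of its convergence.\<close>

definition cell_density :: "real \<Rightarrow> (real \<Rightarrow> real) \<Rightarrow> nat \<Rightarrow> real \<Rightarrow> real" where
  "cell_density T a q t = incr T a q (cell_index T q t) * 2 ^ q / T"

lemma measurable_cell_density [measurable]: "cell_density T a q \<in> borel_measurable borel"
  unfolding cell_density_def by measurable

lemma cell_density_nonneg:
  "mono_on {0..T} a \<Longrightarrow> 0 < T \<Longrightarrow> 0 \<le> t \<Longrightarrow> t < T \<Longrightarrow> 0 \<le> cell_density T a q t"
  unfolding cell_density_def using incr_nonneg[of T a "cell_index T q t" q] cell_index_less[of T t q] by simp

text \<open>The right-hand side is the Bregman gap between \<open>x\<close> and \<open>y\<close> of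
  the convex function \<open>exp (- x)\<close>. The estimate is again
  \<open>exp u \<ge> 1 + u\<close>, now at \<open>u = (x - y) / 2\<close>.\<close>

lemma exp_half_gap:
  "(exp (- x / 2) - exp (- y / 2))\<^sup>2 \<le> exp (- y) - exp (- x) + exp (- x) * (y - (x::real))"
proof -
  have "exp (- x) * (1 + (x - y) / 2) \<le> exp (- x) * exp ((x - y) / 2)"
    by (intro mult_left_mono exp_ge_add_one_self) auto
  also have "\<dots> = exp (- x / 2) * exp (- y / 2)"
    by (simp add: exp_add[symmetric] field_simps)
  finally have *: "exp (- x) * (1 + (x - y) / 2) \<le> exp (- x / 2) * exp (- y / 2)" .
  have "exp (- x / 2) ^ 2 = exp (- x)" "exp (- y / 2) ^ 2 = exp (- y)"
    by (simp_all add: power2_eq_square exp_add[symmetric])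
  then have "(exp (- x / 2) - exp (- y / 2))\<^sup>2 = exp (- x) + exp (- y) - 2 * (exp (- x / 2) * exp (- y / 2))"
    by (simp add: power2_diff)
  moreover have "exp (- x) * (1 + (x - y) / 2) = exp (- x) + exp (- x) * (x - y) / 2"
    by (simp add: algebra_simps)
  moreover have "exp (- x) * (y - x) = - (exp (- x) * (x - y))" by (simp add: algebra_simps)
  ultimately show ?thesis using * by linarith
qed

text \<open>By Jensen's inequality the integrals \<open>E q\<close> of
  \<open>exp (- density)\<close> increase with \<open>q\<close>, and they are at most
  \<open>T\<close> since the density is nonnegative. Their differences dominate the squared L2
  distances of \<open>exp (- density / 2)\<close>, so these functions are Cauchy in L2 and therefore
  in L1.\<close>

lemma cell_density_cauchy:
  fixes a :: "real \<Rightarrow> real"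
  assumes T: "0 < T" and mono: "mono_on {0..T} a" and e: "0 < e"
  shows "\<exists>N. \<forall>i\<ge>N. \<forall>j\<ge>N. (LINT t|restrict_space lborel {0..<T}.
     norm (exp (- cell_density T a i t / 2) - exp (- cell_density T a j t / 2))) < e"
proof -
  let ?M = "restrict_space lborel {0..<T}"
  define E where "E q = (\<Sum>k<2 ^ q. exp (- (incr T a q k * 2 ^ q / T)) * (T / 2 ^ q))" for q
  define x where "x q k = incr T a q k * 2 ^ q / T" for q k
  have xc: "cell_density T a q t = x q (cell_index T q t)" for q t
    by (simp add: cell_density_def x_def)
  define u where "u q t = exp (- cell_density T a q t / 2)" for q t
  have ui: "integrable ?M (u q)" for q
    unfolding u_def xc using cell_step_integral[OF T, of "\<lambda>k. exp (- x q k / 2)" q]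
    by (simp add: has_bochner_integral_iff)
  have gap: "(LINT t|?M. (u q t - u (q + d) t)\<^sup>2) \<le> E (q + d) - E q"
    and gapi: "integrable ?M (\<lambda>t. (u q t - u (q + d) t)\<^sup>2)" for q d
  proof -
    let ?h = "T / 2 ^ (q + d)"
    define z where "z j = (exp (- x q (j div 2 ^ d) / 2) - exp (- x (q + d) j / 2))\<^sup>2" for j
    have eq: "(u q t - u (q + d) t)\<^sup>2 = z (cell_index T (q + d) t)" if "t \<in> space ?M" for t
      using that cell_index_div[OF T, of t q d] by (simp add: u_def xc z_def space_restrict_space)
    have "has_bochner_integral ?M (\<lambda>t. (u q t - u (q + d) t)\<^sup>2) (\<Sum>j<2 ^ (q + d). z j * ?h)"
      using cell_step_integral[OF T, of z "q + d"] eq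
      by (subst has_bochner_integral_cong[OF refl _ refl]) auto
    then show "integrable ?M (\<lambda>t. (u q t - u (q + d) t)\<^sup>2)"
      and "(LINT t|?M. (u q t - u (q + d) t)\<^sup>2) \<le> E (q + d) - E q"
    proof (auto simp: has_bochner_integral_iff)
      have "(\<Sum>j<2 ^ (q + d). z j * ?h) \<le> (\<Sum>j<2 ^ (q + d). exp (- x (q + d) j) * ?h
          - exp (- x q (j div 2 ^ d)) * ?h + (exp (- x q (j div 2 ^ d)) * incr T a (q + d) j
          - exp (- x q (j div 2 ^ d)) * x q (j div 2 ^ d) * ?h))"
      proof (intro sum_mono)
        fix j
        have "z j * ?h \<le> (exp (- x (q + d) j) - exp (- x q (j div 2 ^ d))
           + exp (- x q (j div 2 ^ d)) * (x (q + d) j - x q (j div 2 ^ d))) * ?h"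
          unfolding z_def using T by (intro mult_right_mono exp_half_gap) auto
        also have "incr T a (q + d) j = x (q + d) j * ?h" using T by (simp add: x_def)
        then have "(exp (- x (q + d) j) - exp (- x q (j div 2 ^ d))
           + exp (- x q (j div 2 ^ d)) * (x (q + d) j - x q (j div 2 ^ d))) * ?h = 
           exp (- x (q + d) j) * ?h
          - exp (- x q (j div 2 ^ d)) * ?h + (exp (- x q (j div 2 ^ d)) * incr T a (q + d) j
          - exp (- x q (j div 2 ^ d)) * x q (j div 2 ^ d) * ?h)"
          by (simp only: left_diff_distrib right_diff_distrib distrib_right mult.assoc)
        finally show "z j * ?h \<le> exp (- x (q + d) j) * ?h
          - exp (- x q (j div 2 ^ d)) * ?h + (exp (- x q (j div 2 ^ d)) * incr T a (q + d) j
          - exp (- x q (j div 2 ^ d)) * x q (j div 2 ^ d) * ?h)" .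
      qed
      also have "\<dots> = E (q + d) - (\<Sum>j<2 ^ (q + d). exp (- x q (j div 2 ^ d)) * ?h)
         + ((\<Sum>j<2 ^ (q + d). exp (- x q (j div 2 ^ d)) * incr T a (q + d) j)
           - (\<Sum>j<2 ^ (q + d). exp (- x q (j div 2 ^ d)) * x q (j div 2 ^ d) * ?h))"
        by (simp add: sum.distrib sum_subtractf E_def x_def)
      also have "(\<Sum>j<2 ^ (q + d). exp (- x q (j div 2 ^ d)) * ?h) = E q"
        using incr_refine[of "\<lambda>k. exp (- x q k)" d T "\<lambda>t. t" q]
        by (simp add: incr_def tgrid_Suc E_def x_def)
      \<comment> \<open>This sum and the one with the fine increments of \<open>a\<close> turn out
        to be the same coarse sum, so the linear part of the Bregman gap cancels. This is the
        martingale property.\<close>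
      also have "(\<Sum>j<2 ^ (q + d). exp (- x q (j div 2 ^ d)) * x q (j div 2 ^ d) * ?h) =
          (\<Sum>k<2 ^ q. exp (- x q k) * x q k * (T / 2 ^ q))"
        using incr_refine[of "\<lambda>k. exp (- x q k) * x q k" d T "\<lambda>t. t" q]
        by (simp add: incr_def tgrid_Suc)
      also have "\<dots> = (\<Sum>k<2 ^ q. exp (- x q k) * incr T a q k)"
        using T by (intro sum.cong refl) (simp add: x_def)
      also have "(\<Sum>j<2 ^ (q + d). exp (- x q (j div 2 ^ d)) * incr T a (q + d) j) = (\<Sum>k<2 ^ q. exp (- x q k) * incr T a q k)"
        by (rule incr_refine)
      finally show "(\<Sum>j<2 ^ (q + d). z j * T / 2 ^ (q + d)) \<le> E (q + d) - E q" by simp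
    qed
  qed
  \<comment> \<open>Jensen's inequality, read off from \<open>gap\<close>, whose left-hand side is
    nonnegative.\<close>
  have Emono: "E q \<le> E (q + d)" for q d
  proof -
    have "0 \<le> (LINT t|?M. (u q t - u (q + d) t)\<^sup>2)" by (intro Bochner_Integration.integral_nonneg) simp
    then show ?thesis using gap[of q d] by linarith
  qed
  have "E q \<le> T" for q
  proof -
    have "E q \<le> (\<Sum>k<2 ^ q::nat. 1 * (T / 2 ^ q))"
      unfolding E_def using T incr_nonneg[OF mono T] by (intro sum_mono mult_right_mono) auto
    then show ?thesis by simp
  qed
  moreover have "incseq E" using Emono by (auto simp: incseq_def le_iff_add)
  ultimately obtain L where "E \<longlonglongrightarrow> L" using incseq_convergent[of E T] by blast
  then have "Cauchy E" by (rule LIMSEQ_imp_Cauchy)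
  \<comment> \<open>Chosen for the passage from L2 to L1 by
    \<open>\<bar>y\<bar> \<le> \<epsilon> + y\<^sup>2 / \<epsilon>\<close>: the first term
    integrates to less than \<open>e / 2\<close>, and the second to at most \<open>e / 2\<close>
    once the gap is below \<open>\<epsilon> * e / 2\<close>.\<close>
  define \<epsilon> where "\<epsilon> = e / (2 * (T + 1))"
  have \<epsilon>: "0 < \<epsilon>" "\<epsilon> * T < e / 2" using e T by (auto simp: \<epsilon>_def field_simps)
  have pos2: "0 < \<epsilon> * e / 2" using \<epsilon> e by simp
  obtain N where N: "\<And>i j. i \<ge> N \<Longrightarrow> j \<ge> N \<Longrightarrow> \<bar>E i - E j\<bar> < \<epsilon> * e / 2"
    using \<open>Cauchy E\<close>[unfolded Cauchy_def, rule_format, OF pos2] by (auto simp: dist_real_def)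
  have L1: "(LINT t|?M. norm (u q t - u (q + d) t)) < e" if "q \<ge> N" for q d
  proof -
    have fin: "integrable ?M (\<lambda>t. \<epsilon>)"
      using cell_step_integral[OF T, of "\<lambda>k. \<epsilon>" 0] by (simp add: has_bochner_integral_iff)
    have fin2: "(LINT t|?M. \<epsilon>) = \<epsilon> * T"
      using cell_step_integral[OF T, of "\<lambda>k. \<epsilon>" 0] by (simp add: has_bochner_integral_iff)
    have "(LINT t|?M. norm (u q t - u (q + d) t)) \<le> (LINT t|?M. \<epsilon> + (u q t - u (q + d) t)\<^sup>2 / \<epsilon>)"
    proof (intro integral_mono integrable_norm Bochner_Integration.integrable_diff ui
        Bochner_Integration.integrable_add fin integrable_divide gapi)
      fix t
      have "\<bar>y\<bar> \<le> \<epsilon> + y\<^sup>2 / \<epsilon>" for y :: real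
      proof (cases "\<bar>y\<bar> \<le> \<epsilon>")
        case True then show ?thesis using \<epsilon> by (simp add: add_increasing2)
      next
        case False
        then have "\<epsilon> * \<bar>y\<bar> \<le> \<bar>y\<bar> * \<bar>y\<bar>" by (intro mult_right_mono) auto
        then have "\<bar>y\<bar> \<le> y\<^sup>2 / \<epsilon>" using \<epsilon> by (simp add: field_simps power2_eq_square)
        then show ?thesis using \<epsilon> by simp
      qed
      then show "norm (u q t - u (q + d) t) \<le> \<epsilon> + (u q t - u (q + d) t)\<^sup>2 / \<epsilon>" by simp
    qed
    also have "\<dots> = \<epsilon> * T + (LINT t|?M. (u q t - u (q + d) t)\<^sup>2) / \<epsilon>"
      by (subst Bochner_Integration.integral_add) (auto intro: fin gapi simp: fin2 simp del: lebesgue_integral_const)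
    also have "(LINT t|?M. (u q t - u (q + d) t)\<^sup>2) / \<epsilon> \<le> (\<epsilon> * e / 2) / \<epsilon>"
    proof (intro divide_right_mono)
      show "(LINT t|?M. (u q t - u (q + d) t)\<^sup>2) \<le> \<epsilon> * e / 2"
        using gap[of q d] N[of "q + d" q] that by linarith
    qed (use \<epsilon> in auto)
    finally show ?thesis using \<epsilon> by simp
  qed
  show ?thesis
  proof (intro exI[of _ N] allI impI)
    fix i j assume "i \<ge> N" "j \<ge> N"
    then have "(LINT t|?M. norm (u i t - u j t)) < e"
      using L1[of i "j - i"] L1[of j "i - j"] by (cases "i \<le> j") (auto simp: abs_minus_commute)
    then show "(LINT t|?M. norm (exp (- cell_density T a i t / 2) - exp (- cell_density T a j t / 2))) < e"
      by (simp only: u_def)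
  qed
qed

text \<open>Uniform integrability in the manner of de la Vallee-Poussin. The slope \<open>B\<close>
  is tested on the cells of density above \<open>K\<close> only. First \<open>B\<close> is taken so
  large that \<open>c / B\<close> is at most \<open>e / 2\<close>, then \<open>K\<close> so large
  that the price \<open>exp B * V\<close> times the total length of these cells, which is at most
  \<open>A / K\<close>, is at most \<open>B * e / 2\<close>.\<close>

lemma cell_density_tail:
  fixes a W :: "real \<Rightarrow> real"
  assumes T: "0 < T" and mono: "mono_on {0..T} a"
    and W: "\<And>q k. k < 2 ^ q \<Longrightarrow> incr T W q k \<le> V * (T / 2 ^ q)" and V: "0 \<le> V"
    and cost: "\<And>q \<beta>. dual_cost T a W q \<beta> \<le> c" and e: "0 < e"
  obtains K where "0 < K" "\<And>q. (LINT t|restrict_space lborel {0..<T}. max 0 (cell_density T a q t - K)) \<le> e"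
proof -
  define A where "A = a T - a 0"
  have A: "0 \<le> A" using mono T by (auto simp: A_def intro: mono_onD)
  have c0: "0 \<le> c" using cost[of 0 "\<lambda>_. 0"] by (simp add: dual_cost_def)
  define B where "B = 2 * (c + 1) / e"
  have B: "0 < B" using c0 e by (simp add: B_def)
  define K where "K = 2 * (exp B * V * A + 1) / (B * e)"
  have K: "0 < K" unfolding K_def using B e V A by (intro divide_pos_pos mult_pos_pos add_nonneg_pos) auto
  have "(LINT t|restrict_space lborel {0..<T}. max 0 (cell_density T a q t - K)) \<le> e" for q
  proof -
    define x where "x k = incr T a q k * 2 ^ q / T" for k
    define h where "h = T / 2 ^ q"
    have h: "0 < h" using T by (simp add: h_def)
    have xh: "x k * h = incr T a q k" for k using T by (simp add: x_def h_def)
    have xc: "cell_density T a q t = x (cell_index T q t)" for t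
      by (simp add: cell_density_def x_def)
    have "(LINT t|restrict_space lborel {0..<T}. max 0 (cell_density T a q t - K)) = (\<Sum>k<2 ^ q. max 0 (x k - K) * h)"
      unfolding xc h_def using cell_step_integral[OF T, of "\<lambda>k. max 0 (x k - K)" q]
      by (simp add: has_bochner_integral_iff)
    also have "\<dots> \<le> (\<Sum>k<2 ^ q. if x k > K then incr T a q k else 0)"
    proof (intro sum_mono)
      fix k
      have "(x k - K) * h \<le> x k * h" using h K by (intro mult_right_mono) auto
      then show "max 0 (x k - K) * h \<le> (if x k > K then incr T a q k else 0)" by (auto simp: xh max_def)
    qed
    also have "B * \<dots> \<le> c + exp B * V * (A / K)"
    proof -
      define \<beta> where "\<beta> k = (if x k > K then B else 0)" for k
      have "B * (\<Sum>k<2 ^ q. if x k > K then incr T a q k else 0) =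
         dual_cost T a W q \<beta> + (\<Sum>k<2 ^ q. (exp (\<beta> k) - 1) * incr T W q k)"
        unfolding dual_cost_def sum.distrib[symmetric] sum_distrib_left
        by (intro sum.cong refl) (simp add: \<beta>_def)
      also have "(\<Sum>k<2 ^ q. (exp (\<beta> k) - 1) * incr T W q k) \<le> (\<Sum>k<2 ^ q. exp B * V * (incr T a q k / K))"
      proof (intro sum_mono)
        fix k :: nat assume "k \<in> {..<2 ^ q}"
        then have k: "k < 2 ^ q" by simp
        show "(exp (\<beta> k) - 1) * incr T W q k \<le> exp B * V * (incr T a q k / K)"
        proof (cases "x k > K")
          case True
          have "(exp B - 1) * incr T W q k \<le> (exp B - 1) * (V * h)"
            using W[OF k] B by (intro mult_left_mono) (auto simp: h_def)
          also have "\<dots> \<le> exp B * (V * h)" using V h by (intro mult_right_mono) auto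
          \<comment> \<open>Markov's inequality for one cell: where the density exceeds
            \<open>K\<close>, the length is at most the increment divided by
            \<open>K\<close>.\<close>
          also have "h \<le> x k * h / K" using True h K by (simp add: field_simps)
          finally show ?thesis using True V by (auto simp: \<beta>_def xh mult.assoc mult_left_mono)
        qed (use V K incr_nonneg[OF mono T k] in \<open>auto simp: \<beta>_def\<close>)
      qed
      also have "\<dots> = exp B * V * (A / K)"
        unfolding sum_distrib_left[symmetric] sum_divide_distrib[symmetric] sum_incr by (simp add: A_def)
      finally show ?thesis using cost[of q \<beta>] by simp
    qed
    also have "c + exp B * V * (A / K) \<le> B * e"
    proof -
      have "exp B * V * A \<le> K * (B * e / 2)" using B e by (simp add: K_def)
      then have "exp B * V * (A / K) \<le> B * e / 2" using K by (simp add: field_simps)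
      moreover have "c \<le> B * e / 2" using e by (simp add: B_def)
      ultimately show ?thesis by linarith
    qed
    finally show ?thesis using B by simp
  qed
  with K that show thesis by blast
qed

lemma cell_density_weight_tendsto:
  assumes T: "0 < T" and w: "continuous_on {0..T} w"
    and W: "\<And>t. t \<in> {0..T} \<Longrightarrow> (W has_real_derivative w t) (at t within {0..T})"
    and t: "0 \<le> t" "t < T"
  shows "(\<lambda>q. cell_density T W q t) \<longlonglongrightarrow> w t"
proof (rule LIMSEQ_I)
  fix e :: real assume e: "0 < e"
  obtain d where d: "0 < d" "\<And>s. s \<in> {0..T} \<Longrightarrow> \<bar>s - t\<bar> < d \<Longrightarrow> \<bar>w s - w t\<bar> < e"
    using w[unfolded continuous_on_iff, rule_format, of t e] t e by (auto simp: dist_real_def)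
  have "(\<lambda>q. T / 2 ^ q) \<longlonglongrightarrow> 0" by real_asymp
  then obtain N where N: "\<And>q. q \<ge> N \<Longrightarrow> T / 2 ^ q < d"
    using d(1) T unfolding LIMSEQ_iff by (metis abs_of_pos diff_zero divide_pos_pos real_norm_def zero_less_numeral zero_less_power)
  show "\<exists>N. \<forall>q\<ge>N. norm (cell_density T W q t - w t) < e"
  proof (intro exI[of _ N] allI impI)
    fix q assume q: "q \<ge> N"
    let ?k = "cell_index T q t"
    let ?l = "tgrid T q ?k" and ?r = "tgrid T q (Suc ?k)"
    have k: "?k < 2 ^ q" using cell_index_less[OF T t] .
    have lr: "?l \<in> {0..T}" "?r \<in> {0..T}" using tgrid_mem[OF T] k by auto
    have lt: "?l \<le> t" "t < ?r" using cell_index_bounds[OF T t(1)] by auto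
    have rl: "?r - ?l = T / 2 ^ q" by (simp add: tgrid_Suc)
    have "\<exists>s\<in>{?l<..<?r}. W ?r - W ?l = (\<lambda>s h. w s * h) s (?r - ?l)"
    proof (rule mvt_simple)
      show "?l < ?r" using lt by simp
      fix s assume "?l \<le> s" "s \<le> ?r"
      then have "s \<in> {?l..?r}" by simp
      then have "(W has_real_derivative w s) (at s within {?l..?r})"
        using lr by (intro has_field_derivative_subset[OF W]) auto
      then show "(W has_derivative (*) (w s)) (at s within {?l..?r})"
        by (simp add: has_field_derivative_def)
    qed
    then obtain s where s: "s \<in> {?l<..<?r}" "W ?r - W ?l = w s * (T / 2 ^ q)" using rl by auto
    have "cell_density T W q t = w s" using s(2) T by (simp add: cell_density_def incr_def)
    moreover have "\<bar>s - t\<bar> < d" using s(1) lt rl N[OF q] by auto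
    ultimately show "norm (cell_density T W q t - w t) < e" using d(2)[of s] s(1) lr by auto
  qed
qed

text \<open>The Legendre transform restricted to finitely many slopes, which keeps it continuous and
  measurable in both arguments. The entropy is recovered along an enumeration of the rational
  slopes.\<close>

definition legendre_max :: "real set \<Rightarrow> real \<Rightarrow> real \<Rightarrow> real" where
  "legendre_max B x w = Max ((\<lambda>b. b * x - (exp b - 1) * w) ` B)"

lemma measurable_legendre_max [measurable (raw)]:
  assumes "finite B" "B \<noteq> {}" "f \<in> borel_measurable M" "g \<in> borel_measurable M"
  shows "(\<lambda>t. legendre_max B (f t) (g t)) \<in> borel_measurable M"
  using assms unfolding legendre_max_def
proof (induction B rule: finite_ne_induct)
  case (insert b B)
  then have "(\<lambda>t. max (b * f t - (exp b - 1) * g t) (Max ((\<lambda>b. b * f t - (exp b - 1) * g t) ` B))) \<in> borel_measurable M"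
    by (intro borel_measurable_max) auto
  then show ?case using insert by simp
qed simp

lemma tendsto_legendre_max:
  assumes "finite B" "B \<noteq> {}" "f \<longlonglongrightarrow> x" "g \<longlonglongrightarrow> w"
  shows "(\<lambda>i. legendre_max B (f i) (g i)) \<longlonglongrightarrow> legendre_max B x w"
  using assms unfolding legendre_max_def
proof (induction B rule: finite_ne_induct)
  case (insert b B)
  then have "(\<lambda>i. max (b * f i - (exp b - 1) * g i) (Max ((\<lambda>b. b * f i - (exp b - 1) * g i) ` B))) \<longlonglongrightarrow>
    max (b * x - (exp b - 1) * w) (Max ((\<lambda>b. b * x - (exp b - 1) * w) ` B))"
    by (intro tendsto_max) (auto intro!: tendsto_intros)
  then show ?case using insert by simp
qed (auto intro!: tendsto_intros)

text \<open>In every cell the maximum is attained at some slope of \<open>B\<close>. These slopes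
  form a test vector, and the integral is its dual cost. The slope 0 makes the integrand
  nonnegative.\<close>

lemma legendre_max_integral_le:
  assumes T: "0 < T" and B: "finite B" "0 \<in> B" and cost: "\<And>q \<beta>. dual_cost T a W q \<beta> \<le> c"
  shows "(\<integral>\<^sup>+ t. ennreal (legendre_max B (cell_density T a q t) (cell_density T W q t)) \<partial>restrict_space lborel {0..<T}) \<le> ennreal c"
proof -
  let ?M = "restrict_space lborel {0..<T}"
  define g where "g k = legendre_max B (incr T a q k * 2 ^ q / T) (incr T W q k * 2 ^ q / T)" for k
  have g0: "0 \<le> g k" for k
    unfolding g_def legendre_max_def using B by (intro Max_ge) (auto intro!: image_eqI[of _ _ 0])
  have "\<exists>b\<in>B. g k = b * (incr T a q k * 2 ^ q / T) - (exp b - 1) * (incr T W q k * 2 ^ q / T)" for k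
    using Max_in[of "(\<lambda>b. b * (incr T a q k * 2 ^ q / T) - (exp b - 1) * (incr T W q k * 2 ^ q / T)) ` B"] B
    unfolding g_def legendre_max_def by blast
  then obtain \<beta> where \<beta>: "\<And>k. g k = \<beta> k * (incr T a q k * 2 ^ q / T) - (exp (\<beta> k) - 1) * (incr T W q k * 2 ^ q / T)"
    by metis
  have hb: "has_bochner_integral ?M (\<lambda>t. g (cell_index T q t)) (\<Sum>k<2 ^ q. g k * (T / 2 ^ q))"
    by (rule cell_step_integral[OF T])
  have "(\<Sum>k<2 ^ q. g k * (T / 2 ^ q)) = dual_cost T a W q \<beta>"
    unfolding dual_cost_def \<beta> using T by (intro sum.cong refl) (simp add: field_simps)
  then have le: "(LINT t|?M. g (cell_index T q t)) \<le> c" using cost[of q \<beta>] hb by (simp add: has_bochner_integral_iff)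
  have "(\<integral>\<^sup>+ t. ennreal (g (cell_index T q t)) \<partial>?M) = ennreal (LINT t|?M. g (cell_index T q t))"
    using hb g0 by (intro nn_integral_eq_integral) (auto simp: has_bochner_integral_iff)
  also have "\<dots> \<le> ennreal c" using le by (rule ennreal_leI)
  finally show ?thesis by (simp add: g_def cell_density_def)
qed

text \<open>Continuity in \<open>b\<close> passes from rational to real slopes. The supremum is then
  attained at \<open>b = ln (x / w)\<close>, or approached as \<open>b\<close> tends to minus
  infinity when \<open>x = 0\<close>; for \<open>w = 0\<close> arbitrarily large slopes force
  \<open>x = 0\<close>.\<close>

lemma relent_le_sup_dual:
  assumes x: "0 \<le> x" and w: "0 \<le> w" and H: "\<And>b. b \<in> \<rat> \<Longrightarrow> b * x - (exp b - 1) * w \<le> h"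
  shows "relent x w \<le> h" and "w = 0 \<Longrightarrow> x = 0"
proof -
  have H': "b * x - (exp b - 1) * w \<le> h" for b
  proof (rule ccontr)
    assume "\<not> ?thesis"
    then have "h < b * x - (exp b - 1) * w" by simp
    moreover have "isCont (\<lambda>b. b * x - (exp b - 1) * w) b" by (intro continuous_intros)
    ultimately have "eventually (\<lambda>b. h < b * x - (exp b - 1) * w) (nhds b)"
      by (intro order_tendstoD(1)) (auto simp: continuous_within tendsto_nhds_iff)
    then obtain d where d: "d > 0" "\<And>b'. dist b' b < d \<Longrightarrow> h < b' * x - (exp b' - 1) * w"
      by (auto simp: eventually_nhds_metric)
    obtain r where r: "r \<in> \<rat>" "b < r" "r < b + d" using Rats_dense_in_real[of b "b + d"] d by auto
    then have "h < r * x - (exp r - 1) * w" using d by (intro d) (auto simp: dist_real_def)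
    then show False using H[OF r(1)] by simp
  qed
  show z: "x = 0" if "w = 0"
  proof (rule ccontr)
    assume "x \<noteq> 0"
    then have "0 < x" using x by simp
    then show False using H'[of "(h + 1) / x"] that by (simp add: field_simps)
  qed
  show "relent x w \<le> h"
  proof (cases "x = 0")
    case True
    have lim: "((\<lambda>b. (1 - exp b) * w) \<longlongrightarrow> (1 - 0) * w) at_bot"
      by (intro tendsto_intros exp_at_bot)
    have "(1 - exp b) * w \<le> h" for b using H'[of b] True by (simp add: left_diff_distrib)
    then have "w \<le> h" using tendsto_upperbound[OF lim, of h] by simp
    then show ?thesis using True by (simp add: relent_def)
  next
    case False
    then have "0 < x" "0 < w" using x w z by (auto simp: less_le)
    then have "(exp (ln (x / w)) - 1) * w = x - w" by (simp add: left_diff_distrib)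
    then show ?thesis using H'[of "ln (x / w)"] by (simp add: relent_def mult.commute)
  qed
qed

text \<open>Along a subsequence \<open>exp (- density / 2)\<close> converges almost everywhere to
  some \<open>U\<close> between 0 and 1, and the density itself to \<open>- 2 * ln U\<close>,
  provided that \<open>U\<close> does not vanish.\<close>

lemma cell_density_limit:
  fixes a :: "real \<Rightarrow> real"
  assumes T: "0 < T" and mono: "mono_on {0..T} a"
  obtains r F where "strict_mono (r :: nat \<Rightarrow> nat)" "F \<in> borel_measurable borel" "\<And>t. 0 \<le> F t"
    "AE t in restrict_space lborel {0..<T}. (\<lambda>i. cell_density T a (r i) t) \<longlonglongrightarrow> F t"
proof -
  let ?M = "restrict_space lborel {0..<T}"
  define u where "u q t = exp (- cell_density T a q t / 2)" for q t
  have u_meas [measurable]: "u q \<in> borel_measurable borel" for q unfolding u_def by measurable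
  have ui: "integrable ?M (u q)" for q
    unfolding u_def cell_density_def using cell_step_integral[OF T, of "\<lambda>k. exp (- (incr T a q k * 2 ^ q / T) / 2)" q]
    by (simp add: has_bochner_integral_iff)
  obtain r where r: "strict_mono r" and C: "AE t in ?M. Cauchy (\<lambda>i. u (r i) t)"
  proof (rule cauchy_L1_AE_cauchy_subseq[OF ui])
    fix e :: real assume "0 < e"
    then show "\<exists>N. \<forall>i\<ge>N. \<forall>j\<ge>N. (LINT t|?M. norm (u i t - u j t)) < e"
      unfolding u_def by (rule cell_density_cauchy[OF T mono])
  qed
  define U where "U t = lim (\<lambda>i. u (r i) t)" for t
  have U_meas [measurable]: "U \<in> borel_measurable borel"
    unfolding U_def by (rule borel_measurable_lim_metric) simp
  \<comment> \<open>The maximum makes \<open>F\<close> nonnegative everywhere; where the sequence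
    converges to a positive \<open>U t\<close>, it changes nothing since
    \<open>U t \<le> 1\<close>.\<close>
  define F where "F t = max 0 (- 2 * ln (U t))" for t
  have tot: "(\<integral>\<^sup>+ t. ennreal (cell_density T a q t) \<partial>?M) = ennreal (a T - a 0)" for q
  proof -
    have "has_bochner_integral ?M (cell_density T a q) (a T - a 0)"
      unfolding cell_density_def using cell_step_integral[OF T, of "\<lambda>k. incr T a q k * 2 ^ q / T" q] T
      by (simp add: sum_incr)
    then show ?thesis
      using cell_density_nonneg[OF mono T]
      by (subst nn_integral_eq_integral) (auto simp: has_bochner_integral_iff space_restrict_space intro!: AE_I2)
  qed
  \<comment> \<open>Fatou's lemma: all densities have the same finite integral, so they cannot tend
    to infinity on a set of positive measure. This is what excludes \<open>U t = 0\<close>.\<close>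
  have "(\<integral>\<^sup>+ t. liminf (\<lambda>i. ennreal (cell_density T a (r i) t)) \<partial>?M) \<le> liminf (\<lambda>i. \<integral>\<^sup>+ t. ennreal (cell_density T a (r i) t) \<partial>?M)"
    by (intro nn_integral_liminf measurable_restrict_space1) simp
  also have "\<dots> = ennreal (a T - a 0)" by (simp add: tot Liminf_const)
  finally have fin: "(\<integral>\<^sup>+ t. liminf (\<lambda>i. ennreal (cell_density T a (r i) t)) \<partial>?M) < \<infinity>"
    by (simp add: le_less_trans)
  have "AE t in ?M. liminf (\<lambda>i. ennreal (cell_density T a (r i) t)) \<noteq> \<infinity>"
    using fin by (intro nn_integral_noteq_infinite measurable_restrict_space1) (auto simp: less_top)
  with C have "AE t in ?M. (\<lambda>i. cell_density T a (r i) t) \<longlonglongrightarrow> F t"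
    using AE_space
  proof eventually_elim
    fix t assume C: "Cauchy (\<lambda>i. u (r i) t)" and L: "liminf (\<lambda>i. ennreal (cell_density T a (r i) t)) \<noteq> \<infinity>"
      and t: "t \<in> space ?M"
    have lim: "(\<lambda>i. u (r i) t) \<longlonglongrightarrow> U t"
      unfolding U_def using C by (simp add: Cauchy_convergent convergent_LIMSEQ_iff[symmetric])
    have cd: "0 \<le> cell_density T a q t" for q using t cell_density_nonneg[OF mono T] by (auto simp: space_restrict_space)
    have u01: "0 < u q t" "u q t \<le> 1" for q using cd by (auto simp: u_def)
    have U0: "0 \<le> U t" using lim by (rule LIMSEQ_le_const) (use u01 in \<open>auto intro: less_imp_le\<close>)
    have U1: "U t \<le> 1" using lim by (rule LIMSEQ_le_const2) (use u01 in auto)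
    have cdu: "cell_density T a q t = - 2 * ln (u q t)" for q by (simp add: u_def)
    have Upos: "U t \<noteq> 0"
    proof
      assume "U t = 0"
      then have "filterlim (\<lambda>i. u (r i) t) (at_right 0) sequentially"
        using lim u01 less_imp_neq[OF u01(1), symmetric] by (simp add: filterlim_at)
      then have "filterlim (\<lambda>i. ln (u (r i) t)) at_bot sequentially"
        by (rule filterlim_compose[OF ln_at_0])
      then have "filterlim (\<lambda>i. cell_density T a (r i) t) at_top sequentially"
        using filterlim_tendsto_pos_mult_at_top[OF tendsto_const[of "2::real"], of "\<lambda>i. - ln (u (r i) t)" sequentially]
        by (simp add: cdu filterlim_uminus_at_bot)
      then have "(\<lambda>i. ennreal (cell_density T a (r i) t)) \<longlonglongrightarrow> \<infinity>"
        by (simp add: ennreal_tendsto_top_eq_at_top)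
      then show False using L lim_imp_Liminf[OF sequentially_bot] by blast
    qed
    then have "0 < U t" using U0 by simp
    then have "F t = - 2 * ln (U t)" using U1 by (simp add: F_def max_def)
    moreover have "(\<lambda>i. - 2 * ln (u (r i) t)) \<longlonglongrightarrow> - 2 * ln (U t)"
      using lim \<open>0 < U t\<close> by (intro tendsto_intros) auto
    ultimately show "(\<lambda>i. cell_density T a (r i) t) \<longlonglongrightarrow> F t" unfolding cdu by simp
  qed
  moreover have "F \<in> borel_measurable borel" unfolding F_def by measurable
  ultimately show thesis using r by (intro that[of r F]) (auto simp: F_def)
qed

text \<open>The martingale property again: up to a fixed grid point the integrals no longer depend
  on the level \<open>p\<close> once \<open>p \<ge> q\<close>.\<close>

lemma cell_density_integral_prefix:
  assumes T: "0 < T" and k: "k \<le> 2 ^ q" and p: "q \<le> p"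
  shows "has_bochner_integral (restrict_space lborel {0..<T})
    (\<lambda>t. indicator {0..<tgrid T q k} t * cell_density T a p t) (a (tgrid T q k) - a 0)"
proof -
  let ?M = "restrict_space lborel {0..<T}"
  obtain d where d: "p = q + d" using p le_Suc_ex by blast
  define g where "g j = of_bool (j div 2 ^ d < k) * incr T a p j * 2 ^ p / T" for j
  have "has_bochner_integral ?M (\<lambda>t. g (cell_index T p t)) (\<Sum>j<2 ^ p. g j * (T / 2 ^ p))"
    by (rule cell_step_integral[OF T])
  also have "(\<Sum>j<2 ^ p. g j * (T / 2 ^ p)) = (\<Sum>j<2 ^ (q + d). of_bool (j div 2 ^ d < k) * incr T a (q + d) j)"
    unfolding d[symmetric] using T by (intro sum.cong refl) (simp add: g_def)
  also have "\<dots> = (\<Sum>j<2 ^ q. of_bool (j < k) * incr T a q j)"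
    by (rule incr_refine)
  also have "\<dots> = (\<Sum>j<k. incr T a q j)"
    using k by (intro sum.mono_neutral_cong_right) auto
  also have "\<dots> = a (tgrid T q k) - a 0" by (rule sum_incr_less)
  finally have *: "has_bochner_integral ?M (\<lambda>t. g (cell_index T p t)) (a (tgrid T q k) - a 0)" .
  have "g (cell_index T p t) = indicator {0..<tgrid T q k} t * cell_density T a p t" if "t \<in> space ?M" for t
  proof -
    have t: "0 \<le> t" using that by (auto simp: space_restrict_space)
    have "cell_index T p t div 2 ^ d < k \<longleftrightarrow> t < tgrid T q k"
      unfolding d cell_index_div[OF T t, symmetric]
    proof
      assume "cell_index T q t < k"
      then have "tgrid T q (Suc (cell_index T q t)) \<le> tgrid T q k" using T by (intro tgrid_mono) auto
      then show "t < tgrid T q k" using cell_index_bounds[OF T t, of q] by simp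
    next
      assume *: "t < tgrid T q k"
      show "cell_index T q t < k"
      proof (rule ccontr)
        assume "\<not> ?thesis"
        then have "tgrid T q k \<le> tgrid T q (cell_index T q t)" using T by (intro tgrid_mono) auto
        then show False using * cell_index_bounds[OF T t, of q] by simp
      qed
    qed
    then show ?thesis using t by (simp add: g_def cell_density_def indicator_def)
  qed
  then show ?thesis using * by (subst has_bochner_integral_cong[OF refl _ refl, symmetric]) auto
qed

text \<open>Uniform integrability turns the almost everywhere limit of the dyadic densities into an
  L1 limit, so that \<open>a\<close> is the integral of \<open>F\<close>. The entropy bound is
  Fatou's lemma for finitely many slopes, followed by monotone convergence over all rational slopes;
  finiteness of the supremum also yields that \<open>F\<close> vanishes where \<open>w\<close>
  does.\<close>

lemma entropy_density:
  fixes a w W :: "real \<Rightarrow> real"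
  assumes T: "0 < T" and cont: "continuous_on {0..T} a" and mono: "mono_on {0..T} a"
    and w: "continuous_on {0..T} w" "\<And>t. t \<in> {0..T} \<Longrightarrow> 0 \<le> w t"
    and W: "\<And>t. t \<in> {0..T} \<Longrightarrow> (W has_real_derivative w t) (at t within {0..T})"
    and Wincr: "\<And>q k. k < 2 ^ q \<Longrightarrow> incr T W q k \<le> V * (T / 2 ^ q)" and V: "0 \<le> V"
    and cost: "\<And>q \<beta>. dual_cost T a W q \<beta> \<le> c"
  obtains F where "F \<in> borel_measurable borel" "\<And>t. 0 \<le> F t" "set_integrable lborel {0..T} F"
    "\<And>t. t \<in> {0..T} \<Longrightarrow> (LINT s:{0..t}|lborel. F s) = a t - a 0"
    "AE t in lborel. t \<in> {0..T} \<longrightarrow> w t = 0 \<longrightarrow> F t = 0"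
    "(\<integral>\<^sup>+ t\<in>{0..T}. ennreal (relent (F t) (w t)) \<partial>lborel) \<le> ennreal c"
proof -
  let ?M = "restrict_space lborel {0..<T}"
  interpret M: finite_measure ?M
    using T by (intro finite_measureI) (simp add: space_restrict_space emeasure_restrict_space)
  obtain r F where r: "strict_mono (r :: nat \<Rightarrow> nat)" and F [measurable]: "F \<in> borel_measurable borel" and F0: "\<And>t. 0 \<le> F t"
    and lim: "AE t in ?M. (\<lambda>i. cell_density T a (r i) t) \<longlonglongrightarrow> F t"
    by (rule cell_density_limit[OF T mono]) blast
  define g where "g i = cell_density T a (r i)" for i
  have [measurable]: "g i \<in> borel_measurable borel" for i unfolding g_def by simp
  have g0: "0 \<le> g i t" if "t \<in> space ?M" for i t
    using that cell_density_nonneg[OF mono T] by (auto simp: g_def space_restrict_space)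
  have gi: "integrable ?M (g i)" for i
    unfolding g_def cell_density_def using cell_step_integral[OF T, of "\<lambda>k. incr T a (r i) k * 2 ^ r i / T" "r i"]
    by (simp add: has_bochner_integral_iff)
  have lim: "AE t in ?M. (\<lambda>i. g i t) \<longlonglongrightarrow> F t" using lim by (simp add: g_def)
  \<comment> \<open>Fatou's lemma transfers the uniform tail bound to the limit.\<close>
  have tailF: "(\<integral>\<^sup>+ t. ennreal (max 0 (F t - K)) \<partial>?M) \<le> ennreal e"
    if K: "\<And>q. (LINT t|?M. max 0 (cell_density T a q t - K)) \<le> e" for K e
  proof -
    have "(\<integral>\<^sup>+ t. ennreal (max 0 (F t - K)) \<partial>?M) = (\<integral>\<^sup>+ t. liminf (\<lambda>i. ennreal (max 0 (g i t - K))) \<partial>?M)"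
    proof (rule nn_integral_cong_AE)
      show "AE t in ?M. ennreal (max 0 (F t - K)) = liminf (\<lambda>i. ennreal (max 0 (g i t - K)))"
        using lim
      proof eventually_elim
        case (elim t)
        then have "(\<lambda>i. ennreal (max 0 (g i t - K))) \<longlonglongrightarrow> ennreal (max 0 (F t - K))"
          by (intro tendsto_intros) auto
        then show ?case by (intro lim_imp_Liminf[symmetric]) auto
      qed
    qed
    also have "\<dots> \<le> liminf (\<lambda>i. \<integral>\<^sup>+ t. ennreal (max 0 (g i t - K)) \<partial>?M)"
      by (intro nn_integral_liminf measurable_restrict_space1) simp
    also have "\<dots> \<le> liminf (\<lambda>i. ennreal e)"
    proof (intro Liminf_mono always_eventually allI)
      fix i
      have "(\<integral>\<^sup>+ t. ennreal (max 0 (g i t - K)) \<partial>?M) = ennreal (LINT t|?M. max 0 (g i t - K))"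
        by (intro nn_integral_eq_integral integrable_max gi Bochner_Integration.integrable_diff) auto
      then show "(\<integral>\<^sup>+ t. ennreal (max 0 (g i t - K)) \<partial>?M) \<le> ennreal e"
        using K[of "r i"] by (simp add: g_def ennreal_leI)
    qed
    finally show ?thesis by (simp add: Liminf_const)
  qed
  have Fi: "integrable ?M F"
  proof -
    obtain K where K: "0 < K" "\<And>q. (LINT t|?M. max 0 (cell_density T a q t - K)) \<le> 1"
      using cell_density_tail[OF T mono Wincr V cost, of 1] by auto
    have "integrable ?M (\<lambda>t. max 0 (F t - K))"
      using tailF[OF K(2)] by (intro integrableI_nonneg measurable_restrict_space1) (auto simp: less_top[symmetric] top_unique)
    then have "integrable ?M (\<lambda>t. max 0 (F t - K) + K)" by simp
    then show ?thesis
      by (rule Bochner_Integration.integrable_bound) (use F0 in \<open>auto intro!: measurable_restrict_space1 AE_I2\<close>)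
  qed
  \<comment> \<open>Truncation at \<open>K\<close>: the truncated functions converge by dominated
    convergence, and the two tails contribute at most \<open>e / 4\<close> each.\<close>
  have L1: "(\<lambda>i. LINT t|?M. \<bar>g i t - F t\<bar>) \<longlonglongrightarrow> 0"
  proof (rule LIMSEQ_I)
    fix e :: real assume e: "0 < e"
    obtain K where K: "0 < K" "\<And>q. (LINT t|?M. max 0 (cell_density T a q t - K)) \<le> e / 4"
      using cell_density_tail[OF T mono Wincr V cost, of "e / 4"] e by auto
    have mi: "integrable ?M (\<lambda>t. \<bar>min (g i t) K - min (F t) K\<bar>)" for i
      by (intro integrable_abs Bochner_Integration.integrable_diff integrable_min gi Fi) auto
    have "(\<lambda>i. LINT t|?M. \<bar>min (g i t) K - min (F t) K\<bar>) \<longlonglongrightarrow> (LINT t|?M. 0)"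
    proof (rule integral_dominated_convergence[where w="\<lambda>_. K"])
      show "AE t in ?M. (\<lambda>i. \<bar>min (g i t) K - min (F t) K\<bar>) \<longlonglongrightarrow> 0"
        using lim
      proof eventually_elim
        case (elim t)
        then have "(\<lambda>i. \<bar>min (g i t) K - min (F t) K\<bar>) \<longlonglongrightarrow> \<bar>min (F t) K - min (F t) K\<bar>"
          by (intro tendsto_intros)
        then show ?case by simp
      qed
      show "AE t in ?M. norm \<bar>min (g i t) K - min (F t) K\<bar> \<le> K" for i
      proof (intro AE_I2)
        fix t assume "t \<in> space ?M"
        then have "0 \<le> g i t" "0 \<le> F t" using g0 F0 by auto
        then show "norm \<bar>min (g i t) K - min (F t) K\<bar> \<le> K" using K(1) by (auto simp: min_def abs_if)
      qed
    qed (auto intro!: measurable_restrict_space1)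
    then have "(\<lambda>i. LINT t|?M. \<bar>min (g i t) K - min (F t) K\<bar>) \<longlonglongrightarrow> 0" by simp
    then have "\<exists>N. \<forall>i\<ge>N. norm ((LINT t|?M. \<bar>min (g i t) K - min (F t) K\<bar>) - 0) < e / 4"
      using e by (intro LIMSEQ_D) auto
    then obtain N where N: "\<And>i. i \<ge> N \<Longrightarrow> \<bar>LINT t|?M. \<bar>min (g i t) K - min (F t) K\<bar>\<bar> < e / 4"
      by auto
    have Ft: "(LINT t|?M. max 0 (F t - K)) \<le> e / 4"
    proof -
      have "ennreal (LINT t|?M. max 0 (F t - K)) = (\<integral>\<^sup>+ t. ennreal (max 0 (F t - K)) \<partial>?M)"
        by (intro nn_integral_eq_integral[symmetric] integrable_max Fi Bochner_Integration.integrable_diff) auto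
      also have "\<dots> \<le> ennreal (e / 4)" by (rule tailF[OF K(2)])
      finally show ?thesis using e by (simp add: ennreal_le_iff)
    qed
    show "\<exists>N. \<forall>i\<ge>N. norm ((LINT t|?M. \<bar>g i t - F t\<bar>) - 0) < e"
    proof (intro exI[of _ N] allI impI)
      fix i assume i: "i \<ge> N"
      have "(LINT t|?M. \<bar>g i t - F t\<bar>) \<le> (LINT t|?M. \<bar>min (g i t) K - min (F t) K\<bar> + (max 0 (g i t - K) + max 0 (F t - K)))"
        by (intro integral_mono Bochner_Integration.integrable_add mi integrable_abs integrable_max gi Fi Bochner_Integration.integrable_diff) auto
      also have "\<dots> = (LINT t|?M. \<bar>min (g i t) K - min (F t) K\<bar>) + ((LINT t|?M. max 0 (g i t - K)) + (LINT t|?M. max 0 (F t - K)))"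
      proof -
        have "integrable ?M (\<lambda>t. max 0 (g i t - K))" "integrable ?M (\<lambda>t. max 0 (F t - K))"
          by (intro integrable_max gi Fi Bochner_Integration.integrable_diff; simp)+
        then show ?thesis using mi[of i] by simp
      qed
      also have "\<dots> < e" using N[OF i] Ft K(2)[of "r i"] e by (simp add: g_def)
      finally have "(LINT t|?M. \<bar>g i t - F t\<bar>) < e" .
      moreover have "0 \<le> (LINT t|?M. \<bar>g i t - F t\<bar>)" by (intro Bochner_Integration.integral_nonneg) auto
      ultimately show "norm ((LINT t|?M. \<bar>g i t - F t\<bar>) - 0) < e" by simp
    qed
  qed
  have Fprefix: "(LINT t|?M. indicator {0..<s} t * F t) = a s - a 0" if s: "s = tgrid T q k" "k \<le> 2 ^ q" for s q k
  proof -
    have ii: "integrable ?M (\<lambda>t. indicator {0..<s} t * f t)" if "integrable ?M f" for f :: "real \<Rightarrow> real"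
    proof (rule Bochner_Integration.integrable_bound[OF that])
      show "(\<lambda>t. indicator {0..<s} t * f t) \<in> borel_measurable ?M"
        using borel_measurable_integrable[OF that]
        by (intro borel_measurable_times[OF measurable_restrict_space1]) auto
    qed (auto simp: indicator_def)
    have "(\<lambda>i. LINT t|?M. indicator {0..<s} t * g i t) \<longlonglongrightarrow> (LINT t|?M. indicator {0..<s} t * F t)"
    proof (rule Lim_transform2[OF tendsto_const])
      have "\<bar>(LINT t|?M. indicator {0..<s} t * F t) - (LINT t|?M. indicator {0..<s} t * g i t)\<bar> \<le> (LINT t|?M. \<bar>g i t - F t\<bar>)" for i
      proof -
        have "(LINT t|?M. indicator {0..<s} t * F t) - (LINT t|?M. indicator {0..<s} t * g i t) =
            (LINT t|?M. indicator {0..<s} t * F t - indicator {0..<s} t * g i t)"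
          by (intro Bochner_Integration.integral_diff[symmetric] ii gi Fi)
        also have "\<bar>\<dots>\<bar> \<le> (LINT t|?M. \<bar>indicator {0..<s} t * F t - indicator {0..<s} t * g i t\<bar>)"
          by (rule integral_abs_bound)
        also have "\<dots> \<le> (LINT t|?M. \<bar>g i t - F t\<bar>)"
          by (intro integral_mono integrable_abs Bochner_Integration.integrable_diff ii gi Fi) (auto simp: indicator_def)
        finally show ?thesis .
      qed
      then show "(\<lambda>i. (LINT t|?M. indicator {0..<s} t * F t) - (LINT t|?M. indicator {0..<s} t * g i t)) \<longlonglongrightarrow> 0"
        by (intro tendsto_0_le[OF L1, of _ 1] always_eventually) (auto intro: order_trans)
    qed
    moreover have "eventually (\<lambda>i. (LINT t|?M. indicator {0..<s} t * g i t) = a s - a 0) sequentially"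
    proof (intro eventually_sequentiallyI[of q])
      fix i assume "q \<le> i"
      then have "q \<le> r i" using seq_suble[OF r, of i] by simp
      then show "(LINT t|?M. indicator {0..<s} t * g i t) = a s - a 0"
        using cell_density_integral_prefix[OF T s(2), of "r i" a] by (simp add: g_def s(1) has_bochner_integral_iff)
    qed
    ultimately show ?thesis by (rule LIMSEQ_unique[OF _ tendsto_eventually])
  qed
  have conv: "(LINT s:{0..t}|lborel. F s) = (LINT s|?M. indicator {0..<t} s * F s)"
    and convi: "set_integrable lborel {0..T} F" if t: "t \<in> {0..T}" for t
  proof -
    have ae: "AE s in lborel. s \<noteq> t" "AE s in lborel. s \<noteq> T" using AE_lborel_singleton by auto
    have "(LINT s|?M. indicator {0..<t} s * F s) = (LINT s|lborel. indicator {0..<T} s *\<^sub>R (indicator {0..<t} s * F s))"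
      by (subst integral_restrict_space) auto
    also have "\<dots> = (LINT s|lborel. indicator {0..t} s *\<^sub>R F s)"
      using ae(1) t by (intro integral_cong_AE) (auto simp: indicator_def)
    finally show "(LINT s:{0..t}|lborel. F s) = (LINT s|?M. indicator {0..<t} s * F s)"
      by (simp add: set_lebesgue_integral_def)
    have "integrable lborel (\<lambda>s. indicator {0..<T} s *\<^sub>R F s)"
      using Fi by (subst (asm) integrable_restrict_space) auto
    then show "set_integrable lborel {0..T} F"
      unfolding set_integrable_def using ae(2) by (subst integrable_cong_AE) (auto simp: indicator_def)
  qed
  \<comment> \<open>The identity is already known at the grid points. In between, both sides are
    monotone in \<open>t\<close> and \<open>a\<close> is continuous, so the values at the enclosing
    grid points squeeze the integral.\<close>
  have int: "(LINT s:{0..t}|lborel. F s) = a t - a 0" if t: "t \<in> {0..T}" for t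
  proof (cases "t = T")
    case True
    then show ?thesis using conv[OF t] Fprefix[of T 0 1] by (simp add: tgrid_def)
  next
    case False
    then have t': "0 \<le> t" "t < T" using t by auto
    define L where "L = (LINT s|?M. indicator {0..<t} s * F s)"
    let ?l = "\<lambda>q. tgrid T q (cell_index T q t)" and ?u = "\<lambda>q. tgrid T q (Suc (cell_index T q t))"
    have ii: "integrable ?M (\<lambda>s. indicator {0..<x} s * F s)" for x :: real
      by (rule Bochner_Integration.integrable_bound[OF Fi])
        (auto simp: indicator_def intro!: borel_measurable_times measurable_restrict_space1)
    have mm: "(LINT s|?M. indicator {0..<x} s * F s) \<le> (LINT s|?M. indicator {0..<y} s * F s)" if "x \<le> y" for x y
      using that F0 by (intro integral_mono ii) (auto simp: indicator_def)
    have lu: "?l q \<in> {0..T}" "?u q \<in> {0..T}" for q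
      using cell_index_less[OF T t', of q] tgrid_mem[OF T] by auto
    have "a (?l q) - a 0 \<le> L" for q
      using mm[of "?l q" t] Fprefix[OF refl, of "cell_index T q t" q] cell_index_less[OF T t', of q]
        cell_index_bounds[OF T t'(1), of q] by (simp add: L_def)
    moreover have "L \<le> a (?u q) - a 0" for q
      using mm[of t "?u q"] Fprefix[OF refl, of "Suc (cell_index T q t)" q] cell_index_less[OF T t', of q]
        cell_index_bounds[OF T t'(1), of q] by (simp add: L_def)
    moreover have hz: "(\<lambda>q. T / 2 ^ q) \<longlonglongrightarrow> 0" by real_asymp
    have "?l \<longlonglongrightarrow> t"
    proof (rule real_tendsto_sandwich[of "\<lambda>q. t - T / 2 ^ q" _ _ "\<lambda>_. t"])
      show "(\<lambda>q. t - T / 2 ^ q) \<longlonglongrightarrow> t" using tendsto_diff[OF tendsto_const hz, of t] by simp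
    qed (use cell_index_bounds[OF T t'(1)] in \<open>auto simp: tgrid_Suc algebra_simps less_imp_le\<close>)
    then have l: "(\<lambda>q. a (?l q)) \<longlonglongrightarrow> a t"
      using lu t by (intro continuous_on_tendsto_compose[OF cont]) auto
    have "?u \<longlonglongrightarrow> t"
    proof (rule real_tendsto_sandwich[of "\<lambda>_. t" _ _ "\<lambda>q. t + T / 2 ^ q"])
      show "(\<lambda>q. t + T / 2 ^ q) \<longlonglongrightarrow> t" using tendsto_add[OF tendsto_const hz, of t] by simp
    qed (use cell_index_bounds[OF T t'(1)] in \<open>auto simp: tgrid_Suc less_imp_le\<close>)
    then have u: "(\<lambda>q. a (?u q)) \<longlonglongrightarrow> a t"
      using lu t by (intro continuous_on_tendsto_compose[OF cont]) auto
    have "a t - a 0 \<le> L" "L \<le> a t - a 0"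
      using calculation LIMSEQ_le_const2[OF tendsto_diff[OF l tendsto_const], of "a 0" L]
        LIMSEQ_le_const[OF tendsto_diff[OF u tendsto_const], of L "a 0"] by auto
    then show ?thesis using conv[OF t] by (simp add: L_def)
  qed
  \<comment> \<open>An increasing exhaustion of the rational slopes; the slope 0 is kept throughout
    so that the maxima are nonnegative.\<close>
  define B where "B N = insert 0 (real_of_rat ` from_nat ` {..N::nat})" for N
  have B: "finite (B N)" "0 \<in> B N" "B N \<noteq> {}" for N by (auto simp: B_def)
  \<comment> \<open>Continuity of \<open>w\<close> is known on \<open>[0, T]\<close> only; cutting
    it off gives a Borel function on the line.\<close>
  define w' where "w' t = (if t \<in> {0..<T} then w t else 0)" for t
  have w'_meas [measurable]: "w' \<in> borel_measurable borel"
  proof -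
    have "(\<lambda>t. indicator {0..<T} t *\<^sub>R w t) \<in> borel_measurable borel"
      by (intro borel_measurable_continuous_on_indicator continuous_on_subset[OF w(1)]) auto
    then show ?thesis by (rule measurable_cong[THEN iffD1, rotated]) (auto simp: w'_def indicator_def)
  qed
  have GN: "(\<integral>\<^sup>+ t. ennreal (legendre_max (B N) (F t) (w' t)) \<partial>?M) \<le> ennreal c" for N
  proof -
    have "(\<integral>\<^sup>+ t. ennreal (legendre_max (B N) (F t) (w' t)) \<partial>?M) =
       (\<integral>\<^sup>+ t. liminf (\<lambda>i. ennreal (legendre_max (B N) (g i t) (cell_density T W (r i) t))) \<partial>?M)"
    proof (rule nn_integral_cong_AE)
      show "AE t in ?M. ennreal (legendre_max (B N) (F t) (w' t)) =
          liminf (\<lambda>i. ennreal (legendre_max (B N) (g i t) (cell_density T W (r i) t)))"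
        using lim AE_space
      proof eventually_elim
        case (elim t)
        then have "0 \<le> t" "t < T" "w' t = w t" by (auto simp: space_restrict_space w'_def)
        then have "(\<lambda>i. cell_density T W (r i) t) \<longlonglongrightarrow> w' t"
          using LIMSEQ_subseq_LIMSEQ[OF cell_density_weight_tendsto[OF T w(1) W, of t] r] by (simp add: o_def)
        then have "(\<lambda>i. ennreal (legendre_max (B N) (g i t) (cell_density T W (r i) t))) \<longlonglongrightarrow> ennreal (legendre_max (B N) (F t) (w' t))"
          using elim B by (intro tendsto_ennrealI tendsto_legendre_max) auto
        then show ?case by (intro lim_imp_Liminf[symmetric]) auto
      qed
    qed
    also have "\<dots> \<le> liminf (\<lambda>i. \<integral>\<^sup>+ t. ennreal (legendre_max (B N) (g i t) (cell_density T W (r i) t)) \<partial>?M)"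
      using B by (intro nn_integral_liminf measurable_restrict_space1 measurable_compose[OF _ measurable_ennreal] measurable_legendre_max) auto
    also have "\<dots> \<le> liminf (\<lambda>i. ennreal c)"
      using legendre_max_integral_le[OF T B(1,2) cost] by (intro Liminf_mono always_eventually allI) (simp add: g_def)
    finally show ?thesis by (simp add: Liminf_const)
  qed
  define H where "H t = (SUP N. ennreal (legendre_max (B N) (F t) (w' t)))" for t
  have [measurable]: "H \<in> borel_measurable borel"
    unfolding H_def using B by (intro borel_measurable_SUP measurable_compose[OF _ measurable_ennreal] measurable_legendre_max) auto
  have Hc: "(\<integral>\<^sup>+ t. H t \<partial>?M) \<le> ennreal c"
  proof -
    have "incseq (\<lambda>N t. ennreal (legendre_max (B N) (F t) (w' t)))"
      unfolding incseq_def le_fun_def legendre_max_def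
    proof (intro allI impI ennreal_leI Max_mono)
      fix m n t assume "m \<le> (n::nat)"
      then show "(\<lambda>b. b * F t - (exp b - 1) * w' t) ` B m \<subseteq> (\<lambda>b. b * F t - (exp b - 1) * w' t) ` B n"
        by (intro image_mono) (auto simp: B_def)
    qed (auto simp: B_def)
    then have "(\<integral>\<^sup>+ t. H t \<partial>?M) = (SUP N. \<integral>\<^sup>+ t. ennreal (legendre_max (B N) (F t) (w' t)) \<partial>?M)"
      unfolding H_def using B
      by (intro nn_integral_monotone_convergence_SUP measurable_restrict_space1 measurable_compose[OF _ measurable_ennreal] measurable_legendre_max) auto
    also have "\<dots> \<le> ennreal c" using GN by (intro SUP_least)
    finally show ?thesis .
  qed
  have rel: "ennreal (relent (F t) (w' t)) \<le> H t \<and> (w' t = 0 \<longrightarrow> F t = 0)" if fin: "H t \<noteq> \<infinity>" and t: "t \<in> {0..<T}" for t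
  proof -
    have "b * F t - (exp b - 1) * w' t \<le> enn2real (H t)" if br: "b \<in> \<rat>" for b
    proof -
      obtain x where x: "b = real_of_rat x" using br by (auto elim: Rats_cases)
      have "b \<in> B (to_nat x)" unfolding B_def x by (auto intro!: image_eqI[of _ _ x] image_eqI[of _ _ "to_nat x"])
      then have "b * F t - (exp b - 1) * w' t \<le> legendre_max (B (to_nat x)) (F t) (w' t)"
        unfolding legendre_max_def using B by (intro Max_ge) auto
      then have "ennreal (b * F t - (exp b - 1) * w' t) \<le> H t"
        unfolding H_def by (intro SUP_upper2[of "to_nat x"] ennreal_leI) auto
      also have "H t = ennreal (enn2real (H t))" using fin by (simp add: less_top)
      finally show ?thesis by (simp add: ennreal_le_iff)
    qed
    then have "relent (F t) (w' t) \<le> enn2real (H t)" "w' t = 0 \<Longrightarrow> F t = 0"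
      using relent_le_sup_dual[of "F t" "w' t" "enn2real (H t)"] F0 w(2) t by (auto simp: w'_def)
    then show ?thesis using fin by (metis ennreal_enn2real_if ennreal_leI infinity_ennreal_def)
  qed
  have Hfin: "AE t in ?M. H t \<noteq> \<infinity>"
    using Hc by (intro nn_integral_noteq_infinite measurable_restrict_space1) (auto simp: top_unique)
  have ae: "AE t in ?M. ennreal (relent (F t) (w t)) \<le> H t \<and> (w t = 0 \<longrightarrow> F t = 0)"
    using Hfin AE_space
  proof eventually_elim
    case (elim t)
    then show ?case using rel[of t] by (simp add: w'_def space_restrict_space)
  qed
  then have ae': "AE t in lborel. t \<in> {0..<T} \<longrightarrow> ennreal (relent (F t) (w t)) \<le> H t \<and> (w t = 0 \<longrightarrow> F t = 0)"
    by (subst (asm) AE_restrict_space_iff) auto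
  have aeT: "AE t in lborel. t \<noteq> T" by (rule AE_lborel_singleton)
  show thesis
  proof (rule that[OF F F0 convi[of 0] int])
    show "AE t in lborel. t \<in> {0..T} \<longrightarrow> w t = 0 \<longrightarrow> F t = 0"
      using ae' aeT by eventually_elim auto
    have "(\<integral>\<^sup>+ t\<in>{0..T}. ennreal (relent (F t) (w t)) \<partial>lborel) \<le> (\<integral>\<^sup>+ t. H t * indicator {0..<T} t \<partial>lborel)"
      using ae' aeT by (intro nn_integral_mono_AE, eventually_elim) (auto simp: indicator_def)
    also have "\<dots> = (\<integral>\<^sup>+ t. H t \<partial>?M)" by (subst nn_integral_restrict_space) auto
    finally show "(\<integral>\<^sup>+ t\<in>{0..T}. ennreal (relent (F t) (w t)) \<partial>lborel) \<le> ennreal c" using Hc by simp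
  qed (use T in auto)
qed

section \<open>The Skorohod map\<close>

lemma skorohod_map_cong: "(\<And>s. s \<in> {0..t} \<Longrightarrow> \<psi> s = \<psi>' s) \<Longrightarrow> 0 \<le> t \<Longrightarrow> skorohod_map \<psi> t = skorohod_map \<psi>' t"
  unfolding skorohod_map_def by (auto intro!: INF_cong)

lemma bdd_below_min: "(\<And>s. s \<in> {0..t} \<Longrightarrow> b \<le> \<psi> s) \<Longrightarrow> bdd_below ((\<lambda>s. min (\<psi> s) 0) ` {0..t::real})" for b :: real
  by (rule bdd_belowI[of _ "min b 0"]) (auto simp: min_le_iff_disj)

text \<open>The number \<open>b\<close> makes the infimum range over a set that is bounded below; it
  has the same role in the estimates that follow.\<close>

lemma skorohod_map_nonneg:
  assumes "0 \<le> t" "\<And>s. s \<in> {0..t} \<Longrightarrow> b \<le> \<psi> s"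
  shows "0 \<le> skorohod_map \<psi> t"
proof -
  have "(INF s\<in>{0..t}. min (\<psi> s) 0) \<le> min (\<psi> t) 0"
    using assms by (intro cINF_lower bdd_below_min[of _ b]) auto
  then show ?thesis by (simp add: skorohod_map_def)
qed

lemma skorohod_map_le:
  assumes "0 \<le> t" "\<And>s. s \<in> {0..t} \<Longrightarrow> \<psi> t - min (\<psi> s) 0 \<le> B"
  shows "skorohod_map \<psi> t \<le> B"
proof -
  have "\<psi> t - B \<le> (INF s\<in>{0..t}. min (\<psi> s) 0)"
  proof (rule cINF_greatest)
    fix s assume "s \<in> {0..t}"
    from assms(2)[OF this] show "\<psi> t - B \<le> min (\<psi> s) 0" by linarith
  qed (use assms in auto)
  then show ?thesis by (simp add: skorohod_map_def)
qed

lemma INF_min_diff_le: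
  fixes \<psi> \<psi>' :: "real \<Rightarrow> real"
  assumes t: "0 \<le> t" and b: "\<And>s. s \<in> {0..t} \<Longrightarrow> b \<le> \<psi> s"
    and d: "\<And>s. s \<in> {0..t} \<Longrightarrow> \<psi> s \<le> \<psi>' s + \<delta>" and \<delta>: "0 \<le> \<delta>"
  shows "(INF s\<in>{0..t}. min (\<psi> s) 0) \<le> (INF s\<in>{0..t}. min (\<psi>' s) 0) + (\<delta>::real)"
proof -
  have "(INF s\<in>{0..t}. min (\<psi> s) 0) - \<delta> \<le> (INF s\<in>{0..t}. min (\<psi>' s) 0)"
  proof (rule cINF_greatest)
    fix s assume s: "s \<in> {0..t}"
    have "(INF s\<in>{0..t}. min (\<psi> s) 0) \<le> min (\<psi> s) 0" using s b by (intro cINF_lower bdd_below_min[of _ b]) auto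
    then show "(INF s\<in>{0..t}. min (\<psi> s) 0) - \<delta> \<le> min (\<psi>' s) 0" using d[OF s] \<delta> by simp
  qed (use t in auto)
  then show ?thesis by simp
qed

lemma skorohod_map_lipschitz:
  assumes t: "0 \<le> t" and b: "\<And>s. s \<in> {0..t} \<Longrightarrow> b \<le> \<psi> s" 
    and d: "\<And>s. s \<in> {0..t} \<Longrightarrow> \<bar>\<psi> s - \<psi>' s\<bar> \<le> \<delta>"
  shows "\<bar>skorohod_map \<psi> t - skorohod_map \<psi>' t\<bar> \<le> 2 * \<delta>"
proof -
  have \<delta>: "0 \<le> \<delta>" using d[of t] t by simp
  have b': "\<And>s. s \<in> {0..t} \<Longrightarrow> b - \<delta> \<le> \<psi>' s" using b d by (force simp: abs_le_iff)
  have "(INF s\<in>{0..t}. min (\<psi> s) 0) \<le> (INF s\<in>{0..t}. min (\<psi>' s) 0) + \<delta>"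
    using d by (intro INF_min_diff_le[OF t b _ \<delta>]) (auto simp: abs_le_iff algebra_simps)
  moreover have "(INF s\<in>{0..t}. min (\<psi>' s) 0) \<le> (INF s\<in>{0..t}. min (\<psi> s) 0) + \<delta>"
    using d by (intro INF_min_diff_le[OF t b' _ \<delta>]) (auto simp: abs_le_iff algebra_simps)
  ultimately show ?thesis using d[of t] t unfolding skorohod_map_def by auto
qed

text \<open>From \<open>s\<close> to \<open>t\<close> the running infimum falls by at most the
  oscillation of \<open>\<psi>\<close> on \<open>[s, t]\<close>; one \<open>e / 3\<close> is spent
  on it and one on \<open>\<psi>\<close>.\<close>

lemma continuous_on_skorohod_map:
  assumes c: "continuous_on {0..T} \<psi>"
  shows "continuous_on {0..T} (skorohod_map \<psi>)"
proof (rule uniformly_continuous_imp_continuous)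
  have uc: "uniformly_continuous_on {0..T} \<psi>" using c by (intro compact_uniformly_continuous) auto
  have "bounded (\<psi> ` {0..T})" using c by (intro compact_imp_bounded compact_continuous_image) auto
  then obtain B where B: "\<And>s. s \<in> {0..T} \<Longrightarrow> - B \<le> \<psi> s" unfolding bounded_iff
    by (metis abs_le_iff image_eqI minus_le_iff real_norm_def)
  show "uniformly_continuous_on {0..T} (skorohod_map \<psi>)"
    unfolding uniformly_continuous_on_def
  proof (intro allI impI)
    fix e :: real assume e: "0 < e"
    obtain d where d: "d > 0" "\<And>s t. s \<in> {0..T} \<Longrightarrow> t \<in> {0..T} \<Longrightarrow> \<bar>t - s\<bar> < d \<Longrightarrow> \<bar>\<psi> t - \<psi> s\<bar> < e / 3"
      using uc[unfolded uniformly_continuous_on_def, rule_format, of "e / 3"] e by (auto simp: dist_real_def)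
    have le: "\<bar>skorohod_map \<psi> t - skorohod_map \<psi> s\<bar> < e"
      if st: "s \<in> {0..T}" "t \<in> {0..T}" "s \<le> t" "t - s < d" for s t
    proof -
      let ?m = "\<lambda>t. INF s\<in>{0..t}. min (\<psi> s) 0"
      have "?m t \<le> ?m s"
        using st B by (intro cINF_superset_mono bdd_below_min[of _ "- B"]) auto
      moreover have "?m s - e / 3 \<le> ?m t"
      proof (rule cINF_greatest)
        fix r assume r: "r \<in> {0..t}"
        show "?m s - e / 3 \<le> min (\<psi> r) 0"
        proof (cases "r \<le> s")
          case True
          then have "?m s \<le> min (\<psi> r) 0" using r st B by (intro cINF_lower bdd_below_min[of _ "- B"]) auto
          then show ?thesis using e by simp
        next
          case False
          have "?m s \<le> min (\<psi> s) 0" using st B by (intro cINF_lower bdd_below_min[of _ "- B"]) auto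
          moreover have "\<bar>\<psi> r - \<psi> s\<bar> < e / 3" using False r st by (intro d) auto
          ultimately show ?thesis using e by linarith
        qed
      qed (use st in auto)
      moreover have "\<bar>\<psi> t - \<psi> s\<bar> < e / 3" using st by (intro d) auto
      ultimately show ?thesis unfolding skorohod_map_def by linarith
    qed
    show "\<exists>d>0. \<forall>s\<in>{0..T}. \<forall>t\<in>{0..T}. dist t s < d \<longrightarrow> dist (skorohod_map \<psi> t) (skorohod_map \<psi> s) < e"
    proof (intro exI[of _ d] conjI ballI impI d(1))
      fix s t assume "s \<in> {0..T}" "t \<in> {0..T}" "dist t s < d"
      then show "dist (skorohod_map \<psi> t) (skorohod_map \<psi> s) < e"
        using le[of s t] le[of t s] by (cases "s \<le> t") (auto simp: dist_real_def abs_minus_commute)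
    qed
  qed
qed

section \<open>Compactness of monotone paths\<close>

lemma find_cell:
  assumes T: "0 < T" and t: "t \<in> {0..T}"
  obtains k where "k < 2 ^ q" "tgrid T q k \<le> t" "t \<le> tgrid T q (Suc k)"
proof (cases "t = T")
  case True
  then show thesis using that[of "2 ^ q - 1"] tgrid_mono[OF T, of "2 ^ q - 1" "2 ^ q" q] by simp
next
  case False
  then show thesis using that[of "cell_index T q t"] cell_index_less[OF T, of t q] cell_index_bounds[OF T, of t q] t by simp
qed

text \<open>An interval no longer than the mesh meets at most two adjacent cells, hence the factor
  2.\<close>

lemma grid_modulus:
  assumes T: "0 < T" and mono: "mono_on {0..T} a" and e: "\<And>k. k < 2 ^ q \<Longrightarrow> incr T a q k \<le> e" and e0: "0 \<le> e"
    and st: "s \<in> {0..T}" "t \<in> {0..T}" "s \<le> t" "t - s \<le> T / 2 ^ q"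
  shows "a t - a s \<le> 2 * e"
proof -
  obtain k where k: "k < 2 ^ q" "tgrid T q k \<le> s" "s \<le> tgrid T q (Suc k)" using find_cell[OF T st(1)] .
  have l: "tgrid T q k \<in> {0..T}" "tgrid T q (Suc k) \<in> {0..T}" using tgrid_mem[OF T] k by auto
  have s: "a (tgrid T q k) \<le> a s" using k l st by (intro mono_onD[OF mono]) auto
  show ?thesis
  proof (cases "t \<le> tgrid T q (Suc k)")
    case True
    then have "a t \<le> a (tgrid T q (Suc k))" using l st by (intro mono_onD[OF mono]) auto
    then show ?thesis using e[OF k(1)] e0 s by (simp add: incr_def)
  next
    case False
    have "Suc k \<noteq> 2 ^ q" using False st(2) tgrid_top[of T q] by auto
    then have k2: "Suc k < 2 ^ q" using k by simp
    then have l2: "tgrid T q (Suc (Suc k)) \<in> {0..T}" using tgrid_mem[OF T] by auto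
    have "t \<le> tgrid T q (Suc (Suc k))" using st k by (simp add: tgrid_Suc)
    then have "a t \<le> a (tgrid T q (Suc (Suc k)))" using l2 st by (intro mono_onD[OF mono]) auto
    then show ?thesis using e[OF k(1)] e[OF k2] s by (simp add: incr_def)
  qed
qed

text \<open>The functions may jump, as counting paths do, so equicontinuity is replaced by
  increments that are eventually small on some fixed grid. A diagonal argument gives convergence at
  all dyadic points, and monotonicity makes it uniform.\<close>

lemma monotone_arzela_ascoli:
  fixes F :: "nat \<Rightarrow> real \<Rightarrow> real"
  assumes T: "0 < T" and mono: "\<And>p. mono_on {0..T} (F p)" and zero: "(\<lambda>p. F p 0) \<longlonglongrightarrow> 0"
    and bdd: "\<forall>\<^sub>F p in sequentially. F p T \<le> M"
    and small: "\<And>e. 0 < e \<Longrightarrow> \<exists>q. \<forall>\<^sub>F p in sequentially. \<forall>k<2 ^ q. incr T (F p) q k \<le> e"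
  obtains r G where "strict_mono (r :: nat \<Rightarrow> nat)" "continuous_on {0..T} G" "mono_on {0..T} G" "G 0 = 0"
    "uniform_limit {0..T} (\<lambda>i. F (r i)) G sequentially"
proof -
  have "\<forall>\<^sub>F p in sequentially. - 1 < F p 0" using zero by (rule order_tendstoD) simp
  with bdd have "\<forall>\<^sub>F p in sequentially. F p T \<le> M \<and> - 1 < F p 0" by (rule eventually_conj)
  then obtain P where P: "\<And>p. p \<ge> P \<Longrightarrow> F p T \<le> M \<and> - 1 < F p 0"
    unfolding eventually_sequentially by blast
  define D where "D = (\<lambda>(q, k). tgrid T q k) ` (SIGMA q:UNIV. {..2 ^ q})"
  have "countable D" unfolding D_def by (intro countable_image) auto
  moreover have "norm (F (i + P) x) \<le> \<bar>M\<bar> + 1" if x: "x \<in> D" for i x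
  proof -
    have "x \<in> {0..T}" using x tgrid_mem[OF T] by (auto simp: D_def)
    then have "F (i + P) 0 \<le> F (i + P) x" "F (i + P) x \<le> F (i + P) T"
      by (auto intro!: mono_onD[OF mono])
    then show ?thesis using P[of "i + P"] by auto
  qed
  ultimately obtain r0 where r0: "strict_mono (r0::nat\<Rightarrow>nat)" "\<And>x. x \<in> D \<Longrightarrow> \<exists>l. (\<lambda>n. F (r0 n + P) x) \<longlonglongrightarrow> l"
    by (rule function_convergent_subsequence[of D "\<lambda>i. F (i + P)"]) auto
  define r where "r i = r0 i + P" for i
  have r: "strict_mono r" using r0(1) by (auto simp: r_def strict_mono_def)
  have cauchyD: "Cauchy (\<lambda>i. F (r i) (tgrid T q k))" if "k \<le> 2 ^ q" for q k
    using r0(2)[of "tgrid T q k"] that by (auto simp: D_def r_def intro: LIMSEQ_imp_Cauchy)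
  have "uniformly_Cauchy_on {0..T} (\<lambda>i. F (r i))"
    unfolding uniformly_Cauchy_on_def
  proof (intro allI impI)
    fix e :: real assume e: "0 < e"
    obtain q where "\<forall>\<^sub>F p in sequentially. \<forall>k<2 ^ q. incr T (F p) q k \<le> e / 3" using small[of "e / 3"] e by auto
    then have "\<forall>\<^sub>F i in sequentially. \<forall>k<2 ^ q. incr T (F (r i)) q k \<le> e / 3" using eventually_subseq[OF r] by blast
    then obtain N1 where N1: "\<And>i k. i \<ge> N1 \<Longrightarrow> k < 2 ^ q \<Longrightarrow> incr T (F (r i)) q k \<le> e / 3"
      unfolding eventually_sequentially by blast
    have "\<forall>k\<in>{..2^q}. \<exists>N. \<forall>i\<ge>N. \<forall>j\<ge>N. \<bar>F (r i) (tgrid T q k) - F (r j) (tgrid T q k)\<bar> < e / 3"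
      using cauchyD e unfolding Cauchy_def dist_real_def by (metis atMost_iff divide_pos_pos zero_less_numeral)
    then obtain N2 where N2: "\<And>k i j. k \<le> 2 ^ q \<Longrightarrow> i \<ge> N2 k \<Longrightarrow> j \<ge> N2 k \<Longrightarrow> \<bar>F (r i) (tgrid T q k) - F (r j) (tgrid T q k)\<bar> < e / 3"
      using bchoice[of "{..2^q}" "\<lambda>k N. \<forall>i\<ge>N. \<forall>j\<ge>N. \<bar>F (r i) (tgrid T q k) - F (r j) (tgrid T q k)\<bar> < e / 3"]
      by (metis atMost_iff)
    define N where "N = max N1 (Max (N2 ` {..2 ^ q}))"
    have NN: "N1 \<le> N" "\<And>k. k \<le> 2 ^ q \<Longrightarrow> N2 k \<le> N" unfolding N_def by (auto intro: le_max_iff_disj[THEN iffD2])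
    \<comment> \<open>By monotonicity \<open>F (r i) t\<close> is at most its value at the right
      grid point, and \<open>F (r j) t\<close> at least its value at the left one. Closeness at
      finitely many points therefore suffices, up to one increment.\<close>
    have le: "F (r i) t - F (r j) t < e" if i: "i \<ge> N" and j: "j \<ge> N" and t: "t \<in> {0..T}" for i j t
    proof -
      obtain k where k: "k < 2 ^ q" "tgrid T q k \<le> t" "t \<le> tgrid T q (Suc k)" using find_cell[OF T t] .
      have l: "tgrid T q k \<in> {0..T}" "tgrid T q (Suc k) \<in> {0..T}" using tgrid_mem[OF T] k by auto
      have "F (r i) t \<le> F (r i) (tgrid T q (Suc k))" using k l t by (intro mono_onD[OF mono]) auto
      moreover have "\<bar>F (r i) (tgrid T q (Suc k)) - F (r j) (tgrid T q (Suc k))\<bar> < e / 3"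
        using k i j NN(2)[of "Suc k"] by (intro N2) auto
      moreover have "incr T (F (r j)) q k \<le> e / 3" using k j NN by (intro N1) auto
      moreover have "F (r j) (tgrid T q k) \<le> F (r j) t" using k l t by (intro mono_onD[OF mono]) auto
      ultimately show ?thesis using e unfolding incr_def by linarith
    qed
    show "\<exists>N. \<forall>x\<in>{0..T}. \<forall>m\<ge>N. \<forall>n\<ge>N. dist (F (r m) x) (F (r n) x) < e"
    proof (intro exI[of _ N] ballI allI impI)
      fix x m n assume "x \<in> {0..T}" "N \<le> m" "N \<le> n"
      then show "dist (F (r m) x) (F (r n) x) < e"
        using le[of m n x] le[of n m x] by (auto simp: dist_real_def abs_less_iff)
    qed
  qed
  then have "uniformly_convergent_on {0..T} (\<lambda>i. F (r i))" by (rule Cauchy_uniformly_convergent)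
  then obtain G where G: "uniform_limit {0..T} (\<lambda>i. F (r i)) G sequentially" by (auto simp: uniformly_convergent_on_def)
  have Gp: "(\<lambda>i. F (r i) t) \<longlonglongrightarrow> G t" if "t \<in> {0..T}" for t using tendsto_uniform_limitI[OF G that] .
  have Gm: "mono_on {0..T} G"
  proof (rule mono_onI)
    fix s t assume "s \<in> {0..T}" "t \<in> {0..T}" "s \<le> t"
    then show "G s \<le> G t" by (intro LIMSEQ_le[OF Gp Gp]) (auto intro!: mono_onD[OF mono])
  qed
  have G0: "G 0 = 0" using LIMSEQ_unique[OF Gp[of 0] LIMSEQ_subseq_LIMSEQ[OF zero r, unfolded o_def]] T by simp
  have "continuous_on {0..T} G"
    unfolding continuous_on_iff
  proof (intro ballI allI impI)
    fix x and e :: real assume x: "x \<in> {0..T}" and e: "0 < e"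
    obtain q where "\<forall>\<^sub>F p in sequentially. \<forall>k<2 ^ q. incr T (F p) q k \<le> e / 3" using small[of "e / 3"] e by auto
    then have ev: "\<forall>\<^sub>F i in sequentially. \<forall>k<2 ^ q. incr T (F (r i)) q k \<le> e / 3" using eventually_subseq[OF r] by blast
    have inc: "incr T G q k \<le> e / 3" if k: "k < 2 ^ q" for k
    proof (rule tendsto_upperbound)
      show "(\<lambda>i. incr T (F (r i)) q k) \<longlonglongrightarrow> incr T G q k"
        unfolding incr_def using k tgrid_mem[OF T] by (intro tendsto_diff Gp) auto
      show "\<forall>\<^sub>F i in sequentially. incr T (F (r i)) q k \<le> e / 3" using ev k by (auto elim: eventually_mono)
    qed simp
    show "\<exists>d>0. \<forall>x'\<in>{0..T}. dist x' x < d \<longrightarrow> dist (G x') (G x) < e"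
    proof (intro exI[of _ "T / 2 ^ q"] conjI ballI impI)
      fix x' assume x': "x' \<in> {0..T}" "dist x' x < T / 2 ^ q"
      have "G (max x x') - G (min x x') \<le> 2 * (e / 3)"
        using x x' e by (intro grid_modulus[OF T Gm inc]) (auto simp: dist_real_def max_def min_def)
      moreover have "\<bar>G x' - G x\<bar> = G (max x x') - G (min x x')"
        using mono_onD[OF Gm x x'(1)] mono_onD[OF Gm x'(1) x] by (cases "x \<le> x'") auto
      ultimately show "dist (G x') (G x) < e" using e by (simp add: dist_real_def)
    qed (use T in auto)
  qed
  then show thesis using that[OF r _ Gm G0 G] by blast
qed

section \<open>Limits of sequences with bounded entropy\<close>

lemma dual_cost_single:
  assumes "k < 2 ^ q"
  shows "dual_cost T a W q (\<lambda>j. if j = k then B else 0) = B * incr T a q k - (exp B - 1) * incr T W q k"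
proof -
  have "dual_cost T a W q (\<lambda>j. if j = k then B else 0) =
      (\<Sum>j<2 ^ q. if j = k then B * incr T a q k - (exp B - 1) * incr T W q k else 0)"
    unfolding dual_cost_def by (intro sum.cong) auto
  then show ?thesis using assms by simp
qed

lemma dual_cost_zero [simp]: "dual_cost T a W q (\<lambda>_. 0) = 0"
  by (simp add: dual_cost_def)

text \<open>The order of choice matters: the slope \<open>B\<close> makes \<open>M / B\<close> small
  against \<open>e\<close>, and only then is the grid refined until the weight of a cell beats
  \<open>exp B\<close>. An increment \<open>x\<close> with
  \<open>B * x \<le> M + exp B * (V * (T / 2 ^ q))\<close> is then at most \<open>e\<close>.\<close>

lemma choose_level:
  fixes T e M V :: real
  assumes "0 < e" "0 \<le> M" "0 \<le> V" "0 < T"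
  obtains B q where "0 < B" "\<And>q'. q' \<ge> q \<Longrightarrow> M + exp B * (V * (T / 2 ^ q')) \<le> B * e"
proof -
  define B where "B = 2 * (M + 1) / e"
  have B: "0 < B" "M + 1 = B * e / 2" using assms by (auto simp: B_def)
  have "(\<lambda>q. exp B * (V * (T / 2 ^ q))) \<longlonglongrightarrow> 0" by real_asymp
  then have "\<forall>\<^sub>F q in sequentially. exp B * (V * (T / 2 ^ q)) < 1" by (rule order_tendstoD) simp
  then obtain q where q: "\<And>q'. q' \<ge> q \<Longrightarrow> exp B * (V * (T / 2 ^ q')) < 1" unfolding eventually_sequentially by blast
  show thesis
  proof (rule that[OF B(1), of q])
    fix q' assume "q' \<ge> q"
    then show "M + exp B * (V * (T / 2 ^ q')) \<le> B * e" using q[of q'] B assms by linarith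
  qed
qed

lemma relent_ell: "0 \<le> x \<Longrightarrow> 0 < w \<Longrightarrow> relent x w = w * ell (x / w)"
  by (simp add: relent_def ell_def field_simps)

lemma Sup_add3_le:
  fixes S1 S2 S3 :: "real set"
  assumes "\<And>x y z. x \<in> S1 \<Longrightarrow> y \<in> S2 \<Longrightarrow> z \<in> S3 \<Longrightarrow> x + y + z \<le> m"
    and ne: "S1 \<noteq> {}" "S2 \<noteq> {}" "S3 \<noteq> {}"
  shows "Sup S1 + Sup S2 + Sup S3 \<le> m"
proof -
  have "Sup S3 \<le> m - Sup S1 - Sup S2"
  proof (rule cSup_least[OF ne(3)])
    fix z assume z: "z \<in> S3"
    have "Sup S2 \<le> m - Sup S1 - z"
    proof (rule cSup_least[OF ne(2)])
      fix y assume y: "y \<in> S2"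
      have "Sup S1 \<le> m - y - z"
        using assms(1)[OF _ y z] by (intro cSup_least[OF ne(1)]) (simp add: algebra_simps)
      then show "y \<le> m - Sup S1 - z" by simp
    qed
    then show "z \<le> m - Sup S1 - Sup S2" by simp
  qed
  then show ?thesis by simp
qed

text \<open>The sequences \<open>A\<close>, \<open>S\<close>, \<open>Y\<close> are either integrated controls (for compactness of the level sets)
  or rescaled counting processes (for the upper bound); \<open>y\<close> and \<open>w\<close> are the number and the intensity of
  reneging events per dyadic cell.\<close>

locale entropy_bounded =
  fixes lam mu th x0 T m :: real and A S Y X :: "nat \<Rightarrow> real \<Rightarrow> real" and y w :: "nat \<Rightarrow> nat \<Rightarrow> nat \<Rightarrow> real"
  assumes pos: "0 < lam" "0 < mu" "0 < th" "0 < T" "0 \<le> x0" "0 \<le> m"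
    and mono: "\<And>p. mono_on {0..T} (A p)" "\<And>p. mono_on {0..T} (S p)" "\<And>p. mono_on {0..T} (Y p)"
    and zero: "(\<lambda>p. A p 0) \<longlonglongrightarrow> 0" "(\<lambda>p. S p 0) \<longlonglongrightarrow> 0" "(\<lambda>p. Y p 0) \<longlonglongrightarrow> 0"
    and reflection: "\<And>e. 0 < e \<Longrightarrow> \<forall>\<^sub>F p in sequentially. \<forall>t\<in>{0..T}.
       \<bar>X p t - skorohod_map (\<lambda>r. x0 + A p r - S p r - Y p r) t\<bar> \<le> e"
    and cost: "\<And>q e. 0 < e \<Longrightarrow> \<forall>\<^sub>F p in sequentially. \<forall>b1 b2 b3.
       dual_cost T (A p) (\<lambda>t. lam * t) q b1 + dual_cost T (S p) (\<lambda>t. mu * t) q b2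
       + (\<Sum>k<2 ^ q. b3 k * y p q k - (exp (b3 k) - 1) * w p q k) \<le> m + e"
    and count: "\<And>q k. k < 2 ^ q \<Longrightarrow> (\<lambda>p. y p q k - incr T (Y p) q k) \<longlonglongrightarrow> 0"
    and weight: "\<And>q k e. k < 2 ^ q \<Longrightarrow> 0 < e \<Longrightarrow> \<forall>\<^sub>F p in sequentially. \<forall>g d. continuous_on {0..T} g \<longrightarrow>
       (\<forall>t\<in>{0..T}. \<bar>X p t - g t\<bar> \<le> d) \<longrightarrow>
       \<bar>w p q k - th * integral {tgrid T q k..tgrid T q (Suc k)} g\<bar> \<le> th * (T / 2 ^ q) * d + e"
begin

text \<open>One cell is tested with a large slope for equicontinuity. For the total, level 0 has the
  single cell \<open>[0, T]\<close>, and slope 1 with \<open>exp 1 - 1 \<le> 2\<close> produces the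
  summand \<open>2 * v * T\<close>.\<close>

lemma arrivals_small:
  assumes F: "F = A \<and> v = lam \<or> F = S \<and> v = mu"
  shows "\<And>e. 0 < e \<Longrightarrow> \<exists>q. \<forall>\<^sub>F p in sequentially. \<forall>k<2 ^ q. incr T (F p) q k \<le> e"
    and "\<forall>\<^sub>F p in sequentially. F p T \<le> m + 2 + 2 * v * T"
proof -
  have v: "0 < v" using F pos by auto
  have single: "\<forall>\<^sub>F p in sequentially. \<forall>k<2 ^ q. \<forall>B. B * incr T (F p) q k - (exp B - 1) * (v * (T / 2 ^ q)) \<le> m + 1" for q
  proof -
    have "\<forall>\<^sub>F p in sequentially. \<forall>b. dual_cost T (F p) (\<lambda>t. v * t) q b \<le> m + 1"
      using cost[OF zero_less_one, of q]
    proof eventually_elim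
      case (elim p)
      show ?case
      proof
        fix b
        show "dual_cost T (F p) (\<lambda>t. v * t) q b \<le> m + 1"
          using F elim[rule_format, of b "\<lambda>_. 0" "\<lambda>_. 0"] elim[rule_format, of "\<lambda>_. 0" b "\<lambda>_. 0"] by auto
      qed
    qed
    then show ?thesis
    proof eventually_elim
      case (elim p)
      show ?case
      proof (intro allI impI)
        fix k B assume k: "k < (2::nat) ^ q"
        show "B * incr T (F p) q k - (exp B - 1) * (v * (T / 2 ^ q)) \<le> m + 1"
          using elim[rule_format, of "\<lambda>j. if j = k then B else 0"] unfolding dual_cost_single[OF k]
          by (simp add: incr_def tgrid_Suc right_diff_distrib[symmetric])
      qed
    qed
  qed
  show "\<exists>q. \<forall>\<^sub>F p in sequentially. \<forall>k<2 ^ q. incr T (F p) q k \<le> e" if e: "0 < e" for e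
  proof -
    obtain B q where B: "0 < B" "\<And>q'. q' \<ge> q \<Longrightarrow> (m + 1) + exp B * (v * (T / 2 ^ q')) \<le> B * e"
      using choose_level[OF e, of "m + 1" v T] v pos by auto
    show ?thesis
    proof (rule exI[of _ q], use single[of q] in eventually_elim, intro allI impI)
      fix p k assume h: "\<forall>k<2 ^ q. \<forall>B. B * incr T (F p) q k - (exp B - 1) * (v * (T / 2 ^ q)) \<le> m + 1" and k: "k < (2::nat) ^ q"
      have "(exp B - 1) * (v * (T / 2 ^ q)) \<le> exp B * (v * (T / 2 ^ q))"
        using v pos by (intro mult_right_mono) auto
      then have "B * incr T (F p) q k \<le> B * e" using h[rule_format, OF k, of B] B(2)[OF order_refl] by linarith
      then show "incr T (F p) q k \<le> e" using B by simp
    qed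
  qed
  have "(\<lambda>p. F p 0) \<longlonglongrightarrow> 0" using zero F by auto
  then have "\<forall>\<^sub>F p in sequentially. F p 0 < 1" by (rule order_tendstoD) simp
  with single[of 0] show "\<forall>\<^sub>F p in sequentially. F p T \<le> m + 2 + 2 * v * T"
  proof eventually_elim
    case (elim p)
    have "F p T - F p 0 - (exp 1 - 1) * (v * T) \<le> m + 1"
      using elim(1)[rule_format, of 0 1] by (simp add: incr_def tgrid_def)
    moreover have "(exp 1 - 1) * (v * T) \<le> 2 * (v * T)" using exp_le v pos by (intro mult_right_mono) auto
    ultimately show ?case using elim(2) by simp
  qed
qed

text \<open>The queue does not exceed its initial value plus the arrivals. The summand 4 consists of
  2 from the bound on \<open>A p T\<close>, 1 for the values at time 0 and 1 for the reflection
  error.\<close>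

definition bound where "bound = x0 + m + 4 + 2 * lam * T"

lemma bound_pos: "1 \<le> bound" using pos by (simp add: bound_def)

lemma X_bounded: "\<forall>\<^sub>F p in sequentially. \<forall>t\<in>{0..T}. \<bar>X p t\<bar> \<le> bound"
proof -
  have "\<forall>\<^sub>F p in sequentially. - 1 < A p 0" using zero(1) by (rule order_tendstoD) simp
  moreover have "\<forall>\<^sub>F p in sequentially. A p T \<le> m + 2 + 2 * lam * T" by (rule arrivals_small) simp
  moreover have "\<forall>\<^sub>F p in sequentially. \<forall>t\<in>{0..T}. \<bar>X p t - skorohod_map (\<lambda>r. x0 + A p r - S p r - Y p r) t\<bar> \<le> 1"
    by (rule reflection) simp
  moreover have "\<forall>\<^sub>F p in sequentially. - 1/2 < S p 0" using zero(2) by (rule order_tendstoD) simp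
  moreover have "\<forall>\<^sub>F p in sequentially. - 1/2 < Y p 0" using zero(3) by (rule order_tendstoD) simp
  ultimately show ?thesis
  proof (eventually_elim, intro ballI)
    fix p t assume A0: "- 1 < A p 0" and AT: "A p T \<le> m + 2 + 2 * lam * T"
      and r: "\<forall>t\<in>{0..T}. \<bar>X p t - skorohod_map (\<lambda>r. x0 + A p r - S p r - Y p r) t\<bar> \<le> 1"
      and S0: "- 1/2 < S p 0" and Y0: "- 1/2 < Y p 0" and t: "t \<in> {0..T}"
    let ?f = "\<lambda>r. x0 + A p r - S p r - Y p r"
    have 0: "0 \<le> skorohod_map ?f t"
    proof (rule skorohod_map_nonneg[of _ "x0 + A p 0 - S p t - Y p t"])
      fix s assume s: "s \<in> {0..t}"
      then show "x0 + A p 0 - S p t - Y p t \<le> ?f s"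
        using t mono_onD[OF mono(1), of 0 s p] mono_onD[OF mono(2), of s t p] mono_onD[OF mono(3), of s t p] by simp
    qed (use t in auto)
    have "skorohod_map ?f t \<le> x0 + m + 3 + 2 * lam * T"
    proof (rule skorohod_map_le)
      fix s assume s: "s \<in> {0..t}"
      have "A p t \<le> A p T" "S p 0 \<le> S p t" "Y p 0 \<le> Y p t" "S p s \<le> S p t" "Y p s \<le> Y p t" "A p 0 \<le> A p s"
        using s t by (auto intro!: mono_onD[OF mono(1)] mono_onD[OF mono(2)] mono_onD[OF mono(3)])
      then show "?f t - min (?f s) 0 \<le> x0 + m + 3 + 2 * lam * T"
        using A0 S0 Y0 AT pos by (simp add: min_def)
    qed (use t in auto)
    then show "\<bar>X p t\<bar> \<le> bound" using 0 r t unfolding bound_def by force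
  qed
qed

text \<open>The intensity of reneging involves \<open>X\<close>, so the bound on \<open>X\<close>,
  which comes from the arrivals alone, is used first. It bounds the weights, and then the argument
  for the arrivals applies.\<close>

lemma reneging_small:
  shows "\<And>e. 0 < e \<Longrightarrow> \<exists>q. \<forall>\<^sub>F p in sequentially. \<forall>k<2 ^ q. incr T (Y p) q k \<le> e"
    and "\<exists>M. \<forall>\<^sub>F p in sequentially. Y p T \<le> M"
proof -
  \<comment> \<open>\<open>X p\<close> may jump, so the assumption \<open>weight\<close> compares
    with arbitrary continuous functions. Here the comparison function is 0 at distance
    \<open>bound\<close>, which gives an a priori bound before any limit is known.\<close>
  have wb: "\<forall>\<^sub>F p in sequentially. \<forall>k<2 ^ q. w p q k \<le> th * (bound + 1) * (T / 2 ^ q)" for q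
  proof -
    have "\<forall>k\<in>{..<2 ^ q}. \<forall>\<^sub>F p in sequentially. w p q k \<le> th * (bound + 1) * (T / 2 ^ q)"
    proof
      fix k :: nat assume k: "k \<in> {..<2 ^ q}"
      have e: "0 < th * (T / 2 ^ q)" using pos by simp
      have k': "k < 2 ^ q" using k by simp
      from weight[OF k' e] X_bounded show "\<forall>\<^sub>F p in sequentially. w p q k \<le> th * (bound + 1) * (T / 2 ^ q)"
      proof eventually_elim
        case (elim p)
        have "\<bar>w p q k - th * integral {tgrid T q k..tgrid T q (Suc k)} (\<lambda>t. 0)\<bar> \<le> th * (T / 2 ^ q) * bound + th * (T / 2 ^ q)"
          using elim k by (intro elim(1)[rule_format]) auto
        moreover have "th * (T / 2 ^ q) * bound + th * (T / 2 ^ q) = th * (bound + 1) * (T / 2 ^ q)" by (simp add: field_simps)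
        ultimately show ?case by simp
      qed
    qed
    then have "\<forall>\<^sub>F p in sequentially. \<forall>k\<in>{..<2 ^ q}. w p q k \<le> th * (bound + 1) * (T / 2 ^ q)"
      by (intro eventually_ball_finite) auto
    then show ?thesis by (rule eventually_mono) auto
  qed
  have yc: "\<forall>\<^sub>F p in sequentially. \<forall>k<2 ^ q. incr T (Y p) q k \<le> y p q k + d" if d: "0 < d" for q d
  proof -
    have "\<forall>k\<in>{..<2 ^ q}. \<forall>\<^sub>F p in sequentially. incr T (Y p) q k \<le> y p q k + d"
    proof
      fix k :: nat assume "k \<in> {..<2 ^ q}"
      then have "\<forall>\<^sub>F p in sequentially. - d < y p q k - incr T (Y p) q k"
        using d by (intro order_tendstoD(1)[OF count]) auto
      then show "\<forall>\<^sub>F p in sequentially. incr T (Y p) q k \<le> y p q k + d" by (rule eventually_mono) simp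
    qed
    then have "\<forall>\<^sub>F p in sequentially. \<forall>k\<in>{..<2 ^ q}. incr T (Y p) q k \<le> y p q k + d"
      by (intro eventually_ball_finite) auto
    then show ?thesis by (rule eventually_mono) auto
  qed
  have single: "\<forall>\<^sub>F p in sequentially. \<forall>k<2 ^ q. \<forall>B. B * y p q k - (exp B - 1) * w p q k \<le> m + 1" for q
    using cost[OF zero_less_one, of q]
  proof (eventually_elim, intro allI impI)
    fix p k and B :: real
    assume h: "\<forall>b1 b2 b3. dual_cost T (A p) (\<lambda>t. lam * t) q b1 + dual_cost T (S p) (\<lambda>t. mu * t) q b2
       + (\<Sum>k<2 ^ q. b3 k * y p q k - (exp (b3 k) - 1) * w p q k) \<le> m + 1" and k: "k < (2::nat) ^ q"
    define b where "b j = (if j = k then B else 0)" for j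
    have "(\<Sum>j<2 ^ q. b j * y p q j - (exp (b j) - 1) * w p q j) = (\<Sum>j<2 ^ q. if j = k then B * y p q k - (exp B - 1) * w p q k else 0)"
      by (intro sum.cong) (auto simp: b_def)
    then show "B * y p q k - (exp B - 1) * w p q k \<le> m + 1"
      using h[rule_format, of "\<lambda>_. 0" "\<lambda>_. 0" b] k by simp
  qed
  have incrB: "\<forall>\<^sub>F p in sequentially. \<forall>k<2 ^ q. B * incr T (Y p) q k \<le> (m + 1) + exp B * (th * (bound + 1) * (T / 2 ^ q)) + B * d"
    if B: "0 < B" and d: "0 < d" for q B d
    using wb[of q] yc[OF d, of q] single[of q]
  proof (eventually_elim, intro allI impI)
    fix p k assume w: "\<forall>k<2 ^ q. w p q k \<le> th * (bound + 1) * (T / 2 ^ q)" and y: "\<forall>k<2 ^ q. incr T (Y p) q k \<le> y p q k + d"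
      and s: "\<forall>k<2 ^ q. \<forall>B. B * y p q k - (exp B - 1) * w p q k \<le> m + 1" and k: "k < (2::nat) ^ q"
    have "(exp B - 1) * w p q k \<le> (exp B - 1) * (th * (bound + 1) * (T / 2 ^ q))"
      using w k B by (intro mult_left_mono) auto
    also have "\<dots> \<le> exp B * (th * (bound + 1) * (T / 2 ^ q))"
      using pos bound_pos by (intro mult_right_mono) auto
    finally have "B * y p q k \<le> (m + 1) + exp B * (th * (bound + 1) * (T / 2 ^ q))" using s[rule_format, OF k, of B] by linarith
    moreover have "B * incr T (Y p) q k \<le> B * (y p q k + d)" using y k B by (intro mult_left_mono) auto
    ultimately show "B * incr T (Y p) q k \<le> (m + 1) + exp B * (th * (bound + 1) * (T / 2 ^ q)) + B * d"
      by (simp add: distrib_left)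
  qed
  show "\<exists>q. \<forall>\<^sub>F p in sequentially. \<forall>k<2 ^ q. incr T (Y p) q k \<le> e" if e: "0 < e" for e
  proof -
    obtain B q where B: "0 < B" "\<And>q'. q' \<ge> q \<Longrightarrow> (m + 1) + exp B * (th * (bound + 1) * (T / 2 ^ q')) \<le> B * (e / 2)"
      using choose_level[of "e / 2" "m + 1" "th * (bound + 1)" T] e pos bound_pos by auto
    show ?thesis
    proof (rule exI[of _ q], use incrB[OF B(1), of "e / 2" q] e in \<open>auto elim!: eventually_mono\<close>)
      fix p k assume "\<forall>k<2 ^ q. B * incr T (Y p) q k \<le> m + 1 + exp B * (th * (bound + 1) * T) / 2 ^ q + B * e / 2" and "k < (2::nat) ^ q"
      then have "B * incr T (Y p) q k \<le> m + 1 + exp B * (th * (bound + 1) * T) / 2 ^ q + B * e / 2" by blast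
      then have "B * incr T (Y p) q k \<le> B * e" using B(2)[OF order_refl]
        unfolding times_divide_eq_right[symmetric] by (simp only: mult.assoc)
      then show "incr T (Y p) q k \<le> e" using B(1) by simp
    qed
  qed
  show "\<exists>M. \<forall>\<^sub>F p in sequentially. Y p T \<le> M"
  proof
    have "\<forall>\<^sub>F p in sequentially. Y p 0 < 1" using zero(3) by (rule order_tendstoD) simp
    with incrB[OF zero_less_one zero_less_one, of 0] show "\<forall>\<^sub>F p in sequentially. Y p T \<le> (m + 1) + exp 1 * (th * (bound + 1) * T) + 2"
      by eventually_elim (auto simp: incr_def tgrid_def)
  qed
qed

text \<open>Three successive extractions give uniform limits of \<open>A\<close>, \<open>S\<close>
  and \<open>Y\<close>, hence of the reflected path \<open>X\<close>. The dual costs converge for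
  fixed test vectors, so the bound \<open>m\<close> survives. The densities of the limits, divided
  by the base rates, are the controls.\<close>

theorem limit_has_control:
  obtains r \<xi> \<zeta> where "strict_mono (r :: nat \<Rightarrow> nat)" "continuous_on {0..T} \<xi>" "continuous_on {0..T} \<zeta>"
    "uniform_limit {0..T} (\<lambda>i. X (r i)) \<xi> sequentially" "uniform_limit {0..T} (\<lambda>i. Y (r i)) \<zeta> sequentially"
    "\<And>t. t \<in> {0..T} \<Longrightarrow> 0 \<le> \<xi> t" "\<And>t. t \<in> {0..T} \<Longrightarrow> 0 \<le> \<zeta> t"
    "\<exists>\<phi>\<in>controls lam mu th x0 T \<xi> \<zeta>. control_cost lam mu th T \<xi> \<phi> \<le> ennreal m"
proof -
  have T: "0 < T" using pos by simp
  obtain r1 a where r1: "strict_mono r1" and a: "continuous_on {0..T} a" "mono_on {0..T} a" "a 0 = 0"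
    "uniform_limit {0..T} (\<lambda>i. A (r1 i)) a sequentially"
    using monotone_arzela_ascoli[OF T mono(1) zero(1) arrivals_small(2)[of A lam] arrivals_small(1)[of A lam]] by auto
  have sub: "\<exists>q. \<forall>\<^sub>F p in sequentially. \<forall>k<2 ^ q. incr T (F (\<rho> p)) q k \<le> e"
    if "\<exists>q. \<forall>\<^sub>F p in sequentially. \<forall>k<2 ^ q. incr T (F p) q k \<le> e" "strict_mono \<rho>" for F :: "nat \<Rightarrow> real \<Rightarrow> real" and e and \<rho> :: "nat \<Rightarrow> nat"
    using that eventually_subseq by blast
  obtain r2 s where r2: "strict_mono r2" and s: "continuous_on {0..T} s" "mono_on {0..T} s" "s 0 = 0"
    "uniform_limit {0..T} (\<lambda>i. S (r1 (r2 i))) s sequentially"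
  proof (rule monotone_arzela_ascoli[of T "\<lambda>i. S (r1 i)" "m + 2 + 2 * mu * T"])
    show "(\<lambda>p. S (r1 p) 0) \<longlonglongrightarrow> 0" using LIMSEQ_subseq_LIMSEQ[OF zero(2) r1] by (simp add: o_def)
    show "\<forall>\<^sub>F p in sequentially. S (r1 p) T \<le> m + 2 + 2 * mu * T"
      using eventually_subseq[OF r1 arrivals_small(2)[of S mu]] by simp
    show "\<And>e. 0 < e \<Longrightarrow> \<exists>q. \<forall>\<^sub>F p in sequentially. \<forall>k<2 ^ q. incr T (S (r1 p)) q k \<le> e"
      using sub[OF arrivals_small(1)[of S mu] r1] by simp
  qed (use T mono in auto)
  obtain M where M: "\<forall>\<^sub>F p in sequentially. Y p T \<le> M" using reneging_small(2) by blast
  have r12: "strict_mono (\<lambda>i. r1 (r2 i))" using r1 r2 by (auto simp: strict_mono_def)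
  obtain r3 \<zeta> where r3: "strict_mono r3" and z: "continuous_on {0..T} \<zeta>" "mono_on {0..T} \<zeta>" "\<zeta> 0 = 0"
    "uniform_limit {0..T} (\<lambda>i. Y (r1 (r2 (r3 i)))) \<zeta> sequentially"
  proof (rule monotone_arzela_ascoli[of T "\<lambda>i. Y (r1 (r2 i))" M])
    show "(\<lambda>p. Y (r1 (r2 p)) 0) \<longlonglongrightarrow> 0" using LIMSEQ_subseq_LIMSEQ[OF zero(3) r12] by (simp add: o_def)
    show "\<forall>\<^sub>F p in sequentially. Y (r1 (r2 p)) T \<le> M"
      using eventually_subseq[OF r12 M] by simp
    show "\<And>e. 0 < e \<Longrightarrow> \<exists>q. \<forall>\<^sub>F p in sequentially. \<forall>k<2 ^ q. incr T (Y (r1 (r2 p))) q k \<le> e"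
      by (rule sub[OF reneging_small(1) r12])
  qed (use T mono in auto)
  define r where "r i = r1 (r2 (r3 i))" for i
  have r: "strict_mono r" using r1 r2 r3 by (auto simp: strict_mono_def r_def)
  have ua: "uniform_limit {0..T} (\<lambda>i. A (r i)) a sequentially"
    unfolding r_def using r2 r3
    by (intro filterlim_compose[OF a(4), of "\<lambda>i. r2 (r3 i)"] filterlim_subseq) (auto simp: strict_mono_def)
  have us: "uniform_limit {0..T} (\<lambda>i. S (r i)) s sequentially"
    unfolding r_def by (intro filterlim_compose[OF s(4), of r3] filterlim_subseq r3)
  have uz: "uniform_limit {0..T} (\<lambda>i. Y (r i)) \<zeta> sequentially" using z(4) by (simp add: r_def)
  define \<psi> where "\<psi> t = x0 + a t - s t - \<zeta> t" for t
  have \<psi>c: "continuous_on {0..T} \<psi>" unfolding \<psi>_def using a s z by (intro continuous_intros)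
  define \<xi> where "\<xi> = skorohod_map \<psi>"
  have \<xi>c: "continuous_on {0..T} \<xi>" unfolding \<xi>_def by (rule continuous_on_skorohod_map[OF \<psi>c])
  have "bounded (\<psi> ` {0..T})" using \<psi>c by (intro compact_imp_bounded compact_continuous_image) auto
  then obtain B where B: "\<And>t. t \<in> {0..T} \<Longrightarrow> - B \<le> \<psi> t"
    unfolding bounded_iff by (metis abs_le_iff image_eqI minus_le_iff real_norm_def)
  have \<xi>0: "0 \<le> \<xi> t" if "t \<in> {0..T}" for t
    unfolding \<xi>_def using that B by (intro skorohod_map_nonneg[of _ "- B"]) auto
  have \<zeta>0: "0 \<le> \<zeta> t" if "t \<in> {0..T}" for t
    using mono_onD[OF z(2), of 0 t] that z(3) by auto
  have ux: "uniform_limit {0..T} (\<lambda>i. X (r i)) \<xi> sequentially"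
    unfolding uniform_limit_iff
  proof (intro allI impI)
    fix e :: real assume e: "0 < e"
    have "\<forall>\<^sub>F i in sequentially. \<forall>t\<in>{0..T}. dist (A (r i) t) (a t) < e / 12"
      using e by (intro uniform_limitD[OF ua]) auto
    moreover have "\<forall>\<^sub>F i in sequentially. \<forall>t\<in>{0..T}. dist (S (r i) t) (s t) < e / 12"
      using e by (intro uniform_limitD[OF us]) auto
    moreover have "\<forall>\<^sub>F i in sequentially. \<forall>t\<in>{0..T}. dist (Y (r i) t) (\<zeta> t) < e / 12"
      using e by (intro uniform_limitD[OF uz]) auto
    moreover have "\<forall>\<^sub>F i in sequentially. \<forall>t\<in>{0..T}. \<bar>X (r i) t - skorohod_map (\<lambda>u. x0 + A (r i) u - S (r i) u - Y (r i) u) t\<bar> \<le> e / 4"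
      using eventually_subseq[OF r reflection[of "e / 4"]] e by simp
    ultimately show "\<forall>\<^sub>F i in sequentially. \<forall>t\<in>{0..T}. dist (X (r i) t) (\<xi> t) < e"
    proof (eventually_elim, intro ballI)
      fix i t assume h: "\<forall>t\<in>{0..T}. dist (A (r i) t) (a t) < e / 12" "\<forall>t\<in>{0..T}. dist (S (r i) t) (s t) < e / 12"
        "\<forall>t\<in>{0..T}. dist (Y (r i) t) (\<zeta> t) < e / 12"
        "\<forall>t\<in>{0..T}. \<bar>X (r i) t - skorohod_map (\<lambda>u. x0 + A (r i) u - S (r i) u - Y (r i) u) t\<bar> \<le> e / 4"
        and t: "t \<in> {0..T}"
      have "\<bar>skorohod_map \<psi> t - skorohod_map (\<lambda>u. x0 + A (r i) u - S (r i) u - Y (r i) u) t\<bar> \<le> 2 * (e / 4)"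
      proof (rule skorohod_map_lipschitz[of _ "- B"])
        fix u assume "u \<in> {0..t}"
        then have "u \<in> {0..T}" using t by auto
        then have "\<bar>A (r i) u - a u\<bar> < e / 12" "\<bar>S (r i) u - s u\<bar> < e / 12" "\<bar>Y (r i) u - \<zeta> u\<bar> < e / 12" "- B \<le> \<psi> u"
          using h B by (auto simp: dist_real_def)
        then show "\<bar>\<psi> u - (x0 + A (r i) u - S (r i) u - Y (r i) u)\<bar> \<le> e / 4" "- B \<le> \<psi> u"
          unfolding \<psi>_def by linarith+
      qed (use t in auto)
      then show "dist (X (r i) t) (\<xi> t) < e" using h(4)[rule_format, OF t] e unfolding \<xi>_def dist_real_def
        by linarith
    qed
  qed
  \<comment> \<open>The antiderivative of the limiting reneging intensity; its increments will be
    the limits of the weights.\<close>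
  define W where "W t = th * integral {0..t} \<xi>" for t
  have Wincr: "incr T W q k = th * integral {tgrid T q k..tgrid T q (Suc k)} \<xi>" if "k < 2 ^ q" for q k
  proof -
    have l: "tgrid T q k \<in> {0..T}" "tgrid T q (Suc k) \<in> {0..T}" "tgrid T q k \<le> tgrid T q (Suc k)"
      using tgrid_mem[OF T] tgrid_mono[OF T] that by auto
    have "\<xi> integrable_on {0..tgrid T q (Suc k)}"
      using l by (intro integrable_continuous_real continuous_on_subset[OF \<xi>c]) auto
    then have "integral {0..tgrid T q k} \<xi> + integral {tgrid T q k..tgrid T q (Suc k)} \<xi> = integral {0..tgrid T q (Suc k)} \<xi>"
      using l by (intro Henstock_Kurzweil_Integration.integral_combine) auto
    then show ?thesis unfolding incr_def W_def by (simp add: right_diff_distrib[symmetric])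
  qed
  have limit_cost: "dual_cost T a (\<lambda>t. lam * t) q b1 + dual_cost T s (\<lambda>t. mu * t) q b2 + dual_cost T \<zeta> W q b3 \<le> m" for q b1 b2 b3
  proof (rule field_le_epsilon)
    fix e :: real assume e: "0 < e"
    have inc: "(\<lambda>i. incr T (F (r i)) q k) \<longlonglongrightarrow> incr T f q k"
      if "uniform_limit {0..T} (\<lambda>i. F (r i)) f sequentially" "k < 2 ^ q" for F :: "nat \<Rightarrow> real \<Rightarrow> real" and f k
      unfolding incr_def using that tgrid_mem[OF T] by (intro tendsto_diff tendsto_uniform_limitI[OF that(1)]) auto
    have "(\<lambda>i. dual_cost T (A (r i)) (\<lambda>t. lam * t) q b1) \<longlonglongrightarrow> dual_cost T a (\<lambda>t. lam * t) q b1"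
      unfolding dual_cost_def by (intro tendsto_sum tendsto_diff tendsto_mult tendsto_const inc ua) auto
    moreover have "(\<lambda>i. dual_cost T (S (r i)) (\<lambda>t. mu * t) q b2) \<longlonglongrightarrow> dual_cost T s (\<lambda>t. mu * t) q b2"
      unfolding dual_cost_def by (intro tendsto_sum tendsto_diff tendsto_mult tendsto_const inc us) auto
    moreover have "(\<lambda>i. \<Sum>k<2 ^ q. b3 k * y (r i) q k - (exp (b3 k) - 1) * w (r i) q k) \<longlonglongrightarrow> dual_cost T \<zeta> W q b3"
      unfolding dual_cost_def
    proof (intro tendsto_sum tendsto_diff tendsto_mult tendsto_const)
      fix k :: nat assume "k \<in> {..<2 ^ q}"
      then have k: "k < 2 ^ q" by simp
      have "(\<lambda>i. (y (r i) q k - incr T (Y (r i)) q k) + incr T (Y (r i)) q k) \<longlonglongrightarrow> 0 + incr T \<zeta> q k"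
        using LIMSEQ_subseq_LIMSEQ[OF count[OF k] r] by (intro tendsto_add inc uz k) (auto simp: o_def)
      then show "(\<lambda>i. y (r i) q k) \<longlonglongrightarrow> incr T \<zeta> q k" by simp
      \<comment> \<open>Now \<open>weight\<close> is applied with the limit \<open>\<xi>\<close>
        itself as comparison function; \<open>d\<close> is chosen so that its contribution is
        \<open>\<epsilon> / 4\<close>.\<close>
      show "(\<lambda>i. w (r i) q k) \<longlonglongrightarrow> incr T W q k"
        unfolding Wincr[OF k]
      proof (rule LIMSEQ_I, unfold eventually_sequentially[symmetric])
        fix \<epsilon> :: real assume \<epsilon>: "0 < \<epsilon>"
        define d where "d = \<epsilon> / (4 * (th * (T / 2 ^ q)))"
        have d: "0 < d" "th * (T / 2 ^ q) * d = \<epsilon> / 4" using \<epsilon> pos by (auto simp: d_def)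
        have "\<forall>\<^sub>F i in sequentially. \<forall>t\<in>{0..T}. dist (X (r i) t) (\<xi> t) < d" using ux d by (auto simp: uniform_limit_iff)
        moreover have "\<forall>\<^sub>F i in sequentially. \<forall>g d. continuous_on {0..T} g \<longrightarrow> (\<forall>t\<in>{0..T}. \<bar>X (r i) t - g t\<bar> \<le> d) \<longrightarrow>
            \<bar>w (r i) q k - th * integral {tgrid T q k..tgrid T q (Suc k)} g\<bar> \<le> th * (T / 2 ^ q) * d + \<epsilon> / 4"
          using eventually_subseq[OF r weight[OF k, of "\<epsilon> / 4"]] \<epsilon> by simp
        ultimately have "\<forall>\<^sub>F i in sequentially. norm (w (r i) q k - th * integral {tgrid T q k..tgrid T q (Suc k)} \<xi>) < \<epsilon>"
        proof eventually_elim
          case (elim i)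
          have "\<bar>w (r i) q k - th * integral {tgrid T q k..tgrid T q (Suc k)} \<xi>\<bar> \<le> th * (T / 2 ^ q) * d + \<epsilon> / 4"
            using elim(1) by (intro elim(2)[rule_format] \<xi>c) (auto simp: dist_real_def less_imp_le)
          also have "\<dots> = \<epsilon> / 2" unfolding d(2) by simp
          finally show ?case unfolding real_norm_def using \<epsilon> by linarith
        qed
        then show "\<forall>\<^sub>F n in sequentially. norm (w (r n) q k - th * integral {tgrid T q k..tgrid T q (Suc k)} \<xi>) < \<epsilon>" .
      qed
    qed
    ultimately have lim: "(\<lambda>i. dual_cost T (A (r i)) (\<lambda>t. lam * t) q b1 + dual_cost T (S (r i)) (\<lambda>t. mu * t) q b2
        + (\<Sum>k<2 ^ q. b3 k * y (r i) q k - (exp (b3 k) - 1) * w (r i) q k)) \<longlonglongrightarrow>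
        dual_cost T a (\<lambda>t. lam * t) q b1 + dual_cost T s (\<lambda>t. mu * t) q b2 + dual_cost T \<zeta> W q b3"
      by (intro tendsto_add)
    show "dual_cost T a (\<lambda>t. lam * t) q b1 + dual_cost T s (\<lambda>t. mu * t) q b2 + dual_cost T \<zeta> W q b3 \<le> m + e"
      using eventually_subseq[OF r cost[OF e, of q]] by (intro tendsto_upperbound[OF lim]) (auto elim: eventually_mono)
  qed
  \<comment> \<open>\<open>entropy_density\<close> treats one component at a time, so the joint
    bound is split into three suprema over all levels and test vectors, whose sum is still at most
    \<open>m\<close>.\<close>
  define C1 where "C1 = range (\<lambda>(q, b). dual_cost T a (\<lambda>t. lam * t) q b)"
  define C2 where "C2 = range (\<lambda>(q, b). dual_cost T s (\<lambda>t. mu * t) q b)"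
  define C3 where "C3 = range (\<lambda>(q, b). dual_cost T \<zeta> W q b)"
  have bdd: "bdd_above C1" "bdd_above C2" "bdd_above C3"
    using limit_cost[of _ _ "\<lambda>_. 0" "\<lambda>_. 0"] limit_cost[of _ "\<lambda>_. 0" _ "\<lambda>_. 0"] limit_cost[of _ "\<lambda>_. 0" "\<lambda>_. 0"]
    by (auto simp: C1_def C2_def C3_def intro!: bdd_aboveI[of _ m])
  have sum: "Sup C1 + Sup C2 + Sup C3 \<le> m"
  proof (rule Sup_add3_le)
    fix u v x assume "u \<in> C1" "v \<in> C2" "x \<in> C3"
    then obtain q1 b1 q2 b2 q3 b3 where uvx: "u = dual_cost T a (\<lambda>t. lam * t) q1 b1" "v = dual_cost T s (\<lambda>t. mu * t) q2 b2" "x = dual_cost T \<zeta> W q3 b3"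
      unfolding C1_def C2_def C3_def by auto
    \<comment> \<open>The three test vectors may live on different levels; refinement brings them to
      the common level \<open>q1 + q2 + q3\<close>, where the joint bound applies.\<close>
    have "u = dual_cost T a (\<lambda>t. lam * t) (q1 + (q2 + q3)) (\<lambda>j. b1 (j div 2 ^ (q2 + q3)))"
      "v = dual_cost T s (\<lambda>t. mu * t) (q2 + (q1 + q3)) (\<lambda>j. b2 (j div 2 ^ (q1 + q3)))"
      "x = dual_cost T \<zeta> W (q3 + (q1 + q2)) (\<lambda>j. b3 (j div 2 ^ (q1 + q2)))"
      unfolding uvx by (simp_all only: dual_cost_refine)
    moreover have "q2 + (q1 + q3) = q1 + (q2 + q3)" "q3 + (q1 + q2) = q1 + (q2 + q3)" by auto
    ultimately show "u + v + x \<le> m" using limit_cost[of "q1 + (q2 + q3)"] by simp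
  qed (auto simp: C1_def C2_def C3_def)
  have c1: "dual_cost T a (\<lambda>t. lam * t) q b \<le> Sup C1" for q b by (intro cSup_upper bdd) (auto simp: C1_def)
  have c2: "dual_cost T s (\<lambda>t. mu * t) q b \<le> Sup C2" for q b by (intro cSup_upper bdd) (auto simp: C2_def)
  have c3: "dual_cost T \<zeta> W q b \<le> Sup C3" for q b by (intro cSup_upper bdd) (auto simp: C3_def)
  have c0: "0 \<le> Sup C1" "0 \<le> Sup C2" "0 \<le> Sup C3"
    using c1[of 0 "\<lambda>_. 0"] c2[of 0 "\<lambda>_. 0"] c3[of 0 "\<lambda>_. 0"] by auto
  have lin: "incr T (\<lambda>t. v * t) q k \<le> v * (T / 2 ^ q)" for v q k
    by (simp add: incr_def tgrid_Suc right_diff_distrib[symmetric])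
  obtain F1 where F1: "F1 \<in> borel_measurable borel" "\<And>t. 0 \<le> F1 t" "set_integrable lborel {0..T} F1"
    "\<And>t. t \<in> {0..T} \<Longrightarrow> (LINT s:{0..t}|lborel. F1 s) = a t - a 0"
    "(\<integral>\<^sup>+ t\<in>{0..T}. ennreal (relent (F1 t) lam) \<partial>lborel) \<le> ennreal (Sup C1)"
    by (rule entropy_density[OF T a(1,2) _ _ _ lin _ c1, of "\<lambda>_. lam"])
      (use pos in \<open>auto intro!: derivative_eq_intros\<close>)
  obtain F2 where F2: "F2 \<in> borel_measurable borel" "\<And>t. 0 \<le> F2 t" "set_integrable lborel {0..T} F2"
    "\<And>t. t \<in> {0..T} \<Longrightarrow> (LINT u:{0..t}|lborel. F2 u) = s t - s 0"
    "(\<integral>\<^sup>+ t\<in>{0..T}. ennreal (relent (F2 t) mu) \<partial>lborel) \<le> ennreal (Sup C2)"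
    by (rule entropy_density[OF T s(1,2) _ _ _ lin _ c2, of "\<lambda>_. mu"])
      (use pos in \<open>auto intro!: derivative_eq_intros\<close>)
  have "bounded (\<xi> ` {0..T})" using \<xi>c by (intro compact_imp_bounded compact_continuous_image) auto
  then obtain V where V: "0 < V" "\<And>t. t \<in> {0..T} \<Longrightarrow> \<xi> t \<le> V" unfolding bounded_pos by (auto simp: abs_le_iff)
  obtain F3 where F3: "F3 \<in> borel_measurable borel" "\<And>t. 0 \<le> F3 t" "set_integrable lborel {0..T} F3"
    "\<And>t. t \<in> {0..T} \<Longrightarrow> (LINT u:{0..t}|lborel. F3 u) = \<zeta> t - \<zeta> 0"
    "AE t in lborel. t \<in> {0..T} \<longrightarrow> th * \<xi> t = 0 \<longrightarrow> F3 t = 0"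
    "(\<integral>\<^sup>+ t\<in>{0..T}. ennreal (relent (F3 t) (th * \<xi> t)) \<partial>lborel) \<le> ennreal (Sup C3)"
  proof (rule entropy_density[OF T z(1,2), of "\<lambda>t. th * \<xi> t" W "th * V" "Sup C3"])
    show "(W has_real_derivative th * \<xi> t) (at t within {0..T})" if "t \<in> {0..T}" for t
      unfolding W_def using integral_has_real_derivative[OF \<xi>c that] by (rule DERIV_cmult)
    show "incr T W q k \<le> th * V * (T / 2 ^ q)" if k: "k < 2 ^ q" for q k
    proof -
      have l: "tgrid T q k \<in> {0..T}" "tgrid T q (Suc k) \<in> {0..T}" "tgrid T q k \<le> tgrid T q (Suc k)"
        using tgrid_mem[OF T] tgrid_mono[OF T] k by auto
      have "integral {tgrid T q k..tgrid T q (Suc k)} \<xi> \<le> integral {tgrid T q k..tgrid T q (Suc k)} (\<lambda>_. V)"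
        using l V by (intro integral_le integrable_continuous_real continuous_on_subset[OF \<xi>c]) auto
      also have "\<dots> = V * (T / 2 ^ q)" using l by (simp add: tgrid_Suc)
      finally have "th * integral {tgrid T q k..tgrid T q (Suc k)} \<xi> \<le> th * (V * (T / 2 ^ q))"
        using pos by (intro mult_left_mono) auto
      then show ?thesis unfolding Wincr[OF k] by (simp only: mult.assoc)
    qed
    show "continuous_on {0..T} (\<lambda>t. th * \<xi> t)" using \<xi>c by (intro continuous_intros)
  qed (use pos V \<xi>0 c3 in auto)
  \<comment> \<open>A Borel extension of \<open>\<xi>\<close> to the line by its values at 0 and
    \<open>T\<close>.\<close>
  define \<xi>e where "\<xi>e t = \<xi> (max 0 (min T t))" for t
  have \<xi>em [measurable]: "\<xi>e \<in> borel_measurable borel"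
    unfolding \<xi>e_def using T
    by (intro borel_measurable_continuous_onI continuous_on_compose2[OF \<xi>c]) (auto intro!: continuous_intros)
  have \<xi>e: "\<xi>e t = \<xi> t" if "t \<in> {0..T}" for t using that by (simp add: \<xi>e_def)
  \<comment> \<open>\<open>F3\<close> vanishes almost everywhere on the zeros of
    \<open>\<xi>\<close>; \<open>F\<close> vanishes there everywhere. This makes the division by
    \<open>th * \<xi>e t\<close> harmless in the next definition: where \<open>\<xi>\<close> is 0,
    both the reneging rate and its cost are 0.\<close>
  define F where "F t = (if 0 < \<xi>e t then F3 t else 0)" for t
  have [measurable]: "F3 \<in> borel_measurable borel" "F1 \<in> borel_measurable borel" "F2 \<in> borel_measurable borel" by fact+
  have Fm [measurable]: "F \<in> borel_measurable borel" unfolding F_def by measurable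
  have Fae: "AE t in lborel. t \<in> {0..T} \<longrightarrow> F t = F3 t"
    using F3(5)
  proof eventually_elim
    case (elim t)
    then show ?case using \<xi>0[of t] \<xi>e[of t] pos by (auto simp: F_def)
  qed
  define \<phi>3 where "\<phi>3 t = F t / (th * \<xi>e t)" for t
  have [measurable]: "\<phi>3 \<in> borel_measurable borel" unfolding \<phi>3_def by measurable
  have \<phi>3: "\<phi>3 t * \<xi> t = F t / th" if "t \<in> {0..T}" for t
    using that \<xi>e[OF that] pos \<xi>0[OF that] by (auto simp: \<phi>3_def F_def)
  have \<phi>3_0: "0 \<le> \<phi>3 t" if "t \<in> {0..T}" for t
    using that \<xi>e[OF that] pos \<xi>0[OF that] F3(2)[of t] by (auto simp: \<phi>3_def F_def)
  have FI: "set_integrable lborel {0..T} F"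
    using F3(3) unfolding set_integrable_def
    by (subst integrable_cong_AE[where g="\<lambda>t. indicator {0..T} t *\<^sub>R F3 t"]) (use Fae in \<open>auto simp: indicator_def\<close>)
  have Fint: "(LINT u:{0..t}|lborel. \<phi>3 u * \<xi> u) = \<zeta> t / th" if t: "t \<in> {0..T}" for t
  proof -
    have "(LINT u:{0..t}|lborel. \<phi>3 u * \<xi> u) = (LINT u:{0..t}|lborel. F u / th)"
      using \<phi>3 t by (intro set_lebesgue_integral_cong) auto
    also have "\<dots> = (LINT u:{0..t}|lborel. F u) / th" by simp
    also have "(LINT u:{0..t}|lborel. F u) = (LINT u:{0..t}|lborel. F3 u)"
      using Fae t unfolding set_lebesgue_integral_def by (intro integral_cong_AE) (auto simp: indicator_def)
    also have "\<dots> = \<zeta> t" using F3(4)[OF t] z(3) by simp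
    finally show ?thesis .
  qed
  have F1int: "lam * (LINT u:{0..t}|lborel. F1 u / lam) = a t" if t: "t \<in> {0..T}" for t
    using F1(4)[OF t] a(3) pos by simp
  have F2int: "mu * (LINT u:{0..t}|lborel. F2 u / mu) = s t" if t: "t \<in> {0..T}" for t
    using F2(4)[OF t] s(3) pos by simp
  let ?\<phi> = "(\<lambda>t. F1 t / lam, \<lambda>t. F2 t / mu, \<phi>3)"
  have ctl: "?\<phi> \<in> controls lam mu th x0 T \<xi> \<zeta>"
    unfolding controls_def
  proof (intro CollectI case_prodI conjI ballI)
    fix \<phi> assume "\<phi> \<in> {\<lambda>t. F1 t / lam, \<lambda>t. F2 t / mu, \<phi>3}"
    then show "\<phi> \<in> borel_measurable (restrict_space borel {0..T})"
      by (auto intro!: measurable_restrict_space1)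
  next
    fix \<phi> t assume "\<phi> \<in> {\<lambda>t. F1 t / lam, \<lambda>t. F2 t / mu, \<phi>3}" "t \<in> {0..T}"
    then show "0 \<le> \<phi> t" using F1(2)[of t] F2(2)[of t] \<phi>3_0[of t] pos by auto
  next
    show "set_integrable lborel {0..T} (\<lambda>t. F1 t / lam)" "set_integrable lborel {0..T} (\<lambda>t. F2 t / mu)"
      using F1(3) F2(3) by (auto intro!: set_integrable_divide)
    have "set_integrable lborel {0..T} (\<lambda>t. F t / th)" using FI by (intro set_integrable_divide)
    then show "set_integrable lborel {0..T} (\<lambda>t. \<phi>3 t * \<xi> t)"
      by (rule set_integrable_cong[THEN iffD1, rotated -1]) (auto simp: \<phi>3)
  next
    fix t assume t: "t \<in> {0..T}"
    show "\<xi> t = skorohod_map (\<lambda>r. x0 + lam * (LINT s:{0..r}|lborel. F1 s / lam)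
        - mu * (LINT s:{0..r}|lborel. F2 s / mu) - th * (LINT s:{0..r}|lborel. \<phi>3 s * \<xi> s)) t"
      unfolding \<xi>_def[THEN fun_cong]
    proof (rule skorohod_map_cong)
      fix u assume "u \<in> {0..t}"
      then have u: "u \<in> {0..T}" using t by auto
      show "\<psi> u = x0 + lam * (LINT s:{0..u}|lborel. F1 s / lam)
        - mu * (LINT s:{0..u}|lborel. F2 s / mu) - th * (LINT s:{0..u}|lborel. \<phi>3 s * skorohod_map \<psi> s)"
        using F1int[OF u] F2int[OF u] Fint[OF u] pos by (simp add: \<psi>_def \<xi>_def)
    qed (use t in auto)
    show "\<zeta> t = th * (LINT s:{0..t}|lborel. \<phi>3 s * \<xi> s)" using Fint[OF t] pos by simp
  qed
  have cost1: "ennreal v * (\<integral>\<^sup>+u\<in>{0..T}. ennreal (ell (G u / v)) \<partial>lborel) = (\<integral>\<^sup>+ t\<in>{0..T}. ennreal (relent (G t) v) \<partial>lborel)"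
    if "0 < v" "\<And>t. 0 \<le> G t" and [measurable]: "G \<in> borel_measurable borel" for v G
  proof -
    have [measurable]: "(\<lambda>u. ell (G u / v)) \<in> borel_measurable borel" unfolding ell_def by measurable
    show ?thesis
      by (subst nn_integral_cmult[symmetric]) (auto simp: relent_ell that ennreal_mult' mult.assoc less_imp_le)
  qed
  have cost3: "ennreal th * (\<integral>\<^sup>+u\<in>{0..T}. ennreal (\<xi> u * ell (\<phi>3 u)) \<partial>lborel) \<le> ennreal (Sup C3)"
  proof -
    have [measurable]: "(\<lambda>u. \<xi>e u * ell (\<phi>3 u)) \<in> borel_measurable borel" unfolding ell_def by measurable
    have "ennreal th * (\<integral>\<^sup>+u\<in>{0..T}. ennreal (\<xi> u * ell (\<phi>3 u)) \<partial>lborel) =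
        ennreal th * (\<integral>\<^sup>+u\<in>{0..T}. ennreal (\<xi>e u * ell (\<phi>3 u)) \<partial>lborel)"
      using \<xi>e by (intro arg_cong[where f="\<lambda>x. ennreal th * x"] nn_integral_cong) (auto simp: indicator_def)
    also have "\<dots> = (\<integral>\<^sup>+u\<in>{0..T}. ennreal (th * (\<xi>e u * ell (\<phi>3 u))) \<partial>lborel)"
      using pos by (subst nn_integral_cmult[symmetric]) (auto simp: ennreal_mult' mult.assoc)
    also have "\<dots> \<le> (\<integral>\<^sup>+ t\<in>{0..T}. ennreal (relent (F3 t) (th * \<xi> t)) \<partial>lborel)"
    proof (intro nn_integral_mono_AE, use Fae in eventually_elim)
      fix t assume F: "t \<in> {0..T} \<longrightarrow> F t = F3 t"
      show "ennreal (th * (\<xi>e t * ell (\<phi>3 t))) * indicator {0..T} t \<le> ennreal (relent (F3 t) (th * \<xi> t)) * indicator {0..T} t"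
      proof (cases "t \<in> {0..T}")
        case True
        then have eq: "F3 t = F t" "\<xi>e t = \<xi> t" using F \<xi>e by auto
        show ?thesis
        proof (cases "0 < \<xi> t")
          case pt: True
          then have "relent (F3 t) (th * \<xi> t) = th * \<xi> t * ell (F3 t / (th * \<xi> t))"
            using pos F3(2) by (intro relent_ell) auto
          then show ?thesis using True eq pt by (simp add: \<phi>3_def mult.assoc)
        next
          case False
          then have "\<xi> t = 0" using \<xi>0[OF True] by simp
          then show ?thesis using True eq by (simp add: F_def)
        qed
      qed simp
    qed
    finally show ?thesis using F3(6) by simp
  qed
  have "control_cost lam mu th T \<xi> ?\<phi> \<le> ennreal (Sup C1) + ennreal (Sup C2) + ennreal (Sup C3)"
    unfolding control_cost_def prod.case using F1(5) F2(5) cost3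
    by (intro add_mono) (auto simp: cost1 F1(1,2) F2(1,2) pos)
  also have "\<dots> = ennreal (Sup C1 + Sup C2 + Sup C3)" using c0 by (simp add: ennreal_plus)
  also have "\<dots> \<le> ennreal m" using sum by (rule ennreal_leI)
  finally show thesis using ctl that[OF r \<xi>c z(1) ux uz \<xi>0 \<zeta>0] by blast
qed

end

section \<open>Pathwise analysis of the queue\<close>

text \<open>A single realisation outside a null event; everything in this locale is deterministic.
  Only \<open>\<nu>1\<close> and \<open>\<nu>2\<close> are finite, whereas \<open>\<nu>3\<close> may
  have infinite mass over the unbounded axis of marks.\<close>

locale queue_path =
  fixes T :: real and n :: nat and xn :: real and \<nu>1 \<nu>2 :: "real measure" and \<nu>3 :: "(real \<times> real) measure"
    and f g :: "real \<Rightarrow> real"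
  assumes T: "0 < T" and n: "0 < n" and xn: "0 \<le> xn"
    and eqs: "mm1m_equations T n xn \<nu>1 \<nu>2 \<nu>3 f g"
    and sets1: "sets \<nu>1 = sets (restrict_space borel {0..T})"
    and sets2: "sets \<nu>2 = sets (restrict_space borel {0..T})"
    and sets3: "sets \<nu>3 = sets (restrict_space borel ({0..T} \<times> {0..}))"
    and fin1: "emeasure \<nu>1 {0..T} < \<infinity>" and fin2: "emeasure \<nu>2 {0..T} < \<infinity>"
    and null: "emeasure \<nu>1 {0} = 0" "emeasure \<nu>2 {0} = 0" "emeasure \<nu>3 ({0} \<times> {0..}) = 0"
    and cadlag: "path_pair T f g \<in> cadlag_space T ({0..} \<times> {0..})"
begin

definition arr where "arr t = measure \<nu>1 {0..t} / n"
definition srv where "srv t = measure \<nu>2 {0..t} / n"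
text \<open>Services offered while the server is idle. This is the pushing term in the Skorohod
  decomposition of the queue.\<close>

definition idle where "idle t = measure \<nu>2 ({0..t} \<inter> {s. left_limit f s = 0}) / n"
text \<open>The customer in service does not renege, hence the subtraction of
  \<open>1 / n\<close>.\<close>

definition level where "level s = max 0 (left_limit f s - 1 / n)"
definition region where "region t = {(s, y). s \<in> {0..t} \<and> 0 \<le> y \<and> y \<le> level s}"

lemma space: "space \<nu>1 = {0..T}" "space \<nu>2 = {0..T}" "space \<nu>3 = {0..T} \<times> {0..}"
  using sets_eq_imp_space_eq[OF sets1] sets_eq_imp_space_eq[OF sets2] sets_eq_imp_space_eq[OF sets3]
  by (auto simp: space_restrict_space)

lemma sets1I: "B \<in> sets borel \<Longrightarrow> B \<subseteq> {0..T} \<Longrightarrow> B \<in> sets \<nu>1"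
  unfolding sets1 by (subst sets_restrict_space_iff) auto

lemma sets2I: "B \<in> sets borel \<Longrightarrow> B \<subseteq> {0..T} \<Longrightarrow> B \<in> sets \<nu>2"
  unfolding sets2 by (subst sets_restrict_space_iff) auto

lemma sets3I: "B \<in> sets borel \<Longrightarrow> B \<subseteq> {0..T} \<times> {0..} \<Longrightarrow> B \<in> sets \<nu>3"
  unfolding sets3 by (subst sets_restrict_space_iff) (auto intro: borel_closed closed_Times)

lemma finite_measure1: "finite_measure \<nu>1" and finite_measure2: "finite_measure \<nu>2"
  using fin1 fin2 by (auto intro!: finite_measureI simp: space)

lemma f_nonneg: "t \<in> {0..T} \<Longrightarrow> 0 \<le> f t" and g_nonneg: "t \<in> {0..T} \<Longrightarrow> 0 \<le> g t"
proof -
  assume t: "t \<in> {0..T}"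
  have "path_pair T f g \<in> {0..T} \<rightarrow>\<^sub>E {0..} \<times> {0..}" using cadlag by (simp add: cadlag_space_def)
  from PiE_mem[OF this t] have "path_pair T f g t \<in> {0..} \<times> {0..}" .
  then show "0 \<le> f t" "0 \<le> g t" using t by (auto simp: path_pair_def)
qed

lemma f_right: assumes t: "t \<in> {0..<T}" shows "(f \<longlongrightarrow> f t) (at_right t)"
proof -
  have "(path_pair T f g \<longlongrightarrow> path_pair T f g t) (at_right t)" using cadlag t by (auto simp: cadlag_space_def)
  then have "((\<lambda>s. fst (path_pair T f g s)) \<longlongrightarrow> fst (path_pair T f g t)) (at_right t)" by (rule tendsto_fst)
  moreover have "\<forall>\<^sub>F s in at_right t. fst (path_pair T f g s) = f s"
    using t unfolding eventually_at_right_field by (intro exI[of _ T]) (auto simp: path_pair_def)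
  ultimately show ?thesis using t by (auto simp: path_pair_def dest: tendsto_cong[THEN iffD1, rotated])
qed

lemma f_left: assumes t: "t \<in> {0<..T}" shows "(f \<longlongrightarrow> left_limit f t) (at_left t)" 
proof -
  obtain l where "(path_pair T f g \<longlongrightarrow> l) (at_left t)" using cadlag t unfolding cadlag_space_def by blast
  then have "((\<lambda>s. fst (path_pair T f g s)) \<longlongrightarrow> fst l) (at_left t)" by (rule tendsto_fst)
  moreover have "\<forall>\<^sub>F s in at_left t. fst (path_pair T f g s) = f s"
    using t unfolding eventually_at_left_field by (intro exI[of _ 0]) (auto simp: path_pair_def)
  ultimately have l: "(f \<longlongrightarrow> fst l) (at_left t)" by (auto dest: tendsto_cong[THEN iffD1, rotated])
  then have "left_limit f t = fst l" using t unfolding left_limit_def by (auto intro: tendsto_Lim)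
  then show ?thesis using l by simp
qed

lemma left_limit_bounds:
  assumes t: "t \<in> {0<..T}" and u: "u < t" and b: "\<And>s. s \<in> {0..T} \<Longrightarrow> u < s \<Longrightarrow> s < t \<Longrightarrow> l \<le> f s \<and> f s \<le> h"
  shows "l \<le> left_limit f t" "left_limit f t \<le> h"
proof -
  have ev: "\<forall>\<^sub>F s in at_left t. l \<le> f s \<and> f s \<le> h"
    using t u b unfolding eventually_at_left_field by (intro exI[of _ "max u 0"]) auto
  show "l \<le> left_limit f t" using ev by (intro tendsto_lowerbound[OF f_left[OF t]]) (auto elim: eventually_mono)
  show "left_limit f t \<le> h" using ev by (intro tendsto_upperbound[OF f_left[OF t]]) (auto elim: eventually_mono)
qed

text \<open>For positive \<open>s\<close> the left limit is the limit of \<open>f\<close> along the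
  last grid points strictly before \<open>s\<close>; the ceiling minus 1 makes this strict. Each
  approximation is a function of an integer-valued measurable index.\<close>

lemma left_limit_measurable: "\<exists>L\<in>borel_measurable borel. \<forall>s\<in>{0..T}. left_limit f s = L s"
proof -
  define k where "k q s = nat (\<lceil>s * 2 ^ q / T\<rceil> - 1)" for q :: nat and s :: real
  have km [measurable]: "k q \<in> borel \<rightarrow>\<^sub>M count_space UNIV" for q unfolding k_def by measurable
  define L where "L s = lim (\<lambda>q. f (tgrid T q (k q s)))" for s
  have Lm [measurable]: "L \<in> borel_measurable borel"
    unfolding L_def by (rule borel_measurable_lim_metric) measurable
  have "left_limit f s = L s" if s: "s \<in> {0<..T}" for s
  proof -
    have b: "tgrid T q (k q s) < s \<and> s - T / 2 ^ q \<le> tgrid T q (k q s)" for q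
    proof -
      have "0 < s * 2 ^ q / T" using s T by simp
      then have "0 < \<lceil>s * 2 ^ q / T\<rceil>" by simp
      then have "real (k q s) = of_int \<lceil>s * 2 ^ q / T\<rceil> - 1" by (simp add: k_def)
      then have "real (k q s) < s * 2 ^ q / T" "s * 2 ^ q / T - 1 \<le> real (k q s)" by linarith+
      then have "real (k q s) * (T / 2 ^ q) < s * 2 ^ q / T * (T / 2 ^ q)"
        "(s * 2 ^ q / T - 1) * (T / 2 ^ q) \<le> real (k q s) * (T / 2 ^ q)"
        using T by (intro mult_strict_right_mono mult_right_mono; simp)+
      then show ?thesis using T by (auto simp: tgrid_def left_diff_distrib diff_divide_distrib)
    qed
    have "(\<lambda>q. tgrid T q (k q s)) \<longlonglongrightarrow> s"
    proof (rule real_tendsto_sandwich[of "\<lambda>q. s - T / 2 ^ q" _ _ "\<lambda>_. s"])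
      have "(\<lambda>q. T / 2 ^ q) \<longlonglongrightarrow> 0" by real_asymp
      then show "(\<lambda>q. s - T / 2 ^ q) \<longlonglongrightarrow> s" using tendsto_diff[OF tendsto_const, of _ 0 _ s] by simp
    qed (use b in \<open>auto simp: less_imp_le\<close>)
    moreover have "\<forall>\<^sub>F q in sequentially. tgrid T q (k q s) \<in> {..<s} \<and> tgrid T q (k q s) \<noteq> s"
      using b by (intro always_eventually allI) (metis lessThan_iff less_irrefl)
    ultimately have "filterlim (\<lambda>q. tgrid T q (k q s)) (at_left s) sequentially"
      by (simp add: filterlim_at)
    then have "(\<lambda>q. f (tgrid T q (k q s))) \<longlonglongrightarrow> left_limit f s"
      by (rule filterlim_compose[OF f_left[OF s]])
    then show ?thesis unfolding L_def by (simp add: limI)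
  qed
  then have "\<forall>s\<in>{0..T}. left_limit f s = (if s \<le> 0 then f 0 else L s)" by (auto simp: left_limit_def)
  moreover have "(\<lambda>s. if s \<le> 0 then f 0 else L s) \<in> borel_measurable borel" by measurable
  ultimately show ?thesis by (intro bexI[of _ "\<lambda>s. if s \<le> 0 then f 0 else L s"])
qed

lemma zero_set: "t \<le> T \<Longrightarrow> {0..t} \<inter> {s. left_limit f s = 0} \<in> sets borel"
proof -
  assume t: "t \<le> T"
  obtain L where [measurable]: "L \<in> borel_measurable borel" and L: "\<forall>s\<in>{0..T}. left_limit f s = L s"
    using left_limit_measurable by blast
  have "{s \<in> space borel. s \<in> {0..t} \<and> L s = 0} \<in> sets borel" by measurable
  also have "{s \<in> space borel. s \<in> {0..t} \<and> L s = 0} = {0..t} \<inter> {s. left_limit f s = 0}" using L t by auto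
  finally show ?thesis .
qed

lemma region_sets: assumes t: "t \<le> T" shows "region t \<in> sets borel"
proof -
  obtain L where [measurable]: "L \<in> borel_measurable borel" and L: "\<forall>s\<in>{0..T}. left_limit f s = L s"
    using left_limit_measurable by blast
  have "{p \<in> space (borel \<Otimes>\<^sub>M borel). fst p \<in> {0..t} \<and> 0 \<le> snd p \<and> snd p \<le> max 0 (L (fst p) - 1 / n)} \<in> sets (borel \<Otimes>\<^sub>M borel)"
    by measurable
  also have "{p \<in> space (borel \<Otimes>\<^sub>M borel). fst p \<in> {0..t} \<and> 0 \<le> snd p \<and> snd p \<le> max 0 (L (fst p) - 1 / n)} = region t"
    using L t by (auto simp: region_def level_def space_pair_measure)
  finally show ?thesis unfolding borel_prod .
qed

lemma region_sub: "t \<le> T \<Longrightarrow> region t \<subseteq> {0..T} \<times> {0..}" by (auto simp: region_def)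

lemma g_eq: assumes t: "t \<in> {0..T}" shows "g t = measure \<nu>3 (region t) / n"
proof -
  have "g t = 1 / real n * (LINT p:{0..t} \<times> {0..}|\<nu>3. indicator {0..max 0 (left_limit f (fst p) - 1 / real n)} (snd p))"
    using eqs t by (simp add: mm1m_equations_def)
  also have "(LINT p:{0..t} \<times> {0..}|\<nu>3. indicator {0..max 0 (left_limit f (fst p) - 1 / real n)} (snd p)) =
      (LINT p|\<nu>3. indicator (region t) p)"
    unfolding set_lebesgue_integral_def by (intro Bochner_Integration.integral_cong refl)
      (auto simp: region_def level_def indicator_def)
  also have "\<dots> = measure \<nu>3 (region t \<inter> space \<nu>3)" by simp
  also have "region t \<inter> space \<nu>3 = region t" using region_sub[of t] t by (auto simp: space)
  finally show ?thesis by simp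
qed

lemma f_eq: assumes t: "t \<in> {0..T}" shows "f t = xn + arr t - srv t + idle t - g t"
proof -
  interpret N2: finite_measure \<nu>2 by (rule finite_measure2)
  have "f t = xn + 1 / real n * (LINT s:{0..t}|\<nu>1. 1) - 1 / real n * (LINT s:{0..t}|\<nu>2. indicator {s. left_limit f s \<noteq> 0} s) - g t"
    using eqs t by (simp add: mm1m_equations_def)
  also have "(LINT s:{0..t}|\<nu>1. 1) = measure \<nu>1 {0..t}"
  proof -
    have "{0..t} \<inter> space \<nu>1 = {0..t}" using t by (auto simp: space)
    then show ?thesis by (simp add: set_lebesgue_integral_def)
  qed
  also have "(LINT s:{0..t}|\<nu>2. indicator {s. left_limit f s \<noteq> 0} s) = (LINT s|\<nu>2. indicator ({0..t} \<inter> {s. left_limit f s \<noteq> 0}) s)"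
    unfolding set_lebesgue_integral_def by (intro Bochner_Integration.integral_cong refl) (auto simp: indicator_def)
  also have "\<dots> = measure \<nu>2 ({0..t} - ({0..t} \<inter> {s. left_limit f s = 0}))"
  proof -
    have "{0..t} \<inter> {s. left_limit f s \<noteq> 0} \<inter> space \<nu>2 = {0..t} - ({0..t} \<inter> {s. left_limit f s = 0})" using t by (auto simp: space)
    then show ?thesis by simp
  qed
  also have "\<dots> = measure \<nu>2 {0..t} - measure \<nu>2 ({0..t} \<inter> {s. left_limit f s = 0})"
    using t zero_set[of t] by (intro N2.finite_measure_Diff) (auto intro!: sets2I)
  finally show ?thesis by (simp add: arr_def srv_def idle_def diff_divide_distrib)
qed

lemma arr_diff: assumes "0 \<le> s" "s \<le> t" "t \<le> T" shows "arr t - arr s = measure \<nu>1 {s<..t} / n"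
proof -
  interpret N1: finite_measure \<nu>1 by (rule finite_measure1)
  have "measure \<nu>1 ({0..t} - {0..s}) = measure \<nu>1 {0..t} - measure \<nu>1 {0..s}"
    using assms by (intro N1.finite_measure_Diff) (auto intro!: sets1I)
  moreover have "{0..t} - {0..s} = {s<..t}" using assms by auto
  ultimately show ?thesis by (simp add: arr_def diff_divide_distrib)
qed

lemma srv_diff: assumes "0 \<le> s" "s \<le> t" "t \<le> T" shows "srv t - srv s = measure \<nu>2 {s<..t} / n"
proof -
  interpret N2: finite_measure \<nu>2 by (rule finite_measure2)
  have "measure \<nu>2 ({0..t} - {0..s}) = measure \<nu>2 {0..t} - measure \<nu>2 {0..s}"
    using assms by (intro N2.finite_measure_Diff) (auto intro!: sets2I)
  moreover have "{0..t} - {0..s} = {s<..t}" using assms by auto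
  ultimately show ?thesis by (simp add: srv_def diff_divide_distrib)
qed

lemma idle_diff: assumes "0 \<le> s" "s \<le> t" "t \<le> T" shows "idle t - idle s = measure \<nu>2 ({s<..t} \<inter> {s. left_limit f s = 0}) / n"
proof -
  interpret N2: finite_measure \<nu>2 by (rule finite_measure2)
  have "measure \<nu>2 (({0..t} \<inter> {s. left_limit f s = 0}) - ({0..s} \<inter> {s. left_limit f s = 0})) =
     measure \<nu>2 ({0..t} \<inter> {s. left_limit f s = 0}) - measure \<nu>2 ({0..s} \<inter> {s. left_limit f s = 0})"
    using assms by (intro N2.finite_measure_Diff) (auto intro!: sets2I zero_set)
  moreover have "({0..t} \<inter> {s. left_limit f s = 0}) - ({0..s} \<inter> {s. left_limit f s = 0}) = {s<..t} \<inter> {s. left_limit f s = 0}" using assms by auto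
  ultimately show ?thesis by (simp add: idle_def diff_divide_distrib)
qed

lemma arr_mono: "mono_on {0..T} arr"
proof (rule mono_onI)
  fix s t assume "s \<in> {0..T}" "t \<in> {0..T}" "s \<le> t"
  then have "arr t - arr s = measure \<nu>1 {s<..t} / n" by (intro arr_diff) auto
  also have "0 \<le> \<dots>" by simp
  finally show "arr s \<le> arr t" by simp
qed

lemma srv_mono: "mono_on {0..T} srv"
proof (rule mono_onI)
  fix s t assume "s \<in> {0..T}" "t \<in> {0..T}" "s \<le> t"
  then have "srv t - srv s = measure \<nu>2 {s<..t} / n" by (intro srv_diff) auto
  also have "0 \<le> \<dots>" by simp
  finally show "srv s \<le> srv t" by simp
qed

lemma idle_mono: "mono_on {0..T} idle"
proof (rule mono_onI)
  fix s t assume "s \<in> {0..T}" "t \<in> {0..T}" "s \<le> t"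
  then have "idle t - idle s = measure \<nu>2 ({s<..t} \<inter> {s. left_limit f s = 0}) / n" by (intro idle_diff) auto
  also have "0 \<le> \<dots>" by simp
  finally show "idle s \<le> idle t" by simp
qed

lemma idle_diff_le: assumes "0 \<le> s" "s \<le> t" "t \<le> T" shows "idle t - idle s \<le> srv t - srv s"
proof -
  interpret N2: finite_measure \<nu>2 by (rule finite_measure2)
  have "measure \<nu>2 ({s<..t} \<inter> {s. left_limit f s = 0}) \<le> measure \<nu>2 {s<..t}"
    using assms by (intro N2.finite_measure_mono) (auto intro!: sets2I)
  then show ?thesis unfolding srv_diff[OF assms] idle_diff[OF assms] by (simp add: divide_right_mono)
qed

lemma at_0: "arr 0 = 0" "srv 0 = 0" "idle 0 = 0" "g 0 = 0"
proof -
  show "arr 0 = 0" "srv 0 = 0" using null by (simp_all add: arr_def srv_def measure_def)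
  have "emeasure \<nu>2 ({0..0} \<inter> {s. left_limit f s = 0}) \<le> emeasure \<nu>2 {0}"
    using T by (intro emeasure_mono) (auto intro!: sets2I)
  then show "idle 0 = 0" using null by (simp add: idle_def measure_def)
  have "emeasure \<nu>3 (region 0) \<le> emeasure \<nu>3 ({0} \<times> {0..})"
    using T by (intro emeasure_mono) (auto simp: region_def intro!: sets3I borel_closed closed_Times)
  then show "g 0 = 0" using null g_eq[of 0] T by (simp add: measure_def)
qed

lemma f_le: assumes "t \<in> {0..T}" shows "f t \<le> xn + arr t"
proof -
  have "idle t \<le> srv t" using idle_diff_le[of 0 t] assms at_0 by simp
  then show ?thesis using f_eq[OF assms] g_nonneg[OF assms] by simp
qed

text \<open>Since \<open>f\<close> is nonnegative, \<open>idle\<close> dominates the regulator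
  \<open>m\<close> of the Skorohod map. For the converse let \<open>\<tau>\<close> be the supremum
  of the times with left limit 0; \<open>idle\<close> is constant after \<open>\<tau>\<close>. Just
  before such a time close to \<open>\<tau>\<close> the queue is nearly empty, so
  \<open>idle\<close> is nearly at most \<open>m\<close> there, and until \<open>\<tau>\<close> it
  grows by at most \<open>\<delta>\<close>. Simultaneous jumps need not be excluded, at the price of
  this \<open>\<delta>\<close>.\<close>

lemma reflection:
  assumes d: "0 < d" and small: "\<And>s t. s \<in> {0..T} \<Longrightarrow> t \<in> {0..T} \<Longrightarrow> s \<le> t \<Longrightarrow> t - s < d \<Longrightarrow> srv t - srv s \<le> \<delta>"
    and t: "t \<in> {0..T}"
  shows "\<bar>f t - skorohod_map (\<lambda>r. xn + arr r - srv r - g r) t\<bar> \<le> \<delta>"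
proof -
  define \<psi> where "\<psi> r = xn + arr r - srv r - g r" for r
  define m where "m = - (INF r\<in>{0..t}. min (\<psi> r) 0)"
  have f: "f r = \<psi> r + idle r" if "r \<in> {0..T}" for r using f_eq[OF that] by (simp add: \<psi>_def)
  have \<delta>: "0 \<le> \<delta>" using small[of t t] t d by simp
  have lower: "- idle t \<le> \<psi> r" if "r \<in> {0..t}" for r
  proof -
    have "r \<in> {0..T}" using that t by auto
    then show ?thesis using f[of r] f_nonneg[of r] mono_onD[OF idle_mono, of r t] that t by auto
  qed
  have it0: "0 \<le> idle t" using mono_onD[OF idle_mono, of 0 t] t at_0 by auto
  have "- idle t \<le> (INF r\<in>{0..t}. min (\<psi> r) 0)"
    using t lower it0 by (intro cINF_greatest) auto
  then have 1: "m \<le> idle t" by (simp add: m_def)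
  have mle: "- min (\<psi> r) 0 \<le> m" if "r \<in> {0..t}" for r
  proof -
    have "(INF r\<in>{0..t}. min (\<psi> r) 0) \<le> min (\<psi> r) 0"
      using that lower by (intro cINF_lower bdd_below_min[of _ "- idle t"]) auto
    then show ?thesis by (simp add: m_def)
  qed
  have m0: "0 \<le> m" using mle[of 0] t by (simp add: min_def split: if_splits)
  have 2: "idle t \<le> m + \<delta>"
  proof (cases "\<exists>r\<in>{0..t}. left_limit f r = 0")
    case False
    then have "{0..t} \<inter> {s. left_limit f s = 0} = {}" by auto
    then have "idle t = 0" by (simp add: idle_def)
    then show ?thesis using m0 \<delta> by simp
  next
    case True
    define Z where "Z = {r \<in> {0..t}. left_limit f r = 0}"
    have Z: "Z \<noteq> {}" "bdd_above Z" "Z \<subseteq> {0..t}" using True by (auto simp: Z_def intro!: bdd_aboveI[of _ t])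
    define \<tau> where "\<tau> = Sup Z"
    have \<tau>: "\<tau> \<in> {0..t}"
    proof -
      obtain r where r: "r \<in> Z" using Z by blast
      then have "r \<le> \<tau>" unfolding \<tau>_def using Z by (intro cSup_upper)
      moreover have "\<tau> \<le> t" unfolding \<tau>_def using Z by (intro cSup_least) auto
      ultimately show ?thesis using r Z(3) by auto
    qed
    obtain r where r: "r \<in> Z" "\<tau> - d < r" using less_cSupD[OF Z(1), of "\<tau> - d"] d by (auto simp: \<tau>_def)
    have r\<tau>: "r \<le> \<tau>" unfolding \<tau>_def using Z r by (intro cSup_upper)
    \<comment> \<open>Nothing is added after \<open>\<tau>\<close>, and between \<open>u\<close> and
      \<open>\<tau>\<close> no more than the services offered.\<close>
    have step: "idle t \<le> idle u + \<delta>" if u: "u \<in> {0..\<tau>}" "\<tau> - d < u" for u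
    proof -
      have e: "idle t - idle \<tau> = 0"
      proof -
        have "{\<tau><..t} \<inter> {s. left_limit f s = 0} = {}"
        proof (rule equals0I)
          fix v assume v: "v \<in> {\<tau><..t} \<inter> {s. left_limit f s = 0}"
          then have "v \<in> Z" using \<tau> by (auto simp: Z_def)
          then have "v \<le> \<tau>" unfolding \<tau>_def using Z by (intro cSup_upper)
          then show False using v by auto
        qed
        then show ?thesis using idle_diff[of \<tau> t] \<tau> t by simp
      qed
      have "idle \<tau> - idle u \<le> srv \<tau> - srv u" using u \<tau> t by (intro idle_diff_le) auto
      also have "\<dots> \<le> \<delta>" using u \<tau> t by (intro small) auto
      finally show ?thesis using e by simp
    qed
    show ?thesis
    proof (cases "r = 0")
      case True
      then show ?thesis using step[of 0] r r\<tau> at_0 m0 by auto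
    next
      case False
      then have r0: "r \<in> {0<..T}" using r Z t by auto
      show ?thesis
      proof (rule field_le_epsilon)
        fix e :: real assume e: "0 < e"
        have lr: "left_limit f r = 0" using r by (simp add: Z_def)
        have "\<forall>\<^sub>F u in at_left r. f u < e" using f_left[OF r0] e unfolding lr by (intro order_tendstoD)
        then obtain b where b: "b < r" "\<And>u. b < u \<Longrightarrow> u < r \<Longrightarrow> f u < e"
          unfolding eventually_at_left_field by blast
        \<comment> \<open>A time strictly before \<open>r\<close> at which \<open>f\<close> is below
          \<open>e\<close>, and still within distance \<open>d\<close> of
          \<open>\<tau>\<close>.\<close>
        obtain u where u: "max (max b 0) (\<tau> - d) < u" "u < r" using dense[of "max (max b 0) (\<tau> - d)" r] b r r0 by auto
        have ut: "u \<in> {0..t}" "u \<in> {0..T}" using u r\<tau> \<tau> t by auto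
        have "idle t \<le> idle u + \<delta>" using u r\<tau> by (intro step) auto
        also have "idle u = f u - \<psi> u" using f[OF ut(2)] by simp
        also have "f u < e" using b u by auto
        finally show "idle t \<le> m + \<delta> + e" using mle[OF ut(1)] by (auto simp: min_def split: if_splits)
      qed
    qed
  qed
  have "f t - skorohod_map \<psi> t = idle t - m" using f[OF t] by (simp add: skorohod_map_def m_def)
  then have "\<bar>f t - skorohod_map \<psi> t\<bar> \<le> \<delta>" using 1 2 by simp
  then show ?thesis by (simp add: \<psi>_def[abs_def])
qed

text \<open>The increment of \<open>idle\<close> lies between 0 and the increment of
  \<open>srv\<close>, so the reflection adds nothing to the sum of the three increments.\<close>

lemma oscillation:
  assumes st: "s \<in> {0..T}" "t \<in> {0..T}" "s \<le> t" and gm: "g s \<le> g t"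
  shows "\<bar>f t - f s\<bar> \<le> (arr t - arr s) + (srv t - srv s) + (g t - g s)"
proof -
  have "idle t - idle s \<le> srv t - srv s" using st by (intro idle_diff_le) auto
  moreover have "idle s \<le> idle t" "arr s \<le> arr t"
    using st by (auto intro: mono_onD[OF idle_mono] mono_onD[OF arr_mono])
  ultimately show ?thesis using f_eq[OF st(1)] f_eq[OF st(2)] gm by linarith
qed

end

section \<open>Paths and the rate function\<close>

lemma path_pair_cadlag:
  assumes T: "0 < T" and c: "continuous_on {0..T} \<xi>" "continuous_on {0..T} \<zeta>"
    and nn: "\<And>t. t \<in> {0..T} \<Longrightarrow> 0 \<le> \<xi> t" "\<And>t. t \<in> {0..T} \<Longrightarrow> 0 \<le> \<zeta> t"
  shows "path_pair T \<xi> \<zeta> \<in> cadlag_space T ({0..} \<times> {0..})"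
proof -
  let ?z = "path_pair T \<xi> \<zeta>"
  have z: "?z t = (\<xi> t, \<zeta> t)" if "t \<in> {0..T}" for t using that by (simp add: path_pair_def)
  have "continuous_on {0..T} (\<lambda>t. (\<xi> t, \<zeta> t))" by (intro continuous_on_Pair c)
  then have cz: "continuous_on {0..T} ?z" using z by (subst continuous_on_cong[OF refl]) auto
  show ?thesis
    unfolding cadlag_space_def
  proof (intro CollectI conjI ballI)
    show "?z \<in> {0..T} \<rightarrow>\<^sub>E {0..} \<times> {0..}" using nn by (auto simp: path_pair_def)
    fix t assume t: "t \<in> {0..<T}"
    then have "(?z \<longlongrightarrow> ?z t) (at t within {0..T})" using cz by (auto simp: continuous_on_def)
    then have "(?z \<longlongrightarrow> ?z t) (at t within {t..T})" by (rule tendsto_within_subset) (use t in auto)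
    then show "(?z \<longlongrightarrow> ?z t) (at_right t)" using t by (simp add: at_within_Icc_at_right)
  next
    fix t assume t: "t \<in> {0<..T}"
    then have "(?z \<longlongrightarrow> ?z t) (at t within {0..T})" using cz by (auto simp: continuous_on_def)
    then have "(?z \<longlongrightarrow> ?z t) (at t within {0..t})" by (rule tendsto_within_subset) (use t in auto)
    then have "(?z \<longlongrightarrow> ?z t) (at_left t)" using t by (simp add: at_within_Icc_at_left)
    moreover have "?z t \<in> {0..} \<times> {0..}" using z[of t] nn[of t] t by auto
    ultimately show "\<exists>l\<in>{0..} \<times> {0..}. (?z \<longlongrightarrow> l) (at_left t)" by (rule bexI)
  qed
qed

lemma skorohod_dist_le:
  assumes "0 \<le> e" "\<And>t. t \<in> {0..T} \<Longrightarrow> dist (f t) (g t) \<le> e"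
  shows "skorohod_dist T f g \<le> e"
  unfolding skorohod_dist_def
proof (rule enn2real_leI)
  show "skorohod_edist T f g \<le> ennreal e"
    using assms by (intro skorohod_edist_leI[OF id_time_change]) auto
qed (use assms in auto)

lemma dist_pair_le: "dist (a, b) (c, d) \<le> \<bar>a - c\<bar> + \<bar>b - d\<bar>" for a b c d :: real
  using sqrt_sum_squares_le_sum_abs[of "dist a c" "dist b d"] by (simp add: dist_Pair_Pair dist_real_def)

lemma controls_cong:
  assumes eq: "\<And>t. t \<in> {0..T} \<Longrightarrow> \<xi> t = \<xi>' t" "\<And>t. t \<in> {0..T} \<Longrightarrow> \<zeta> t = \<zeta>' t"
  shows "controls lam mu th x0 T \<xi> \<zeta> = controls lam mu th x0 T \<xi>' \<zeta>'"
proof -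
  have sub: "controls lam mu th x0 T \<xi> \<zeta> \<subseteq> controls lam mu th x0 T \<xi>' \<zeta>'"
    if eq: "\<And>t. t \<in> {0..T} \<Longrightarrow> \<xi> t = \<xi>' t" "\<And>t. t \<in> {0..T} \<Longrightarrow> \<zeta> t = \<zeta>' t" for \<xi> \<zeta> \<xi>' \<zeta>'
  proof
    fix \<phi> assume "\<phi> \<in> controls lam mu th x0 T \<xi> \<zeta>"
    then obtain \<phi>1 \<phi>2 \<phi>3 where \<phi>: "\<phi> = (\<phi>1, \<phi>2, \<phi>3)"
      and m: "\<forall>\<phi>\<in>{\<phi>1, \<phi>2, \<phi>3}. \<phi> \<in> borel_measurable (restrict_space borel {0..T}) \<and> (\<forall>s\<in>{0..T}. 0 \<le> \<phi> s)"
      and i: "set_integrable lborel {0..T} \<phi>1" "set_integrable lborel {0..T} \<phi>2" "set_integrable lborel {0..T} (\<lambda>s. \<phi>3 s * \<xi> s)"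
      and e: "\<forall>t\<in>{0..T}. \<xi> t = skorohod_map (\<lambda>r. x0 + lam * (LINT s:{0..r}|lborel. \<phi>1 s)
         - mu * (LINT s:{0..r}|lborel. \<phi>2 s) - th * (LINT s:{0..r}|lborel. \<phi>3 s * \<xi> s)) t \<and>
         \<zeta> t = th * (LINT s:{0..t}|lborel. \<phi>3 s * \<xi> s)"
      unfolding controls_def by auto
    have L: "(LINT s:{0..r}|lborel. \<phi>3 s * \<xi> s) = (LINT s:{0..r}|lborel. \<phi>3 s * \<xi>' s)" if "r \<le> T" for r
      using that eq by (intro set_lebesgue_integral_cong) auto
    have i3: "set_integrable lborel {0..T} (\<lambda>s. \<phi>3 s * \<xi>' s)"
      using i(3) by (rule set_integrable_cong[THEN iffD1, rotated -1]) (auto simp: eq)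
    have e': "\<forall>t\<in>{0..T}. \<xi>' t = skorohod_map (\<lambda>r. x0 + lam * (LINT s:{0..r}|lborel. \<phi>1 s)
         - mu * (LINT s:{0..r}|lborel. \<phi>2 s) - th * (LINT s:{0..r}|lborel. \<phi>3 s * \<xi>' s)) t \<and>
         \<zeta>' t = th * (LINT s:{0..t}|lborel. \<phi>3 s * \<xi>' s)"
    proof
      fix t assume t: "t \<in> {0..T}"
      have "\<xi> t = skorohod_map (\<lambda>r. x0 + lam * (LINT s:{0..r}|lborel. \<phi>1 s)
         - mu * (LINT s:{0..r}|lborel. \<phi>2 s) - th * (LINT s:{0..r}|lborel. \<phi>3 s * \<xi> s)) t" using e t by blast
      also have "\<dots> = skorohod_map (\<lambda>r. x0 + lam * (LINT s:{0..r}|lborel. \<phi>1 s)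
         - mu * (LINT s:{0..r}|lborel. \<phi>2 s) - th * (LINT s:{0..r}|lborel. \<phi>3 s * \<xi>' s)) t"
        using t L by (intro skorohod_map_cong) auto
      finally show "\<xi>' t = skorohod_map (\<lambda>r. x0 + lam * (LINT s:{0..r}|lborel. \<phi>1 s)
         - mu * (LINT s:{0..r}|lborel. \<phi>2 s) - th * (LINT s:{0..r}|lborel. \<phi>3 s * \<xi>' s)) t \<and>
         \<zeta>' t = th * (LINT s:{0..t}|lborel. \<phi>3 s * \<xi>' s)"
        using e t eq[OF t] L[of t] by auto
    qed
    show "\<phi> \<in> controls lam mu th x0 T \<xi>' \<zeta>'"
      unfolding \<phi> controls_def using m i i3 e' by blast
  qed
  show ?thesis using sub[of \<xi> \<xi>' \<zeta> \<zeta>'] sub[of \<xi>' \<xi> \<zeta>' \<zeta>] eq by (intro equalityI) auto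
qed

lemma control_cost_cong:
  assumes "\<And>t. t \<in> {0..T} \<Longrightarrow> \<xi> t = \<xi>' t"
  shows "control_cost lam mu th T \<xi> \<phi> = control_cost lam mu th T \<xi>' \<phi>"
proof -
  obtain \<phi>1 \<phi>2 \<phi>3 where \<phi>: "\<phi> = (\<phi>1, \<phi>2, \<phi>3)" by (cases \<phi>)
  have "(\<integral>\<^sup>+s\<in>{0..T}. ennreal (\<xi> s * ell (\<phi>3 s)) \<partial>lborel) = (\<integral>\<^sup>+s\<in>{0..T}. ennreal (\<xi>' s * ell (\<phi>3 s)) \<partial>lborel)"
    using assms by (intro nn_integral_cong) (auto simp: indicator_def)
  then show ?thesis by (simp add: \<phi> control_cost_def)
qed

lemma mm1m_rate_path_pair:
  assumes "continuous_on {0..T} \<xi>" "continuous_on {0..T} \<zeta>"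
  shows "mm1m_rate lam mu th x0 T (path_pair T \<xi> \<zeta>) = (INF \<phi>\<in>controls lam mu th x0 T \<xi> \<zeta>. control_cost lam mu th T \<xi> \<phi>)"
proof -
  have "continuous_on {0..T} (\<lambda>t. (\<xi> t, \<zeta> t))" by (intro continuous_on_Pair assms)
  then have c: "continuous_on {0..T} (path_pair T \<xi> \<zeta>)"
    by (subst continuous_on_cong[OF refl]) (auto simp: path_pair_def)
  have "controls lam mu th x0 T (\<lambda>t. fst (path_pair T \<xi> \<zeta> t)) (\<lambda>t. snd (path_pair T \<xi> \<zeta> t)) = controls lam mu th x0 T \<xi> \<zeta>"
    by (intro controls_cong) (auto simp: path_pair_def)
  moreover have "control_cost lam mu th T (\<lambda>t. fst (path_pair T \<xi> \<zeta> t)) = control_cost lam mu th T \<xi>"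
    by (intro ext control_cost_cong) (auto simp: path_pair_def)
  ultimately show ?thesis using c by (simp add: mm1m_rate_def Let_def)
qed

lemma ell_dual: "0 \<le> x \<Longrightarrow> b * x - (exp b - 1) \<le> ell x"
  using relent_dual[of x 1 b] by (simp add: relent_def ell_def)

section \<open>The dual cost of an integrated control\<close>

lemma set_integral_Ioc_diff:
  fixes h :: "real \<Rightarrow> real"
  assumes h: "set_integrable lborel {0..T} h" and st: "0 \<le> s" "s \<le> t" "t \<le> T"
  shows "(LINT u:{0..t}|lborel. h u) - (LINT u:{0..s}|lborel. h u) = (LINT u:{s<..t}|lborel. h u)"
proof -
  have "(LINT u:{0..s} \<union> {s<..t}|lborel. h u) = (LINT u:{0..s}|lborel. h u) + (LINT u:{s<..t}|lborel. h u)"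
    using st by (intro set_integral_Un set_integrable_subset[OF h]) auto
  moreover have "{0..s} \<union> {s<..t} = {0..t}" using st by auto
  ultimately show ?thesis by simp
qed

text \<open>The easy half of the duality between control cost and dual cost: the pointwise
  inequality is integrated with a slope that is constant on every cell.\<close>

lemma dual_cost_le_integral:
  fixes h v c :: "real \<Rightarrow> real"
  assumes T: "0 < T" and h: "set_integrable lborel {0..T} h" and v: "set_integrable lborel {0..T} v"
    and dual: "\<And>b t. t \<in> {0..T} \<Longrightarrow> b * h t - (exp b - 1) * v t \<le> c t"
    and C: "(\<integral>\<^sup>+ t\<in>{0..T}. ennreal (c t) \<partial>lborel) \<le> ennreal C" "0 \<le> C"
  shows "dual_cost T (\<lambda>t. LINT u:{0..t}|lborel. h u) (\<lambda>t. LINT u:{0..t}|lborel. v u) q \<beta> \<le> C"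
proof -
  let ?I = "\<lambda>k. {tgrid T q k<..tgrid T q (Suc k)}"
  define G where "G t = (\<Sum>k<2 ^ q. indicator (?I k) t *\<^sub>R (\<beta> k * h t - (exp (\<beta> k) - 1) * v t))" for t
  have sub: "?I k \<subseteq> {0..T}" if "k < 2 ^ q" for k
    using tgrid_mem[OF T, of k q] tgrid_mem[OF T, of "Suc k" q] that by auto
  have ii: "set_integrable lborel (?I k) h" "set_integrable lborel (?I k) v" if "k < 2 ^ q" for k
    using sub[OF that] by (auto intro: set_integrable_subset[OF h] set_integrable_subset[OF v])
  have ig: "set_integrable lborel (?I k) (\<lambda>t. \<beta> k * h t - (exp (\<beta> k) - 1) * v t)" if "k < 2 ^ q" for k
    using ii[OF that] by (intro set_integral_diff set_integrable_mult_right) auto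
  have inc: "incr T (\<lambda>t. LINT u:{0..t}|lborel. w u) q k = (LINT u:?I k|lborel. w u)"
    if "k < 2 ^ q" "set_integrable lborel {0..T} w" for k and w :: "real \<Rightarrow> real"
    unfolding incr_def using that tgrid_mem[OF T, of k q] tgrid_mem[OF T, of "Suc k" q] tgrid_mono[OF T, of k "Suc k" q]
    by (intro set_integral_Ioc_diff) auto
  have "dual_cost T (\<lambda>t. LINT u:{0..t}|lborel. h u) (\<lambda>t. LINT u:{0..t}|lborel. v u) q \<beta> =
      (\<Sum>k<2 ^ q. LINT u:?I k|lborel. \<beta> k * h u - (exp (\<beta> k) - 1) * v u)"
    unfolding dual_cost_def
  proof (intro sum.cong refl)
    fix k :: nat assume "k \<in> {..<2 ^ q}"
    then have k: "k < 2 ^ q" by simp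
    have "(LINT u:?I k|lborel. \<beta> k * h u - (exp (\<beta> k) - 1) * v u) =
        (LINT u:?I k|lborel. \<beta> k * h u) - (LINT u:?I k|lborel. (exp (\<beta> k) - 1) * v u)"
      using ii[OF k] by (intro set_integral_diff set_integrable_mult_right) auto
    then show "\<beta> k * incr T (\<lambda>t. LINT u:{0..t}|lborel. h u) q k - (exp (\<beta> k) - 1) * incr T (\<lambda>t. LINT u:{0..t}|lborel. v u) q k =
        (LINT u:?I k|lborel. \<beta> k * h u - (exp (\<beta> k) - 1) * v u)"
      by (simp add: inc[OF k h] inc[OF k v])
  qed
  also have "\<dots> = (LINT t|lborel. G t)"
    unfolding G_def set_lebesgue_integral_def using ig
    by (intro Bochner_Integration.integral_sum[symmetric]) (auto simp: set_integrable_def)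
  also have "\<dots> \<le> C"
  \<comment> \<open>The integrand \<open>G\<close> may be negative; a bound on the integral of its
    positive part is enough for an upper bound.\<close>
  proof (rule integral_real_bounded[OF C(2)])
    have "(\<integral>\<^sup>+ t. ennreal (G t) \<partial>lborel) \<le> (\<integral>\<^sup>+ t\<in>{0..T}. ennreal (c t) \<partial>lborel)"
    proof (intro nn_integral_mono)
      fix t
      show "ennreal (G t) \<le> ennreal (c t) * indicator {0..T} t"
      proof (cases "\<exists>k<2 ^ q. t \<in> ?I k")
        case True
        then obtain k where k: "k < 2 ^ q" "t \<in> ?I k" by blast
        then have t: "t \<in> {0..T}" using sub by blast
        have uniq: "j = k" if "t \<in> ?I j" for j
        proof (rule ccontr)
          assume "j \<noteq> k"
          then have "Suc j \<le> k \<or> Suc k \<le> j" by auto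
          then show False
            using tgrid_mono[OF T, of "Suc j" k q] tgrid_mono[OF T, of "Suc k" j q] that k by auto
        qed
        have "G t = (\<Sum>j<2 ^ q. if j = k then \<beta> k * h t - (exp (\<beta> k) - 1) * v t else 0)"
          unfolding G_def
        proof (intro sum.cong refl)
          fix j
          show "indicator (?I j) t *\<^sub>R (\<beta> j * h t - (exp (\<beta> j) - 1) * v t) = (if j = k then \<beta> k * h t - (exp (\<beta> k) - 1) * v t else 0)"
          proof (cases "j = k")
            case True then show ?thesis using k(2) by simp
          next
            case False
            then have "t \<notin> ?I j" using uniq by blast
            then show ?thesis using False by (simp only: indicator_simps) simp
          qed
        qed
        also have "\<dots> = \<beta> k * h t - (exp (\<beta> k) - 1) * v t" using k(1) by simp
        also have "\<dots> \<le> c t" by (rule dual[OF t])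
        finally show ?thesis using t by (simp add: ennreal_leI)
      next
        case False
        then have "G t = 0" unfolding G_def by (intro sum.neutral) (auto simp: indicator_def)
        then show ?thesis by simp
      qed
    qed
    then show "(\<integral>\<^sup>+ t. ennreal (G t) \<partial>lborel) \<le> ennreal C" using C(1) by (rule order_trans)
  qed
  finally show ?thesis .
qed

lemma mono_on_set_integral:
  fixes h :: "real \<Rightarrow> real"
  assumes h: "set_integrable lborel {0..T} h" "\<And>t. t \<in> {0..T} \<Longrightarrow> 0 \<le> h t"
  shows "mono_on {0..T} (\<lambda>t. LINT u:{0..t}|lborel. h u)"
proof (rule mono_onI)
  fix s t assume st: "s \<in> {0..T}" "t \<in> {0..T}" "s \<le> t"
  have "0 \<le> (LINT u:{s<..t}|lborel. h u)"
    unfolding set_lebesgue_integral_def using st h(2) by (intro Bochner_Integration.integral_nonneg) (auto simp: indicator_def)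
  then show "(LINT u:{0..s}|lborel. h u) \<le> (LINT u:{0..t}|lborel. h u)"
    using set_integral_Ioc_diff[OF h(1), of s t] st by auto
qed

lemma set_integral_zero_interval: "(LINT u:{0..0::real}|lborel. (h u :: real)) = 0"
  unfolding set_lebesgue_integral_def
  by (rule integral_eq_zero_AE, rule AE_mp[OF AE_lborel_singleton[of 0]]) (auto simp: indicator_def)

text \<open>The converse of \<open>limit_has_control\<close>: a control of finite cost is replaced
  by its integrated paths and a bound on their dual costs, the only form in which it is used
  afterwards, both for the level sets and for the lower bound.\<close>

lemma control_facts:
  assumes pos: "0 < lam" "0 < mu" "0 < th" "0 < T"
    and \<xi>: "continuous_on {0..T} \<xi>" "\<And>t. t \<in> {0..T} \<Longrightarrow> 0 \<le> \<xi> t"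
    and ctl: "\<phi> \<in> controls lam mu th x0 T \<xi> \<zeta>" and cost: "control_cost lam mu th T \<xi> \<phi> \<le> ennreal m" and m: "0 \<le> m"
  obtains a s where "mono_on {0..T} a" "mono_on {0..T} s" "mono_on {0..T} \<zeta>" "a 0 = 0" "s 0 = 0" "\<zeta> 0 = 0"
    "\<And>t. t \<in> {0..T} \<Longrightarrow> \<xi> t = skorohod_map (\<lambda>r. x0 + a r - s r - \<zeta> r) t"
    "\<And>q b1 b2 b3. dual_cost T a (\<lambda>t. lam * t) q b1 + dual_cost T s (\<lambda>t. mu * t) q b2
       + dual_cost T \<zeta> (\<lambda>t. th * integral {0..t} \<xi>) q b3 \<le> m"
proof -
  obtain \<phi>1 \<phi>2 \<phi>3 where \<phi>: "\<phi> = (\<phi>1, \<phi>2, \<phi>3)"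
    and nn: "\<And>t. t \<in> {0..T} \<Longrightarrow> 0 \<le> \<phi>1 t" "\<And>t. t \<in> {0..T} \<Longrightarrow> 0 \<le> \<phi>2 t" "\<And>t. t \<in> {0..T} \<Longrightarrow> 0 \<le> \<phi>3 t"
    and i: "set_integrable lborel {0..T} \<phi>1" "set_integrable lborel {0..T} \<phi>2" "set_integrable lborel {0..T} (\<lambda>s. \<phi>3 s * \<xi> s)"
    and e: "\<And>t. t \<in> {0..T} \<Longrightarrow> \<xi> t = skorohod_map (\<lambda>r. x0 + lam * (LINT s:{0..r}|lborel. \<phi>1 s)
       - mu * (LINT s:{0..r}|lborel. \<phi>2 s) - th * (LINT s:{0..r}|lborel. \<phi>3 s * \<xi> s)) t"
    and ez: "\<And>t. t \<in> {0..T} \<Longrightarrow> \<zeta> t = th * (LINT s:{0..t}|lborel. \<phi>3 s * \<xi> s)"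
    using ctl unfolding controls_def by auto
  define a where "a t = (LINT u:{0..t}|lborel. lam * \<phi>1 u)" for t
  define s where "s t = (LINT u:{0..t}|lborel. mu * \<phi>2 u)" for t
  define z where "z t = (LINT u:{0..t}|lborel. th * (\<phi>3 u * \<xi> u))" for t
  have zz: "\<zeta> t = z t" if "t \<in> {0..T}" for t using ez[OF that] by (simp add: z_def)
  have ints: "set_integrable lborel {0..T} (\<lambda>t. lam * \<phi>1 t)" "set_integrable lborel {0..T} (\<lambda>t. mu * \<phi>2 t)"
    "set_integrable lborel {0..T} (\<lambda>t. th * (\<phi>3 t * \<xi> t))" using i by (auto intro!: set_integrable_mult_right)
  have const: "set_integrable lborel {0..T} (\<lambda>t. c::real)" for c
    by (intro borel_integrable_atLeastAtMost' continuous_intros)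
  have \<xi>i: "set_integrable lborel {0..T} (\<lambda>t. th * \<xi> t)"
    by (intro borel_integrable_atLeastAtMost' continuous_intros \<xi>)
  let ?c1 = "ennreal lam * (\<integral>\<^sup>+s\<in>{0..T}. ennreal (ell (\<phi>1 s)) \<partial>lborel)"
  let ?c2 = "ennreal mu * (\<integral>\<^sup>+s\<in>{0..T}. ennreal (ell (\<phi>2 s)) \<partial>lborel)"
  let ?c3 = "ennreal th * (\<integral>\<^sup>+s\<in>{0..T}. ennreal (\<xi> s * ell (\<phi>3 s)) \<partial>lborel)"
  have c: "?c1 + ?c2 + ?c3 \<le> ennreal m" using cost by (simp add: \<phi> control_cost_def)
  have fin: "?c1 \<noteq> \<infinity>" "?c2 \<noteq> \<infinity>" "?c3 \<noteq> \<infinity>"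
    using c by (auto simp: top_unique)
  have sumC: "enn2real ?c1 + enn2real ?c2 + enn2real ?c3 \<le> m"
  proof -
    have "ennreal (enn2real ?c1 + enn2real ?c2 + enn2real ?c3) = ?c1 + ?c2 + ?c3"
      using fin by (simp add: ennreal_plus less_top)
    also have "\<dots> \<le> ennreal m" by (rule c)
    finally show ?thesis using m by (simp only: ennreal_le_iff)
  qed
  have scale: "(\<integral>\<^sup>+ t\<in>{0..T}. ennreal (l * r t) \<partial>lborel) = ennreal l * (\<integral>\<^sup>+ t\<in>{0..T}. ennreal (r t) \<partial>lborel)"
    if l: "0 < l" and r: "(\<lambda>t. r t * indicator {0..T} t) \<in> borel_measurable lborel" for l and r :: "real \<Rightarrow> real"
  proof -
    have "(\<lambda>t. ennreal (r t) * indicator {0..T} t) \<in> borel_measurable lborel"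
      using measurable_compose[OF r measurable_ennreal] by (rule measurable_cong[THEN iffD1, rotated]) (auto simp: indicator_def)
    then show ?thesis using l by (subst nn_integral_cmult[symmetric]) (auto simp: ennreal_mult' mult.assoc)
  qed
  have ms: "\<phi> \<in> borel_measurable (restrict_space borel {0..T})" if "\<phi> \<in> {\<phi>1, \<phi>2, \<phi>3}" for \<phi>
    using ctl that unfolding \<phi> controls_def by auto
  have meas: "(\<lambda>t. v t * ell (r t) * indicator {0..T} t) \<in> borel_measurable lborel"
    if r: "r \<in> borel_measurable (restrict_space borel {0..T})" and v: "v \<in> borel_measurable (restrict_space borel {0..T})" for v r :: "real \<Rightarrow> real"
  proof -
    have "(\<lambda>t. v t * ell (r t)) \<in> borel_measurable (restrict_space borel {0..T})"
      using r v unfolding ell_def by measurable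
    then show ?thesis by (subst (asm) borel_measurable_restrict_space_iff) (auto simp: mult.commute)
  qed
  have d1: "dual_cost T a (\<lambda>t. LINT u:{0..t}|lborel. lam) q b \<le> enn2real ?c1" for q b
    unfolding a_def
  proof (rule dual_cost_le_integral[OF pos(4) ints(1) const])
    fix b t assume t: "t \<in> {0..T}"
    have "lam * (b * \<phi>1 t - (exp b - 1)) \<le> lam * ell (\<phi>1 t)" using nn(1)[OF t] pos by (intro mult_left_mono ell_dual) auto
    then show "b * (lam * \<phi>1 t) - (exp b - 1) * lam \<le> lam * ell (\<phi>1 t)" by (simp add: algebra_simps)
  next
    show "(\<integral>\<^sup>+ t\<in>{0..T}. ennreal (lam * ell (\<phi>1 t)) \<partial>lborel) \<le> ennreal (enn2real ?c1)"
      using fin(1) meas[OF ms, of \<phi>1 "\<lambda>_. 1"] by (subst scale) (auto simp: pos less_top)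
  qed simp
  have d2: "dual_cost T s (\<lambda>t. LINT u:{0..t}|lborel. mu) q b \<le> enn2real ?c2" for q b
    unfolding s_def
  proof (rule dual_cost_le_integral[OF pos(4) ints(2) const])
    fix b t assume t: "t \<in> {0..T}"
    have "mu * (b * \<phi>2 t - (exp b - 1)) \<le> mu * ell (\<phi>2 t)" using nn(2)[OF t] pos by (intro mult_left_mono ell_dual) auto
    then show "b * (mu * \<phi>2 t) - (exp b - 1) * mu \<le> mu * ell (\<phi>2 t)" by (simp add: algebra_simps)
  next
    show "(\<integral>\<^sup>+ t\<in>{0..T}. ennreal (mu * ell (\<phi>2 t)) \<partial>lborel) \<le> ennreal (enn2real ?c2)"
      using fin(2) meas[OF ms, of \<phi>2 "\<lambda>_. 1"] by (subst scale) (auto simp: pos less_top)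
  qed simp
  have d3: "dual_cost T z (\<lambda>t. LINT u:{0..t}|lborel. th * \<xi> u) q b \<le> enn2real ?c3" for q b
    unfolding z_def
  proof (rule dual_cost_le_integral[OF pos(4) ints(3) \<xi>i])
    fix b t assume t: "t \<in> {0..T}"
    have "(th * \<xi> t) * (b * \<phi>3 t - (exp b - 1)) \<le> (th * \<xi> t) * ell (\<phi>3 t)"
      using nn(3)[OF t] \<xi>(2)[OF t] pos by (intro mult_left_mono ell_dual) auto
    then show "b * (th * (\<phi>3 t * \<xi> t)) - (exp b - 1) * (th * \<xi> t) \<le> th * (\<xi> t * ell (\<phi>3 t))" by (simp add: algebra_simps)
  next
    have "\<xi> \<in> borel_measurable (restrict_space borel {0..T})" by (rule borel_measurable_continuous_on_restrict[OF \<xi>(1)])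
    then show "(\<integral>\<^sup>+ t\<in>{0..T}. ennreal (th * (\<xi> t * ell (\<phi>3 t))) \<partial>lborel) \<le> ennreal (enn2real ?c3)"
      using fin(3) meas[OF ms, of \<phi>3 \<xi>] by (subst scale) (auto simp: pos less_top)
  qed simp
  have dc: "dual_cost T a1 W1 q b = dual_cost T a2 W2 q b"
    if "\<And>t. t \<in> {0..T} \<Longrightarrow> a1 t = a2 t" "\<And>t. t \<in> {0..T} \<Longrightarrow> W1 t = W2 t" for a1 a2 W1 W2 q b
    unfolding dual_cost_def incr_def using that tgrid_mem[OF pos(4)] by (intro sum.cong) auto
  have lint: "(LINT u:{0..t}|lborel. c) = c * t" if "t \<in> {0..T}" for c t :: real
    using that by (simp add: set_lebesgue_integral_def)
  have xint: "(LINT u:{0..t}|lborel. th * \<xi> u) = th * integral {0..t} \<xi>" if "t \<in> {0..T}" for t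
  proof -
    have "set_integrable lborel {0..t} \<xi>"
      using that by (intro borel_integrable_atLeastAtMost' continuous_on_subset[OF \<xi>(1)]) auto
    then show ?thesis by (simp add: set_borel_integral_eq_integral(2))
  qed
  show thesis
  proof (rule that)
    show "mono_on {0..T} a" unfolding a_def using nn pos by (intro mono_on_set_integral ints) auto
    show "mono_on {0..T} s" unfolding s_def using nn pos by (intro mono_on_set_integral ints) auto
    have "mono_on {0..T} z" unfolding z_def using nn \<xi>(2) pos by (intro mono_on_set_integral ints) auto
    then show "mono_on {0..T} \<zeta>" using zz by (simp add: mono_on_def)
    show "a 0 = 0" "s 0 = 0" unfolding a_def s_def by (rule set_integral_zero_interval)+
    have "z 0 = 0" unfolding z_def by (rule set_integral_zero_interval)
    then show "\<zeta> 0 = 0" using zz[of 0] pos by simp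
    show "\<xi> t = skorohod_map (\<lambda>r. x0 + a r - s r - \<zeta> r) t" if t: "t \<in> {0..T}" for t
    proof -
      have "skorohod_map (\<lambda>r. x0 + lam * (LINT s:{0..r}|lborel. \<phi>1 s)
       - mu * (LINT s:{0..r}|lborel. \<phi>2 s) - th * (LINT s:{0..r}|lborel. \<phi>3 s * \<xi> s)) t = skorohod_map (\<lambda>r. x0 + a r - s r - \<zeta> r) t"
        using t zz by (intro skorohod_map_cong) (auto simp: a_def s_def z_def)
      then show ?thesis using e[OF t] by simp
    qed
    show "dual_cost T a (\<lambda>t. lam * t) q b1 + dual_cost T s (\<lambda>t. mu * t) q b2
       + dual_cost T \<zeta> (\<lambda>t. th * integral {0..t} \<xi>) q b3 \<le> m" for q b1 b2 b3
    proof -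
      have "dual_cost T a (\<lambda>t. lam * t) q b1 = dual_cost T a (\<lambda>t. LINT u:{0..t}|lborel. lam) q b1"
        by (intro dc refl) (simp only: lint)
      moreover have "dual_cost T s (\<lambda>t. mu * t) q b2 = dual_cost T s (\<lambda>t. LINT u:{0..t}|lborel. mu) q b2"
        by (intro dc refl) (simp only: lint)
      moreover have "dual_cost T \<zeta> (\<lambda>t. th * integral {0..t} \<xi>) q b3 = dual_cost T z (\<lambda>t. LINT u:{0..t}|lborel. th * \<xi> u) q b3"
        by (intro dc) (simp_all only: xint zz)
      ultimately show ?thesis using d1[of q b1] d2[of q b2] d3[of q b3] sumC by linarith
    qed
  qed
qed

section \<open>Compactness of the level sets\<close>

text \<open>The slack \<open>e\<close> is there because the infimum that defines the rate is not yet
  known to be attained.\<close>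

lemma rate_le_imp_control:
  assumes z: "z \<in> cadlag_space T ({0..} \<times> {0..})" and le: "mm1m_rate lam mu th x0 T z \<le> ennreal m" and m: "0 \<le> m" and e: "0 < e"
  shows "continuous_on {0..T} (\<lambda>t. fst (z t))" "continuous_on {0..T} (\<lambda>t. snd (z t))"
    "\<And>t. t \<in> {0..T} \<Longrightarrow> 0 \<le> fst (z t)" 
    "\<exists>\<phi>\<in>controls lam mu th x0 T (\<lambda>t. fst (z t)) (\<lambda>t. snd (z t)). control_cost lam mu th T (\<lambda>t. fst (z t)) \<phi> \<le> ennreal (m + e)"
proof -
  have c: "continuous_on {0..T} z"
    using le by (auto simp: mm1m_rate_def Let_def top_unique split: if_splits)
  then show "continuous_on {0..T} (\<lambda>t. fst (z t))" "continuous_on {0..T} (\<lambda>t. snd (z t))"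
    by (auto intro: continuous_on_fst continuous_on_snd)
  have "z \<in> {0..T} \<rightarrow>\<^sub>E {0..} \<times> {0..}" using z by (simp add: cadlag_space_def)
  from PiE_mem[OF this] show "0 \<le> fst (z t)" if "t \<in> {0..T}" for t using that by fastforce
  have "(INF \<phi>\<in>controls lam mu th x0 T (\<lambda>t. fst (z t)) (\<lambda>t. snd (z t)). control_cost lam mu th T (\<lambda>t. fst (z t)) \<phi>) < ennreal (m + e)"
  proof -
    have "ennreal m < ennreal (m + e)" using m e by (simp add: ennreal_less_iff)
    then show ?thesis using le c by (simp add: mm1m_rate_def Let_def)
  qed
  then show "\<exists>\<phi>\<in>controls lam mu th x0 T (\<lambda>t. fst (z t)) (\<lambda>t. snd (z t)). control_cost lam mu th T (\<lambda>t. fst (z t)) \<phi> \<le> ennreal (m + e)"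
    unfolding INF_less_iff by (auto intro: less_imp_le)
qed

text \<open>Uniform convergence implies Skorohod convergence by the identity time change. The
  approximating paths may jump, so the lemma also applies to the queueing processes.\<close>

lemma rate_limit:
  fixes Z :: "nat \<Rightarrow> real \<Rightarrow> real \<times> real"
  assumes T: "0 < T" and Z: "\<And>p. Z p \<in> cadlag_space T ({0..} \<times> {0..})"
    and c: "continuous_on {0..T} \<xi>" "continuous_on {0..T} \<zeta>"
    and u: "uniform_limit {0..T} (\<lambda>i t. fst (Z i t)) \<xi> sequentially" "uniform_limit {0..T} (\<lambda>i t. snd (Z i t)) \<zeta> sequentially"
    and nn: "\<And>t. t \<in> {0..T} \<Longrightarrow> 0 \<le> \<xi> t" "\<And>t. t \<in> {0..T} \<Longrightarrow> 0 \<le> \<zeta> t"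
  shows "limitin (skorohod_topology T ({0..} \<times> {0..})) Z (path_pair T \<xi> \<zeta>) sequentially"
proof -
  interpret S: Metric_space "cadlag_space T ({0..} \<times> {0..} :: (real \<times> real) set)" "skorohod_dist T"
    using T by (intro Metric_space_skorohod) simp
  show ?thesis
    unfolding skorohod_topology_def S.limitin_metric
  proof (intro conjI allI impI)
    show "path_pair T \<xi> \<zeta> \<in> cadlag_space T ({0..} \<times> {0..})" by (intro path_pair_cadlag T c nn)
    fix e :: real assume e: "0 < e"
    have "\<forall>\<^sub>F i in sequentially. \<forall>t\<in>{0..T}. dist (fst (Z i t)) (\<xi> t) < e / 4" using e by (intro uniform_limitD[OF u(1)]) auto
    moreover have "\<forall>\<^sub>F i in sequentially. \<forall>t\<in>{0..T}. dist (snd (Z i t)) (\<zeta> t) < e / 4" using e by (intro uniform_limitD[OF u(2)]) auto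
    ultimately show "\<forall>\<^sub>F i in sequentially. Z i \<in> cadlag_space T ({0..} \<times> {0..}) \<and> skorohod_dist T (Z i) (path_pair T \<xi> \<zeta>) < e"
    proof eventually_elim
      case (elim i)
      have "skorohod_dist T (Z i) (path_pair T \<xi> \<zeta>) \<le> e / 2"
      proof (rule skorohod_dist_le)
        fix t assume t: "t \<in> {0..T}"
        have "dist (fst (Z i t), snd (Z i t)) (\<xi> t, \<zeta> t) \<le> \<bar>fst (Z i t) - \<xi> t\<bar> + \<bar>snd (Z i t) - \<zeta> t\<bar>" by (rule dist_pair_le)
        also have "\<dots> \<le> e / 2" using elim(1)[rule_format, OF t] elim(2)[rule_format, OF t] unfolding dist_real_def by linarith
        finally show "dist (Z i t) (path_pair T \<xi> \<zeta> t) \<le> e / 2" using t by (simp add: path_pair_def)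
      qed (use e in auto)
      then show ?case using Z e by simp
    qed
  qed
qed

text \<open>Sequential compactness. A sequence in the level set is given controls with slack
  \<open>e p\<close> tending to 0, and \<open>limit_has_control\<close> produces a limit whose cost
  is at most \<open>m\<close> without slack.\<close>

lemma rate_function_mm1m:
  assumes pos: "0 < lam" "0 < mu" "0 < th" "0 < T" "0 \<le> x0"
  shows "rate_function (skorohod_topology T ({0..} \<times> {0..})) (mm1m_rate lam mu th x0 T)"
  unfolding rate_function_def
proof (intro allI impI)
  fix M :: ennreal assume M: "M < \<infinity>"
  interpret S: Metric_space "cadlag_space T ({0..} \<times> {0..} :: (real \<times> real) set)" "skorohod_dist T"
    using pos by (intro Metric_space_skorohod) simp
  define m where "m = enn2real M"
  have m: "M = ennreal m" "0 \<le> m" using M by (auto simp: m_def)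
  let ?L = "{z \<in> topspace (skorohod_topology T ({0..} \<times> {0..})). mm1m_rate lam mu th x0 T z \<le> M}"
  have top: "topspace (skorohod_topology T ({0..} \<times> {0..} :: (real \<times> real) set)) = cadlag_space T ({0..} \<times> {0..})"
    by (simp add: skorohod_topology_def)
  have "compactin S.mtopology ?L"
    unfolding S.compactin_sequentially
  proof (intro conjI allI impI)
    show "?L \<subseteq> cadlag_space T ({0..} \<times> {0..})" by (auto simp: top)
    fix \<sigma> :: "nat \<Rightarrow> real \<Rightarrow> real \<times> real" assume "range \<sigma> \<subseteq> ?L"
    then have \<sigma>: "\<sigma> p \<in> cadlag_space T ({0..} \<times> {0..})" "mm1m_rate lam mu th x0 T (\<sigma> p) \<le> ennreal m" for p
      by (auto simp: top m)
    define X where "X p t = fst (\<sigma> p t)" for p t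
    define Y where "Y p t = snd (\<sigma> p t)" for p t
    define e where "e p = 1 / (real p + 1)" for p
    have e: "0 < e p" for p by (simp add: e_def)
    have elim: "e \<longlonglongrightarrow> 0" unfolding e_def by real_asymp
    have cX: "continuous_on {0..T} (X p)" "continuous_on {0..T} (Y p)" and nnX: "\<And>t. t \<in> {0..T} \<Longrightarrow> 0 \<le> X p t" for p
      unfolding X_def Y_def using rate_le_imp_control(1-3)[OF \<sigma> m(2) zero_less_one] by blast+
    define good where "good p a s \<longleftrightarrow> mono_on {0..T} a \<and> mono_on {0..T} s \<and> mono_on {0..T} (Y p) \<and> a 0 = 0 \<and> s 0 = 0 \<and> Y p 0 = 0 \<and>
      (\<forall>t\<in>{0..T}. X p t = skorohod_map (\<lambda>r. x0 + a r - s r - Y p r) t) \<and>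
      (\<forall>q b1 b2 b3. dual_cost T a (\<lambda>t. lam * t) q b1 + dual_cost T s (\<lambda>t. mu * t) q b2
       + dual_cost T (Y p) (\<lambda>t. th * integral {0..t} (X p)) q b3 \<le> m + e p)" for p a s
    have "\<exists>a s. good p a s" for p
    proof -
      obtain \<phi> where \<phi>: "\<phi> \<in> controls lam mu th x0 T (X p) (Y p)" "control_cost lam mu th T (X p) \<phi> \<le> ennreal (m + e p)"
        unfolding X_def Y_def using rate_le_imp_control(4)[OF \<sigma> m(2) e] by blast
      show ?thesis unfolding good_def
        by (rule control_facts[OF pos(1-4) cX(1) nnX \<phi>]) (use m e[of p] in \<open>auto intro: add_nonneg_nonneg less_imp_le\<close>)
    qed
    then obtain A S where good: "\<And>p. good p (A p) (S p)" by metis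
    have AS: "mono_on {0..T} (A p) \<and> mono_on {0..T} (S p) \<and> mono_on {0..T} (Y p) \<and> A p 0 = 0 \<and> S p 0 = 0 \<and> Y p 0 = 0 \<and>
      (\<forall>t\<in>{0..T}. X p t = skorohod_map (\<lambda>r. x0 + A p r - S p r - Y p r) t) \<and>
      (\<forall>q b1 b2 b3. dual_cost T (A p) (\<lambda>t. lam * t) q b1 + dual_cost T (S p) (\<lambda>t. mu * t) q b2
       + dual_cost T (Y p) (\<lambda>t. th * integral {0..t} (X p)) q b3 \<le> m + e p)" for p
      using good[of p] unfolding good_def .
    define w where "w p q k = incr T (\<lambda>t. th * integral {0..t} (X p)) q k" for p q k
    have w: "w p q k = th * integral {tgrid T q k..tgrid T q (Suc k)} (X p)" if k: "k < 2 ^ q" for p q k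
    proof -
      have l: "tgrid T q k \<in> {0..T}" "tgrid T q (Suc k) \<in> {0..T}" "tgrid T q k \<le> tgrid T q (Suc k)"
        using tgrid_mem[OF pos(4)] tgrid_mono[OF pos(4)] k by auto
      have "X p integrable_on {0..tgrid T q (Suc k)}"
        using l by (intro integrable_continuous_real continuous_on_subset[OF cX(1)]) auto
      then have "integral {0..tgrid T q k} (X p) + integral {tgrid T q k..tgrid T q (Suc k)} (X p) = integral {0..tgrid T q (Suc k)} (X p)"
        using l by (intro Henstock_Kurzweil_Integration.integral_combine) auto
      then show ?thesis unfolding w_def incr_def by (simp add: right_diff_distrib[symmetric])
    qed
    \<comment> \<open>The reflection and the weights are exact here; only the cost bound requires
      \<open>p\<close> to be large.\<close>
    interpret E: entropy_bounded lam mu th x0 T m A S Y X "\<lambda>p q k. incr T (Y p) q k" w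
    proof
      show "\<forall>\<^sub>F p in sequentially. \<forall>t\<in>{0..T}. \<bar>X p t - skorohod_map (\<lambda>r. x0 + A p r - S p r - Y p r) t\<bar> \<le> d" if d: "0 < d" for d
      proof (intro always_eventually allI ballI)
        fix p t assume "t \<in> {0..T}"
        then have "X p t = skorohod_map (\<lambda>r. x0 + A p r - S p r - Y p r) t" using AS by blast
        then show "\<bar>X p t - skorohod_map (\<lambda>r. x0 + A p r - S p r - Y p r) t\<bar> \<le> d" using d by simp
      qed
      show "\<forall>\<^sub>F p in sequentially. \<forall>b1 b2 b3. dual_cost T (A p) (\<lambda>t. lam * t) q b1 + dual_cost T (S p) (\<lambda>t. mu * t) q b2
         + (\<Sum>k<2 ^ q. b3 k * incr T (Y p) q k - (exp (b3 k) - 1) * w p q k) \<le> m + d" if d: "0 < d" for q d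
      proof -
        have "\<forall>\<^sub>F p in sequentially. e p < d" using elim d by (rule order_tendstoD)
        then show ?thesis
        proof eventually_elim
          case (elim p)
          show ?case
          proof (intro allI)
            fix b1 b2 b3
            have "dual_cost T (A p) (\<lambda>t. lam * t) q b1 + dual_cost T (S p) (\<lambda>t. mu * t) q b2
               + dual_cost T (Y p) (\<lambda>t. th * integral {0..t} (X p)) q b3 \<le> m + e p" using AS by blast
            then show "dual_cost T (A p) (\<lambda>t. lam * t) q b1 + dual_cost T (S p) (\<lambda>t. mu * t) q b2
               + (\<Sum>k<2 ^ q. b3 k * incr T (Y p) q k - (exp (b3 k) - 1) * w p q k) \<le> m + d"
              using elim by (simp add: dual_cost_def w_def)
          qed
        qed
      qed
      show "\<forall>\<^sub>F p in sequentially. \<forall>g d'. continuous_on {0..T} g \<longrightarrow> (\<forall>t\<in>{0..T}. \<bar>X p t - g t\<bar> \<le> d') \<longrightarrow>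
         \<bar>w p q k - th * integral {tgrid T q k..tgrid T q (Suc k)} g\<bar> \<le> th * (T / 2 ^ q) * d' + d" if k: "k < 2 ^ q" and d: "0 < d" for q k d
      proof (intro always_eventually allI impI)
        fix p g d' assume g: "continuous_on {0..T} g" "\<forall>t\<in>{0..T}. \<bar>X p t - g t\<bar> \<le> d'"
        let ?I = "{tgrid T q k..tgrid T q (Suc k)}"
        have l: "?I \<subseteq> {0..T}" "tgrid T q k \<le> tgrid T q (Suc k)"
          using tgrid_mem[OF pos(4), of k q] tgrid_mem[OF pos(4), of "Suc k" q] tgrid_mono[OF pos(4)] k by auto
        have "norm (integral ?I (\<lambda>t. X p t - g t)) \<le> integral ?I (\<lambda>_. d')"
          using l g by (intro integral_norm_bound_integral integrable_continuous_real continuous_intros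
              continuous_on_subset[OF cX(1)] continuous_on_subset[OF g(1)]) auto
        moreover have "integral ?I (\<lambda>t. X p t - g t) = integral ?I (X p) - integral ?I g"
          using l by (intro Henstock_Kurzweil_Integration.integral_diff integrable_continuous_real
              continuous_on_subset[OF cX(1)] continuous_on_subset[OF g(1)])
        moreover have "integral ?I (\<lambda>_. d') = (T / 2 ^ q) * d'" using l by (simp add: tgrid_Suc)
        ultimately have "th * \<bar>integral ?I (X p) - integral ?I g\<bar> \<le> th * ((T / 2 ^ q) * d')"
          using pos by (intro mult_left_mono) auto
        moreover have "th * \<bar>integral ?I (X p) - integral ?I g\<bar> = \<bar>w p q k - th * integral ?I g\<bar>"
          using pos by (simp add: w[OF k] right_diff_distrib[symmetric] abs_mult)
        ultimately show "\<bar>w p q k - th * integral ?I g\<bar> \<le> th * (T / 2 ^ q) * d' + d" using d by (simp only: mult.assoc)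
      qed
    qed (use pos m AS in auto)
    obtain r \<xi> \<zeta> where r: "strict_mono r" and lim: "continuous_on {0..T} \<xi>" "continuous_on {0..T} \<zeta>"
      "uniform_limit {0..T} (\<lambda>i. X (r i)) \<xi> sequentially" "uniform_limit {0..T} (\<lambda>i. Y (r i)) \<zeta> sequentially"
      "\<And>t. t \<in> {0..T} \<Longrightarrow> 0 \<le> \<xi> t" "\<And>t. t \<in> {0..T} \<Longrightarrow> 0 \<le> \<zeta> t"
      "\<exists>\<phi>\<in>controls lam mu th x0 T \<xi> \<zeta>. control_cost lam mu th T \<xi> \<phi> \<le> ennreal m"
      by (rule E.limit_has_control) blast
    have "limitin S.mtopology (\<lambda>i. \<sigma> (r i)) (path_pair T \<xi> \<zeta>) sequentially"
      using rate_limit[OF pos(4), of "\<lambda>i. \<sigma> (r i)" \<xi> \<zeta>] \<sigma> lim unfolding X_def[abs_def] Y_def[abs_def] skorohod_topology_def by blast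
    moreover have "path_pair T \<xi> \<zeta> \<in> ?L"
      using lim path_pair_cadlag[OF pos(4) lim(1,2,5,6)]
      by (auto simp: top m mm1m_rate_path_pair intro: INF_lower2)
    ultimately show "\<exists>l r. l \<in> ?L \<and> strict_mono r \<and> limitin S.mtopology (\<sigma> \<circ> r) l sequentially"
      using r unfolding o_def by blast
  qed
  then show "compactin (skorohod_topology T ({0..} \<times> {0..})) ?L" by (simp add: skorohod_topology_def)
qed

section \<open>Counting on a dyadic space-time grid\<close>

text \<open>Left open, since the increment of a path that counts points of \<open>[0, t]\<close>
  counts the points of a left-open interval. Time 0 carries no points.\<close>

definition time_cell :: "real \<Rightarrow> nat \<Rightarrow> nat \<Rightarrow> real set" where
  "time_cell T p k = {tgrid T p k<..tgrid T p (Suc k)}"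

text \<open>Left closed, so that the cells cover the mark 0 as well.\<close>

definition mark_cell :: "nat \<Rightarrow> nat \<Rightarrow> real set" where
  "mark_cell p i = {real i / 2 ^ p..<real (Suc i) / 2 ^ p}"

lemma time_cell_subset: "0 < T \<Longrightarrow> k < 2 ^ p \<Longrightarrow> time_cell T p k \<subseteq> {0..T}"
  using tgrid_mem[of T k p] tgrid_mem[of T "Suc k" p] by (auto simp: time_cell_def)

lemma time_cell_disjoint: "0 < T \<Longrightarrow> j \<noteq> k \<Longrightarrow> time_cell T p j \<inter> time_cell T p k = {}"
proof -
  assume T: "0 < T" and "j \<noteq> k"
  then have "Suc j \<le> k \<or> Suc k \<le> j" by auto
  then show ?thesis using tgrid_mono[OF T, of "Suc j" k p] tgrid_mono[OF T, of "Suc k" j p] by (auto simp: time_cell_def)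
qed

lemma mark_cell_disjoint: "i \<noteq> j \<Longrightarrow> mark_cell p i \<inter> mark_cell p j = {}"
proof -
  assume "i \<noteq> j"
  then have "Suc i \<le> j \<or> Suc j \<le> i" by auto
  then have "real (Suc i) / 2 ^ p \<le> real j / 2 ^ p \<or> real (Suc j) / 2 ^ p \<le> real i / 2 ^ p"
    by (metis divide_right_mono of_nat_le_iff zero_le_numeral zero_le_power)
  then show ?thesis by (auto simp: mark_cell_def)
qed

lemma mark_cellE:
  assumes "0 \<le> y" obtains i where "y \<in> mark_cell p i"
proof -
  define i where "i = nat \<lfloor>y * 2 ^ p\<rfloor>"
  have "0 \<le> y * 2 ^ p" using assms by simp
  then have "real i \<le> y * 2 ^ p" "y * 2 ^ p < real i + 1" unfolding i_def by linarith+
  then have "y \<in> mark_cell p i" by (simp add: mark_cell_def field_simps)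
  then show thesis by (rule that)
qed

section \<open>Entropy estimates for one realisation of the queue\<close>

lemma relent_dual':
  assumes "0 \<le> x" "0 < w"
  shows "b * x - (exp b - 1) * w \<le> relent x w"
  using relent_dual[of x w b] assms by (simp add: mult.commute)

text \<open>One parameter \<open>p\<close> fixes the time mesh \<open>T / 2 ^ p\<close>, the mark
  mesh \<open>1 / 2 ^ p\<close> and the height \<open>p\<close> of the mark grid. The height must
  exceed the a priori bound \<open>B\<close> on the queue, and it grows slowly enough for
  \<open>p / 2 ^ p\<close> to vanish.\<close>

locale good_path = queue_path +
  fixes lam mu th m B :: real and p :: nat
  assumes pos: "0 < lam" "0 < mu" "0 < th" 
    and B: "xn + m + 2 * lam * T \<le> B" "B + 1 \<le> real p"
    and fin3: "\<And>k i. k < 2 ^ p \<Longrightarrow> i < p * 2 ^ p \<Longrightarrow> emeasure \<nu>3 (time_cell T p k \<times> mark_cell p i) < \<infinity>"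
    and cost_less: "(\<Sum>k<2 ^ p. relent (measure \<nu>1 (time_cell T p k) / n) (lam * (T / 2 ^ p)))
       + (\<Sum>k<2 ^ p. relent (measure \<nu>2 (time_cell T p k) / n) (mu * (T / 2 ^ p)))
       + (\<Sum>k<2 ^ p. \<Sum>i<p * 2 ^ p. relent (measure \<nu>3 (time_cell T p k \<times> mark_cell p i) / n) (th * (T / 2 ^ p) / 2 ^ p)) < m"
begin

definition "K k i = measure \<nu>3 (time_cell T p k \<times> mark_cell p i) / n"
definition "V1 = (\<Sum>k<2 ^ p. relent (measure \<nu>1 (time_cell T p k) / n) (lam * (T / 2 ^ p)))"
definition "V2 = (\<Sum>k<2 ^ p. relent (measure \<nu>2 (time_cell T p k) / n) (mu * (T / 2 ^ p)))"
definition "V3 = (\<Sum>k<2 ^ p. \<Sum>i<p * 2 ^ p. relent (K k i) (th * (T / 2 ^ p) / 2 ^ p))"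

lemma V_less: "V1 + V2 + V3 < m" using cost_less by (simp add: V1_def V2_def V3_def K_def)

lemma K_nonneg: "0 \<le> K k i" by (simp add: K_def)

lemma V_nonneg: "0 \<le> V1" "0 \<le> V2" "0 \<le> V3"
  unfolding V1_def V2_def V3_def using pos T K_nonneg by (auto intro!: sum_nonneg relent_nonneg)

lemma grid: "k < 2 ^ p \<Longrightarrow> tgrid T p k \<in> {0..T} \<and> tgrid T p (Suc k) \<in> {0..T} \<and> tgrid T p k \<le> tgrid T p (Suc k)"
  using tgrid_mem[OF T] tgrid_mono[OF T] by auto

lemma incr_arr: "k < 2 ^ p \<Longrightarrow> incr T arr p k = measure \<nu>1 (time_cell T p k) / n"
  unfolding incr_def time_cell_def using grid[of k] by (intro arr_diff) auto

lemma incr_srv: "k < 2 ^ p \<Longrightarrow> incr T srv p k = measure \<nu>2 (time_cell T p k) / n"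
  unfolding incr_def time_cell_def using grid[of k] by (intro srv_diff) auto

lemma incr_linear: "incr T (\<lambda>t. v * t) q k = v * (T / 2 ^ q)"
  by (simp add: incr_def tgrid_Suc right_diff_distrib[symmetric])

text \<open>The test vector is copied to the finest level \<open>p\<close>, where
  \<open>relent_dual'\<close> is applied cell by cell.\<close>

lemma dual_arr: assumes "q \<le> p" shows "dual_cost T arr (\<lambda>t. lam * t) q b \<le> V1"
proof -
  obtain d where d: "p = q + d" using assms le_Suc_ex by blast
  have "dual_cost T arr (\<lambda>t. lam * t) q b = dual_cost T arr (\<lambda>t. lam * t) p (\<lambda>j. b (j div 2 ^ d))"
    unfolding d dual_cost_refine ..
  also have "\<dots> \<le> V1"
    unfolding dual_cost_def V1_def
  proof (intro sum_mono)
    fix k :: nat assume "k \<in> {..<2 ^ p}"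
    then have k: "k < 2 ^ p" by simp
    show "b (k div 2 ^ d) * incr T arr p k - (exp (b (k div 2 ^ d)) - 1) * incr T (\<lambda>t. lam * t) p k
       \<le> relent (measure \<nu>1 (time_cell T p k) / n) (lam * (T / 2 ^ p))"
      unfolding incr_linear incr_arr[OF k] using pos T by (intro relent_dual') auto
  qed
  finally show ?thesis .
qed

lemma dual_srv: assumes "q \<le> p" shows "dual_cost T srv (\<lambda>t. mu * t) q b \<le> V2"
proof -
  obtain d where d: "p = q + d" using assms le_Suc_ex by blast
  have "dual_cost T srv (\<lambda>t. mu * t) q b = dual_cost T srv (\<lambda>t. mu * t) p (\<lambda>j. b (j div 2 ^ d))"
    unfolding d dual_cost_refine ..
  also have "\<dots> \<le> V2"
    unfolding dual_cost_def V2_def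
  proof (intro sum_mono)
    fix k :: nat assume "k \<in> {..<2 ^ p}"
    then have k: "k < 2 ^ p" by simp
    show "b (k div 2 ^ d) * incr T srv p k - (exp (b (k div 2 ^ d)) - 1) * incr T (\<lambda>t. mu * t) p k
       \<le> relent (measure \<nu>2 (time_cell T p k) / n) (mu * (T / 2 ^ p))"
      unfolding incr_linear incr_srv[OF k] using pos T by (intro relent_dual') auto
  qed
  finally show ?thesis .
qed

text \<open>Slope 1 on the single cell of level 0 bounds the arrivals by
  \<open>m + 2 * lam * T\<close>, and the queue is at most its initial value plus the
  arrivals.\<close>

lemma f_bound: assumes t: "t \<in> {0..T}" shows "f t \<le> B"
proof -
  have "dual_cost T arr (\<lambda>t. lam * t) 0 (\<lambda>_. 1) = arr T - arr 0 - (exp 1 - 1) * (lam * T)"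
    by (simp add: dual_cost_def incr_linear) (simp add: incr_def tgrid_def)
  then have "arr T - (exp 1 - 1) * (lam * T) \<le> V1" using dual_arr[of 0 "\<lambda>_. 1"] at_0 by simp
  moreover have "(exp 1 - 1) * (lam * T) \<le> 2 * (lam * T)" using exp_le pos T by (intro mult_right_mono) auto
  ultimately have "arr T \<le> m + 2 * lam * T" using V_less V_nonneg by simp
  moreover have "arr t \<le> arr T" using t by (intro mono_onD[OF arr_mono]) auto
  ultimately show ?thesis using f_le[OF t] B by simp
qed

lemma level_bound: assumes t: "t \<in> {0<..T}" shows "level t \<le> B"
proof -
  have "0 \<le> B" using f_bound[of 0] f_nonneg[of 0] T by simp
  moreover have "left_limit f t \<le> B"
    using t f_bound f_nonneg by (intro left_limit_bounds(2)[of t 0 0]) auto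
  moreover have "0 \<le> 1 / real n" by simp
  ultimately show ?thesis unfolding level_def by (intro max.boundedI) linarith+
qed

definition slab where "slab k = {(s, y). s \<in> time_cell T p k \<and> 0 \<le> y \<and> y \<le> level s}"

lemma slab_eq: "k < 2 ^ p \<Longrightarrow> slab k = region (tgrid T p (Suc k)) - region (tgrid T p k)"
  using grid[of k] by (auto simp: slab_def region_def time_cell_def)

text \<open>The level stays below \<open>B\<close>, hence below the top of the mark grid, so the
  grid misses no mark that counts.\<close>

lemma slab_subset: 
  assumes k: "k < 2 ^ p" and U: "\<And>s y i. s \<in> time_cell T p k \<Longrightarrow> 0 \<le> y \<Longrightarrow> y \<le> level s \<Longrightarrow> y \<in> mark_cell p i \<Longrightarrow> i < p * 2 ^ p \<Longrightarrow> i \<in> U"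
  shows "slab k \<subseteq> (\<Union>i\<in>U. time_cell T p k \<times> mark_cell p i)"
proof
  fix z assume "z \<in> slab k"
  then obtain s y where z: "z = (s, y)" "s \<in> time_cell T p k" "0 \<le> y" "y \<le> level s" by (auto simp: slab_def)
  obtain i where i: "y \<in> mark_cell p i" using mark_cellE[OF z(3)] .
  have "s \<in> {0<..T}" using z(2) grid[OF k] by (auto simp: time_cell_def)
  then have "y \<le> B" using z(4) level_bound by force
  moreover have "real i \<le> y * 2 ^ p" using i by (simp add: mark_cell_def field_simps)
  ultimately have "real i \<le> B * 2 ^ p" by (meson mult_right_mono order_trans zero_le_numeral zero_le_power)
  also have "\<dots> < real p * 2 ^ p" using B by (intro mult_strict_right_mono) auto
  also have "\<dots> = real (p * 2 ^ p)" by simp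
  finally have "i < p * 2 ^ p" by (simp only: of_nat_less_iff)
  then show "z \<in> (\<Union>i\<in>U. time_cell T p k \<times> mark_cell p i)" using U[OF z(2-4) i] z i by auto
qed

lemma box_sets: "k < 2 ^ p \<Longrightarrow> time_cell T p k \<times> mark_cell p i \<in> sets \<nu>3"
proof (rule sets3I)
  have "time_cell T p k \<times> mark_cell p i \<in> sets (borel \<Otimes>\<^sub>M borel)"
    by (intro pair_measureI) (auto simp: time_cell_def mark_cell_def)
  then show "time_cell T p k \<times> mark_cell p i \<in> sets borel" unfolding borel_prod .
  assume "k < 2 ^ p"
  then show "time_cell T p k \<times> mark_cell p i \<subseteq> {0..T} \<times> {0..}"
    using time_cell_subset[OF T, of k p] by (auto simp: mark_cell_def intro: order_trans[of 0 "real i / 2 ^ p"])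
qed

lemma region_meas: "t \<le> T \<Longrightarrow> region t \<in> sets \<nu>3" using sets3I[OF region_sets region_sub] by simp

lemma region_mono: "s \<le> t \<Longrightarrow> region s \<subseteq> region t" by (auto simp: region_def)

lemma slab_sets: "k < 2 ^ p \<Longrightarrow> slab k \<in> sets \<nu>3"
  unfolding slab_eq using grid[of k] by (intro sets.Diff region_meas) auto

lemma region_cover: "region T \<subseteq> {0} \<times> {0..} \<union> (\<Union>k<2 ^ p. slab k)"
proof
  fix z assume "z \<in> region T"
  then obtain s y where z: "z = (s, y)" "s \<in> {0..T}" "0 \<le> y" "y \<le> level s" by (auto simp: region_def)
  show "z \<in> {0} \<times> {0..} \<union> (\<Union>k<2 ^ p. slab k)"
  proof (cases "s = 0")
    case False
    define k where "k = nat (\<lceil>s * 2 ^ p / T\<rceil> - 1)"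
    have s: "0 < s" "s \<le> T" using z(2) False by auto
    have "0 < s * 2 ^ p / T" using s T by simp
    then have k: "real k = of_int \<lceil>s * 2 ^ p / T\<rceil> - 1" by (simp add: k_def)
    then have "real k < s * 2 ^ p / T" "s * 2 ^ p / T \<le> real k + 1" by linarith+
    then have c: "s \<in> time_cell T p k" using T by (auto simp: time_cell_def tgrid_def field_simps)
    have "k < 2 ^ p"
    proof (rule ccontr)
      assume "\<not> ?thesis"
      then have "tgrid T p (2 ^ p) \<le> tgrid T p k" by (intro tgrid_mono T) simp
      then show False using c s by (simp add: time_cell_def)
    qed
    then show ?thesis using c z by (auto simp: slab_def)
  qed (use z in auto)
qed

lemma boxes_finite: "k < 2 ^ p \<Longrightarrow> U \<subseteq> {..<p * 2 ^ p} \<Longrightarrow> emeasure \<nu>3 (\<Union>i\<in>U. time_cell T p k \<times> mark_cell p i) < \<infinity>"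
proof -
  assume k: "k < 2 ^ p" and U: "U \<subseteq> {..<p * 2 ^ p}"
  then have fU: "finite U" by (auto intro: finite_subset)
  have "emeasure \<nu>3 (\<Union>i\<in>U. time_cell T p k \<times> mark_cell p i) \<le> (\<Sum>i\<in>U. emeasure \<nu>3 (time_cell T p k \<times> mark_cell p i))"
    using fU k by (intro emeasure_subadditive_finite) (auto intro: box_sets)
  also have "\<dots> < \<infinity>" using fU U k fin3 by (auto simp: less_top[symmetric] sum_Pinfty dest!: subsetD)
  finally show ?thesis .
qed

lemma slab_finite: assumes k: "k < 2 ^ p" shows "emeasure \<nu>3 (slab k) < \<infinity>"
proof -
  have "emeasure \<nu>3 (slab k) \<le> emeasure \<nu>3 (\<Union>i\<in>{..<p * 2 ^ p}. time_cell T p k \<times> mark_cell p i)"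
    using k by (intro emeasure_mono slab_subset sets.finite_UN) (auto intro: box_sets)
  also have "\<dots> < \<infinity>" using k by (intro boxes_finite) auto
  finally show ?thesis .
qed

text \<open>Needed because \<open>measure\<close> is 0 on sets of infinite measure: only with finite
  regions are the increments of \<open>g\<close> the measures of the slabs, and \<open>g\<close>
  monotone.\<close>

lemma region_finite: "t \<le> T \<Longrightarrow> emeasure \<nu>3 (region t) < \<infinity>"
proof -
  assume t: "t \<le> T"
  have s0: "{0} \<times> {0..} \<in> sets \<nu>3" using T by (intro sets3I borel_closed closed_Times) auto
  have "emeasure \<nu>3 (region t) \<le> emeasure \<nu>3 ({0} \<times> {0..} \<union> (\<Union>k<2 ^ p. slab k))"
    using t region_cover s0 by (intro emeasure_mono sets.Un sets.finite_UN) (auto simp: region_def intro!: slab_sets)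
  also have "\<dots> \<le> emeasure \<nu>3 ({0} \<times> {0..}) + emeasure \<nu>3 (\<Union>k<2 ^ p. slab k)"
    using s0 by (intro emeasure_subadditive sets.finite_UN) (auto intro: slab_sets)
  also have "\<dots> = emeasure \<nu>3 (\<Union>k<2 ^ p. slab k)" using null by simp
  also have "\<dots> \<le> (\<Sum>k<2 ^ p. emeasure \<nu>3 (slab k))" by (intro emeasure_subadditive_finite) (auto intro: slab_sets)
  also have "\<dots> < \<infinity>" using slab_finite by (auto simp: less_top[symmetric] sum_Pinfty)
  finally show ?thesis .
qed

lemma g_mono: "mono_on {0..T} g"
proof (rule mono_onI)
  fix s t assume st: "s \<in> {0..T}" "t \<in> {0..T}" "s \<le> t"
  have "measure \<nu>3 (region s) \<le> measure \<nu>3 (region t)"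
    using st region_finite[of t] by (intro measure_mono_fmeasurable region_mono) (auto simp: fmeasurable_def intro!: region_meas)
  then show "g s \<le> g t" using st by (simp add: g_eq divide_right_mono)
qed

lemma incr_g: assumes k: "k < 2 ^ p" shows "incr T g p k = measure \<nu>3 (slab k) / n"
proof -
  have "measure \<nu>3 (region (tgrid T p (Suc k)) - region (tgrid T p k)) = measure \<nu>3 (region (tgrid T p (Suc k))) - measure \<nu>3 (region (tgrid T p k))"
    using grid[OF k] region_finite[of "tgrid T p (Suc k)"]
    by (intro measure_Diff region_mono region_meas) (auto simp: less_top[symmetric])
  then show ?thesis using grid[OF k] by (simp add: incr_def slab_eq[OF k] g_eq diff_divide_distrib)
qed

lemma measure_boxes: assumes k: "k < 2 ^ p" and U: "U \<subseteq> {..<p * 2 ^ p}"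
  shows "measure \<nu>3 (\<Union>i\<in>U. time_cell T p k \<times> mark_cell p i) / n = (\<Sum>i\<in>U. K k i)"
proof -
  have fU: "finite U" using U by (auto intro: finite_subset)
  have "measure \<nu>3 (\<Union>i\<in>U. time_cell T p k \<times> mark_cell p i) = (\<Sum>i\<in>U. measure \<nu>3 (time_cell T p k \<times> mark_cell p i))"
    using fU k U fin3[OF k] mark_cell_disjoint[of _ _ p]
    by (intro measure_finite_Union) (auto simp: disjoint_family_on_def less_top[symmetric] top_unique dest!: subsetD intro!: box_sets)
  then show ?thesis by (simp add: K_def sum_divide_distrib)
qed

lemma incr_g_le: assumes k: "k < 2 ^ p" and U: "U \<subseteq> {..<p * 2 ^ p}" and s: "slab k \<subseteq> (\<Union>i\<in>U. time_cell T p k \<times> mark_cell p i)"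
  shows "incr T g p k \<le> (\<Sum>i\<in>U. K k i)"
proof -
  have "measure \<nu>3 (slab k) \<le> measure \<nu>3 (\<Union>i\<in>U. time_cell T p k \<times> mark_cell p i)"
    using k U s boxes_finite[OF k U] finite_subset[OF U]
    by (intro measure_mono_fmeasurable) (auto simp: fmeasurable_def intro!: slab_sets sets.finite_UN box_sets)
  then show ?thesis unfolding incr_g[OF k] measure_boxes[OF k U, symmetric] by (simp add: divide_right_mono)
qed

lemma incr_g_ge: assumes k: "k < 2 ^ p" and U: "U \<subseteq> {..<p * 2 ^ p}" and s: "(\<Union>i\<in>U. time_cell T p k \<times> mark_cell p i) \<subseteq> slab k"
  shows "(\<Sum>i\<in>U. K k i) \<le> incr T g p k"
proof -
  have "measure \<nu>3 (\<Union>i\<in>U. time_cell T p k \<times> mark_cell p i) \<le> measure \<nu>3 (slab k)"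
    using k U s slab_finite[OF k] finite_subset[OF U]
    by (intro measure_mono_fmeasurable) (auto simp: fmeasurable_def intro!: slab_sets sets.finite_UN box_sets)
  then show ?thesis unfolding incr_g[OF k] measure_boxes[OF k U, symmetric] by (simp add: divide_right_mono)
qed

text \<open>The boxes \<open>U k\<close> may be selected after looking at the path, because every
  box that is left out has nonnegative entropy. This is how the dependence of reneging on the queue
  is circumvented.\<close>

lemma K_sum_dual:
  assumes U: "\<And>k. k < 2 ^ p \<Longrightarrow> U k \<subseteq> {..<p * 2 ^ p}"
  shows "(\<Sum>k<2 ^ p. \<Sum>i\<in>U k. b k * K k i - (exp (b k) - 1) * (th * (T / 2 ^ p) / 2 ^ p)) \<le> V3"
  unfolding V3_def
proof (intro sum_mono)
  fix k :: nat assume "k \<in> {..<2 ^ p}"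
  then have k: "k < 2 ^ p" by simp
  have "(\<Sum>i\<in>U k. b k * K k i - (exp (b k) - 1) * (th * (T / 2 ^ p) / 2 ^ p)) \<le> (\<Sum>i\<in>U k. relent (K k i) (th * (T / 2 ^ p) / 2 ^ p))"
  proof (intro sum_mono)
    fix i
    show "b k * K k i - (exp (b k) - 1) * (th * (T / 2 ^ p) / 2 ^ p) \<le> relent (K k i) (th * (T / 2 ^ p) / 2 ^ p)"
      using K_nonneg pos T by (intro relent_dual') auto
  qed
  also have "\<dots> \<le> (\<Sum>i<p * 2 ^ p. relent (K k i) (th * (T / 2 ^ p) / 2 ^ p))"
    using U[OF k] pos T K_nonneg by (intro sum_mono2) (auto intro!: relent_nonneg)
  finally show "(\<Sum>i\<in>U k. b k * K k i - (exp (b k) - 1) * (th * (T / 2 ^ p) / 2 ^ p)) \<le> (\<Sum>i<p * 2 ^ p. relent (K k i) (th * (T / 2 ^ p) / 2 ^ p))" .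
qed

text \<open>A single cell is tested with slope \<open>b\<close>. For reneging all boxes up to height
  \<open>p\<close> are taken, which is crude, but the weight \<open>th * p * T / 2 ^ p\<close> still
  tends to 0.\<close>

lemma increments_le:
  assumes k: "k < 2 ^ p" and b: "0 < b"
  shows "b * incr T arr p k \<le> m + exp b * (lam * (T / 2 ^ p))"
    and "b * incr T srv p k \<le> m + exp b * (mu * (T / 2 ^ p))"
    and "b * incr T g p k \<le> m + exp b * (th * real p * (T / 2 ^ p))"
proof -
  have le: "(exp b - 1) * v \<le> exp b * v" if "0 \<le> v" for v using that by (intro mult_right_mono) auto
  have le_lam: "(exp b - 1) * (lam * (T / 2 ^ p)) \<le> exp b * (lam * (T / 2 ^ p))"
    and le_mu: "(exp b - 1) * (mu * (T / 2 ^ p)) \<le> exp b * (mu * (T / 2 ^ p))"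
    and le_th: "(exp b - 1) * (th * real p * (T / 2 ^ p)) \<le> exp b * (th * real p * (T / 2 ^ p))"
    using pos T by (intro le; simp)+
  have "b * incr T arr p k - (exp b - 1) * (lam * (T / 2 ^ p)) \<le> V1"
    using dual_arr[of p "\<lambda>j. if j = k then b else 0"] unfolding dual_cost_single[OF k] by (simp add: incr_linear)
  then show "b * incr T arr p k \<le> m + exp b * (lam * (T / 2 ^ p))"
    using le_lam V_less V_nonneg by linarith
  have "b * incr T srv p k - (exp b - 1) * (mu * (T / 2 ^ p)) \<le> V2"
    using dual_srv[of p "\<lambda>j. if j = k then b else 0"] unfolding dual_cost_single[OF k] by (simp add: incr_linear)
  then show "b * incr T srv p k \<le> m + exp b * (mu * (T / 2 ^ p))"
    using le_mu V_less V_nonneg by linarith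
  have "(\<Sum>j<2 ^ p. \<Sum>i<p * 2 ^ p. (if j = k then b else 0) * K j i - (exp (if j = k then b else 0) - 1) * (th * (T / 2 ^ p) / 2 ^ p)) \<le> V3"
    by (rule K_sum_dual[where U="\<lambda>_. {..<p * 2 ^ p}"]) simp
  also have "(\<Sum>j<2 ^ p. \<Sum>i<p * 2 ^ p. (if j = k then b else 0) * K j i - (exp (if j = k then b else 0) - 1) * (th * (T / 2 ^ p) / 2 ^ p))
     = (\<Sum>j<2 ^ p. if j = k then (\<Sum>i<p * 2 ^ p. b * K k i - (exp b - 1) * (th * (T / 2 ^ p) / 2 ^ p)) else 0)"
    by (intro sum.cong refl) auto
  also have "\<dots> = (\<Sum>i<p * 2 ^ p. b * K k i - (exp b - 1) * (th * (T / 2 ^ p) / 2 ^ p))" using k by simp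
  also have "\<dots> = b * (\<Sum>i<p * 2 ^ p. K k i) - (exp b - 1) * (th * real p * (T / 2 ^ p))"
    by (simp add: sum_subtractf sum_distrib_left) 
  finally have "b * (\<Sum>i<p * 2 ^ p. K k i) \<le> m + exp b * (th * real p * (T / 2 ^ p))"
    using le_th V_less V_nonneg by linarith
  moreover have "incr T g p k \<le> (\<Sum>i<p * 2 ^ p. K k i)"
    using k by (intro incr_g_le slab_subset) auto
  then have "b * incr T g p k \<le> b * (\<Sum>i<p * 2 ^ p. K k i)" using b by (intro mult_left_mono) auto
  ultimately show "b * incr T g p k \<le> m + exp b * (th * real p * (T / 2 ^ p))" by simp
qed

context
  fixes Osc :: real
  assumes Osc: "\<And>k. k < 2 ^ p \<Longrightarrow> incr T arr p k + incr T srv p k + incr T g p k \<le> Osc"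
begin

text \<open>Within a time cell \<open>f\<close> moves by at most \<open>Osc\<close>. The boxes of
  \<open>inboxes\<close> therefore lie below the level throughout the cell, and those of
  \<open>outboxes\<close> cover all that lies below it; the summand \<open>1 / n\<close> comes from
  the definition of \<open>level\<close>.\<close>

definition "low k = max 0 (f (tgrid T p k) - Osc - 1 / n)"
definition "inboxes k = {i. i < p * 2 ^ p \<and> real (Suc i) / 2 ^ p \<le> low k}"
definition "outboxes k = {i. i < p * 2 ^ p \<and> real i / 2 ^ p \<le> f (tgrid T p k) + Osc}"

lemma Osc_nonneg: "0 \<le> Osc"
  using Osc[of 0] incr_nonneg[OF arr_mono T, of 0 p] incr_nonneg[OF srv_mono T, of 0 p] incr_nonneg[OF g_mono T, of 0 p] by simp

lemma f_near: assumes k: "k < 2 ^ p" and t: "t \<in> {tgrid T p k..tgrid T p (Suc k)}"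
  shows "\<bar>f t - f (tgrid T p k)\<bar> \<le> Osc"
proof -
  note g = grid[OF k]
  have tT: "t \<in> {0..T}" using g t by auto
  have "\<bar>f t - f (tgrid T p k)\<bar> \<le> (arr t - arr (tgrid T p k)) + (srv t - srv (tgrid T p k)) + (g t - g (tgrid T p k))"
    using g t tT by (intro oscillation mono_onD[OF g_mono]) auto
  also have "\<dots> \<le> incr T arr p k + incr T srv p k + incr T g p k"
    unfolding incr_def using g t tT
    by (intro add_mono diff_right_mono mono_onD[OF g_mono] mono_onD[OF arr_mono] mono_onD[OF srv_mono]) auto
  finally show ?thesis using Osc[OF k] by simp
qed

lemma level_near: assumes k: "k < 2 ^ p" and t: "t \<in> time_cell T p k"
  shows "low k \<le> level t" "level t \<le> f (tgrid T p k) + Osc"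
proof -
  note g = grid[OF k]
  have tT: "t \<in> {0<..T}" "tgrid T p k < t" using g t by (auto simp: time_cell_def)
  have b: "f (tgrid T p k) - Osc \<le> f s \<and> f s \<le> f (tgrid T p k) + Osc" if "s \<in> {0..T}" "tgrid T p k < s" "s < t" for s
    using f_near[OF k, of s] that t by (auto simp: time_cell_def)
  have l: "f (tgrid T p k) - Osc \<le> left_limit f t" "left_limit f t \<le> f (tgrid T p k) + Osc"
    using left_limit_bounds[OF tT b] by auto
  show "low k \<le> level t" using l(1) by (auto simp: low_def level_def)
  have "0 \<le> f (tgrid T p k) + Osc" using f_nonneg[of "tgrid T p k"] g Osc_nonneg by simp
  moreover have "0 \<le> 1 / real n" by simp
  ultimately show "level t \<le> f (tgrid T p k) + Osc" unfolding level_def using l(2) by (intro max.boundedI) linarith+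
qed

lemma inboxes_le: assumes k: "k < 2 ^ p" shows "(\<Sum>i\<in>inboxes k. K k i) \<le> incr T g p k"
proof (rule incr_g_ge[OF k])
  show "(\<Union>i\<in>inboxes k. time_cell T p k \<times> mark_cell p i) \<subseteq> slab k"
  proof clarify
    fix s y i assume i: "i \<in> inboxes k" and s: "s \<in> time_cell T p k" and y: "y \<in> mark_cell p i"
    have "0 \<le> real i / 2 ^ p" by simp
    then have "0 \<le> y" using y unfolding mark_cell_def atLeastLessThan_iff by linarith
    moreover have "y \<le> level s" using y i level_near(1)[OF k s] unfolding mark_cell_def inboxes_def by auto
    ultimately show "(s, y) \<in> slab k" using s by (simp add: slab_def)
  qed
qed (auto simp: inboxes_def)

lemma le_outboxes: assumes k: "k < 2 ^ p" shows "incr T g p k \<le> (\<Sum>i\<in>outboxes k. K k i)"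
proof (rule incr_g_le[OF k])
  show "slab k \<subseteq> (\<Union>i\<in>outboxes k. time_cell T p k \<times> mark_cell p i)"
  proof (rule slab_subset[OF k])
    fix s y i assume "s \<in> time_cell T p k" "0 \<le> y" "y \<le> level s" "y \<in> mark_cell p i" "i < p * 2 ^ p"
    then show "i \<in> outboxes k" using level_near(2)[OF k, of s] unfolding outboxes_def mark_cell_def by auto
  qed
qed (auto simp: outboxes_def)

lemma inboxes_outboxes: assumes "k < 2 ^ p" shows "inboxes k \<subseteq> outboxes k"
proof
  fix i assume i: "i \<in> inboxes k"
  have "real i / 2 ^ p \<le> real (Suc i) / 2 ^ p" by (intro divide_right_mono) auto
  also have "\<dots> \<le> low k" using i by (simp add: inboxes_def)
  also have "low k \<le> f (tgrid T p k) + Osc"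
  proof -
    have "0 \<le> 1 / real n" by simp
    moreover have "0 \<le> f (tgrid T p k)" using f_nonneg grid[OF assms] by blast
    ultimately show ?thesis unfolding low_def using Osc_nonneg by (intro max.boundedI) linarith+
  qed
  finally show "i \<in> outboxes k" using i by (simp add: inboxes_def outboxes_def)
qed

lemma card_inboxes: assumes k: "k < 2 ^ p" shows "\<bar>real (card (inboxes k)) / 2 ^ p - low k\<bar> \<le> 1 / 2 ^ p"
proof -
  define N where "N = nat \<lfloor>low k * 2 ^ p\<rfloor>"
  have l0: "0 \<le> low k * 2 ^ p" by (simp add: low_def)
  then have N: "real N \<le> low k * 2 ^ p" "low k * 2 ^ p < real N + 1" unfolding N_def by linarith+
  have "low k \<le> B"
  proof -
    have "0 \<le> B" using f_bound[of 0] f_nonneg[of 0] T by simp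
    moreover have "f (tgrid T p k) \<le> B" using f_bound grid[OF k] by blast
    moreover have "0 \<le> 1 / real n" by simp
    ultimately show ?thesis unfolding low_def using Osc_nonneg by (intro max.boundedI) linarith+
  qed
  then have "low k * 2 ^ p \<le> real p * 2 ^ p" using B by (intro mult_right_mono) auto
  then have "real N \<le> real p * 2 ^ p" using N(1) by linarith
  then have NH: "real N \<le> real (p * 2 ^ p)" by simp
  have "inboxes k = {..<N}"
  proof (intro equalityI subsetI)
    fix i assume "i \<in> inboxes k"
    then have "real (Suc i) \<le> low k * 2 ^ p" by (simp add: inboxes_def field_simps)
    then have "real (Suc i) < real N + 1" using N by linarith
    then show "i \<in> {..<N}" by simp
  next
    fix i assume "i \<in> {..<N}"
    then have i: "real (Suc i) \<le> real N" by simp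
    then have "real (Suc i) \<le> low k * 2 ^ p" using N by linarith
    moreover have "real i < real (p * 2 ^ p)" using i NH by linarith
    then have "i < p * 2 ^ p" by (simp only: of_nat_less_iff)
    ultimately show "i \<in> inboxes k" by (simp add: inboxes_def field_simps)
  qed
  then have c: "card (inboxes k) = N" by simp
  have "real N / 2 ^ p \<le> low k" "low k \<le> (real N + 1) / 2 ^ p" using N by (auto simp: field_simps)
  then show ?thesis unfolding c by (auto simp: add_divide_distrib abs_if)
qed

text \<open>The two bounds on the level differ by at most \<open>2 * Osc + 1 / n\<close>; rounding
  at both ends of the strip adds at most two boxes.\<close>

lemma card_strip: assumes k: "k < 2 ^ p" shows "real (card (outboxes k - inboxes k)) / 2 ^ p \<le> 2 * Osc + 1 / n + 2 / 2 ^ p"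
proof -
  define c where "c = f (tgrid T p k) + Osc"
  define a where "a = nat \<lfloor>low k * 2 ^ p\<rfloor>" 
  define b where "b = nat \<lfloor>c * 2 ^ p\<rfloor>"
  have f0: "0 \<le> f (tgrid T p k)" using f_nonneg grid[OF k] by blast
  have l0: "0 \<le> low k * 2 ^ p" by (simp add: low_def)
  have c0: "0 \<le> c * 2 ^ p" using f0 Osc_nonneg by (simp add: c_def)
  have a: "real a \<le> low k * 2 ^ p" "low k * 2 ^ p < real a + 1" using l0 unfolding a_def by linarith+
  have b: "real b \<le> c * 2 ^ p" "c * 2 ^ p < real b + 1" using c0 unfolding b_def by linarith+
  have "outboxes k - inboxes k \<subseteq> {a..b}"
  proof
    fix i assume i: "i \<in> outboxes k - inboxes k"
    then have "real i \<le> c * 2 ^ p" by (simp add: outboxes_def c_def field_simps)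
    then have "real i < real b + 1" using b by linarith
    moreover have "low k < real (Suc i) / 2 ^ p" using i by (auto simp: outboxes_def inboxes_def)
    then have "low k * 2 ^ p < real (Suc i)" by (simp add: field_simps)
    then have "real a < real (Suc i)" using a by linarith
    ultimately show "i \<in> {a..b}" by simp
  qed
  then have "card (outboxes k - inboxes k) \<le> card {a..b}" by (intro card_mono) auto
  then have "real (card (outboxes k - inboxes k)) \<le> real (Suc b - a)" by simp
  also have "\<dots> \<le> c * 2 ^ p - low k * 2 ^ p + 2"
  proof (cases "a \<le> Suc b")
    case True then show ?thesis using a b by (simp add: of_nat_diff)
  next
    case False
    have "low k * 2 ^ p \<le> c * 2 ^ p"
    proof (intro mult_right_mono)
      have "0 \<le> 1 / real n" by simp
      then show "low k \<le> c" unfolding low_def c_def using Osc_nonneg f0 by (intro max.boundedI) linarith+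
    qed simp
    then show ?thesis using False by simp
  qed
  also have "\<dots> \<le> (2 * Osc + 1 / n) * 2 ^ p + 2"
  proof -
    have "c - low k \<le> 2 * Osc + 1 / n" unfolding c_def low_def by linarith
    then have "(c - low k) * 2 ^ p \<le> (2 * Osc + 1 / n) * 2 ^ p" by (intro mult_right_mono) auto
    then show ?thesis by (simp add: left_diff_distrib)
  qed
  finally show ?thesis by (simp add: field_simps)
qed

text \<open>The constant slope \<open>b\<close> is tested on the boxes of the strip. Their total
  intensity is small, so for large \<open>b\<close> bounded entropy leaves few points in
  them.\<close>

lemma strip_count:
  assumes b: "0 < b"
  shows "b * (\<Sum>k<2 ^ p. \<Sum>i\<in>outboxes k - inboxes k. K k i) \<le> m + exp b * (th * T * (2 * Osc + 1 / n + 2 / 2 ^ p))"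
proof -
  have "(\<Sum>k<2 ^ p. \<Sum>i\<in>outboxes k - inboxes k. b * K k i - (exp b - 1) * (th * (T / 2 ^ p) / 2 ^ p)) \<le> V3"
    by (rule K_sum_dual[where b="\<lambda>_. b"]) (auto simp: outboxes_def)
  then have "b * (\<Sum>k<2 ^ p. \<Sum>i\<in>outboxes k - inboxes k. K k i) \<le> V3 + (\<Sum>k<2 ^ p. \<Sum>i\<in>outboxes k - inboxes k. (exp b - 1) * (th * (T / 2 ^ p) / 2 ^ p))"
    by (simp add: sum_subtractf sum_distrib_left)
  also have "(\<Sum>k<2 ^ p. \<Sum>i\<in>outboxes k - inboxes k. (exp b - 1) * (th * (T / 2 ^ p) / 2 ^ p)) \<le>
      (\<Sum>k<(2::nat) ^ p. exp b * (th * (T / 2 ^ p)) * (2 * Osc + 1 / n + 2 / 2 ^ p))"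
  proof (intro sum_mono)
    fix k :: nat assume "k \<in> {..<2 ^ p}"
    then have k: "k < 2 ^ p" by simp
    have "(\<Sum>i\<in>outboxes k - inboxes k. (exp b - 1) * (th * (T / 2 ^ p) / 2 ^ p)) =
        (exp b - 1) * (th * (T / 2 ^ p)) * (real (card (outboxes k - inboxes k)) / 2 ^ p)"
      by (simp add: field_simps)
    also have "\<dots> \<le> exp b * (th * (T / 2 ^ p)) * (2 * Osc + 1 / n + 2 / 2 ^ p)"
      using b pos T card_strip[OF k] by (intro mult_mono) auto
    finally show "(\<Sum>i\<in>outboxes k - inboxes k. (exp b - 1) * (th * (T / 2 ^ p) / 2 ^ p)) \<le> exp b * (th * (T / 2 ^ p)) * (2 * Osc + 1 / n + 2 / 2 ^ p)" .
  qed
  also have "\<dots> = exp b * (th * T * (2 * Osc + 1 / n + 2 / 2 ^ p))" by simp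
  finally show ?thesis using V_less V_nonneg by linarith
qed

text \<open>Number and intensity of the inner boxes, gathered from level \<open>p\<close> into the
  cells of level \<open>q\<close>. They become the sequences \<open>y\<close> and \<open>w\<close>
  of \<open>entropy_bounded\<close>.\<close>

definition "renege_count q k = (\<Sum>j\<in>{k * 2 ^ (p - q)..<k * 2 ^ (p - q) + 2 ^ (p - q)}. \<Sum>i\<in>inboxes j. K j i)"
definition "renege_weight q k = (\<Sum>j\<in>{k * 2 ^ (p - q)..<k * 2 ^ (p - q) + 2 ^ (p - q)}. th * (T / 2 ^ p) * (real (card (inboxes j)) / 2 ^ p))"

lemma block_less: "q \<le> p \<Longrightarrow> (k::nat) < 2 ^ q \<Longrightarrow> j < k * 2 ^ (p - q) + 2 ^ (p - q) \<Longrightarrow> j < 2 ^ p"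
proof -
  assume q: "q \<le> p" and k: "k < 2 ^ q" and j: "j < k * 2 ^ (p - q) + 2 ^ (p - q)"
  have "Suc k * 2 ^ (p - q) \<le> 2 ^ q * 2 ^ (p - q)" using k by (intro mult_right_mono) auto
  also have "2 ^ q * 2 ^ (p - q) = (2::nat) ^ p" using q by (simp add: power_add[symmetric])
  finally show ?thesis using j by simp
qed

lemma total_cost: assumes q: "q \<le> p"
  shows "dual_cost T arr (\<lambda>t. lam * t) q b1 + dual_cost T srv (\<lambda>t. mu * t) q b2
     + (\<Sum>k<2 ^ q. b3 k * renege_count q k - (exp (b3 k) - 1) * renege_weight q k) \<le> m"
proof -
  have "(\<Sum>k<2 ^ q. b3 k * renege_count q k - (exp (b3 k) - 1) * renege_weight q k) =
     (\<Sum>k<2 ^ q. \<Sum>j\<in>{k * 2 ^ (p - q)..<k * 2 ^ (p - q) + 2 ^ (p - q)}. 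
        \<Sum>i\<in>inboxes j. b3 (j div 2 ^ (p - q)) * K j i - (exp (b3 (j div 2 ^ (p - q))) - 1) * (th * (T / 2 ^ p) / 2 ^ p))"
  proof (intro sum.cong refl)
    fix k
    have "b3 k * renege_count q k - (exp (b3 k) - 1) * renege_weight q k =
       (\<Sum>j\<in>{k * 2 ^ (p - q)..<k * 2 ^ (p - q) + 2 ^ (p - q)}. \<Sum>i\<in>inboxes j. b3 k * K j i - (exp (b3 k) - 1) * (th * (T / 2 ^ p) / 2 ^ p))"
      unfolding renege_count_def renege_weight_def sum_distrib_left sum_subtractf[symmetric]
      by (intro sum.cong refl) (simp add: sum_subtractf)
    also have "\<dots> = (\<Sum>j\<in>{k * 2 ^ (p - q)..<k * 2 ^ (p - q) + 2 ^ (p - q)}. 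
        \<Sum>i\<in>inboxes j. b3 (j div 2 ^ (p - q)) * K j i - (exp (b3 (j div 2 ^ (p - q))) - 1) * (th * (T / 2 ^ p) / 2 ^ p))"
      by (intro sum.cong refl) (simp only: div_dyadic_block)
    finally show "b3 k * renege_count q k - (exp (b3 k) - 1) * renege_weight q k =
       (\<Sum>j\<in>{k * 2 ^ (p - q)..<k * 2 ^ (p - q) + 2 ^ (p - q)}. 
        \<Sum>i\<in>inboxes j. b3 (j div 2 ^ (p - q)) * K j i - (exp (b3 (j div 2 ^ (p - q))) - 1) * (th * (T / 2 ^ p) / 2 ^ p))" .
  qed
  also have "\<dots> = (\<Sum>j<2 ^ p. \<Sum>i\<in>inboxes j. b3 (j div 2 ^ (p - q)) * K j i - (exp (b3 (j div 2 ^ (p - q))) - 1) * (th * (T / 2 ^ p) / 2 ^ p))"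
  proof -
    have "(\<Sum>j<2 ^ p. F j) = (\<Sum>k<2 ^ q. \<Sum>j\<in>{k * 2 ^ (p - q)..<k * 2 ^ (p - q) + 2 ^ (p - q)}. F j)" for F :: "nat \<Rightarrow> real"
      using sum_dyadic_group[of F q "p - q"] q by simp
    then show ?thesis by (rule sym)
  qed
  also have "\<dots> \<le> V3" by (rule K_sum_dual) (auto simp: inboxes_def)
  finally show ?thesis using dual_arr[OF q, of b1] dual_srv[OF q, of b2] V_less by linarith
qed

lemma count_near: assumes q: "q \<le> p" and k: "k < 2 ^ q"
  shows "\<bar>renege_count q k - incr T g q k\<bar> \<le> (\<Sum>k<2 ^ p. \<Sum>i\<in>outboxes k - inboxes k. K k i)"
proof -
  let ?J = "{k * 2 ^ (p - q)..<k * 2 ^ (p - q) + 2 ^ (p - q)}"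
  have J: "j < 2 ^ p" if "j \<in> ?J" for j using block_less[OF q k, of j] that by simp
  have inc: "incr T g q k = (\<Sum>j\<in>?J. incr T g p j)" using incr_block[of T g q "p - q" k] q by simp
  have "(\<Sum>j\<in>?J. \<Sum>i\<in>inboxes j. K j i) \<le> (\<Sum>j\<in>?J. incr T g p j)" using J by (intro sum_mono inboxes_le) auto
  moreover have "(\<Sum>j\<in>?J. incr T g p j) - (\<Sum>j\<in>?J. \<Sum>i\<in>inboxes j. K j i) \<le> (\<Sum>j\<in>?J. \<Sum>i\<in>outboxes j - inboxes j. K j i)"
    unfolding sum_subtractf[symmetric]
  proof (intro sum_mono)
    fix j assume j: "j \<in> ?J"
    have "finite (outboxes j)" by (simp add: outboxes_def)
    then have "(\<Sum>i\<in>outboxes j. K j i) = (\<Sum>i\<in>outboxes j - inboxes j. K j i) + (\<Sum>i\<in>inboxes j. K j i)"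
      using inboxes_outboxes[OF J[OF j]] by (intro sum.subset_diff) auto
    then show "incr T g p j - (\<Sum>i\<in>inboxes j. K j i) \<le> (\<Sum>i\<in>outboxes j - inboxes j. K j i)" using le_outboxes[OF J[OF j]] by simp
  qed
  moreover have "(\<Sum>j\<in>?J. \<Sum>i\<in>outboxes j - inboxes j. K j i) \<le> (\<Sum>j<2 ^ p. \<Sum>i\<in>outboxes j - inboxes j. K j i)"
    using J K_nonneg by (intro sum_mono2) (auto intro!: sum_nonneg)
  ultimately show ?thesis unfolding renege_count_def inc by linarith
qed

text \<open>The intensity of a time cell is proportional to the height of its inner boxes. The error
  consists of \<open>d\<close> from \<open>h\<close> to \<open>f\<close>, \<open>Osc\<close> from
  \<open>f\<close> to its value at the left grid point, \<open>Osc + 1 / n\<close> from there to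
  \<open>low\<close>, and \<open>1 / 2 ^ p\<close> from rounding.\<close>

lemma weight_near:
  assumes q: "q \<le> p" and k: "k < 2 ^ q" and h: "continuous_on {0..T} h" "\<And>t. t \<in> {0..T} \<Longrightarrow> \<bar>f t - h t\<bar> \<le> d"
  shows "\<bar>renege_weight q k - th * integral {tgrid T q k..tgrid T q (Suc k)} h\<bar> \<le> th * (T / 2 ^ q) * (d + (2 * Osc + 1 / n + 1 / 2 ^ p))"
proof -
  let ?J = "{k * 2 ^ (p - q)..<k * 2 ^ (p - q) + 2 ^ (p - q)}"
  define E where "E = d + (2 * Osc + 1 / n + 1 / 2 ^ p)"
  have J: "j < 2 ^ p" if "j \<in> ?J" for j using block_less[OF q k, of j] that by simp
  have comb: "integral {tgrid T r j..tgrid T r (Suc j)} h = incr T (\<lambda>t. integral {0..t} h) r j" if j: "j < 2 ^ r" for r j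
  proof -
    have l: "tgrid T r j \<in> {0..T}" "tgrid T r (Suc j) \<in> {0..T}" "tgrid T r j \<le> tgrid T r (Suc j)"
      using tgrid_mem[OF T] tgrid_mono[OF T] j by auto
    have "h integrable_on {0..tgrid T r (Suc j)}"
      using l by (intro integrable_continuous_real continuous_on_subset[OF h(1)]) auto
    then have "integral {0..tgrid T r j} h + integral {tgrid T r j..tgrid T r (Suc j)} h = integral {0..tgrid T r (Suc j)} h"
      using l by (intro Henstock_Kurzweil_Integration.integral_combine) auto
    then show ?thesis unfolding incr_def by simp
  qed
  have "integral {tgrid T q k..tgrid T q (Suc k)} h = (\<Sum>j\<in>?J. incr T (\<lambda>t. integral {0..t} h) p j)"
    using incr_block[of T "\<lambda>t. integral {0..t} h" q "p - q" k] q by (simp add: comb[OF k])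
  also have "\<dots> = (\<Sum>j\<in>?J. integral {tgrid T p j..tgrid T p (Suc j)} h)"
    by (intro sum.cong refl) (simp add: comb J)
  finally have int: "integral {tgrid T q k..tgrid T q (Suc k)} h = (\<Sum>j\<in>?J. integral {tgrid T p j..tgrid T p (Suc j)} h)" .
  have each: "\<bar>T / 2 ^ p * (real (card (inboxes j)) / 2 ^ p) - integral {tgrid T p j..tgrid T p (Suc j)} h\<bar> \<le> T / 2 ^ p * E" if "j \<in> ?J" for j
  proof -
    let ?I = "{tgrid T p j..tgrid T p (Suc j)}" and ?c = "real (card (inboxes j)) / 2 ^ p"
    have j: "j < 2 ^ p" using J[OF that] .
    have sub: "?I \<subseteq> {0..T}" using grid[OF j] by auto
    have near: "norm (?c - h t) \<le> E" if t: "t \<in> ?I" for t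
    proof -
      have 1: "\<bar>?c - low j\<bar> \<le> 1 / 2 ^ p" by (rule card_inboxes[OF j])
      have 2: "\<bar>f t - f (tgrid T p j)\<bar> \<le> Osc" by (rule f_near[OF j t])
      have 3: "\<bar>f t - h t\<bar> \<le> d" using h(2) t sub by blast
      have "0 \<le> f (tgrid T p j)" using f_nonneg grid[OF j] by blast
      moreover have "0 \<le> 1 / real n" by simp
      ultimately have 4: "\<bar>low j - f (tgrid T p j)\<bar> \<le> Osc + 1 / n" unfolding low_def using Osc_nonneg by linarith
      show ?thesis using 1 2 3 4 unfolding E_def real_norm_def by linarith
    qed
    have hi: "h integrable_on ?I" using sub by (intro integrable_continuous_real continuous_on_subset[OF h(1)])
    have "norm (integral ?I (\<lambda>t. ?c - h t)) \<le> integral ?I (\<lambda>_. E)"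
      using near hi by (intro integral_norm_bound_integral Henstock_Kurzweil_Integration.integrable_diff integrable_const_ivl)
    moreover have "integral ?I (\<lambda>t. ?c - h t) = integral ?I (\<lambda>_. ?c) - integral ?I h"
      using hi by (intro Henstock_Kurzweil_Integration.integral_diff integrable_const_ivl)
    moreover have "integral ?I (\<lambda>_. v) = T / 2 ^ p * v" for v :: real using grid[OF j] by (simp add: tgrid_Suc)
    ultimately show ?thesis by (simp only: real_norm_def)
  qed
  have eq: "renege_weight q k - th * integral {tgrid T q k..tgrid T q (Suc k)} h =
      th * (\<Sum>j\<in>?J. T / 2 ^ p * (real (card (inboxes j)) / 2 ^ p) - integral {tgrid T p j..tgrid T p (Suc j)} h)"
    unfolding renege_weight_def int by (simp add: sum_subtractf sum_distrib_left right_diff_distrib mult.assoc)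
  have "\<bar>renege_weight q k - th * integral {tgrid T q k..tgrid T q (Suc k)} h\<bar> = th * \<bar>\<Sum>j\<in>?J. T / 2 ^ p * (real (card (inboxes j)) / 2 ^ p) - integral {tgrid T p j..tgrid T p (Suc j)} h\<bar>"
    unfolding eq abs_mult using pos(3) by (simp only: abs_of_pos)
  also have "\<dots> \<le> th * (\<Sum>j\<in>?J. T / 2 ^ p * E)"
  proof (rule mult_left_mono)
    have "\<bar>\<Sum>j\<in>?J. T / 2 ^ p * (real (card (inboxes j)) / 2 ^ p) - integral {tgrid T p j..tgrid T p (Suc j)} h\<bar>
        \<le> (\<Sum>j\<in>?J. \<bar>T / 2 ^ p * (real (card (inboxes j)) / 2 ^ p) - integral {tgrid T p j..tgrid T p (Suc j)} h\<bar>)"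
      by (rule sum_abs)
    also have "\<dots> \<le> (\<Sum>j\<in>?J. T / 2 ^ p * E)" by (rule sum_mono) (rule each)
    finally show "\<bar>\<Sum>j\<in>?J. T / 2 ^ p * (real (card (inboxes j)) / 2 ^ p) - integral {tgrid T p j..tgrid T p (Suc j)} h\<bar>
        \<le> (\<Sum>j\<in>?J. T / 2 ^ p * E)" .
  qed (use pos in simp)
  also have "(\<Sum>j\<in>?J. T / 2 ^ p * E) = T / 2 ^ q * E"
  proof -
    have "real (2 ^ (p - q)) * (T / 2 ^ p) = T / 2 ^ q"
    proof -
      have "(2::real) ^ p = 2 ^ q * 2 ^ (p - q)" using q by (simp add: power_add[symmetric])
      then show ?thesis by (simp add: field_simps)
    qed
    then have "real (2 ^ (p - q)) * (T / 2 ^ p) * E = T / 2 ^ q * E" by (simp only:)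
    then show ?thesis by (simp add: mult.assoc)
  qed
  finally show ?thesis by (simp only: E_def mult.assoc)
qed

end

end

text \<open>The sequential form of \<open>choose_level\<close>: a large slope makes
  \<open>M / b\<close> small, and then the weight \<open>c p\<close> is taken below
  \<open>exp (- b)\<close>.\<close>

lemma tendsto_zero_dual:
  fixes f c :: "nat \<Rightarrow> real"
  assumes f: "\<And>p. 0 \<le> f p" and b: "\<And>p b. 0 < b \<Longrightarrow> b * f p \<le> M + exp b * c p" and c: "c \<longlonglongrightarrow> 0" and M: "0 \<le> M"
  shows "f \<longlonglongrightarrow> 0"
proof (rule order_tendstoI)
  fix e :: real assume e: "0 < e"
  define B where "B = 2 * (M + 1) / e"
  have B: "0 < B" "B * e = 2 * (M + 1)" using e M by (auto simp: B_def)
  have "(\<lambda>p. exp B * c p) \<longlonglongrightarrow> exp B * 0" by (intro tendsto_intros c)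
  then have "\<forall>\<^sub>F p in sequentially. exp B * c p < 1" by (rule order_tendstoD) simp
  then show "\<forall>\<^sub>F p in sequentially. f p < e"
  proof eventually_elim
    case (elim p)
    have "B * f p \<le> M + exp B * c p" by (rule b[OF B(1)])
    also have "\<dots> < M + 1" using elim by simp
    also have "\<dots> \<le> B * e" using B(2) M by simp
    finally have "B * f p < B * e" .
    then show ?case using B(1) by simp
  qed
next
  fix e :: real assume e: "e < 0"
  have "e < f p" for p using f[of p] e by simp
  then show "\<forall>\<^sub>F p in sequentially. e < f p" by simp
qed

text \<open>All that the upper bound needs from one good realisation, freed from the locale so that
  the witnesses can be chosen along a sequence of realisations.\<close>

definition level_facts where
  "level_facts lam mu th m T p n xn A S g f osc strip y w \<longleftrightarrow>
    mono_on {0..T} A \<and> mono_on {0..T} S \<and> mono_on {0..T} g \<and> A 0 = 0 \<and> S 0 = 0 \<and> g 0 = 0 \<and>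
    0 \<le> osc \<and> 0 \<le> strip \<and>
    (\<forall>b>0. b * osc \<le> 3 * m + exp b * ((lam + mu + th * real p) * (T / 2 ^ p))) \<and>
    (\<forall>b>0. b * strip \<le> m + exp b * (th * T * (2 * osc + 1 / real n + 2 / 2 ^ p))) \<and>
    (\<forall>t\<in>{0..T}. \<bar>f t - skorohod_map (\<lambda>r. xn + A r - S r - g r) t\<bar> \<le> 2 * osc) \<and>
    (\<forall>q\<le>p. \<forall>b1 b2 b3. dual_cost T A (\<lambda>t. lam * t) q b1 + dual_cost T S (\<lambda>t. mu * t) q b2
       + (\<Sum>k<2 ^ q. b3 k * y q k - (exp (b3 k) - 1) * w q k) \<le> m) \<and>
    (\<forall>q\<le>p. \<forall>k<2 ^ q. \<bar>y q k - incr T g q k\<bar> \<le> strip) \<and>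
    (\<forall>q\<le>p. \<forall>k<2 ^ q. \<forall>h d. continuous_on {0..T} h \<longrightarrow> (\<forall>t\<in>{0..T}. \<bar>f t - h t\<bar> \<le> d) \<longrightarrow>
       \<bar>w q k - th * integral {tgrid T q k..tgrid T q (Suc k)} h\<bar> \<le> th * (T / 2 ^ q) * (d + (2 * osc + 1 / real n + 1 / 2 ^ p)))"

lemma level_factsD:
  assumes "level_facts lam mu th m T p n xn A S g f osc strip y w"
  shows "mono_on {0..T} A" "mono_on {0..T} S" "mono_on {0..T} g" "A 0 = 0" "S 0 = 0" "g 0 = 0" "0 \<le> osc" "0 \<le> strip"
    "\<And>b. 0 < b \<Longrightarrow> b * osc \<le> 3 * m + exp b * ((lam + mu + th * real p) * (T / 2 ^ p))"
    "\<And>b. 0 < b \<Longrightarrow> b * strip \<le> m + exp b * (th * T * (2 * osc + 1 / real n + 2 / 2 ^ p))"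
    "\<And>t. t \<in> {0..T} \<Longrightarrow> \<bar>f t - skorohod_map (\<lambda>r. xn + A r - S r - g r) t\<bar> \<le> 2 * osc"
    "\<And>q b1 b2 b3. q \<le> p \<Longrightarrow> dual_cost T A (\<lambda>t. lam * t) q b1 + dual_cost T S (\<lambda>t. mu * t) q b2
       + (\<Sum>k<2 ^ q. b3 k * y q k - (exp (b3 k) - 1) * w q k) \<le> m"
    "\<And>q k. q \<le> p \<Longrightarrow> k < 2 ^ q \<Longrightarrow> \<bar>y q k - incr T g q k\<bar> \<le> strip"
    "\<And>q k h d. q \<le> p \<Longrightarrow> k < 2 ^ q \<Longrightarrow> continuous_on {0..T} h \<Longrightarrow> (\<forall>t\<in>{0..T}. \<bar>f t - h t\<bar> \<le> d) \<Longrightarrow>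
       \<bar>w q k - th * integral {tgrid T q k..tgrid T q (Suc k)} h\<bar> \<le> th * (T / 2 ^ q) * (d + (2 * osc + 1 / real n + 1 / 2 ^ p))"
  using assms unfolding level_facts_def by (elim conjE, blast)+

lemma (in good_path) level_facts:
  "\<exists>A S osc strip y w. level_facts lam mu th m T p n xn A S g f osc strip y w"
proof -
  define I where "I k = incr T arr p k + incr T srv p k + incr T g p k" for k
  define osc where "osc = Max (I ` {..<2 ^ p})"
  have osc: "I k \<le> osc" if "k < 2 ^ p" for k unfolding osc_def using that by (intro Max_ge) auto
  note Osc = osc[unfolded I_def]
  have I0: "0 \<le> incr T arr p k" "0 \<le> incr T srv p k" "0 \<le> incr T g p k" if "k < 2 ^ p" for k
    using incr_nonneg[OF arr_mono T that] incr_nonneg[OF srv_mono T that] incr_nonneg[OF g_mono T that] by auto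
  have osc0: "0 \<le> osc" using osc[of 0] I0[of 0] by (simp add: I_def)
  obtain k0 where k0: "k0 < 2 ^ p" "osc = I k0"
  proof -
    have "osc \<in> I ` {..<2 ^ p}" unfolding osc_def by (intro Max_in) (auto simp: lessThan_empty_iff)
    then show thesis using that by auto
  qed
  \<comment> \<open>The sum of the three bounds of \<open>increments_le\<close> in the cell where
    the maximum is attained, hence \<open>3 * m\<close>.\<close>
  have b1: "b * osc \<le> 3 * m + exp b * ((lam + mu + th * real p) * (T / 2 ^ p))" if "0 < b" for b
    using increments_le[OF k0(1) that] unfolding k0(2) I_def by (simp add: algebra_simps add_divide_distrib)
  define strip where "strip = (\<Sum>k<2 ^ p. \<Sum>i\<in>outboxes osc k - inboxes osc k. K k i)"
  have strip0: "0 \<le> strip" unfolding strip_def by (intro sum_nonneg K_nonneg)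
  have refl: "\<bar>f t - skorohod_map (\<lambda>r. xn + arr r - srv r - g r) t\<bar> \<le> 2 * osc" if t: "t \<in> {0..T}" for t
  proof (rule reflection[of "T / 2 ^ p", OF _ _ t])
    fix s t assume st: "s \<in> {0..T}" "t \<in> {0..T}" "s \<le> t" "t - s < T / 2 ^ p"
    have "incr T srv p k \<le> osc" if "k < 2 ^ p" for k using Osc[OF that] I0[OF that] by simp
    then show "srv t - srv s \<le> 2 * osc" using st by (intro grid_modulus[OF T srv_mono _ osc0]) auto
  qed (use T in simp)
  have "level_facts lam mu th m T p n xn arr srv g f osc strip (renege_count osc) (renege_weight osc)"
    unfolding level_facts_def
  proof (intro conjI allI impI ballI)
    fix b :: real assume "0 < b"
    then show "b * strip \<le> m + exp b * (th * T * (2 * osc + 1 / real n + 2 / 2 ^ p))"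
      unfolding strip_def by (intro strip_count Osc)
  next
    fix q b1 b2 b3 assume "q \<le> p"
    then show "dual_cost T arr (\<lambda>t. lam * t) q b1 + dual_cost T srv (\<lambda>t. mu * t) q b2
       + (\<Sum>k<2 ^ q. b3 k * renege_count osc q k - (exp (b3 k) - 1) * renege_weight osc q k) \<le> m" by (intro total_cost Osc)
  next
    fix q k assume "q \<le> p" "k < (2::nat) ^ q"
    then show "\<bar>renege_count osc q k - incr T g q k\<bar> \<le> strip" unfolding strip_def by (intro count_near Osc)
  next
    fix q k h d assume "q \<le> p" "k < (2::nat) ^ q" "continuous_on {0..T} h" "\<forall>t\<in>{0..T}. \<bar>f t - h t\<bar> \<le> d"
    then show "\<bar>renege_weight osc q k - th * integral {tgrid T q k..tgrid T q (Suc k)} h\<bar>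
        \<le> th * (T / 2 ^ q) * (d + (2 * osc + 1 / real n + 1 / 2 ^ p))" by (intro weight_near Osc) auto
  qed (use arr_mono srv_mono g_mono at_0 osc0 strip0 b1 refl in auto)
  then show ?thesis by blast
qed

section \<open>Intensities of boxes\<close>

lemma sets_time_intensity: "sets (time_intensity c T) = sets (restrict_space borel {0..T})"
  by (simp add: time_intensity_def cong: sets_restrict_space_cong)

lemma sets_time_mark_intensity: "sets (time_mark_intensity c T) = sets (restrict_space borel ({0..T} \<times> {0..}))"
  by (simp add: time_mark_intensity_def cong: sets_restrict_space_cong)

lemma time_intensity_setsI: "B \<in> sets borel \<Longrightarrow> B \<subseteq> {0..T} \<Longrightarrow> B \<in> sets (time_intensity c T)"
  unfolding sets_time_intensity by (subst sets_restrict_space_iff) auto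

lemma time_mark_intensity_setsI: "B \<in> sets borel \<Longrightarrow> B \<subseteq> {0..T} \<times> {0..} \<Longrightarrow> B \<in> sets (time_mark_intensity c T)"
  unfolding sets_time_mark_intensity by (subst sets_restrict_space_iff) (auto intro: borel_closed closed_Times)

lemma emeasure_time_intensity:
  "B \<in> sets borel \<Longrightarrow> B \<subseteq> {0..T} \<Longrightarrow> emeasure (time_intensity c T) B = ennreal c * emeasure lborel B"
  by (simp add: time_intensity_def emeasure_restrict_space)

lemma emeasure_time_mark_intensity:
  "B \<in> sets borel \<Longrightarrow> B \<subseteq> {0..T} \<times> {0..} \<Longrightarrow> emeasure (time_mark_intensity c T) B = ennreal c * emeasure lborel B"
  by (simp add: time_mark_intensity_def emeasure_restrict_space borel_closed closed_Times)

lemma emeasure_lborel_rect: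
  assumes "A \<in> sets borel" "B \<in> sets borel"
  shows "emeasure lborel (A \<times> B :: (real \<times> real) set) = emeasure lborel A * emeasure lborel B"
  unfolding lborel_prod[symmetric] using assms by (intro lborel.emeasure_pair_measure_Times) auto

lemma rect_borel: "A \<in> sets borel \<Longrightarrow> B \<in> sets borel \<Longrightarrow> A \<times> B \<in> sets (borel :: (real \<times> real) measure)"
  unfolding borel_prod[symmetric] by (rule pair_measureI)

lemma time_intensity_Ioc:
  assumes "0 \<le> a" "a \<le> b" "b \<le> T" "0 \<le> c"
  shows "{a<..b} \<in> sets (time_intensity c T)" "emeasure (time_intensity c T) {a<..b} = ennreal (c * (b - a))"
    "measure (time_intensity c T) {a<..b} = c * (b - a)"
proof -
  show "{a<..b} \<in> sets (time_intensity c T)" using assms by (intro time_intensity_setsI) auto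
  show "emeasure (time_intensity c T) {a<..b} = ennreal (c * (b - a))"
    using assms by (subst emeasure_time_intensity) (auto simp: ennreal_mult)
  then show "measure (time_intensity c T) {a<..b} = c * (b - a)" using assms by (simp add: measure_def)
qed

lemma time_mark_intensity_rect:
  assumes "0 \<le> a" "a \<le> b" "b \<le> T" "0 \<le> c" "B \<in> sets borel" "B \<subseteq> {0..}" "emeasure lborel B = ennreal h" "0 \<le> h"
  shows "{a<..b} \<times> B \<in> sets (time_mark_intensity c T)" "emeasure (time_mark_intensity c T) ({a<..b} \<times> B) = ennreal (c * (b - a) * h)"
    "measure (time_mark_intensity c T) ({a<..b} \<times> B) = c * (b - a) * h"
proof -
  have s: "{a<..b} \<times> B \<in> sets borel" "{a<..b} \<times> B \<subseteq> {0..T} \<times> {0..}" using assms by (auto intro!: rect_borel)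
  show "{a<..b} \<times> B \<in> sets (time_mark_intensity c T)" using s by (intro time_mark_intensity_setsI)
  have "emeasure lborel ({a<..b} \<times> B) = ennreal (b - a) * ennreal h" using assms by (subst emeasure_lborel_rect) auto
  then show "emeasure (time_mark_intensity c T) ({a<..b} \<times> B) = ennreal (c * (b - a) * h)"
    using assms by (subst emeasure_time_mark_intensity[OF s]) (auto simp: ennreal_mult mult.assoc)
  then show "measure (time_mark_intensity c T) ({a<..b} \<times> B) = c * (b - a) * h" using assms by (simp add: measure_def)
qed

lemma mark_cell_borel: "mark_cell p i \<in> sets borel" "mark_cell p i \<subseteq> {0..}" "emeasure lborel (mark_cell p i) = ennreal (1 / 2 ^ p)"
proof -
  show "mark_cell p i \<in> sets borel" by (simp add: mark_cell_def)
  have "0 \<le> real i / 2 ^ p" by simp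
  then show "mark_cell p i \<subseteq> {0..}" unfolding mark_cell_def by (metis atLeastLessThan_iff atLeast_iff order_trans subsetI)
  have "real i / 2 ^ p \<le> real (Suc i) / 2 ^ p" by (intro divide_right_mono) auto
  then have "emeasure lborel (mark_cell p i) = ennreal (real (Suc i) / 2 ^ p - real i / 2 ^ p)" unfolding mark_cell_def by simp
  also have "real (Suc i) / 2 ^ p - real i / 2 ^ p = 1 / 2 ^ p" by (simp add: diff_divide_distrib[symmetric])
  finally show "emeasure lborel (mark_cell p i) = ennreal (1 / 2 ^ p)" .
qed

text \<open>\<open>enn2real\<close> would turn an infinite measure into the count 0; the value -1 is
  not a natural number and so cannot be mistaken for a count.\<close>

definition box_count :: "('w \<Rightarrow> 'b measure) \<Rightarrow> 'b set \<Rightarrow> 'w \<Rightarrow> real" where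
  "box_count N A \<omega> = (if emeasure (N \<omega>) A = \<infinity> then - 1 else enn2real (emeasure (N \<omega>) A))"

lemma box_count_eq: "box_count N A \<omega> = real k \<longleftrightarrow> emeasure (N \<omega>) A = of_nat k"
proof (cases "emeasure (N \<omega>) A")
  case (real r)
  then show ?thesis by (simp add: box_count_def ennreal_of_nat_eq_real_of_nat)
next
  case top
  moreover have "of_nat k \<noteq> (top :: ennreal)" by (simp add: ennreal_of_nat_eq_real_of_nat)
  ultimately show ?thesis by (simp add: box_count_def)
qed

lemma box_count_measure: "emeasure (N \<omega>) A < \<infinity> \<Longrightarrow> box_count N A \<omega> = measure (N \<omega>) A"
  by (simp add: box_count_def measure_def)

lemma space_borel_of: "space (borel_of X) = topspace X"
  unfolding borel_of_def by (intro space_measure_of) (auto dest: openin_subset)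

lemma borel_of_open: "openin X U \<Longrightarrow> U \<in> sets (borel_of X)"
  unfolding borel_of_def by (subst sets_measure_of) (auto dest: openin_subset)

section \<open>The sequence of queueing systems and the upper bound\<close>

locale mm1m_system =
  fixes lam mu th T x0 :: real
    and x :: "nat \<Rightarrow> real"
    and M :: "nat \<Rightarrow> 'w measure"
    and N1 N2 :: "nat \<Rightarrow> 'w \<Rightarrow> real measure"
    and N3 :: "nat \<Rightarrow> 'w \<Rightarrow> (real \<times> real) measure"
    and X Y :: "nat \<Rightarrow> 'w \<Rightarrow> real \<Rightarrow> real"
  assumes pos: "0 < lam" "0 < mu" "0 < th" "0 < T"
    and x: "\<And>n. 0 < n \<Longrightarrow> 0 \<le> x n" and x_lim: "x \<longlonglongrightarrow> x0"
    and prob: "\<And>n. 0 < n \<Longrightarrow> prob_space (M n)"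
    and noise: "\<And>n. 0 < n \<Longrightarrow> mm1m_noise (M n) lam mu th T n (N1 n) (N2 n) (N3 n)"
    and meas: "\<And>n. 0 < n \<Longrightarrow>
           (\<lambda>\<omega>. path_pair T (X n \<omega>) (Y n \<omega>)) \<in> M n \<rightarrow>\<^sub>M borel_of (skorohod_topology T ({0..} \<times> {0..}))"
    and eqs: "\<And>n. 0 < n \<Longrightarrow>
           AE \<omega> in M n. mm1m_equations T n (x n) (N1 n \<omega>) (N2 n \<omega>) (N3 n \<omega>) (X n \<omega>) (Y n \<omega>)"
begin

definition "qpath n \<omega> = path_pair T (X n \<omega>) (Y n \<omega>)"
definition "path_ok n \<omega> \<longleftrightarrow> queue_path T n (x n) (N1 n \<omega>) (N2 n \<omega>) (N3 n \<omega>) (X n \<omega>) (Y n \<omega>)"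

lemma x0_nonneg: "0 \<le> x0"
  using x by (intro LIMSEQ_le_const[OF x_lim]) (auto intro!: exI[of _ 1])

lemma prm: assumes "0 < n"
  shows "poisson_random_measure (M n) (time_intensity (real n * lam) T) (N1 n)"
    "poisson_random_measure (M n) (time_intensity (real n * mu) T) (N2 n)"
    "poisson_random_measure (M n) (time_mark_intensity (real n * th) T) (N3 n)"
  using noise[OF assms] by (auto simp: mm1m_noise_def)

lemma topspace_sk: "topspace (skorohod_topology T S) = cadlag_space T S"
proof -
  interpret S: Metric_space "cadlag_space T S" "skorohod_dist T"
    using pos by (intro Metric_space_skorohod) simp
  show ?thesis by (simp add: skorohod_topology_def)
qed

lemma path_cadlag: assumes "0 < n" "\<omega> \<in> space (M n)" shows "qpath n \<omega> \<in> cadlag_space T ({0..} \<times> {0..})"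
  using measurable_space[OF meas[OF assms(1)] assms(2)] by (simp add: space_borel_of topspace_sk qpath_def)

lemma path_event: assumes n: "0 < n" and F: "F \<in> sets (borel_of (skorohod_topology T ({0..} \<times> {0..})))"
  shows "{\<omega> \<in> space (M n). qpath n \<omega> \<in> F} \<in> sets (M n)"
proof -
  have "qpath n -` F \<inter> space (M n) \<in> sets (M n)" unfolding qpath_def[abs_def] using meas[OF n] F by (rule measurable_sets)
  also have "qpath n -` F \<inter> space (M n) = {\<omega> \<in> space (M n). qpath n \<omega> \<in> F}" by auto
  finally show ?thesis .
qed

lemma AE_path_ok: assumes n: "0 < n" shows "AE \<omega> in M n. path_ok n \<omega>"
proof -
  interpret prob_space "M n" by (rule prob[OF n])
  note P = prm[OF n]
  have tot: "emeasure (time_intensity (real n * c) T) {0..T} < \<infinity>" "{0..T} \<in> sets (time_intensity (real n * c) T)" for c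
    using pos by (auto simp: emeasure_time_intensity ennreal_mult_less_top intro!: time_intensity_setsI)
  have z: "{0} \<in> sets (time_intensity (real n * c) T)" "emeasure (time_intensity (real n * c) T) {0} = 0" for c
    using pos by (auto simp: emeasure_time_intensity intro!: time_intensity_setsI)
  have z3: "{0} \<times> {0..} \<in> sets (time_mark_intensity (real n * th) T)" "emeasure (time_mark_intensity (real n * th) T) ({0} \<times> {0..}) = 0"
  proof -
    have s: "{0::real} \<times> {0::real..} \<in> sets borel" "{0} \<times> {0..} \<subseteq> {0..T} \<times> {0::real..}" using pos by (auto intro!: rect_borel)
    then show "{0} \<times> {0..} \<in> sets (time_mark_intensity (real n * th) T)" by (rule time_mark_intensity_setsI)
    have "emeasure lborel ({0::real} \<times> {0::real..}) = 0" by (subst emeasure_lborel_rect) auto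
    then show "emeasure (time_mark_intensity (real n * th) T) ({0} \<times> {0..}) = 0"
      by (simp only: emeasure_time_mark_intensity[OF s] mult_zero_right)
  qed
  have f1: "AE \<omega> in M n. \<exists>k::nat. emeasure (N1 n \<omega>) {0..T} = of_nat k" by (rule poisson_random_measure_AE[OF P(1) tot(2) tot(1)])
  have f2: "AE \<omega> in M n. \<exists>k::nat. emeasure (N2 n \<omega>) {0..T} = of_nat k" by (rule poisson_random_measure_AE[OF P(2) tot(2) tot(1)])
  show ?thesis
    using f1 f2 poisson_random_measure_null[OF P(1) z] poisson_random_measure_null[OF P(2) z]
      poisson_random_measure_null[OF P(3) z3] eqs[OF n] AE_space
  proof eventually_elim
    case (elim \<omega>)
    show ?case
      unfolding path_ok_def
    proof
      show "sets (N1 n \<omega>) = sets (restrict_space borel {0..T})" "sets (N2 n \<omega>) = sets (restrict_space borel {0..T})"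
        "sets (N3 n \<omega>) = sets (restrict_space borel ({0..T} \<times> {0..}))"
        using P elim(7) by (auto simp: poisson_random_measure_def sets_time_intensity sets_time_mark_intensity)
      show "emeasure (N1 n \<omega>) {0..T} < \<infinity>" "emeasure (N2 n \<omega>) {0..T} < \<infinity>"
        using elim(1,2) by (auto simp: ennreal_of_nat_eq_real_of_nat)
      show "path_pair T (X n \<omega>) (Y n \<omega>) \<in> cadlag_space T ({0..} \<times> {0..})" using path_cadlag[OF n elim(7)] by (simp add: qpath_def)
    qed (use pos n x elim in auto)
  qed
qed

text \<open>A sum type collects the cells of all three random measures into one finite family, as
  \<open>poisson_family_upper\<close> requires.\<close>

definition "box_index p = {..<(2::nat) ^ p} <+> ({..<(2::nat) ^ p} <+> {..<(2::nat) ^ p} \<times> {..<p * 2 ^ p})"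

definition "grid_count n p j = (case j of Inl k \<Rightarrow> box_count (N1 n) (time_cell T p k)
   | Inr (Inl k) \<Rightarrow> box_count (N2 n) (time_cell T p k)
   | Inr (Inr (k, i)) \<Rightarrow> box_count (N3 n) (time_cell T p k \<times> mark_cell p i))"

definition "grid_weight p j = (case j of Inl k \<Rightarrow> lam * (T / 2 ^ p) | Inr (Inl k) \<Rightarrow> mu * (T / 2 ^ p)
   | Inr (Inr (k, i)) \<Rightarrow> th * (T / 2 ^ p) / 2 ^ p)"

definition "grid_cost n p \<omega> = (\<Sum>j\<in>box_index p. relent (grid_count n p j \<omega> / n) (grid_weight p j))"

lemma box_index_cases:
  assumes "j \<in> box_index p"
  obtains k where "k < 2 ^ p" "j = Inl k" | k where "k < 2 ^ p" "j = Inr (Inl k)"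
    | k i where "k < 2 ^ p" "i < p * 2 ^ p" "j = Inr (Inr (k, i))"
  using assms unfolding box_index_def by auto

lemma time_cell_facts: assumes "k < 2 ^ p" "0 \<le> c"
  shows "time_cell T p k \<in> sets (time_intensity c T)" "emeasure (time_intensity c T) (time_cell T p k) < \<infinity>"
    "measure (time_intensity c T) (time_cell T p k) = c * (T / 2 ^ p)"
proof -
  have l: "0 \<le> tgrid T p k" "tgrid T p k \<le> tgrid T p (Suc k)" "tgrid T p (Suc k) \<le> T"
    using tgrid_mem[OF pos(4), of k p] tgrid_mem[OF pos(4), of "Suc k" p] tgrid_mono[OF pos(4), of k "Suc k" p] assms by auto
  show "time_cell T p k \<in> sets (time_intensity c T)" "emeasure (time_intensity c T) (time_cell T p k) < \<infinity>"
    "measure (time_intensity c T) (time_cell T p k) = c * (T / 2 ^ p)"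
    using time_intensity_Ioc[OF l assms(2)] unfolding time_cell_def by (auto simp: tgrid_Suc)
qed

lemma box_facts: assumes "k < 2 ^ p" "0 \<le> c" "B \<in> sets borel" "B \<subseteq> {0..}" "emeasure lborel B = ennreal h" "0 \<le> h"
  shows "time_cell T p k \<times> B \<in> sets (time_mark_intensity c T)" "emeasure (time_mark_intensity c T) (time_cell T p k \<times> B) < \<infinity>"
    "measure (time_mark_intensity c T) (time_cell T p k \<times> B) = c * (T / 2 ^ p) * h"
proof -
  have l: "0 \<le> tgrid T p k" "tgrid T p k \<le> tgrid T p (Suc k)" "tgrid T p (Suc k) \<le> T"
    using tgrid_mem[OF pos(4), of k p] tgrid_mem[OF pos(4), of "Suc k" p] tgrid_mono[OF pos(4), of k "Suc k" p] assms by auto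
  show "time_cell T p k \<times> B \<in> sets (time_mark_intensity c T)" "emeasure (time_mark_intensity c T) (time_cell T p k \<times> B) < \<infinity>"
    "measure (time_mark_intensity c T) (time_cell T p k \<times> B) = c * (T / 2 ^ p) * h"
    using time_mark_intensity_rect[OF l assms(2-6)] unfolding time_cell_def by (auto simp: tgrid_Suc)
qed

lemma mark_box_facts: assumes "k < 2 ^ p" "0 \<le> c"
  shows "time_cell T p k \<times> mark_cell p i \<in> sets (time_mark_intensity c T)"
    "emeasure (time_mark_intensity c T) (time_cell T p k \<times> mark_cell p i) < \<infinity>"
    "measure (time_mark_intensity c T) (time_cell T p k \<times> mark_cell p i) = c * (T / 2 ^ p) / 2 ^ p"
  using box_facts[OF assms mark_cell_borel] by auto

lemma grid_count_measurable: assumes n: "0 < n" and j: "j \<in> box_index p" shows "grid_count n p j \<in> borel_measurable (M n)"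
proof -
  have *: "box_count N A \<in> borel_measurable (M n)" if "(\<lambda>\<omega>. emeasure (N \<omega>) A) \<in> borel_measurable (M n)" for N :: "'w \<Rightarrow> 'b measure" and A
    unfolding box_count_def using that by measurable
  have nn: "0 \<le> real n * lam" "0 \<le> real n * mu" "0 \<le> real n * th" using pos by auto
  show ?thesis
    using j
  proof (cases rule: box_index_cases)
    case (1 k)
    then show ?thesis using prm(1)[OF n] time_cell_facts(1)[OF _ nn(1), of k p]
      by (auto simp: grid_count_def poisson_random_measure_def intro!: *)
  next
    case (2 k)
    then show ?thesis using prm(2)[OF n] time_cell_facts(1)[OF _ nn(2), of k p]
      by (auto simp: grid_count_def poisson_random_measure_def intro!: *)
  next
    case (3 k i)
    then show ?thesis using prm(3)[OF n] mark_box_facts(1)[OF _ nn(3), of k p i]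
      by (auto simp: grid_count_def poisson_random_measure_def intro!: *)
  qed
qed

lemma grid_count_marginal: assumes n: "0 < n" and j: "j \<in> box_index p"
  shows "measure (M n) {\<omega> \<in> space (M n). grid_count n p j \<omega> = real c} = poisson_weight (real n * grid_weight p j) c"
proof -
  have nn: "0 \<le> real n * lam" "0 \<le> real n * mu" "0 \<le> real n * th" using pos by auto
  show ?thesis
    using j
  proof (cases rule: box_index_cases)
    case (1 k)
    then show ?thesis using prm(1)[OF n] time_cell_facts[OF _ nn(1), of k p]
      by (simp add: grid_count_def grid_weight_def box_count_eq poisson_random_measure_def poisson_weight_def mult.assoc)
  next
    case (2 k)
    then show ?thesis using prm(2)[OF n] time_cell_facts[OF _ nn(2), of k p]
      by (simp add: grid_count_def grid_weight_def box_count_eq poisson_random_measure_def poisson_weight_def mult.assoc)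
  next
    case (3 k i)
    then show ?thesis using prm(3)[OF n] mark_box_facts[OF _ nn(3), of k p i]
      by (simp add: grid_count_def grid_weight_def box_count_eq poisson_random_measure_def poisson_weight_def mult.assoc)
  qed
qed

lemma grid_count_joint: assumes n: "0 < n"
  shows "measure (M n) {\<omega> \<in> space (M n). \<forall>j\<in>box_index p. grid_count n p j \<omega> = real (\<kappa> j)} =
    (\<Prod>j\<in>box_index p. poisson_weight (real n * grid_weight p j) (\<kappa> j))"
proof -
  interpret prob_space "M n" by (rule prob[OF n])
  have nn: "0 \<le> real n * lam" "0 \<le> real n * mu" "0 \<le> real n * th" using pos by auto
  let ?P = "{..<(2::nat) ^ p} \<times> {..<p * 2 ^ p}"
  \<comment> \<open>Pairs of indices are encoded because \<open>poisson_random_measure\<close>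
    states independence for families indexed by natural numbers.\<close>
  let ?J3 = "prod_encode ` ?P"
  define A3 where "A3 j = (case prod_decode j of (k, i) \<Rightarrow> time_cell T p k \<times> mark_cell p i)" for j
  have "measure (M n) {\<omega> \<in> space (M n). (\<forall>k\<in>{..<2 ^ p}. emeasure (N1 n \<omega>) (time_cell T p k) = of_nat (\<kappa> (Inl k))) \<and>
      (\<forall>k\<in>{..<2 ^ p}. emeasure (N2 n \<omega>) (time_cell T p k) = of_nat (\<kappa> (Inr (Inl k)))) \<and>
      (\<forall>j\<in>?J3. emeasure (N3 n \<omega>) (A3 j) = of_nat (\<kappa> (Inr (Inr (prod_decode j)))))} =
     (\<Prod>k<2 ^ p. poisson_weight (measure (time_intensity (real n * lam) T) (time_cell T p k)) (\<kappa> (Inl k))) *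
     (\<Prod>k<2 ^ p. poisson_weight (measure (time_intensity (real n * mu) T) (time_cell T p k)) (\<kappa> (Inr (Inl k)))) *
     (\<Prod>j\<in>?J3. poisson_weight (measure (time_mark_intensity (real n * th) T) (A3 j)) (\<kappa> (Inr (Inr (prod_decode j)))))"
  proof (rule mm1m_noise_joint[OF noise[OF n]])
    show "disjoint_family_on (time_cell T p) {..<2 ^ p}" using time_cell_disjoint[OF pos(4)] by (auto simp: disjoint_family_on_def)
    then show "disjoint_family_on (time_cell T p) {..<2 ^ p}" .
    show "disjoint_family_on A3 ?J3"
      unfolding disjoint_family_on_def
    proof (intro ballI impI)
      fix a b assume "a \<in> ?J3" "b \<in> ?J3" and ab: "a \<noteq> b"
      then obtain k i k' i' where e: "a = prod_encode (k, i)" "b = prod_encode (k', i')" by auto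
      then have "k \<noteq> k' \<or> i \<noteq> i'" using ab by auto
      then show "A3 a \<inter> A3 b = {}"
        using time_cell_disjoint[OF pos(4), of k k' p] mark_cell_disjoint[of i i' p] unfolding e A3_def by auto
    qed
    show "A3 j \<in> sets (time_mark_intensity (real n * th) T)" "emeasure (time_mark_intensity (real n * th) T) (A3 j) < \<infinity>" if "j \<in> ?J3" for j
      using that mark_box_facts[OF _ nn(3)] by (auto simp: A3_def)
  qed (use time_cell_facts nn in auto)
  also have "{\<omega> \<in> space (M n). (\<forall>k\<in>{..<2 ^ p}. emeasure (N1 n \<omega>) (time_cell T p k) = of_nat (\<kappa> (Inl k))) \<and>
      (\<forall>k\<in>{..<2 ^ p}. emeasure (N2 n \<omega>) (time_cell T p k) = of_nat (\<kappa> (Inr (Inl k)))) \<and>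
      (\<forall>j\<in>?J3. emeasure (N3 n \<omega>) (A3 j) = of_nat (\<kappa> (Inr (Inr (prod_decode j)))))} =
      {\<omega> \<in> space (M n). \<forall>j\<in>box_index p. grid_count n p j \<omega> = real (\<kappa> j)}"
  proof (intro Collect_cong conj_cong refl)
    fix \<omega>
    show "((\<forall>k\<in>{..<2 ^ p}. emeasure (N1 n \<omega>) (time_cell T p k) = of_nat (\<kappa> (Inl k))) \<and>
      (\<forall>k\<in>{..<2 ^ p}. emeasure (N2 n \<omega>) (time_cell T p k) = of_nat (\<kappa> (Inr (Inl k)))) \<and>
      (\<forall>j\<in>?J3. emeasure (N3 n \<omega>) (A3 j) = of_nat (\<kappa> (Inr (Inr (prod_decode j)))))) =
      (\<forall>j\<in>box_index p. grid_count n p j \<omega> = real (\<kappa> j))"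
    proof -
      have "(\<forall>j\<in>box_index p. Q j) \<longleftrightarrow> (\<forall>k\<in>{..<2 ^ p}. Q (Inl k)) \<and> (\<forall>k\<in>{..<2 ^ p}. Q (Inr (Inl k))) \<and> (\<forall>z\<in>?P. Q (Inr (Inr z)))" for Q
        unfolding box_index_def by auto
      then show ?thesis by (simp add: grid_count_def A3_def box_count_eq)
    qed
  qed
  also have "(\<Prod>k<2 ^ p. poisson_weight (measure (time_intensity (real n * lam) T) (time_cell T p k)) (\<kappa> (Inl k))) =
     (\<Prod>k<2 ^ p. poisson_weight (real n * grid_weight p (Inl k)) (\<kappa> (Inl k)))"
    using time_cell_facts(3)[OF _ nn(1)] by (intro prod.cong refl) (simp add: grid_weight_def mult.assoc)
  also have "(\<Prod>k<2 ^ p. poisson_weight (measure (time_intensity (real n * mu) T) (time_cell T p k)) (\<kappa> (Inr (Inl k)))) =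
     (\<Prod>k<2 ^ p. poisson_weight (real n * grid_weight p (Inr (Inl k))) (\<kappa> (Inr (Inl k))))"
    using time_cell_facts(3)[OF _ nn(2)] by (intro prod.cong refl) (simp add: grid_weight_def mult.assoc)
  also have "(\<Prod>j\<in>?J3. poisson_weight (measure (time_mark_intensity (real n * th) T) (A3 j)) (\<kappa> (Inr (Inr (prod_decode j))))) =
     (\<Prod>z\<in>?P. poisson_weight (measure (time_mark_intensity (real n * th) T) (A3 (prod_encode z))) (\<kappa> (Inr (Inr z))))"
    by (subst prod.reindex) (auto simp: inj_on_def)
  also have "\<dots> = (\<Prod>z\<in>?P. poisson_weight (real n * grid_weight p (Inr (Inr z))) (\<kappa> (Inr (Inr z))))"
    using mark_box_facts(3)[OF _ nn(3)] by (intro prod.cong refl) (auto simp: grid_weight_def A3_def mult.assoc)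
  finally show ?thesis
    unfolding box_index_def by (simp add: prod.Plus mult.assoc)
qed

lemma grid_cost_upper: assumes n: "0 < n"
  shows "measure (M n) {\<omega> \<in> space (M n). m \<le> grid_cost n p \<omega>} \<le>
    (2 * card (box_index p) + (real n * (\<bar>m\<bar> + 2 * (\<Sum>j\<in>box_index p. grid_weight p j)) + 2) ^ card (box_index p)) * exp (- (real n * m))"
proof -
  interpret prob_space "M n" by (rule prob[OF n])
  show ?thesis
    unfolding grid_cost_def
  proof (rule poisson_family_upper)
    show "finite (box_index p)" by (simp add: box_index_def)
    show "0 < grid_weight p j" if "j \<in> box_index p" for j
      using that pos by (cases rule: box_index_cases) (auto simp: grid_weight_def)
  qed (use n grid_count_measurable grid_count_marginal grid_count_joint in auto)
qed

definition "boxes_ok n p \<omega> \<longleftrightarrow> (\<forall>k<2 ^ p. \<forall>i<p * 2 ^ p. emeasure (N3 n \<omega>) (time_cell T p k \<times> mark_cell p i) < \<infinity>)"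

lemma AE_boxes_ok: assumes n: "0 < n" shows "AE \<omega> in M n. boxes_ok n p \<omega>"
proof -
  interpret prob_space "M n" by (rule prob[OF n])
  have nn: "0 \<le> real n * th" using pos by auto
  have "AE \<omega> in M n. \<forall>z\<in>{..<2 ^ p} \<times> {..<p * 2 ^ p}. emeasure (N3 n \<omega>) (time_cell T p (fst z) \<times> mark_cell p (snd z)) < \<infinity>"
  proof (rule AE_finite_allI)
    fix z :: "nat \<times> nat" assume "z \<in> {..<2 ^ p} \<times> {..<p * 2 ^ p}"
    then have k: "fst z < 2 ^ p" by auto
    have "AE \<omega> in M n. \<exists>c::nat. emeasure (N3 n \<omega>) (time_cell T p (fst z) \<times> mark_cell p (snd z)) = of_nat c"
      by (rule poisson_random_measure_AE[OF prm(3)[OF n] mark_box_facts(1,2)[OF k nn]])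
    then show "AE \<omega> in M n. emeasure (N3 n \<omega>) (time_cell T p (fst z) \<times> mark_cell p (snd z)) < \<infinity>"
      by eventually_elim (auto simp: ennreal_of_nat_eq_real_of_nat)
  qed simp
  then show ?thesis unfolding boxes_ok_def by eventually_elim auto
qed

lemma grid_cost_eq:
  assumes ok: "path_ok n \<omega>" and box: "boxes_ok n p \<omega>"
  shows "grid_cost n p \<omega> = (\<Sum>k<2 ^ p. relent (measure (N1 n \<omega>) (time_cell T p k) / n) (lam * (T / 2 ^ p)))
       + (\<Sum>k<2 ^ p. relent (measure (N2 n \<omega>) (time_cell T p k) / n) (mu * (T / 2 ^ p)))
       + (\<Sum>k<2 ^ p. \<Sum>i<p * 2 ^ p. relent (measure (N3 n \<omega>) (time_cell T p k \<times> mark_cell p i) / n) (th * (T / 2 ^ p) / 2 ^ p))"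
proof -
  interpret Q: queue_path T n "x n" "N1 n \<omega>" "N2 n \<omega>" "N3 n \<omega>" "X n \<omega>" "Y n \<omega>" using ok by (simp add: path_ok_def)
  have 1: "box_count (N1 n) (time_cell T p k) \<omega> = measure (N1 n \<omega>) (time_cell T p k)"
    "box_count (N2 n) (time_cell T p k) \<omega> = measure (N2 n \<omega>) (time_cell T p k)" if k: "k < 2 ^ p" for k
    using finite_measure.emeasure_finite[OF Q.finite_measure1] finite_measure.emeasure_finite[OF Q.finite_measure2]
    by (auto intro!: box_count_measure simp: less_top)
  have 2: "box_count (N3 n) (time_cell T p k \<times> mark_cell p i) \<omega> = measure (N3 n \<omega>) (time_cell T p k \<times> mark_cell p i)"
    if "k < 2 ^ p" "i < p * 2 ^ p" for k i using box that by (intro box_count_measure) (auto simp: boxes_ok_def)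
  have "grid_cost n p \<omega> = (\<Sum>k<2 ^ p. relent (box_count (N1 n) (time_cell T p k) \<omega> / n) (lam * (T / 2 ^ p)))
       + ((\<Sum>k<2 ^ p. relent (box_count (N2 n) (time_cell T p k) \<omega> / n) (mu * (T / 2 ^ p)))
       + (\<Sum>z\<in>{..<2 ^ p} \<times> {..<p * 2 ^ p}. relent (grid_count n p (Inr (Inr z)) \<omega> / n) (grid_weight p (Inr (Inr z)))))"
    unfolding grid_cost_def box_index_def by (simp add: sum.Plus grid_count_def grid_weight_def)
  also have "(\<Sum>z\<in>{..<2 ^ p} \<times> {..<p * 2 ^ p}. relent (grid_count n p (Inr (Inr z)) \<omega> / n) (grid_weight p (Inr (Inr z)))) =
      (\<Sum>k<2 ^ p. \<Sum>i<p * 2 ^ p. relent (box_count (N3 n) (time_cell T p k \<times> mark_cell p i) \<omega> / n) (th * (T / 2 ^ p) / 2 ^ p))"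
    unfolding sum.cartesian_product by (intro sum.cong refl) (auto simp: grid_count_def grid_weight_def)
  finally show ?thesis using 1 2 by (simp add: add.assoc)
qed

text \<open>If no grid level works, then for every \<open>p\<close> there is some
  \<open>n \<ge> p\<close> and a realisation outside the null events whose path lies in
  \<open>F\<close> although its grid cost is below \<open>m\<close>. Such a sequence is
  deterministic and satisfies \<open>entropy_bounded\<close>; a limit of its paths lies in the
  closed set \<open>F\<close> and has rate at most \<open>m\<close>, a contradiction.\<close>

lemma upper_key:
  assumes F: "closedin (skorohod_topology T ({0..} \<times> {0..})) F" and m: "0 \<le> m"
    and I: "\<And>z. z \<in> F \<Longrightarrow> ennreal m < mm1m_rate lam mu th x0 T z"
  shows "\<exists>p n0. \<forall>n\<ge>n0. 0 < n \<longrightarrow> (AE \<omega> in M n. qpath n \<omega> \<in> F \<longrightarrow> m \<le> grid_cost n p \<omega>)"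
proof (rule ccontr)
  assume "\<not> ?thesis"
  then have neg: "\<And>p n0. \<exists>n\<ge>n0. 0 < n \<and> \<not> (AE \<omega> in M n. qpath n \<omega> \<in> F \<longrightarrow> m \<le> grid_cost n p \<omega>)" by blast
  have "\<exists>n \<omega>. n \<ge> p \<and> 0 < n \<and> path_ok n \<omega> \<and> boxes_ok n p \<omega> \<and> qpath n \<omega> \<in> F \<and> grid_cost n p \<omega> < m" for p
  proof -
    obtain n where n: "n \<ge> p" "0 < n" "\<not> (AE \<omega> in M n. qpath n \<omega> \<in> F \<longrightarrow> m \<le> grid_cost n p \<omega>)" using neg by blast
    have "\<exists>\<omega>. path_ok n \<omega> \<and> boxes_ok n p \<omega> \<and> qpath n \<omega> \<in> F \<and> grid_cost n p \<omega> < m"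
    proof (rule ccontr)
      assume none: "\<not> ?thesis"
      have "AE \<omega> in M n. qpath n \<omega> \<in> F \<longrightarrow> m \<le> grid_cost n p \<omega>"
        using AE_path_ok[OF n(2)] AE_boxes_ok[OF n(2), of p] by eventually_elim (use none in force)
      then show False using n(3) by blast
    qed
    then show ?thesis using n by blast
  qed
  then obtain nn ww where nw: "\<And>p. nn p \<ge> p \<and> 0 < nn p \<and> path_ok (nn p) (ww p) \<and> boxes_ok (nn p) p (ww p) \<and> qpath (nn p) (ww p) \<in> F \<and> grid_cost (nn p) p (ww p) < m"
    by metis
  obtain bx where bx: "\<And>n. x n \<le> bx" using convergent_imp_Bseq[OF convergentI[OF x_lim]] unfolding Bseq_def by (auto simp: abs_le_iff)
  \<comment> \<open>A bound on the queue length common to all \<open>n\<close>. The levels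
    \<open>L p\<close> start at \<open>P0\<close>, so that the mark grid is always higher than
    \<open>B\<close>.\<close>
  define B where "B = bx + m + 2 * lam * T"
  define P0 where "P0 = nat \<lceil>B + 1\<rceil>"
  define L where "L p = P0 + p" for p
  define n where "n p = nn (L p)" for p
  define \<omega> where "\<omega> p = ww (L p)" for p
  have nL: "n p \<ge> L p" "0 < n p" "path_ok (n p) (\<omega> p)" "boxes_ok (n p) (L p) (\<omega> p)" "qpath (n p) (\<omega> p) \<in> F" "grid_cost (n p) (L p) (\<omega> p) < m" for p
    using nw[of "L p"] by (auto simp: n_def \<omega>_def)
  define f where "f p = X (n p) (\<omega> p)" for p
  define g where "g p = Y (n p) (\<omega> p)" for p
  have good: "good_path T (n p) (x (n p)) (N1 (n p) (\<omega> p)) (N2 (n p) (\<omega> p)) (N3 (n p) (\<omega> p)) (f p) (g p) lam mu th m B (L p)" for p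
  proof -
    interpret Q: queue_path T "n p" "x (n p)" "N1 (n p) (\<omega> p)" "N2 (n p) (\<omega> p)" "N3 (n p) (\<omega> p)" "f p" "g p"
      using nL(3)[of p] by (simp add: path_ok_def f_def g_def)
    show ?thesis
    proof
      show "x (n p) + m + 2 * lam * T \<le> B" using bx by (simp add: B_def)
      have "B + 1 \<le> real P0" unfolding P0_def by linarith
      then show "B + 1 \<le> real (L p)" by (simp add: L_def)
    qed (use pos nL[of p] grid_cost_eq[OF nL(3,4), of p] in \<open>auto simp: boxes_ok_def\<close>)
  qed
  \<comment> \<open>The six witnesses of \<open>level_facts\<close> are packed into a tuple, to be
    chosen for all \<open>p\<close> at once.\<close>
  define pk where "pk p D \<longleftrightarrow> (case D of (A, S, osc, strip, y, w) \<Rightarrow>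
     level_facts lam mu th m T (L p) (n p) (x (n p)) A S (g p) (f p) osc strip y w)" for p D
  have "\<exists>D. pk p D" for p
    using good_path.level_facts[OF good[of p]] unfolding pk_def by auto
  then obtain D where D: "\<And>p. pk p (D p)" by metis
  define A where "A p = fst (D p)" for p
  define S where "S p = fst (snd (D p))" for p
  define osc where "osc p = fst (snd (snd (D p)))" for p
  define strip where "strip p = fst (snd (snd (snd (D p))))" for p
  define y where "y p = fst (snd (snd (snd (snd (D p)))))" for p
  define w where "w p = snd (snd (snd (snd (snd (D p)))))" for p
  have lf: "level_facts lam mu th m T (L p) (n p) (x (n p)) (A p) (S p) (g p) (f p) (osc p) (strip p) (y p) (w p)" for p
    using D[of p] unfolding pk_def A_def S_def osc_def strip_def y_def w_def by (simp add: case_prod_beta)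
  note lf' = level_factsD[OF lf]
  have Lq: "\<forall>\<^sub>F p in sequentially. q \<le> L p" for q unfolding L_def by (rule eventually_sequentiallyI[of q]) simp
  have Linf: "filterlim L at_top sequentially" unfolding L_def filterlim_at_top
  proof
    fix Z show "\<forall>\<^sub>F p in sequentially. Z \<le> P0 + p" by (rule eventually_sequentiallyI[of Z]) simp
  qed
  have ninf: "filterlim n at_top sequentially"
    by (rule filterlim_at_top_mono[OF Linf]) (use nL in auto)
  have n1: "(\<lambda>p. 1 / real (n p)) \<longlonglongrightarrow> 0"
    by (rule filterlim_compose[OF lim_1_over_n ninf])
  have L1: "(\<lambda>p. 1 / 2 ^ L p) \<longlonglongrightarrow> (0::real)"
  proof -
    have "(\<lambda>p. 1 / 2 ^ p) \<longlonglongrightarrow> (0::real)" by real_asymp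
    then show ?thesis by (rule filterlim_compose[OF _ Linf])
  qed
  \<comment> \<open>The weight contains the height \<open>L p\<close> of the mark grid, but the mesh
    \<open>T / 2 ^ L p\<close> outweighs it.\<close>
  have osc0: "osc \<longlonglongrightarrow> 0"
  proof (rule tendsto_zero_dual)
    show "0 \<le> osc p" for p by (rule lf'(7))
    show "b * osc p \<le> 3 * m + exp b * ((lam + mu + th * real (L p)) * (T / 2 ^ L p))" if "0 < b" for p b using that by (rule lf'(9))
    have "(\<lambda>p. (lam + mu + th * real p) * (T / 2 ^ p)) \<longlonglongrightarrow> 0" by real_asymp
    then show "(\<lambda>p. (lam + mu + th * real (L p)) * (T / 2 ^ L p)) \<longlonglongrightarrow> 0" by (rule filterlim_compose[OF _ Linf])
  qed (use m in simp)
  have strip0: "strip \<longlonglongrightarrow> 0"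
  proof (rule tendsto_zero_dual)
    show "0 \<le> strip p" for p by (rule lf'(8))
    show "b * strip p \<le> m + exp b * (th * T * (2 * osc p + 1 / real (n p) + 2 / 2 ^ L p))" if "0 < b" for p b using that by (rule lf'(10))
    have "(\<lambda>p. th * T * (2 * osc p + 1 / real (n p) + 2 * (1 / 2 ^ L p))) \<longlonglongrightarrow> th * T * (2 * 0 + 0 + 2 * 0)"
      by (intro tendsto_intros osc0 n1 L1)
    then show "(\<lambda>p. th * T * (2 * osc p + 1 / real (n p) + 2 / 2 ^ L p)) \<longlonglongrightarrow> 0" by simp
  qed (use m in simp)
  have xn: "(\<lambda>p. x (n p)) \<longlonglongrightarrow> x0" by (rule filterlim_compose[OF x_lim ninf])
  interpret E: entropy_bounded lam mu th x0 T m A S g f y w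
  proof
    show "mono_on {0..T} (A p)" "mono_on {0..T} (S p)" "mono_on {0..T} (g p)" for p by (rule lf'(1) lf'(2) lf'(3))+
    show "(\<lambda>p. A p 0) \<longlonglongrightarrow> 0" "(\<lambda>p. S p 0) \<longlonglongrightarrow> 0" "(\<lambda>p. g p 0) \<longlonglongrightarrow> 0" by (simp_all add: lf'(4-6))
    show "\<forall>\<^sub>F p in sequentially. \<forall>t\<in>{0..T}. \<bar>f p t - skorohod_map (\<lambda>r. x0 + A p r - S p r - g p r) t\<bar> \<le> e" if e: "0 < e" for e
    proof -
      have "\<forall>\<^sub>F p in sequentially. osc p < e / 4" using osc0 e by (intro order_tendstoD) auto
      moreover have "\<forall>\<^sub>F p in sequentially. dist (x (n p)) x0 < e / 4" using xn e by (intro tendstoD) auto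
      ultimately show ?thesis
      proof (eventually_elim, intro ballI)
        fix p t assume o: "osc p < e / 4" and d: "dist (x (n p)) x0 < e / 4" and t: "t \<in> {0..T}"
        have l1: "\<bar>f p t - skorohod_map (\<lambda>r. x (n p) + A p r - S p r - g p r) t\<bar> \<le> 2 * osc p" using t by (rule lf'(11))
        have "\<bar>skorohod_map (\<lambda>r. x (n p) + A p r - S p r - g p r) t - skorohod_map (\<lambda>r. x0 + A p r - S p r - g p r) t\<bar> \<le> 2 * (e / 4)"
        proof (rule skorohod_map_lipschitz[of _ "- S p T - g p T"])
          fix s assume "s \<in> {0..t}"
          then have s: "s \<in> {0..T}" using t by auto
          note m3 = lf'(1-4)[of p]
          have "0 \<le> A p s" "S p s \<le> S p T" "g p s \<le> g p T"
            using mono_onD[OF m3(1), of 0 s] mono_onD[OF m3(2), of s T] mono_onD[OF m3(3), of s T] m3(4) s pos by auto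
          then show "- S p T - g p T \<le> x (n p) + A p s - S p s - g p s" using x[OF nL(2), of p] by linarith
          show "\<bar>x (n p) + A p s - S p s - g p s - (x0 + A p s - S p s - g p s)\<bar> \<le> e / 4" using d by (simp add: dist_real_def)
        qed (use t in auto)
        then show "\<bar>f p t - skorohod_map (\<lambda>r. x0 + A p r - S p r - g p r) t\<bar> \<le> e" using l1 o by linarith
      qed
    qed
    show "\<forall>\<^sub>F p in sequentially. \<forall>b1 b2 b3. dual_cost T (A p) (\<lambda>t. lam * t) q b1 + dual_cost T (S p) (\<lambda>t. mu * t) q b2
         + (\<Sum>k<2 ^ q. b3 k * y p q k - (exp (b3 k) - 1) * w p q k) \<le> m + e" if e: "0 < e" for q e
      using Lq[of q]
    proof (eventually_elim, intro allI)
      fix p b1 b2 b3 assume "q \<le> L p"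
      then have "dual_cost T (A p) (\<lambda>t. lam * t) q b1 + dual_cost T (S p) (\<lambda>t. mu * t) q b2
         + (\<Sum>k<2 ^ q. b3 k * y p q k - (exp (b3 k) - 1) * w p q k) \<le> m" by (rule lf'(12))
      then show "dual_cost T (A p) (\<lambda>t. lam * t) q b1 + dual_cost T (S p) (\<lambda>t. mu * t) q b2
         + (\<Sum>k<2 ^ q. b3 k * y p q k - (exp (b3 k) - 1) * w p q k) \<le> m + e" using e by linarith
    qed
    show "(\<lambda>p. y p q k - incr T (g p) q k) \<longlonglongrightarrow> 0" if k: "k < 2 ^ q" for q k
    proof (rule Lim_null_comparison[OF _ strip0])
      show "\<forall>\<^sub>F p in sequentially. norm (y p q k - incr T (g p) q k) \<le> strip p"
        using Lq[of q]
      proof eventually_elim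
        case (elim p)
        then have "\<bar>y p q k - incr T (g p) q k\<bar> \<le> strip p" using k by (intro lf'(13))
        then show ?case by simp
      qed
    qed
    show "\<forall>\<^sub>F p in sequentially. \<forall>h d. continuous_on {0..T} h \<longrightarrow> (\<forall>t\<in>{0..T}. \<bar>f p t - h t\<bar> \<le> d) \<longrightarrow>
       \<bar>w p q k - th * integral {tgrid T q k..tgrid T q (Suc k)} h\<bar> \<le> th * (T / 2 ^ q) * d + e" if k: "k < 2 ^ q" and e: "0 < e" for q k e
    proof -
      have "(\<lambda>p. th * (T / 2 ^ q) * (2 * osc p + 1 / real (n p) + 1 / 2 ^ L p)) \<longlonglongrightarrow> th * (T / 2 ^ q) * (2 * 0 + 0 + 0)"
        by (intro tendsto_intros osc0 n1 L1)
      then have "\<forall>\<^sub>F p in sequentially. th * (T / 2 ^ q) * (2 * osc p + 1 / real (n p) + 1 / 2 ^ L p) < e"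
        using e by (intro order_tendstoD(2)) auto
      then show ?thesis using Lq[of q]
      proof (eventually_elim, intro allI impI)
        fix p h d assume s: "th * (T / 2 ^ q) * (2 * osc p + 1 / real (n p) + 1 / 2 ^ L p) < e" and q: "q \<le> L p"
          and h: "continuous_on {0..T} h" "\<forall>t\<in>{0..T}. \<bar>f p t - h t\<bar> \<le> d"
        have "\<bar>w p q k - th * integral {tgrid T q k..tgrid T q (Suc k)} h\<bar> \<le> th * (T / 2 ^ q) * (d + (2 * osc p + 1 / real (n p) + 1 / 2 ^ L p))"
          using q k h by (rule lf'(14))
        also have "\<dots> = th * (T / 2 ^ q) * d + th * (T / 2 ^ q) * (2 * osc p + 1 / real (n p) + 1 / 2 ^ L p)" by (rule distrib_left)
        finally show "\<bar>w p q k - th * integral {tgrid T q k..tgrid T q (Suc k)} h\<bar> \<le> th * (T / 2 ^ q) * d + e" using s by linarith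
      qed
    qed
  qed (use pos m x0_nonneg in auto)
  obtain r \<xi> \<zeta> where r: "strict_mono r" and lim: "continuous_on {0..T} \<xi>" "continuous_on {0..T} \<zeta>"
      "uniform_limit {0..T} (\<lambda>i. f (r i)) \<xi> sequentially" "uniform_limit {0..T} (\<lambda>i. g (r i)) \<zeta> sequentially"
      "\<And>t. t \<in> {0..T} \<Longrightarrow> 0 \<le> \<xi> t" "\<And>t. t \<in> {0..T} \<Longrightarrow> 0 \<le> \<zeta> t"
      "\<exists>\<phi>\<in>controls lam mu th x0 T \<xi> \<zeta>. control_cost lam mu th T \<xi> \<phi> \<le> ennreal m"
    by (rule E.limit_has_control) blast
  define Z where "Z i = qpath (n (r i)) (\<omega> (r i))" for i
  have ZF: "Z i \<in> F" for i using nL(5) by (simp add: Z_def)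
  have Zc: "Z i \<in> cadlag_space T ({0..} \<times> {0..})" for i using ZF closedin_subset[OF F] topspace_sk by blast
  have Zv: "fst (Z i t) = f (r i) t" "snd (Z i t) = g (r i) t" if "t \<in> {0..T}" for i t
    using that by (auto simp: Z_def qpath_def path_pair_def f_def g_def)
  have u1: "uniform_limit {0..T} (\<lambda>i t. fst (Z i t)) \<xi> sequentially"
    using lim(3) by (rule uniform_limit_cong'[THEN iffD1, rotated -1]) (auto simp: Zv)
  have u2: "uniform_limit {0..T} (\<lambda>i t. snd (Z i t)) \<zeta> sequentially"
    using lim(4) by (rule uniform_limit_cong'[THEN iffD1, rotated -1]) (auto simp: Zv)
  have "limitin (skorohod_topology T ({0..} \<times> {0..})) Z (path_pair T \<xi> \<zeta>) sequentially"
    by (rule rate_limit[OF pos(4) Zc lim(1,2) u1 u2 lim(5,6)])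
  then have "path_pair T \<xi> \<zeta> \<in> F" using F ZF by (intro limitin_closedin[of _ Z _ sequentially]) auto
  from I[OF this] have I': "ennreal m < (INF \<phi>\<in>controls lam mu th x0 T \<xi> \<zeta>. control_cost lam mu th T \<xi> \<phi>)"
    by (simp add: mm1m_rate_path_pair[OF lim(1,2)])
  obtain \<phi> where \<phi>: "\<phi> \<in> controls lam mu th x0 T \<xi> \<zeta>" "control_cost lam mu th T \<xi> \<phi> \<le> ennreal m" using lim(7) by blast
  have "(INF \<phi>\<in>controls lam mu th x0 T \<xi> \<zeta>. control_cost lam mu th T \<xi> \<phi>) \<le> ennreal m"
    using \<phi> by (rule INF_lower2)
  then show False using I' by (simp add: leD)
qed

lemma upper_limit:
  fixes P :: "nat \<Rightarrow> real"
  assumes C: "0 \<le> C" and P: "\<And>n. n \<ge> n0 \<Longrightarrow> 0 < n \<Longrightarrow> 0 \<le> P n \<and> P n \<le> (2 * real D + (real n * C + 2) ^ D) * exp (- (real n * m))"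
  shows "limsup (\<lambda>n. ereal (1 / real n) * elog (P n)) \<le> - ereal m"
proof -
  \<comment> \<open>Large enough for \<open>n * E\<close> to exceed both \<open>n * C + 2\<close>
    and \<open>2 * D + 1\<close>, so that the whole prefactor is at most
    \<open>(n * E) ^ (D + 1)\<close>.\<close>
  define E where "E = C + 3 + 2 * real D"
  define h where "h n = real (D + 1) * (ln (real n) + ln E) / real n - m" for n
  have E: "3 \<le> E" using C by (simp add: E_def)
  have "h \<longlonglongrightarrow> - m"
  proof -
    have "(\<lambda>n. real (D + 1) * (ln (real n) + ln E) / real n) \<longlonglongrightarrow> 0" by real_asymp
    then have "(\<lambda>n. real (D + 1) * (ln (real n) + ln E) / real n - m) \<longlonglongrightarrow> 0 - m" by (intro tendsto_intros)
    then show ?thesis by (simp add: h_def[abs_def])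
  qed
  then have lim: "(\<lambda>n. ereal (h n)) \<longlonglongrightarrow> ereal (- m)" by simp
  have "\<forall>\<^sub>F n in sequentially. ereal (1 / real n) * elog (P n) \<le> ereal (h n)"
  proof (rule eventually_sequentiallyI[of "max 1 n0"])
    fix n assume "n \<ge> max 1 n0"
    then have n: "n \<ge> n0" "0 < n" "1 \<le> real n" by auto
    show "ereal (1 / real n) * elog (P n) \<le> ereal (h n)"
    proof (cases "P n = 0")
      case True then show ?thesis using n by (simp add: elog_def)
    next
      case False
      then have P0: "0 < P n" using P[OF n(1,2)] by simp
      have nE: "1 \<le> real n * E" using mult_mono[OF n(3), of 1 E] E by simp
      have CE: "real n * C + 2 \<le> real n * E"
      proof -
        have "2 \<le> real n * (3 + 2 * real D)" using mult_mono[OF n(3), of 2 "3 + 2 * real D"] by simp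
        then show ?thesis by (simp add: E_def algebra_simps)
      qed
      have "2 * real D + (real n * C + 2) ^ D \<le> 2 * real D * (real n * E) ^ D + (real n * E) ^ D"
      proof (intro add_mono power_mono CE)
        have "1 \<le> (real n * E) ^ D" using nE by simp
        then show "2 * real D \<le> 2 * real D * (real n * E) ^ D" using mult_left_mono[of 1 "(real n * E) ^ D" "2 * real D"] by simp
      qed (use C in simp)
      also have "\<dots> = (2 * real D + 1) * (real n * E) ^ D" by (simp add: algebra_simps)
      also have "\<dots> \<le> (real n * E) * (real n * E) ^ D"
      proof (intro mult_right_mono)
        have "1 * (2 * real D + 1) \<le> real n * E" using n(3) C by (intro mult_mono) (auto simp: E_def)
        then show "2 * real D + 1 \<le> real n * E" by simp
      qed (use nE in auto)
      finally have "2 * real D + (real n * C + 2) ^ D \<le> (real n * E) ^ (D + 1)" by simp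
      then have "P n \<le> (real n * E) ^ (D + 1) * exp (- (real n * m))"
        using P[OF n(1,2)] by (meson exp_ge_zero mult_right_mono order_trans)
      then have "ln (P n) \<le> ln ((real n * E) ^ (D + 1) * exp (- (real n * m)))" using P0 by (simp add: ln_mono)
      also have "\<dots> = real (D + 1) * (ln (real n) + ln E) - real n * m"
        using n E by (simp add: ln_mult ln_realpow distrib_right)
      finally have "ln (P n) / real n \<le> (real (D + 1) * (ln (real n) + ln E) - real n * m) / real n"
        using n by (intro divide_right_mono) auto
      then show ?thesis using False n by (simp add: elog_def h_def diff_divide_distrib)
    qed
  qed
  then have "limsup (\<lambda>n. ereal (1 / real n) * elog (P n)) \<le> limsup (\<lambda>n. ereal (h n))" by (rule Limsup_mono)
  also have "\<dots> = ereal (- m)" by (rule lim_imp_Limsup[OF sequentially_bot lim])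
  finally show ?thesis by simp
qed

theorem ldp_upper:
  assumes F: "closedin (skorohod_topology T ({0..} \<times> {0..})) F"
  shows "limsup (\<lambda>n. ereal (1 / real n) * elog (measure (M n) {\<omega> \<in> space (M n). qpath n \<omega> \<in> F}))
     \<le> - (INF z\<in>F. enn2ereal (mm1m_rate lam mu th x0 T z))" (is "?L \<le> - ?I")
proof -
  have key: "?L \<le> - ereal m" if m: "ereal m < ?I" for m
  proof (cases "0 \<le> m")
    case True
    have "ennreal m < mm1m_rate lam mu th x0 T z" if "z \<in> F" for z
    proof -
      have "ereal m < enn2ereal (mm1m_rate lam mu th x0 T z)" using m that by (meson INF_lower less_le_trans)
      then show ?thesis using True
        by (cases "mm1m_rate lam mu th x0 T z") (auto simp: ennreal_less_iff enn2ereal_ennreal)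
    qed
    from upper_key[OF F True this] obtain p n0 where pn: "\<And>n. n \<ge> n0 \<Longrightarrow> 0 < n \<Longrightarrow> (AE \<omega> in M n. qpath n \<omega> \<in> F \<longrightarrow> m \<le> grid_cost n p \<omega>)"
      by blast
    let ?C = "\<bar>m\<bar> + 2 * (\<Sum>j\<in>box_index p. grid_weight p j)"
    show ?thesis
    proof (rule upper_limit[of ?C n0 _ "card (box_index p)"])
      have "0 \<le> grid_weight p j" if "j \<in> box_index p" for j
        using that pos by (cases rule: box_index_cases) (auto simp: grid_weight_def)
      then show "0 \<le> ?C" by (intro add_nonneg_nonneg mult_nonneg_nonneg sum_nonneg) auto
      fix n assume n: "n \<ge> n0" "0 < n"
      interpret prob_space "M n" by (rule prob[OF n(2)])
      have gm: "{\<omega> \<in> space (M n). m \<le> grid_cost n p \<omega>} \<in> sets (M n)"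
      proof -
        have "grid_cost n p \<in> borel_measurable (M n)"
          unfolding grid_cost_def relent_def using grid_count_measurable[OF n(2)]
          by (intro borel_measurable_sum borel_measurable_add borel_measurable_diff borel_measurable_times borel_measurable_ln borel_measurable_divide) auto
        then show ?thesis by measurable
      qed
      have "measure (M n) {\<omega> \<in> space (M n). qpath n \<omega> \<in> F} \<le> measure (M n) {\<omega> \<in> space (M n). m \<le> grid_cost n p \<omega>}"
        using pn[OF n] gm by (intro finite_measure_mono_AE) auto
      then show "0 \<le> measure (M n) {\<omega> \<in> space (M n). qpath n \<omega> \<in> F} \<and> measure (M n) {\<omega> \<in> space (M n). qpath n \<omega> \<in> F}
         \<le> (2 * real (card (box_index p)) + (real n * ?C + 2) ^ card (box_index p)) * exp (- (real n * m))"
        using grid_cost_upper[OF n(2), of m p] by simp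
    qed
  next
    \<comment> \<open>Negative \<open>m\<close> is treated apart because \<open>ennreal\<close>
      would truncate it; probabilities are at most 1, and the trivial bound 0 suffices.\<close>
    case False
    have "?L \<le> limsup (\<lambda>n. 0)"
    proof (intro Limsup_mono eventually_sequentiallyI[of 1])
      fix n :: nat assume n: "1 \<le> n"
      interpret prob_space "M n" using n by (intro prob) simp
      have "elog (measure (M n) {\<omega> \<in> space (M n). qpath n \<omega> \<in> F}) \<le> 0"
      proof -
        let ?p = "prob {\<omega> \<in> space (M n). qpath n \<omega> \<in> F}"
        have "?p \<le> 1" "0 \<le> ?p" by simp_all
        then show ?thesis unfolding elog_def by (cases "?p = 0") (auto simp: ln_le_zero_iff less_le)
      qed
      then show "ereal (1 / real n) * elog (measure (M n) {\<omega> \<in> space (M n). qpath n \<omega> \<in> F}) \<le> 0"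
        by (simp add: ereal_mult_le_0_iff)
    qed
    also have "\<dots> = 0" by (simp add: Limsup_const)
    also have "0 \<le> - ereal m" using False by simp
    finally show ?thesis .
  qed
  show ?thesis
  proof (rule ccontr)
    assume "\<not> ?thesis"
    then have "- ?I < ?L" by simp
    then have "- ?L < ?I" by (rule ereal_uminus_less_reorder[THEN iffD1])
    then obtain m where m: "- ?L < ereal m" "ereal m < ?I" using ereal_dense2 by blast
    from m(1) have "- ereal m < ?L" by (rule ereal_uminus_less_reorder[THEN iffD1])
    then show False using leD[OF key[OF m(2)]] by contradiction
  qed
qed

end

section \<open>Tracking a path with finite cost\<close>

text \<open>Adding \<open>D\<close> raises the running infimum by at most \<open>D t\<close> and the
  path at time \<open>t\<close> by exactly \<open>D t\<close>. This is why dropped reneging can only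
  push the queue upwards.\<close>

lemma skorohod_map_shift:
  fixes \<psi> D :: "real \<Rightarrow> real"
  assumes t: "0 \<le> t" and b: "\<And>s. s \<in> {0..t} \<Longrightarrow> b \<le> \<psi> s" and D: "\<And>s. s \<in> {0..t} \<Longrightarrow> 0 \<le> D s \<and> D s \<le> D t"
  shows "skorohod_map \<psi> t \<le> skorohod_map (\<lambda>r. \<psi> r + D r) t"
proof -
  have "(INF s\<in>{0..t}. min (\<psi> s + D s) 0) \<le> (INF s\<in>{0..t}. min (\<psi> s) 0) + D t"
  proof (rule INF_min_diff_le[OF t])
    show "b \<le> \<psi> s + D s" if "s \<in> {0..t}" for s using b[OF that] D[OF that] by simp
    show "\<psi> s + D s \<le> \<psi> s + D t" if "s \<in> {0..t}" for s using D[OF that] by simp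
    show "0 \<le> D t" using D[of t] t by simp
  qed
  then show ?thesis by (simp add: skorohod_map_def)
qed

lemma grid_comparison:
  assumes T: "0 < T" and m: "mono_on {0..T} F" "mono_on {0..T} h"
    and g: "\<And>k. k \<le> 2 ^ p \<Longrightarrow> \<bar>F (tgrid T p k) - h (tgrid T p k)\<bar> \<le> d"
    and i: "\<And>k. k < 2 ^ p \<Longrightarrow> incr T h p k \<le> e" and t: "t \<in> {0..T}"
  shows "\<bar>F t - h t\<bar> \<le> d + e"
proof -
  obtain k where k: "k < 2 ^ p" "tgrid T p k \<le> t" "t \<le> tgrid T p (Suc k)" using find_cell[OF T t] .
  have l: "tgrid T p k \<in> {0..T}" "tgrid T p (Suc k) \<in> {0..T}" using tgrid_mem[OF T] k by auto
  have "F (tgrid T p k) \<le> F t" "F t \<le> F (tgrid T p (Suc k))" "h (tgrid T p k) \<le> h t" "h t \<le> h (tgrid T p (Suc k))"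
    using k l t by (auto intro!: mono_onD[OF m(1)] mono_onD[OF m(2)])
  moreover have "h (tgrid T p (Suc k)) - h (tgrid T p k) \<le> e" using i[OF k(1)] by (simp add: incr_def)
  moreover have "\<bar>F (tgrid T p k) - h (tgrid T p k)\<bar> \<le> d" "\<bar>F (tgrid T p (Suc k)) - h (tgrid T p (Suc k))\<bar> \<le> d"
    using g[of k] g[of "Suc k"] k by auto
  ultimately show ?thesis by linarith
qed

text \<open>Rounding errors accumulate over the cells. With error \<open>1 / n\<close> per cell the
  total \<open>2 ^ p / n\<close> is harmless, since the grid is fixed while \<open>n\<close>
  grows.\<close>

lemma grid_sum_close:
  assumes T: "0 < T" and F0: "F 0 = 0" "h 0 = 0" and c: "\<And>k. k < 2 ^ p \<Longrightarrow> \<bar>incr T F p k - incr T h p k\<bar> \<le> e" and k: "k \<le> 2 ^ p"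
  shows "\<bar>F (tgrid T p k) - h (tgrid T p k)\<bar> \<le> 2 ^ p * e"
proof -
  have e: "0 \<le> e" using c[of 0] by simp
  have "\<bar>F (tgrid T p k) - h (tgrid T p k)\<bar> = \<bar>\<Sum>j<k. incr T F p j - incr T h p j\<bar>"
    using sum_incr_less[of T F p k] sum_incr_less[of T h p k] F0 by (simp add: sum_subtractf)
  also have "\<dots> \<le> (\<Sum>j<k. e)" using k c by (intro order_trans[OF sum_abs] sum_mono) auto
  also have "\<dots> = real k * e" by simp
  also have "\<dots> \<le> 2 ^ p * e"
  proof (intro mult_right_mono e)
    have "real k \<le> real (2 ^ p)" using k by (simp only: of_nat_le_iff)
    then show "real k \<le> 2 ^ p" by simp
  qed
  finally show ?thesis .
qed

text \<open>The marks that are used in a cell with target value \<open>c\<close>. The margin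
  \<open>3 * \<eta>\<close> covers the oscillation of the target, the tolerance of the queue below
  it, and the term \<open>1 / n\<close> in the level, each at most \<open>\<eta>\<close>. Below the
  threshold \<open>\<delta>\<close> no marks are used.\<close>

definition lower_box :: "real \<Rightarrow> real \<Rightarrow> real \<Rightarrow> real set" where
  "lower_box \<delta> \<eta> c = (if \<delta> \<le> c then {0..c - 3 * \<eta>} else {})"

text \<open>The marks that are forbidden: all the others up to \<open>c + \<eta> + \<kappa>\<close>,
  which the level cannot exceed as long as the queue is at most \<open>\<kappa>\<close> above the
  target.\<close>

definition strip_box :: "real \<Rightarrow> real \<Rightarrow> real \<Rightarrow> real \<Rightarrow> real set" where
  "strip_box \<delta> \<eta> \<kappa> c = (if \<delta> \<le> c then {c - 3 * \<eta><..c + \<eta> + \<kappa>} else {0..c + \<eta> + \<kappa>})"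

text \<open>\<open>Z\<close> bounds the reneging mass of the target in the cells where no marks are
  used. Dropping it lifts the reflected path by at most \<open>2 * Z\<close>, by the Lipschitz
  constant of the Skorohod map, hence \<open>2 * Z + \<eta> \<le> \<kappa>\<close>. The tolerance
  below the target covers only rounding errors and oscillations, which \<open>err\<close> keeps
  under \<open>\<eta>\<close>.\<close>

locale lower_path = queue_path +
  fixes x0 :: real and a s \<zeta> \<xi> :: "real \<Rightarrow> real" and p :: nat and \<eta> \<delta> \<kappa> \<epsilon> Z :: real
  assumes par: "0 < \<eta>" "0 \<le> \<epsilon>" "3 * \<eta> < \<delta>" "2 * Z + \<eta> \<le> \<kappa>" "0 \<le> x0"
    and amono: "mono_on {0..T} a" "mono_on {0..T} s" "mono_on {0..T} \<zeta>" and a0: "a 0 = 0" "s 0 = 0" "\<zeta> 0 = 0"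
    and xi_cont: "continuous_on {0..T} \<xi>" and xi_nn: "\<And>t. t \<in> {0..T} \<Longrightarrow> 0 \<le> \<xi> t"
    and xi_eq: "\<And>t. t \<in> {0..T} \<Longrightarrow> \<xi> t = skorohod_map (\<lambda>r. x0 + a r - s r - \<zeta> r) t"
    and xi_osc: "\<And>k t. k < 2 ^ p \<Longrightarrow> t \<in> {tgrid T p k..tgrid T p (Suc k)} \<Longrightarrow> \<bar>\<xi> t - \<xi> (tgrid T p k)\<bar> \<le> \<eta>"
    and incs: "\<And>k. k < 2 ^ p \<Longrightarrow> incr T a p k \<le> \<epsilon>" "\<And>k. k < 2 ^ p \<Longrightarrow> incr T s p k \<le> \<epsilon>" "\<And>k. k < 2 ^ p \<Longrightarrow> incr T \<zeta> p k \<le> \<epsilon>"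
    and Zsum: "(\<Sum>k<2 ^ p. if \<delta> \<le> \<xi> (tgrid T p k) then 0 else incr T \<zeta> p k) \<le> Z"
    and n_eta: "1 / n \<le> \<eta>" and err: "2 * (\<bar>xn - x0\<bar> + 3 * (2 ^ p / n + \<epsilon>)) + 2 * \<epsilon> < \<eta>"
    and c1: "\<And>k. k < 2 ^ p \<Longrightarrow> \<bar>measure \<nu>1 (time_cell T p k) / n - incr T a p k\<bar> \<le> 1 / n"
    and c2: "\<And>k. k < 2 ^ p \<Longrightarrow> \<bar>measure \<nu>2 (time_cell T p k) / n - incr T s p k\<bar> \<le> 1 / n"
      "\<And>k. k < 2 ^ p \<Longrightarrow> measure \<nu>2 (time_cell T p k) / n \<le> incr T s p k"
    and c3: "\<And>k. k < 2 ^ p \<Longrightarrow> emeasure \<nu>3 (time_cell T p k \<times> lower_box \<delta> \<eta> (\<xi> (tgrid T p k))) < \<infinity>"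
      "\<And>k. k < 2 ^ p \<Longrightarrow> \<delta> \<le> \<xi> (tgrid T p k) \<Longrightarrow>
         \<bar>measure \<nu>3 (time_cell T p k \<times> lower_box \<delta> \<eta> (\<xi> (tgrid T p k))) / n - incr T \<zeta> p k\<bar> \<le> 1 / n"
    and c4: "\<And>k. k < 2 ^ p \<Longrightarrow> emeasure \<nu>3 (time_cell T p k \<times> strip_box \<delta> \<eta> \<kappa> (\<xi> (tgrid T p k))) = 0"
begin

abbreviation "lo k \<equiv> time_cell T p k \<times> lower_box \<delta> \<eta> (\<xi> (tgrid T p k))"
abbreviation "st k \<equiv> time_cell T p k \<times> strip_box \<delta> \<eta> \<kappa> (\<xi> (tgrid T p k))"

lemma grid: "k < 2 ^ p \<Longrightarrow> tgrid T p k \<in> {0..T} \<and> tgrid T p (Suc k) \<in> {0..T} \<and> tgrid T p k \<le> tgrid T p (Suc k)"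
  using tgrid_mem[OF T] tgrid_mono[OF T] by auto

lemma incr_arr: "k < 2 ^ p \<Longrightarrow> incr T arr p k = measure \<nu>1 (time_cell T p k) / n"
  unfolding incr_def time_cell_def using grid[of k] by (intro arr_diff) auto

lemma incr_srv: "k < 2 ^ p \<Longrightarrow> incr T srv p k = measure \<nu>2 (time_cell T p k) / n"
  unfolding incr_def time_cell_def using grid[of k] by (intro srv_diff) auto

lemma arr_close: "t \<in> {0..T} \<Longrightarrow> \<bar>arr t - a t\<bar> \<le> 2 ^ p / n + \<epsilon>"
  using grid_sum_close[of T arr a p "1 / n"] T at_0 a0 c1 incr_arr
  by (intro grid_comparison[OF T arr_mono amono(1) _ incs(1)]) auto

lemma srv_close: "t \<in> {0..T} \<Longrightarrow> \<bar>srv t - s t\<bar> \<le> 2 ^ p / n + \<epsilon>"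
  using grid_sum_close[of T srv s p "1 / n"] T at_0 a0 c2 incr_srv
  by (intro grid_comparison[OF T srv_mono amono(2) _ incs(2)]) auto

lemma kap: "0 \<le> Z" "0 < \<kappa>"
proof -
  have "0 \<le> (\<Sum>k<2 ^ p. if \<delta> \<le> \<xi> (tgrid T p k) then 0 else incr T \<zeta> p k)"
    using incr_nonneg[OF amono(3) T] by (intro sum_nonneg) auto
  then show "0 \<le> Z" using Zsum by simp
  then show "0 < \<kappa>" using par by simp
qed

lemma lo_sets: assumes k: "k < 2 ^ p" shows "lo k \<in> sets \<nu>3"
proof (rule sets3I)
  show "lo k \<in> sets borel" by (intro rect_borel) (auto simp: time_cell_def lower_box_def)
  show "lo k \<subseteq> {0..T} \<times> {0..}" using time_cell_subset[OF T k] by (auto simp: lower_box_def split: if_splits)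
qed

lemma st_sets: assumes k: "k < 2 ^ p" shows "st k \<in> sets \<nu>3"
proof (rule sets3I)
  show "st k \<in> sets borel" by (intro rect_borel) (auto simp: time_cell_def strip_box_def)
  show "st k \<subseteq> {0..T} \<times> {0..}" using time_cell_subset[OF T k] par by (auto simp: strip_box_def split: if_splits)
qed

text \<open>\<open>G\<close> is the reneging path that results if exactly the marks of the lower
  boxes count; unlike \<open>g\<close> it does not refer to \<open>f\<close>. \<open>D\<close> is
  the dropped mass of \<open>\<zeta>\<close>, credited at the right end of each cell.\<close>

definition "Lo t = (\<Union>k<2 ^ p. lo k) \<inter> {0..t} \<times> UNIV"
definition "G t = measure \<nu>3 (Lo t) / n"
definition "D t = (\<Sum>k<2 ^ p. if \<delta> \<le> \<xi> (tgrid T p k) then 0 else if tgrid T p (Suc k) \<le> t then incr T \<zeta> p k else 0)"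

lemma Lo_sets: "t \<in> {0..T} \<Longrightarrow> Lo t \<in> sets \<nu>3"
proof -
  assume t: "t \<in> {0..T}"
  have "Lo t = (\<Union>k<2 ^ p. lo k) \<inter> ({0..t} \<times> {0..})" unfolding Lo_def by (auto simp: lower_box_def split: if_splits)
  also have "\<dots> \<in> sets \<nu>3"
    using t by (intro sets.Int sets.finite_UN lo_sets sets3I borel_closed closed_Times) auto
  finally show ?thesis .
qed

lemma Lo_finite: "t \<in> {0..T} \<Longrightarrow> emeasure \<nu>3 (Lo t) < \<infinity>"
proof -
  assume t: "t \<in> {0..T}"
  have "emeasure \<nu>3 (Lo t) \<le> emeasure \<nu>3 (\<Union>k<2 ^ p. lo k)"
    using t by (intro emeasure_mono sets.finite_UN lo_sets) (auto simp: Lo_def)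
  also have "\<dots> \<le> (\<Sum>k<2 ^ p. emeasure \<nu>3 (lo k))" by (intro emeasure_subadditive_finite) (auto intro: lo_sets)
  also have "\<dots> < \<infinity>" using c3(1) by (auto simp: less_top[symmetric] sum_Pinfty)
  finally show ?thesis .
qed

lemma G_mono: "mono_on {0..T} G"
proof (rule mono_onI)
  fix u v assume uv: "u \<in> {0..T}" "v \<in> {0..T}" "u \<le> v"
  have "measure \<nu>3 (Lo u) \<le> measure \<nu>3 (Lo v)"
    using uv Lo_finite[of v] by (intro measure_mono_fmeasurable Lo_sets) (auto simp: fmeasurable_def Lo_def intro!: Lo_sets[unfolded Lo_def])
  then show "G u \<le> G v" by (simp add: G_def divide_right_mono)
qed

lemma G_0: "G 0 = 0"
proof -
  have "Lo 0 = {}"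
  proof -
    have "0 < u" if "k < 2 ^ p" "u \<in> time_cell T p k" for u k using that grid[of k] by (auto simp: time_cell_def)
    then show ?thesis unfolding Lo_def by force
  qed
  then show ?thesis by (simp add: G_def)
qed

lemma incr_G: assumes k: "k < 2 ^ p" shows "incr T G p k = measure \<nu>3 (lo k) / n"
proof -
  have "Lo (tgrid T p (Suc k)) - Lo (tgrid T p k) = lo k"
  proof (intro equalityI subsetI)
    fix z assume z: "z \<in> Lo (tgrid T p (Suc k)) - Lo (tgrid T p k)"
    then have "z \<in> Lo (tgrid T p (Suc k))" by simp
    then obtain j where j: "j < 2 ^ p" "z \<in> lo j" "fst z \<in> {0..tgrid T p (Suc k)}"
      unfolding Lo_def Int_iff UN_iff mem_Times_iff lessThan_iff by blast
    have "fst z \<notin> {0..tgrid T p k}" using z j(1,2) by (force simp: Lo_def)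
    then have "tgrid T p k < fst z" "fst z \<le> tgrid T p (Suc k)" using j(3) by auto
    then have "fst z \<in> time_cell T p k" "fst z \<in> time_cell T p j" using j(2) by (auto simp: time_cell_def)
    then have "j = k" using time_cell_disjoint[OF T, of j k p] by blast
    then show "z \<in> lo k" using j by simp
  next
    fix z assume z: "z \<in> lo k"
    then show "z \<in> Lo (tgrid T p (Suc k)) - Lo (tgrid T p k)" using grid[OF k] k by (auto simp: Lo_def time_cell_def)
  qed
  moreover have "measure \<nu>3 (Lo (tgrid T p (Suc k)) - Lo (tgrid T p k)) = measure \<nu>3 (Lo (tgrid T p (Suc k))) - measure \<nu>3 (Lo (tgrid T p k))"
    using grid[OF k] Lo_finite[of "tgrid T p (Suc k)"] by (intro measure_Diff Lo_sets) (auto simp: Lo_def)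
  ultimately show ?thesis by (simp add: incr_def G_def diff_divide_distrib)
qed

lemma D_facts: "mono_on {0..T} D" "D 0 = 0" "t \<in> {0..T} \<Longrightarrow> 0 \<le> D t" "t \<in> {0..T} \<Longrightarrow> D t \<le> Z"
proof -
  have inc: "0 \<le> incr T \<zeta> p k" if "k < 2 ^ p" for k using incr_nonneg[OF amono(3) T that] .
  show "mono_on {0..T} D" unfolding D_def by (intro mono_onI sum_mono) (auto intro: inc)
  have "\<not> tgrid T p (Suc k) \<le> 0" for k using T by (simp add: tgrid_def not_le zero_less_divide_iff zero_less_mult_iff)
  then show "D 0 = 0" unfolding D_def by (intro sum.neutral) auto
  show "0 \<le> D t" if "t \<in> {0..T}" unfolding D_def by (intro sum_nonneg) (auto intro: inc)
  have "D t \<le> (\<Sum>k<2 ^ p. if \<delta> \<le> \<xi> (tgrid T p k) then 0 else incr T \<zeta> p k)"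
    unfolding D_def by (intro sum_mono) (auto intro: inc)
  then show "D t \<le> Z" using Zsum by simp
qed

lemma incr_D: assumes k: "k < 2 ^ p" shows "incr T D p k = (if \<delta> \<le> \<xi> (tgrid T p k) then 0 else incr T \<zeta> p k)"
proof -
  have tg: "tgrid T p (Suc j) \<le> tgrid T p i \<longleftrightarrow> Suc j \<le> i" for i j
    using T by (simp add: tgrid_def divide_le_cancel) linarith
  have "incr T D p k = (\<Sum>j<2 ^ p. (if \<delta> \<le> \<xi> (tgrid T p j) then 0 else if Suc j \<le> Suc k then incr T \<zeta> p j else 0) -
      (if \<delta> \<le> \<xi> (tgrid T p j) then 0 else if Suc j \<le> k then incr T \<zeta> p j else 0))"
    unfolding incr_def[of T D] D_def tg by (simp add: sum_subtractf)
  also have "\<dots> = (\<Sum>j<2 ^ p. if j = k then (if \<delta> \<le> \<xi> (tgrid T p k) then 0 else incr T \<zeta> p k) else 0)"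
    by (intro sum.cong refl) auto
  finally show ?thesis using k by simp
qed

lemma GD_close: assumes t: "t \<in> {0..T}" shows "\<bar>G t + D t - \<zeta> t\<bar> \<le> 2 ^ p / n + \<epsilon>"
proof -
  have m: "mono_on {0..T} (\<lambda>t. G t + D t)" using G_mono D_facts(1) by (auto simp: mono_on_def intro: add_mono)
  have "\<bar>incr T (\<lambda>t. G t + D t) p k - incr T \<zeta> p k\<bar> \<le> 1 / n" if k: "k < 2 ^ p" for k
  proof -
    have "incr T (\<lambda>t. G t + D t) p k = incr T G p k + incr T D p k" by (simp add: incr_def)
    then show ?thesis using incr_G[OF k] incr_D[OF k] c3(2)[OF k]
      by (cases "\<delta> \<le> \<xi> (tgrid T p k)") (auto simp: lower_box_def)
  qed
  then have "\<bar>G (tgrid T p k) + D (tgrid T p k) - \<zeta> (tgrid T p k)\<bar> \<le> 2 ^ p * (1 / n)" if "k \<le> 2 ^ p" for k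
    using grid_sum_close[of T "\<lambda>t. G t + D t" \<zeta> p "1 / n" k] T a0 that G_0 D_facts(2) by simp
  then show ?thesis using grid_comparison[OF T m amono(3) _ incs(3) t, of "2 ^ p * (1 / n)"] by simp
qed

lemma find_open_cell: assumes "u \<in> {0<..T}" obtains k where "k < 2 ^ p" "u \<in> time_cell T p k"
proof -
  define k where "k = nat (\<lceil>u * 2 ^ p / T\<rceil> - 1)"
  have "0 < u * 2 ^ p / T" using assms T by simp
  then have k: "real k = of_int \<lceil>u * 2 ^ p / T\<rceil> - 1" by (simp add: k_def)
  then have "real k < u * 2 ^ p / T" "u * 2 ^ p / T \<le> real k + 1" by linarith+
  then have c: "u \<in> time_cell T p k" using T by (auto simp: time_cell_def tgrid_def field_simps)
  have "k < 2 ^ p"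
  proof (rule ccontr)
    assume "\<not> ?thesis"
    then have "tgrid T p (2 ^ p) \<le> tgrid T p k" by (intro tgrid_mono T) simp
    then show False using c assms by (simp add: time_cell_def)
  qed
  then show thesis using c that by blast
qed

text \<open>While the queue stays within its tolerances, the level lies above the lower boxes and
  below the top of the strips, which carry no points. Left limits involve earlier times only, so
  information about \<open>u < t\<close> determines \<open>g t\<close>.\<close>

lemma g_eq_G:
  assumes t: "t \<in> {0..T}" and inv: "\<And>u. 0 \<le> u \<Longrightarrow> u < t \<Longrightarrow> \<xi> u - \<eta> \<le> f u \<and> f u \<le> \<xi> u + \<kappa>"
  shows "g t = G t"
proof -
  have lev: "\<xi> (tgrid T p k) - 3 * \<eta> \<le> level u" "level u \<le> \<xi> (tgrid T p k) + \<eta> + \<kappa>"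
    if k: "k < 2 ^ p" and u: "u \<in> time_cell T p k" "u \<le> t" for k u
  proof -
    note gr = grid[OF k]
    have uT: "u \<in> {0<..T}" "tgrid T p k < u" using gr u by (auto simp: time_cell_def)
    have b: "\<xi> (tgrid T p k) - 2 * \<eta> \<le> f v \<and> f v \<le> \<xi> (tgrid T p k) + \<eta> + \<kappa>" if v: "v \<in> {0..T}" "tgrid T p k < v" "v < u" for v
      using inv[of v] xi_osc[OF k, of v] v u by (auto simp: time_cell_def)
    have l: "\<xi> (tgrid T p k) - 2 * \<eta> \<le> left_limit f u" "left_limit f u \<le> \<xi> (tgrid T p k) + \<eta> + \<kappa>"
      using left_limit_bounds[OF uT b] by auto
    show "\<xi> (tgrid T p k) - 3 * \<eta> \<le> level u" using l(1) n_eta by (auto simp: level_def)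
    have "0 \<le> \<xi> (tgrid T p k) + \<eta> + \<kappa>" using xi_nn[of "tgrid T p k"] gr par kap by simp
    moreover have "0 \<le> 1 / real n" by simp
    ultimately show "level u \<le> \<xi> (tgrid T p k) + \<eta> + \<kappa>" unfolding level_def using l(2) by (intro max.boundedI) linarith+
  qed
  have sub1: "Lo t \<subseteq> region t"
  proof
    fix z assume "z \<in> Lo t"
    then obtain k where k: "k < 2 ^ p" "z \<in> lo k" "fst z \<in> {0..t}" by (auto simp: Lo_def)
    then have z: "fst z \<in> time_cell T p k" "0 \<le> snd z" "snd z \<le> \<xi> (tgrid T p k) - 3 * \<eta>"
      by (auto simp: lower_box_def split: if_splits)
    then have "snd z \<le> level (fst z)" using lev(1)[OF k(1) z(1)] k(3) by simp
    then show "z \<in> region t" using z k by (auto simp: region_def case_prod_beta)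
  qed
  let ?N = "{0} \<times> {0..} \<union> (\<Union>k<2 ^ p. st k)"
  have sub2: "region t \<subseteq> Lo t \<union> ?N"
  proof
    fix z assume z: "z \<in> region t"
    then have z': "fst z \<in> {0..t}" "0 \<le> snd z" "snd z \<le> level (fst z)" by (auto simp: region_def)
    show "z \<in> Lo t \<union> ?N"
    proof (cases "fst z = 0")
      case True then show ?thesis using z' by (cases z) auto
    next
      case False
      then obtain k where k: "k < 2 ^ p" "fst z \<in> time_cell T p k" using find_open_cell[of "fst z"] z' t by auto
      have "snd z \<le> \<xi> (tgrid T p k) + \<eta> + \<kappa>" using lev(2)[OF k] z' by simp
      then have "snd z \<in> lower_box \<delta> \<eta> (\<xi> (tgrid T p k)) \<or> snd z \<in> strip_box \<delta> \<eta> \<kappa> (\<xi> (tgrid T p k))"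
        using z' by (auto simp: lower_box_def strip_box_def)
      then show ?thesis using k z' by (cases z) (auto simp: Lo_def)
    qed
  qed
  have Ns: "?N \<in> sets \<nu>3" using T by (intro sets.Un sets.finite_UN st_sets sets3I borel_closed closed_Times) auto
  have "emeasure \<nu>3 ?N \<le> emeasure \<nu>3 ({0} \<times> {0..}) + emeasure \<nu>3 (\<Union>k<2 ^ p. st k)"
    using T by (intro emeasure_subadditive sets.finite_UN st_sets sets3I borel_closed closed_Times) auto
  also have "emeasure \<nu>3 (\<Union>k<2 ^ p. st k) \<le> (\<Sum>k<2 ^ p. emeasure \<nu>3 (st k))"
    by (intro emeasure_subadditive_finite) (auto intro: st_sets)
  also have "\<dots> = 0" using c4 by simp
  finally have N0: "emeasure \<nu>3 ?N = 0" using null by simp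
  have "emeasure \<nu>3 (region t) \<le> emeasure \<nu>3 (Lo t \<union> ?N)" by (rule emeasure_mono[OF sub2 sets.Un[OF Lo_sets[OF t] Ns]])
  also have "\<dots> \<le> emeasure \<nu>3 (Lo t) + emeasure \<nu>3 ?N" by (rule emeasure_subadditive[OF Lo_sets[OF t] Ns])
  finally have "emeasure \<nu>3 (region t) \<le> emeasure \<nu>3 (Lo t)" using N0 by simp
  moreover have "emeasure \<nu>3 (Lo t) \<le> emeasure \<nu>3 (region t)"
    using sub1 t by (intro emeasure_mono sets3I[OF region_sets region_sub]) auto
  ultimately have "emeasure \<nu>3 (region t) = emeasure \<nu>3 (Lo t)" by (rule antisym)
  then show ?thesis using g_eq[OF t] by (simp add: G_def measure_def)
qed

text \<open>The bootstrap: weak inequalities before \<open>t\<close> give strict ones at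
  \<open>t\<close>. Since \<open>g\<close> equals \<open>G\<close>, the queue is close to the
  reflection of the target data with \<open>D\<close> added, and that reflection lies between
  \<open>\<xi>\<close> and \<open>\<xi> + 2 * Z\<close>.\<close>

lemma f_tracks:
  assumes t: "t \<in> {0..T}" and inv: "\<And>u. 0 \<le> u \<Longrightarrow> u < t \<Longrightarrow> \<xi> u - \<eta> \<le> f u \<and> f u \<le> \<xi> u + \<kappa>"
  shows "\<xi> t - \<eta> < f t" "f t < \<xi> t + \<kappa>"
proof -
  let ?\<psi> = "\<lambda>r. x0 + a r - s r - \<zeta> r"
  have g: "g u = G u" if "u \<in> {0..t}" for u using that t inv by (intro g_eq_G) auto
  have lower: "- s T - \<zeta> T \<le> ?\<psi> u" if "u \<in> {0..T}" for u
    using mono_onD[OF amono(1), of 0 u] mono_onD[OF amono(2), of u T] mono_onD[OF amono(3), of u T] that a0 par T by auto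
  have r1: "\<bar>f t - skorohod_map (\<lambda>r. xn + arr r - srv r - g r) t\<bar> \<le> 2 * \<epsilon>"
  proof (rule reflection[of "T / 2 ^ p", OF _ _ t])
    fix u v assume uv: "u \<in> {0..T}" "v \<in> {0..T}" "u \<le> v" "v - u < T / 2 ^ p"
    have "incr T srv p k \<le> \<epsilon>" if "k < 2 ^ p" for k using c2(2)[OF that] incs(2)[OF that] incr_srv[OF that] by simp
    then show "srv v - srv u \<le> 2 * \<epsilon>" using uv par by (intro grid_modulus[OF T srv_mono]) auto
  qed (use T in simp)
  let ?E = "\<bar>xn - x0\<bar> + 3 * (2 ^ p / n + \<epsilon>)"
  have r2: "\<bar>skorohod_map (\<lambda>r. ?\<psi> r + D r) t - skorohod_map (\<lambda>r. xn + arr r - srv r - g r) t\<bar> \<le> 2 * ?E"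
  proof (rule skorohod_map_lipschitz[of _ "- s T - \<zeta> T"])
    fix u assume u: "u \<in> {0..t}"
    then have uT: "u \<in> {0..T}" using t by auto
    show "- s T - \<zeta> T \<le> ?\<psi> u + D u" using lower[OF uT] D_facts(3)[OF uT] by linarith
    show "\<bar>?\<psi> u + D u - (xn + arr u - srv u - g u)\<bar> \<le> ?E"
    proof -
      define q where "q = 2 ^ p / n + \<epsilon>"
      have "\<bar>arr u - a u\<bar> \<le> q" "\<bar>srv u - s u\<bar> \<le> q" "\<bar>G u + D u - \<zeta> u\<bar> \<le> q"
        using arr_close[OF uT] srv_close[OF uT] GD_close[OF uT] by (simp_all add: q_def)
      moreover have "?\<psi> u + D u - (xn + arr u - srv u - g u) = (x0 - xn) - (arr u - a u) + (srv u - s u) + (G u + D u - \<zeta> u)"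
        using g[OF u] by simp
      ultimately show ?thesis unfolding q_def[symmetric] by linarith
    qed
  qed (use t in auto)
  have r3: "\<xi> t \<le> skorohod_map (\<lambda>r. ?\<psi> r + D r) t"
    unfolding xi_eq[OF t]
  proof (rule skorohod_map_shift)
    fix u assume u: "u \<in> {0..t}"
    then have uT: "u \<in> {0..T}" using t by auto
    show "- s T - \<zeta> T \<le> ?\<psi> u" by (rule lower[OF uT])
    show "0 \<le> D u \<and> D u \<le> D t" using D_facts(3)[OF uT] mono_onD[OF D_facts(1) uT t] u by auto
  qed (use t in auto)
  have r4: "\<bar>skorohod_map ?\<psi> t - skorohod_map (\<lambda>r. ?\<psi> r + D r) t\<bar> \<le> 2 * Z"
  proof (rule skorohod_map_lipschitz[of _ "- s T - \<zeta> T"])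
    fix u assume u: "u \<in> {0..t}"
    then have uT: "u \<in> {0..T}" using t by auto
    show "- s T - \<zeta> T \<le> ?\<psi> u" by (rule lower[OF uT])
    show "\<bar>?\<psi> u - (?\<psi> u + D u)\<bar> \<le> Z" using D_facts(3,4)[OF uT] by simp
  qed (use t in auto)
  \<comment> \<open>The lower bound combines \<open>r3\<close> with the errors in \<open>r1\<close>
    and \<open>r2\<close>, which are below \<open>\<eta>\<close> in total; the upper bound uses
    \<open>r4\<close> instead, which adds \<open>2 * Z\<close>.\<close>
  show "\<xi> t - \<eta> < f t" "f t < \<xi> t + \<kappa>"
    using r1 r2 r3 r4 err par(4) xi_eq[OF t] by linarith+
qed

text \<open>Induction along the time axis. At the infimum of the bad times \<open>f_tracks\<close>
  gives strict inequalities, and right continuity of \<open>f\<close> preserves them for a while, so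
  there is no bad time.\<close>

theorem stays_close: assumes t: "t \<in> {0..T}"
  shows "\<xi> t - \<eta> \<le> f t" "f t \<le> \<xi> t + \<kappa>" "\<bar>g t - \<zeta> t\<bar> \<le> 2 ^ p / n + \<epsilon> + Z"
proof -
  define Bad where "Bad = {t \<in> {0..T}. \<not> (\<xi> t - \<eta> \<le> f t \<and> f t \<le> \<xi> t + \<kappa>)}"
  have "Bad = {}"
  proof (rule ccontr)
    assume ne: "Bad \<noteq> {}"
    define \<tau> where "\<tau> = Inf Bad"
    have bb: "bdd_below Bad" by (rule bdd_belowI[of _ 0]) (auto simp: Bad_def)
    obtain b where b: "b \<in> Bad" using ne by blast
    have "0 \<le> \<tau>" unfolding \<tau>_def using ne by (intro cInf_greatest) (auto simp: Bad_def)
    moreover have "\<tau> \<le> b" unfolding \<tau>_def using b bb by (intro cInf_lower)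
    ultimately have \<tau>: "\<tau> \<in> {0..T}" using b by (auto simp: Bad_def)
    have inv: "\<xi> u - \<eta> \<le> f u \<and> f u \<le> \<xi> u + \<kappa>" if "0 \<le> u" "u < \<tau>" for u
    proof (rule ccontr)
      assume "\<not> ?thesis"
      then have "u \<in> Bad" using that \<tau> by (auto simp: Bad_def)
      then have "\<tau> \<le> u" unfolding \<tau>_def using bb by (intro cInf_lower)
      then show False using that by simp
    qed
    note tr = f_tracks[OF \<tau> inv]
    have nb: "\<tau> \<notin> Bad" using tr by (simp add: Bad_def)
    then have "\<tau> < b" using \<open>\<tau> \<le> b\<close> b by (cases "\<tau> = b") auto
    then have \<tau>T: "\<tau> \<in> {0..<T}" using b \<tau> by (auto simp: Bad_def)
    have fr: "(f \<longlongrightarrow> f \<tau>) (at_right \<tau>)" by (rule f_right[OF \<tau>T])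
    have "(\<xi> \<longlongrightarrow> \<xi> \<tau>) (at \<tau> within {0..T})" using xi_cont \<tau> by (auto simp: continuous_on_def)
    then have "(\<xi> \<longlongrightarrow> \<xi> \<tau>) (at \<tau> within {\<tau>..T})" by (rule tendsto_within_subset) (use \<tau>T in auto)
    then have xr: "(\<xi> \<longlongrightarrow> \<xi> \<tau>) (at_right \<tau>)" using \<tau>T by (simp add: at_within_Icc_at_right)
    have "((\<lambda>u. f u - \<xi> u) \<longlongrightarrow> f \<tau> - \<xi> \<tau>) (at_right \<tau>)" by (intro tendsto_intros fr xr)
    then have "\<forall>\<^sub>F u in at_right \<tau>. - \<eta> < f u - \<xi> u" "\<forall>\<^sub>F u in at_right \<tau>. f u - \<xi> u < \<kappa>"
      using tr by (auto intro: order_tendstoD)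
    then have "\<forall>\<^sub>F u in at_right \<tau>. - \<eta> < f u - \<xi> u \<and> f u - \<xi> u < \<kappa>" by (rule eventually_conj)
    then obtain v where v: "\<tau> < v" "\<And>u. \<tau> < u \<Longrightarrow> u < v \<Longrightarrow> - \<eta> < f u - \<xi> u \<and> f u - \<xi> u < \<kappa>"
      unfolding eventually_at_right_field by blast
    have "v \<le> \<tau>" unfolding \<tau>_def
    proof (rule cInf_greatest[OF ne])
      fix u assume u: "u \<in> Bad"
      then have "\<tau> \<le> u" unfolding \<tau>_def using bb by (intro cInf_lower)
      then have "\<tau> < u" using nb u by (cases "\<tau> = u") auto
      show "v \<le> u"
      proof (rule ccontr)
        assume "\<not> v \<le> u"
        then have "- \<eta> < f u - \<xi> u \<and> f u - \<xi> u < \<kappa>" using v(2) \<open>\<tau> < u\<close> by simp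
        then show False using u by (simp add: Bad_def)
      qed
    qed
    then show False using v(1) by simp
  qed
  then have inv: "\<xi> u - \<eta> \<le> f u \<and> f u \<le> \<xi> u + \<kappa>" if "u \<in> {0..T}" for u using that by (auto simp: Bad_def)
  show "\<xi> t - \<eta> \<le> f t" "f t \<le> \<xi> t + \<kappa>" using inv[OF t] by auto
  have "g t = G t" using inv t by (intro g_eq_G) auto
  then show "\<bar>g t - \<zeta> t\<bar> \<le> 2 ^ p / n + \<epsilon> + Z" using GD_close[OF t] D_facts(3,4)[OF t] by linarith
qed

end

section \<open>The cost of tracking\<close>

text \<open>The maximiser of \<open>b * x - (exp b - 1) * w\<close>, or a very negative slope for
  \<open>x = 0\<close>, where the supremum is approached only as \<open>b\<close> tends to minus
  infinity.\<close>

definition opt_dual :: "real \<Rightarrow> real \<Rightarrow> real \<Rightarrow> real" where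
  "opt_dual N x w = (if 0 < x then ln (x / w) else - N)"

text \<open>The slope is optimal for the smaller weight \<open>w\<close>, but it is tested against
  the larger \<open>W\<close>. This costs \<open>(W - w) * (x / w)\<close>, at most
  \<open>\<rho> * x\<close>; the term \<open>W * exp (- N)\<close> is the loss for
  \<open>x = 0\<close>.\<close>

lemma relent_le_opt_dual:
  assumes x: "0 \<le> x" and w: "0 < w" "w \<le> W" and r: "W - w \<le> \<rho> * w"
  shows "relent x w \<le> opt_dual N x w * x - (exp (opt_dual N x w) - 1) * W + \<rho> * x + W * exp (- N)"
proof (cases "0 < x")
  case True
  have "(W - w) * (x / w) \<le> \<rho> * w * (x / w)" using r True w by (intro mult_right_mono) auto
  then have "W * (x / w) \<le> x + \<rho> * x" using w by (simp add: left_diff_distrib diff_divide_distrib)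
  moreover have "(exp (ln (x / w)) - 1) * W = W * (x / w) - W" using True w by (simp add: right_diff_distrib mult.commute)
  moreover have "0 \<le> W * exp (- N)" using w by simp
  moreover have o: "opt_dual N x w = ln (x / w)" using True by (simp add: opt_dual_def)
  ultimately show ?thesis unfolding relent_def o mult.commute[of x "ln (x / w)"] using w by linarith
next
  case False
  then have "x = 0" using x by simp
  then show ?thesis using w by (simp add: opt_dual_def relent_def right_diff_distrib mult.commute)
qed

text \<open>Turns the dual bound on the target back into the entropies of its increments, now with
  respect to the slightly smaller intensities of the lower boxes. Cells that are not big get slope
  0.\<close>

lemma cell_cost_le:
  fixes a s \<zeta> \<xi> :: "real \<Rightarrow> real"
  assumes pos: "0 < lam" "0 < mu" "0 < th" "0 < T"
    and am: "mono_on {0..T} a" "mono_on {0..T} s" "mono_on {0..T} \<zeta>" and z0: "\<zeta> 0 = 0"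
    and dual: "\<And>b1 b2 b3. dual_cost T a (\<lambda>t. lam * t) p b1 + dual_cost T s (\<lambda>t. mu * t) p b2 + dual_cost T \<zeta> W p b3 \<le> m"
    and w: "\<And>k. k < 2 ^ p \<Longrightarrow> big k \<Longrightarrow> 0 < w k \<and> w k \<le> incr T W p k \<and> incr T W p k - w k \<le> \<rho> * w k" and \<rho>: "0 \<le> \<rho>"
    and Wm: "mono_on {0..T} W" and e: "0 < e"
  shows "(\<Sum>k<2 ^ p. relent (incr T a p k) (lam * (T / 2 ^ p))) + (\<Sum>k<2 ^ p. relent (incr T s p k) (mu * (T / 2 ^ p)))
     + (\<Sum>k<2 ^ p. if big k then relent (incr T \<zeta> p k) (w k) else 0) \<le> m + \<rho> * \<zeta> T + e"
proof -
  define C where "C = lam * T + mu * T + (W T - W 0)"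
  have W0: "W 0 \<le> W T" using pos by (intro mono_onD[OF Wm]) auto
  have C: "0 < C" using pos W0 by (simp add: C_def add_pos_nonneg)
  \<comment> \<open>Since \<open>C\<close> is the total weight of the three components, all losses
    from vanishing increments add up to at most \<open>e\<close>.\<close>
  define N where "N = ln (C / e)"
  have N: "C * exp (- N) = e" using C e by (simp add: N_def exp_minus)
  have lin: "incr T (\<lambda>t. v * t) p k = v * (T / 2 ^ p)" for v k
    by (simp add: incr_def tgrid_Suc right_diff_distrib[symmetric])
  have aux: "(\<Sum>k<2 ^ p. relent (incr T F p k) (v * (T / 2 ^ p))) \<le> dual_cost T F (\<lambda>t. v * t) p (\<lambda>k. opt_dual N (incr T F p k) (v * (T / 2 ^ p))) + v * T * exp (- N)"
    if F: "mono_on {0..T} F" and v: "0 < v" for F v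
  proof -
    have "(\<Sum>k<2 ^ p. relent (incr T F p k) (v * (T / 2 ^ p))) \<le> (\<Sum>k<2 ^ p. (opt_dual N (incr T F p k) (v * (T / 2 ^ p)) * incr T F p k
        - (exp (opt_dual N (incr T F p k) (v * (T / 2 ^ p))) - 1) * incr T (\<lambda>t. v * t) p k) + v * (T / 2 ^ p) * exp (- N))"
    proof (intro sum_mono)
      fix k :: nat assume "k \<in> {..<2 ^ p}"
      then have "0 \<le> incr T F p k" using incr_nonneg[OF F pos(4)] by simp
      then show "relent (incr T F p k) (v * (T / 2 ^ p)) \<le> (opt_dual N (incr T F p k) (v * (T / 2 ^ p)) * incr T F p k
        - (exp (opt_dual N (incr T F p k) (v * (T / 2 ^ p))) - 1) * incr T (\<lambda>t. v * t) p k) + v * (T / 2 ^ p) * exp (- N)"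
        using relent_le_opt_dual[of "incr T F p k" "v * (T / 2 ^ p)" "v * (T / 2 ^ p)" 0 N] v pos unfolding lin by simp
    qed
    also have "\<dots> = dual_cost T F (\<lambda>t. v * t) p (\<lambda>k. opt_dual N (incr T F p k) (v * (T / 2 ^ p))) + v * T * exp (- N)"
      unfolding sum.distrib dual_cost_def by simp
    finally show ?thesis .
  qed
  define b3 where "b3 k = (if big k then opt_dual N (incr T \<zeta> p k) (w k) else 0)" for k
  have "(\<Sum>k<2 ^ p. if big k then relent (incr T \<zeta> p k) (w k) else 0) \<le>
     (\<Sum>k<2 ^ p. (b3 k * incr T \<zeta> p k - (exp (b3 k) - 1) * incr T W p k) + \<rho> * incr T \<zeta> p k + incr T W p k * exp (- N))"
  proof (intro sum_mono)
    fix k :: nat assume "k \<in> {..<2 ^ p}"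
    then have k: "k < 2 ^ p" by simp
    have z: "0 \<le> incr T \<zeta> p k" "0 \<le> incr T W p k" using incr_nonneg[OF am(3) pos(4) k] incr_nonneg[OF Wm pos(4) k] by auto
    show "(if big k then relent (incr T \<zeta> p k) (w k) else 0) \<le> (b3 k * incr T \<zeta> p k - (exp (b3 k) - 1) * incr T W p k) + \<rho> * incr T \<zeta> p k + incr T W p k * exp (- N)"
    proof (cases "big k")
      case True
      then show ?thesis using relent_le_opt_dual[OF z(1), of "w k" "incr T W p k" \<rho> N] w[OF k True] by (simp add: b3_def)
    qed (use z \<rho> in \<open>simp add: b3_def\<close>)
  qed
  also have "\<dots> = dual_cost T \<zeta> W p b3 + \<rho> * (\<zeta> T - \<zeta> 0) + (W T - W 0) * exp (- N)"
    by (simp only: sum.distrib dual_cost_def sum_distrib_left[symmetric] sum_distrib_right[symmetric] sum_incr)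
  finally have "(\<Sum>k<2 ^ p. if big k then relent (incr T \<zeta> p k) (w k) else 0) \<le> dual_cost T \<zeta> W p b3 + \<rho> * \<zeta> T + (W T - W 0) * exp (- N)"
    using z0 by simp
  moreover have "lam * T * exp (- N) + mu * T * exp (- N) + (W T - W 0) * exp (- N) = e"
    unfolding N[symmetric] C_def by (simp add: algebra_simps)
  ultimately show ?thesis using aux[OF am(1) pos(1)] aux[OF am(2) pos(2)]
      dual[of "\<lambda>k. opt_dual N (incr T a p k) (lam * (T / 2 ^ p))" "\<lambda>k. opt_dual N (incr T s p k) (mu * (T / 2 ^ p))" b3] by linarith
qed

section \<open>Lower bounds for counts\<close>

text \<open>Rounding to an integer count and the Stirling error are of order \<open>ln n / n\<close>
  or less in the exponent. For \<open>y = 0\<close> the weight is exactly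
  \<open>exp (- n * \<nu>)\<close>, which includes an empty box with
  \<open>\<nu> = 0\<close>.\<close>

lemma poisson_weight_floor:
  assumes y: "0 \<le> y" and \<nu>: "0 \<le> \<nu>" "\<nu> = 0 \<Longrightarrow> y = 0"
  obtains l where "l \<longlonglongrightarrow> - relent y \<nu>" "\<And>n. 0 < n \<Longrightarrow> exp (real n * l n) \<le> poisson_weight (real n * \<nu>) (nat \<lfloor>real n * y\<rfloor>)"
proof (cases "y = 0")
  case True
  show thesis
  proof (rule that[of "\<lambda>_. - \<nu>"])
    show "(\<lambda>_. - \<nu>) \<longlonglongrightarrow> - relent y \<nu>" using True by (simp add: relent_def)
    show "exp (real n * - \<nu>) \<le> poisson_weight (real n * \<nu>) (nat \<lfloor>real n * y\<rfloor>)" for n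
      using True by (simp add: poisson_weight_def)
  qed
next
  case False
  then have y0: "0 < y" and \<nu>0: "0 < \<nu>" using y \<nu> by (auto simp: less_le)
  define k where "k n = nat \<lfloor>real n * y\<rfloor>" for n :: nat
  have kb: "real n * y - 1 \<le> real (k n)" "real (k n) \<le> real n * y" for n
  proof -
    have "0 \<le> real n * y" using y by simp
    then have "real (k n) = of_int \<lfloor>real n * y\<rfloor>" by (simp add: k_def)
    then show "real n * y - 1 \<le> real (k n)" "real (k n) \<le> real n * y" by linarith+
  qed
  have kn: "(\<lambda>n. real (k n) / real n) \<longlonglongrightarrow> y"
  proof (rule real_tendsto_sandwich[of "\<lambda>n. y - 1 / real n" _ _ "\<lambda>_. y"])
    show "\<forall>\<^sub>F n in sequentially. y - 1 / real n \<le> real (k n) / real n"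
    proof (rule eventually_sequentiallyI[of 1])
      fix n :: nat assume "1 \<le> n"
      then have n: "0 < real n" by simp
      have "(real n * y - 1) / real n \<le> real (k n) / real n" using kb(1)[of n] by (intro divide_right_mono) auto
      then show "y - 1 / real n \<le> real (k n) / real n" using n by (simp add: diff_divide_distrib)
    qed
    show "\<forall>\<^sub>F n in sequentially. real (k n) / real n \<le> y"
    proof (rule eventually_sequentiallyI[of 1])
      fix n :: nat assume "1 \<le> n"
      then show "real (k n) / real n \<le> y" using kb(2)[of n] by (simp add: field_simps)
    qed
    have "(\<lambda>n. y - 1 / real n) \<longlonglongrightarrow> y - 0" by (intro tendsto_intros lim_1_over_n)
    then show "(\<lambda>n. y - 1 / real n) \<longlonglongrightarrow> y" by simp
  qed simp
  have lk: "(\<lambda>n. (ln (real (k n)) + 1) / real n) \<longlonglongrightarrow> 0"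
  proof (rule real_tendsto_sandwich[of "\<lambda>_. 0" _ _ "\<lambda>n. (ln (real n) + ln (y + 1) + 1) / real n"])
    show "\<forall>\<^sub>F n in sequentially. 0 \<le> (ln (real (k n)) + 1) / real n"
    proof (intro always_eventually allI divide_nonneg_nonneg)
      fix n show "0 \<le> ln (real (k n)) + 1" by (cases "k n = 0") (auto intro: add_nonneg_nonneg)
    qed simp
    show "\<forall>\<^sub>F n in sequentially. (ln (real (k n)) + 1) / real n \<le> (ln (real n) + ln (y + 1) + 1) / real n"
    proof (rule eventually_sequentiallyI[of 1])
      fix n :: nat assume n: "1 \<le> n"
      have "ln (real (k n)) \<le> ln (real n) + ln (y + 1)"
      proof (cases "k n = 0")
        case True then show ?thesis using n y by (simp add: add_nonneg_nonneg)
      next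
        case False
        have "real n * y \<le> real n * (y + 1)" by (intro mult_left_mono) auto
        then have "ln (real (k n)) \<le> ln (real n * (y + 1))" using False kb(2)[of n] by (intro ln_mono) linarith+
        also have "\<dots> = ln (real n) + ln (y + 1)" using n y by (simp add: ln_mult)
        finally show ?thesis .
      qed
      then show "(ln (real (k n)) + 1) / real n \<le> (ln (real n) + ln (y + 1) + 1) / real n" by (intro divide_right_mono) auto
    qed
    show "(\<lambda>n. (ln (real n) + ln (y + 1) + 1) / real n) \<longlonglongrightarrow> 0" by real_asymp
  qed simp
  define l where "l n = - relent (real (k n) / real n) \<nu> - (ln (real (k n)) + 1) / real n" for n
  show thesis
  proof (rule that[of l])
    have "(\<lambda>n. - relent (real (k n) / real n) \<nu> - (ln (real (k n)) + 1) / real n) \<longlonglongrightarrow> - relent y \<nu> - 0"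
      unfolding relent_def using y0 \<nu>0 by (intro tendsto_intros kn lk) auto
    then show "l \<longlonglongrightarrow> - relent y \<nu>" by (simp add: l_def[abs_def])
    fix n :: nat assume n: "0 < n"
    have "real n * l n = - (real n * relent (real (k n) / n) \<nu>) - ln (real (k n)) - 1"
      using n by (simp add: l_def right_diff_distrib)
    then show "exp (real n * l n) \<le> poisson_weight (real n * \<nu>) (nat \<lfloor>real n * y\<rfloor>)"
      using poisson_weight_lower[OF n \<nu>0, of "k n"] by (simp add: k_def)
  qed
qed

lemma lower_limit:
  fixes P :: "nat \<Rightarrow> real"
  assumes l: "l \<longlonglongrightarrow> c" and P: "\<forall>\<^sub>F n in sequentially. exp (real n * l n) \<le> P n"
  shows "ereal c \<le> liminf (\<lambda>n. ereal (1 / real n) * elog (P n))"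
proof -
  have "(\<lambda>n. ereal (l n)) \<longlonglongrightarrow> ereal c" using l by simp
  then have "ereal c = liminf (\<lambda>n. ereal (l n))" by (intro lim_imp_Liminf[symmetric]) auto
  also have "\<dots> \<le> liminf (\<lambda>n. ereal (1 / real n) * elog (P n))"
  proof (rule Liminf_mono)
    show "\<forall>\<^sub>F n in sequentially. ereal (l n) \<le> ereal (1 / real n) * elog (P n)"
      using P eventually_gt_at_top[of 0]
    proof eventually_elim
      case (elim n)
      have P0: "0 < P n" using elim(1) exp_gt_zero[of "real n * l n"] by linarith
      have "real n * l n \<le> ln (P n)" using elim(1) P0 by (simp add: ln_ge_iff)
      then have "l n \<le> ln (P n) / real n" using elim(2) by (simp add: field_simps)
      then show ?case using P0 by (simp add: elog_def)
    qed
  qed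
  finally show ?thesis .
qed

section \<open>The lower bound\<close>

lemma lower_box_facts:
  assumes "0 < \<eta>" "3 * \<eta> < \<delta>"
  shows "lower_box \<delta> \<eta> c \<in> sets borel" "lower_box \<delta> \<eta> c \<subseteq> {0..}"
    "emeasure lborel (lower_box \<delta> \<eta> c) = ennreal (if \<delta> \<le> c then c - 3 * \<eta> else 0)" "0 \<le> (if \<delta> \<le> c then c - 3 * \<eta> else 0)"
  using assms by (auto simp: lower_box_def)

lemma strip_box_facts:
  assumes "0 < \<eta>" "3 * \<eta> < \<delta>" "0 < \<kappa>" "0 \<le> c"
  shows "strip_box \<delta> \<eta> \<kappa> c \<in> sets borel" "strip_box \<delta> \<eta> \<kappa> c \<subseteq> {0..}"
    "emeasure lborel (strip_box \<delta> \<eta> \<kappa> c) = ennreal (if \<delta> \<le> c then 4 * \<eta> + \<kappa> else c + \<eta> + \<kappa>)"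
    "0 \<le> (if \<delta> \<le> c then 4 * \<eta> + \<kappa> else c + \<eta> + \<kappa>)"
  using assms by (auto simp: strip_box_def)

lemma sum_pairs: "(\<Sum>j<2 * N. F j) = (\<Sum>k<N. F (2 * k) + F (2 * k + 1))" for F :: "nat \<Rightarrow> real"
  by (induction N) (auto simp: algebra_simps)

context mm1m_system
begin

lemma floor_count:
  assumes "emeasure \<nu> A = of_nat (nat \<lfloor>real n * y\<rfloor>)" "0 \<le> y" "0 < n"
  shows "emeasure \<nu> A < \<infinity>" "\<bar>measure \<nu> A / n - y\<bar> \<le> 1 / n" "measure \<nu> A / n \<le> y"
proof -
  show "emeasure \<nu> A < \<infinity>" using assms(1) by (simp add: ennreal_of_nat_eq_real_of_nat)
  have ny: "0 \<le> real n * y" using assms by simp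
  have "measure \<nu> A = real (nat \<lfloor>real n * y\<rfloor>)" using assms(1) by (simp add: measure_def ennreal_of_nat_eq_real_of_nat)
  then have "measure \<nu> A = of_int \<lfloor>real n * y\<rfloor>" using ny by simp
  then have b: "real n * y - 1 \<le> measure \<nu> A" "measure \<nu> A \<le> real n * y" by linarith+
  have n: "0 < real n" using assms by simp
  have "(real n * y - 1) / n \<le> measure \<nu> A / n" by (rule divide_right_mono[OF b(1)]) simp
  moreover have "measure \<nu> A / n \<le> (real n * y) / n" by (rule divide_right_mono[OF b(2)]) simp
  ultimately
  have "y - 1 / n \<le> measure \<nu> A / n" "measure \<nu> A / n \<le> y" using n by (simp_all add: diff_divide_distrib)
  then show "\<bar>measure \<nu> A / n - y\<bar> \<le> 1 / n" "measure \<nu> A / n \<le> y" by (auto simp: abs_le_iff)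
qed

text \<open>The grid is fixed and \<open>n\<close> tends to infinity. The event \<open>E n\<close>
  prescribes the count in every cell and box; its probability is a product of Poisson weights, and
  by \<open>stays_close\<close> it forces the path into \<open>G\<close> as soon as \<open>n\<close>
  is large.\<close>

lemma lower_core:
  fixes a s \<zeta> \<xi> :: "real \<Rightarrow> real"
  assumes par: "0 < \<eta>" "0 \<le> \<epsilon>" "3 * \<eta> < \<delta>" "2 * Z + \<eta> \<le> \<kappa>" "0 < \<kappa>" "8 * \<epsilon> < \<eta>"
    and amono: "mono_on {0..T} a" "mono_on {0..T} s" "mono_on {0..T} \<zeta>" and a0: "a 0 = 0" "s 0 = 0" "\<zeta> 0 = 0"
    and xi_cont: "continuous_on {0..T} \<xi>" and xi_nn: "\<And>t. t \<in> {0..T} \<Longrightarrow> 0 \<le> \<xi> t"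
    and xi_eq: "\<And>t. t \<in> {0..T} \<Longrightarrow> \<xi> t = skorohod_map (\<lambda>r. x0 + a r - s r - \<zeta> r) t"
    and xi_osc: "\<And>k t. k < 2 ^ p \<Longrightarrow> t \<in> {tgrid T p k..tgrid T p (Suc k)} \<Longrightarrow> \<bar>\<xi> t - \<xi> (tgrid T p k)\<bar> \<le> \<eta>"
    and incs: "\<And>k. k < 2 ^ p \<Longrightarrow> incr T a p k \<le> \<epsilon>" "\<And>k. k < 2 ^ p \<Longrightarrow> incr T s p k \<le> \<epsilon>" "\<And>k. k < 2 ^ p \<Longrightarrow> incr T \<zeta> p k \<le> \<epsilon>"
    and Zsum: "(\<Sum>k<2 ^ p. if \<delta> \<le> \<xi> (tgrid T p k) then 0 else incr T \<zeta> p k) \<le> Z"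
    and G: "openin (skorohod_topology T ({0..} \<times> {0..})) G"
    and GZ: "\<And>z. z \<in> cadlag_space T ({0..} \<times> {0..}) \<Longrightarrow> (\<And>t. t \<in> {0..T} \<Longrightarrow>
        \<xi> t - \<eta> \<le> fst (z t) \<and> fst (z t) \<le> \<xi> t + \<kappa> \<and> \<bar>snd (z t) - \<zeta> t\<bar> \<le> \<eta> + Z) \<Longrightarrow> z \<in> G"
  shows "ereal (- ((\<Sum>k<2 ^ p. relent (incr T a p k) (lam * (T / 2 ^ p))) + (\<Sum>k<2 ^ p. relent (incr T s p k) (mu * (T / 2 ^ p)))
     + (\<Sum>k<2 ^ p. if \<delta> \<le> \<xi> (tgrid T p k) then relent (incr T \<zeta> p k) (th * (T / 2 ^ p) * (\<xi> (tgrid T p k) - 3 * \<eta>)) else 0)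
     + (\<Sum>k<2 ^ p. th * (T / 2 ^ p) * (if \<delta> \<le> \<xi> (tgrid T p k) then 4 * \<eta> + \<kappa> else \<xi> (tgrid T p k) + \<eta> + \<kappa>))))
     \<le> liminf (\<lambda>n. ereal (1 / real n) * elog (measure (M n) {\<omega> \<in> space (M n). qpath n \<omega> \<in> G}))"
proof -
  have T: "0 < T" using pos by simp
  define c where "c k = \<xi> (tgrid T p k)" for k
  have c0: "0 \<le> c k" if "k < 2 ^ p" for k using xi_nn tgrid_mem[OF T, of k p] that by (simp add: c_def)
  \<comment> \<open>The boxes of all time cells form one family: index \<open>2 * k\<close> stands
    for the lower box of cell \<open>k\<close> and \<open>2 * k + 1\<close> for its strip.
    \<open>h\<close> gives their heights, \<open>y3\<close> the rescaled counts prescribed in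
    them.\<close>
  define h where "h j = (if even j then (if \<delta> \<le> c (j div 2) then c (j div 2) - 3 * \<eta> else 0)
     else (if \<delta> \<le> c (j div 2) then 4 * \<eta> + \<kappa> else c (j div 2) + \<eta> + \<kappa>))" for j
  define B where "B j = (if even j then lower_box \<delta> \<eta> (c (j div 2)) else strip_box \<delta> \<eta> \<kappa> (c (j div 2)))" for j
  define A3 where "A3 j = time_cell T p (j div 2) \<times> B j" for j
  define y3 where "y3 j = (if even j \<and> \<delta> \<le> c (j div 2) then incr T \<zeta> p (j div 2) else 0)" for j
  let ?J = "{..<(2::nat) ^ p}" and ?J3 = "{..<2 * (2::nat) ^ p}"
  have J3: "j div 2 < 2 ^ p" if "j \<in> ?J3" for j using that by auto
  have Bf: "B j \<in> sets borel" "B j \<subseteq> {0..}" "emeasure lborel (B j) = ennreal (h j)" "0 \<le> h j" if "j \<in> ?J3" for j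
    using lower_box_facts[OF par(1,3), of "c (j div 2)"] strip_box_facts[OF par(1,3,5) c0[OF J3[OF that]]]
    unfolding B_def h_def by (cases "even j"; simp)+
  have inc0: "0 \<le> incr T a p k" "0 \<le> incr T s p k" "0 \<le> incr T \<zeta> p k" if "k < 2 ^ p" for k
    using incr_nonneg[OF amono(1) T that] incr_nonneg[OF amono(2) T that] incr_nonneg[OF amono(3) T that] by auto
  have y30: "0 \<le> y3 j" if "j \<in> ?J3" for j using inc0(3)[OF J3[OF that]] by (simp add: y3_def)
  have "\<forall>k\<in>?J. \<exists>l. l \<longlonglongrightarrow> - relent (incr T a p k) (lam * (T / 2 ^ p)) \<and> (\<forall>n>0. exp (real n * l n) \<le> poisson_weight (real n * (lam * (T / 2 ^ p))) (nat \<lfloor>real n * incr T a p k\<rfloor>))"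
    using poisson_weight_floor[OF inc0(1), of _ "lam * (T / 2 ^ p)"] pos by (metis lessThan_iff less_eq_real_def mult_pos_pos divide_pos_pos zero_less_numeral zero_less_power order_less_irrefl)
  then obtain l1 where l1: "\<And>k. k \<in> ?J \<Longrightarrow> l1 k \<longlonglongrightarrow> - relent (incr T a p k) (lam * (T / 2 ^ p))"
    "\<And>k n. k \<in> ?J \<Longrightarrow> 0 < n \<Longrightarrow> exp (real n * l1 k n) \<le> poisson_weight (real n * (lam * (T / 2 ^ p))) (nat \<lfloor>real n * incr T a p k\<rfloor>)"
    by (metis (no_types, lifting))
  have "\<forall>k\<in>?J. \<exists>l. l \<longlonglongrightarrow> - relent (incr T s p k) (mu * (T / 2 ^ p)) \<and> (\<forall>n>0. exp (real n * l n) \<le> poisson_weight (real n * (mu * (T / 2 ^ p))) (nat \<lfloor>real n * incr T s p k\<rfloor>))"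
    using poisson_weight_floor[OF inc0(2), of _ "mu * (T / 2 ^ p)"] pos by (metis lessThan_iff less_eq_real_def mult_pos_pos divide_pos_pos zero_less_numeral zero_less_power order_less_irrefl)
  then obtain l2 where l2: "\<And>k. k \<in> ?J \<Longrightarrow> l2 k \<longlonglongrightarrow> - relent (incr T s p k) (mu * (T / 2 ^ p))"
    "\<And>k n. k \<in> ?J \<Longrightarrow> 0 < n \<Longrightarrow> exp (real n * l2 k n) \<le> poisson_weight (real n * (mu * (T / 2 ^ p))) (nat \<lfloor>real n * incr T s p k\<rfloor>)"
    by (metis (no_types, lifting))
  have h0: "h j = 0 \<Longrightarrow> y3 j = 0" for j using par by (auto simp: h_def y3_def)
  have "\<exists>l. l \<longlonglongrightarrow> - relent (y3 j) (th * (T / 2 ^ p) * h j) \<and> (\<forall>n>0. exp (real n * l n) \<le> poisson_weight (real n * (th * (T / 2 ^ p) * h j)) (nat \<lfloor>real n * y3 j\<rfloor>))"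
    if j: "j \<in> ?J3" for j
  proof -
    have nn: "0 \<le> th * (T / 2 ^ p) * h j" using Bf(4)[OF j] pos by simp
    have "th * (T / 2 ^ p) * h j = 0 \<Longrightarrow> y3 j = 0" using h0[of j] pos by auto
    from poisson_weight_floor[OF y30[OF j] nn this] show ?thesis by metis
  qed
  then obtain l3 where l3: "\<And>j. j \<in> ?J3 \<Longrightarrow> l3 j \<longlonglongrightarrow> - relent (y3 j) (th * (T / 2 ^ p) * h j)"
    "\<And>j n. j \<in> ?J3 \<Longrightarrow> 0 < n \<Longrightarrow> exp (real n * l3 j n) \<le> poisson_weight (real n * (th * (T / 2 ^ p) * h j)) (nat \<lfloor>real n * y3 j\<rfloor>)"
    by (metis (no_types, lifting))
  define l where "l n = (\<Sum>k\<in>?J. l1 k n) + (\<Sum>k\<in>?J. l2 k n) + (\<Sum>j\<in>?J3. l3 j n)" for n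
  have lim: "l \<longlonglongrightarrow> (\<Sum>k\<in>?J. - relent (incr T a p k) (lam * (T / 2 ^ p))) + (\<Sum>k\<in>?J. - relent (incr T s p k) (mu * (T / 2 ^ p)))
     + (\<Sum>j\<in>?J3. - relent (y3 j) (th * (T / 2 ^ p) * h j))"
    unfolding l_def by (intro tendsto_add tendsto_sum l1 l2 l3)
  \<comment> \<open>An odd index has count 0 and entropy equal to its weight, the price of an empty
    strip. A lower box below the threshold has weight 0 and costs nothing.\<close>
  have val: "(\<Sum>j\<in>?J3. - relent (y3 j) (th * (T / 2 ^ p) * h j)) =
    - (\<Sum>k<2 ^ p. if \<delta> \<le> c k then relent (incr T \<zeta> p k) (th * (T / 2 ^ p) * (c k - 3 * \<eta>)) else 0)
     - (\<Sum>k<2 ^ p. th * (T / 2 ^ p) * (if \<delta> \<le> c k then 4 * \<eta> + \<kappa> else c k + \<eta> + \<kappa>))"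
    unfolding sum_pairs sum_negf[symmetric] sum_subtractf[symmetric]
    by (intro sum.cong refl) (auto simp: y3_def h_def relent_def)
  define E where "E n = {\<omega> \<in> space (M n). (\<forall>k\<in>?J. emeasure (N1 n \<omega>) (time_cell T p k) = of_nat (nat \<lfloor>real n * incr T a p k\<rfloor>)) \<and>
      (\<forall>k\<in>?J. emeasure (N2 n \<omega>) (time_cell T p k) = of_nat (nat \<lfloor>real n * incr T s p k\<rfloor>)) \<and>
      (\<forall>j\<in>?J3. emeasure (N3 n \<omega>) (A3 j) = of_nat (nat \<lfloor>real n * y3 j\<rfloor>))}" for n
  have PE: "exp (real n * l n) \<le> measure (M n) (E n)" if n: "0 < n" for n
  proof -
    interpret prob_space "M n" by (rule prob[OF n])
    have nn: "0 \<le> real n * lam" "0 \<le> real n * mu" "0 \<le> real n * th" using pos by auto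
    have A3f: "A3 j \<in> sets (time_mark_intensity (real n * th) T)" "emeasure (time_mark_intensity (real n * th) T) (A3 j) < \<infinity>"
      "measure (time_mark_intensity (real n * th) T) (A3 j) = real n * (th * (T / 2 ^ p) * h j)" if j: "j \<in> ?J3" for j
      unfolding A3_def using box_facts[OF J3[OF j] nn(3) Bf[OF j]] by (simp_all add: mult.assoc)
    have "measure (M n) (E n) = (\<Prod>k\<in>?J. poisson_weight (measure (time_intensity (real n * lam) T) (time_cell T p k)) (nat \<lfloor>real n * incr T a p k\<rfloor>)) *
       (\<Prod>k\<in>?J. poisson_weight (measure (time_intensity (real n * mu) T) (time_cell T p k)) (nat \<lfloor>real n * incr T s p k\<rfloor>)) *
       (\<Prod>j\<in>?J3. poisson_weight (measure (time_mark_intensity (real n * th) T) (A3 j)) (nat \<lfloor>real n * y3 j\<rfloor>))"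
      unfolding E_def
    proof (rule mm1m_noise_joint[OF noise[OF n]])
      show "disjoint_family_on (time_cell T p) ?J" using time_cell_disjoint[OF T] by (auto simp: disjoint_family_on_def)
      then show "disjoint_family_on (time_cell T p) ?J" .
      show "disjoint_family_on A3 ?J3"
        unfolding disjoint_family_on_def
      proof (intro ballI impI)
        fix i j :: nat assume "i \<noteq> j"
        then have "i div 2 \<noteq> j div 2 \<or> (even i \<noteq> even j \<and> i div 2 = j div 2)" by presburger
        then show "A3 i \<inter> A3 j = {}"
        proof
          assume "i div 2 \<noteq> j div 2"
          then show ?thesis using time_cell_disjoint[OF T, of "i div 2" "j div 2" p] by (auto simp: A3_def)
        next
          assume "even i \<noteq> even j \<and> i div 2 = j div 2"
          then have "B i \<inter> B j = {}" by (auto simp: B_def lower_box_def strip_box_def)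
          then show ?thesis by (auto simp: A3_def)
        qed
      qed
    qed (use A3f time_cell_facts nn in auto)
    also have "\<dots> = (\<Prod>k\<in>?J. poisson_weight (real n * (lam * (T / 2 ^ p))) (nat \<lfloor>real n * incr T a p k\<rfloor>)) *
       (\<Prod>k\<in>?J. poisson_weight (real n * (mu * (T / 2 ^ p))) (nat \<lfloor>real n * incr T s p k\<rfloor>)) *
       (\<Prod>j\<in>?J3. poisson_weight (real n * (th * (T / 2 ^ p) * h j)) (nat \<lfloor>real n * y3 j\<rfloor>))"
      using time_cell_facts(3)[OF _ nn(1)] time_cell_facts(3)[OF _ nn(2)] A3f(3)
      by (intro arg_cong2[where f="(*)"] prod.cong refl) (simp_all add: mult.assoc)
    also have "\<dots> \<ge> (\<Prod>k\<in>?J. exp (real n * l1 k n)) * (\<Prod>k\<in>?J. exp (real n * l2 k n)) * (\<Prod>j\<in>?J3. exp (real n * l3 j n))"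
    proof -
      have a1: "(\<Prod>k\<in>?J. exp (real n * l1 k n)) \<le> (\<Prod>k\<in>?J. poisson_weight (real n * (lam * (T / 2 ^ p))) (nat \<lfloor>real n * incr T a p k\<rfloor>))"
        by (intro prod_mono conjI l1(2) n exp_ge_zero)
      have a2: "(\<Prod>k\<in>?J. exp (real n * l2 k n)) \<le> (\<Prod>k\<in>?J. poisson_weight (real n * (mu * (T / 2 ^ p))) (nat \<lfloor>real n * incr T s p k\<rfloor>))"
        by (intro prod_mono conjI l2(2) n exp_ge_zero)
      have a3: "(\<Prod>j\<in>?J3. exp (real n * l3 j n)) \<le> (\<Prod>j\<in>?J3. poisson_weight (real n * (th * (T / 2 ^ p) * h j)) (nat \<lfloor>real n * y3 j\<rfloor>))"
        by (intro prod_mono conjI l3(2) n exp_ge_zero)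
      have a4: "0 \<le> (\<Prod>k\<in>?J. poisson_weight (real n * (lam * (T / 2 ^ p))) (nat \<lfloor>real n * incr T a p k\<rfloor>))"
        and a5: "0 \<le> (\<Prod>k\<in>?J. poisson_weight (real n * (mu * (T / 2 ^ p))) (nat \<lfloor>real n * incr T s p k\<rfloor>))"
        using pos by (intro prod_nonneg poisson_weight_nonneg; simp)+
      show ?thesis
        by (rule mult_mono[OF mult_mono[OF a1 a2 a4] a3 mult_nonneg_nonneg[OF a4 a5]]) (auto intro!: prod_nonneg)
    qed
    also have "(\<Prod>k\<in>?J. exp (real n * l1 k n)) * (\<Prod>k\<in>?J. exp (real n * l2 k n)) * (\<Prod>j\<in>?J3. exp (real n * l3 j n)) = exp (real n * l n)"
      by (simp add: l_def exp_sum[symmetric] exp_add[symmetric] sum_distrib_left distrib_left)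
    finally show ?thesis .
  qed
  \<comment> \<open>The limit is \<open>8 * \<epsilon>\<close>, whence the hypothesis
    \<open>8 * \<epsilon> < \<eta>\<close>.\<close>
  have "(\<lambda>n. 2 * (\<bar>x n - x0\<bar> + 3 * (2 ^ p * (1 / real n) + \<epsilon>)) + 2 * \<epsilon>) \<longlonglongrightarrow> 2 * (\<bar>x0 - x0\<bar> + 3 * (2 ^ p * 0 + \<epsilon>)) + 2 * \<epsilon>"
    by (intro tendsto_intros x_lim lim_1_over_n)
  then have e1: "\<forall>\<^sub>F n in sequentially. 2 * (\<bar>x n - x0\<bar> + 3 * (2 ^ p * (1 / real n) + \<epsilon>)) + 2 * \<epsilon> < \<eta>"
    using par by (intro order_tendstoD(2)) auto
  have "(\<lambda>n. 1 / real n) \<longlonglongrightarrow> 0" by (rule lim_1_over_n)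
  then have e2: "\<forall>\<^sub>F n in sequentially. 1 / real n < \<eta>" using par(1) by (rule order_tendstoD)
  have "\<forall>\<^sub>F n in sequentially. exp (real n * l n) \<le> measure (M n) {\<omega> \<in> space (M n). qpath n \<omega> \<in> G}"
    using e1 e2 eventually_gt_at_top[of 0]
  proof eventually_elim
    fix n assume E1: "2 * (\<bar>x n - x0\<bar> + 3 * (2 ^ p * (1 / real n) + \<epsilon>)) + 2 * \<epsilon> < \<eta>" and E2: "1 / real n < \<eta>" and n: "0 < n"
    interpret prob_space "M n" by (rule prob[OF n])
    have "AE \<omega> in M n. \<omega> \<in> E n \<longrightarrow> \<omega> \<in> {\<omega> \<in> space (M n). qpath n \<omega> \<in> G}"
      using AE_path_ok[OF n]
    proof eventually_elim
      fix \<omega> assume ok: "path_ok n \<omega>"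
      show "\<omega> \<in> E n \<longrightarrow> \<omega> \<in> {\<omega> \<in> space (M n). qpath n \<omega> \<in> G}"
      proof
        assume w: "\<omega> \<in> E n"
        interpret Q: queue_path T n "x n" "N1 n \<omega>" "N2 n \<omega>" "N3 n \<omega>" "X n \<omega>" "Y n \<omega>" using ok by (simp add: path_ok_def)
        have w1: "emeasure (N1 n \<omega>) (time_cell T p k) = of_nat (nat \<lfloor>real n * incr T a p k\<rfloor>)"
          and w2: "emeasure (N2 n \<omega>) (time_cell T p k) = of_nat (nat \<lfloor>real n * incr T s p k\<rfloor>)" if "k < 2 ^ p" for k
          using w that by (auto simp: E_def)
        have w3: "emeasure (N3 n \<omega>) (A3 j) = of_nat (nat \<lfloor>real n * y3 j\<rfloor>)" if "j < 2 * 2 ^ p" for j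
          using w that by (auto simp: E_def)
        have lo: "emeasure (N3 n \<omega>) (time_cell T p k \<times> lower_box \<delta> \<eta> (\<xi> (tgrid T p k))) = of_nat (nat \<lfloor>real n * y3 (2 * k)\<rfloor>)" if "k < 2 ^ p" for k
          using w3[of "2 * k"] that by (simp add: A3_def B_def c_def)
        have st: "emeasure (N3 n \<omega>) (time_cell T p k \<times> strip_box \<delta> \<eta> \<kappa> (\<xi> (tgrid T p k))) = 0" if "k < 2 ^ p" for k
          using w3[of "2 * k + 1"] that by (simp add: A3_def B_def c_def y3_def)
        interpret L: lower_path T n "x n" "N1 n \<omega>" "N2 n \<omega>" "N3 n \<omega>" "X n \<omega>" "Y n \<omega>" x0 a s \<zeta> \<xi> p \<eta> \<delta> \<kappa> \<epsilon> Z
        proof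
          fix k assume k: "k < (2::nat) ^ p"
          show "\<bar>measure (N1 n \<omega>) (time_cell T p k) / n - incr T a p k\<bar> \<le> 1 / n" by (rule floor_count(2)[OF w1[OF k] inc0(1)[OF k] n])
          show "\<bar>measure (N2 n \<omega>) (time_cell T p k) / n - incr T s p k\<bar> \<le> 1 / n" by (rule floor_count(2)[OF w2[OF k] inc0(2)[OF k] n])
          show "measure (N2 n \<omega>) (time_cell T p k) / n \<le> incr T s p k" by (rule floor_count(3)[OF w2[OF k] inc0(2)[OF k] n])
          have y0: "0 \<le> y3 (2 * k)" using k by (intro y30) auto
          show "emeasure (N3 n \<omega>) (time_cell T p k \<times> lower_box \<delta> \<eta> (\<xi> (tgrid T p k))) < \<infinity>" by (rule floor_count(1)[OF lo[OF k] y0 n])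
          show "\<bar>measure (N3 n \<omega>) (time_cell T p k \<times> lower_box \<delta> \<eta> (\<xi> (tgrid T p k))) / n - incr T \<zeta> p k\<bar> \<le> 1 / n" if "\<delta> \<le> \<xi> (tgrid T p k)"
            using floor_count(2)[OF lo[OF k] y0 n] that by (simp add: y3_def c_def)
          show "emeasure (N3 n \<omega>) (time_cell T p k \<times> strip_box \<delta> \<eta> \<kappa> (\<xi> (tgrid T p k))) = 0" by (rule st[OF k])
        qed (use par amono a0 xi_cont xi_nn xi_eq xi_osc incs Zsum E1 E2 x0_nonneg in auto)
        have sp: "\<omega> \<in> space (M n)" using w by (simp add: E_def)
        have small: "2 ^ p / n + \<epsilon> \<le> \<eta>"
        proof -
          define Q where "Q = 2 ^ p / real n"
          define D where "D = \<bar>x n - x0\<bar>"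
          have "0 \<le> Q" "2 ^ p * (1 / real n) = Q" "0 \<le> D" by (simp_all add: Q_def D_def)
          moreover from this have "2 * (D + 3 * (Q + \<epsilon>)) + 2 * \<epsilon> < \<eta>" using E1 unfolding D_def[symmetric] by (simp only:)
          ultimately show ?thesis unfolding Q_def[symmetric] using par(2) by argo
        qed
        have "qpath n \<omega> \<in> G"
        proof (rule GZ[OF path_cadlag[OF n sp]])
          fix t assume t: "t \<in> {0..T}"
          have "qpath n \<omega> t = (X n \<omega> t, Y n \<omega> t)" using t by (simp add: qpath_def path_pair_def)
          then show "\<xi> t - \<eta> \<le> fst (qpath n \<omega> t) \<and> fst (qpath n \<omega> t) \<le> \<xi> t + \<kappa> \<and> \<bar>snd (qpath n \<omega> t) - \<zeta> t\<bar> \<le> \<eta> + Z"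
            using L.stays_close[OF t] small by simp
        qed
        then show "\<omega> \<in> {\<omega> \<in> space (M n). qpath n \<omega> \<in> G}" using sp by simp
      qed
    qed
    then have "measure (M n) (E n) \<le> measure (M n) {\<omega> \<in> space (M n). qpath n \<omega> \<in> G}"
      using path_event[OF n borel_of_open[OF G]] by (intro finite_measure_mono_AE)
    then show "exp (real n * l n) \<le> measure (M n) {\<omega> \<in> space (M n). qpath n \<omega> \<in> G}" using PE[OF n] by linarith
  qed
  note bound = lower_limit[OF lim this]
  have regroup: "- s1 + - s2 + (- s3 - s4) = - (s1 + s2 + s3 + s4)" for s1 s2 s3 s4 :: real by simp
  show ?thesis using bound[unfolded val, unfolded sum_negf regroup c_def] .
qed

text \<open>The four \<open>e\<close> pay for a control that is only nearly optimal, for the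
  narrower lower boxes, for the cells with vanishing increments, and for the empty strips. The
  parameters are fixed in the order \<open>\<rho>\<close>, \<open>Z\<close>, \<open>\<beta>\<close>,
  \<open>c\<close>, \<open>\<eta>\<close>, and the grid comes last.\<close>

lemma lower_at:
  assumes G: "openin (skorohod_topology T ({0..} \<times> {0..})) G" and z: "z \<in> G"
    and m: "mm1m_rate lam mu th x0 T z \<le> ennreal m" "0 \<le> m" and e: "0 < e"
  shows "ereal (- (m + 4 * e)) \<le> liminf (\<lambda>n. ereal (1 / real n) * elog (measure (M n) {\<omega> \<in> space (M n). qpath n \<omega> \<in> G}))"
proof -
  have T: "0 < T" using pos by simp
  interpret S: Metric_space "cadlag_space T ({0..} \<times> {0..} :: (real \<times> real) set)" "skorohod_dist T"
    using T by (intro Metric_space_skorohod) simp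
  have zc: "z \<in> cadlag_space T ({0..} \<times> {0..})" using z openin_subset[OF G] topspace_sk by blast
  obtain r where r: "0 < r" "S.mball z r \<subseteq> G"
    using G z unfolding skorohod_topology_def S.openin_mtopology by blast
  define \<xi> where "\<xi> t = fst (z t)" for t
  define \<zeta> where "\<zeta> t = snd (z t)" for t
  have cont: "continuous_on {0..T} \<xi>" "continuous_on {0..T} \<zeta>" and xi_nn: "\<And>t. t \<in> {0..T} \<Longrightarrow> 0 \<le> \<xi> t"
    unfolding \<xi>_def \<zeta>_def using rate_le_imp_control(1-3)[OF zc m e] by blast+
  obtain \<phi> where \<phi>: "\<phi> \<in> controls lam mu th x0 T \<xi> \<zeta>" "control_cost lam mu th T \<xi> \<phi> \<le> ennreal (m + e)"
    unfolding \<xi>_def \<zeta>_def using rate_le_imp_control(4)[OF zc m e] by blast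
  define m' where "m' = m + e"
  have m': "0 \<le> m'" using m e by (simp add: m'_def)
  define W where "W t = th * integral {0..t} \<xi>" for t
  obtain a s where as: "mono_on {0..T} a" "mono_on {0..T} s" "mono_on {0..T} \<zeta>" "a 0 = 0" "s 0 = 0" "\<zeta> 0 = 0"
    and xi_eq: "\<And>t. t \<in> {0..T} \<Longrightarrow> \<xi> t = skorohod_map (\<lambda>r. x0 + a r - s r - \<zeta> r) t"
    and dual: "\<And>q b1 b2 b3. dual_cost T a (\<lambda>t. lam * t) q b1 + dual_cost T s (\<lambda>t. mu * t) q b2 + dual_cost T \<zeta> W q b3 \<le> m'"
  proof (rule control_facts[OF pos cont(1) xi_nn \<phi>])
    show "0 \<le> m + e" using m e by simp
  next
    fix a s
    assume f: "mono_on {0..T} a" "mono_on {0..T} s" "mono_on {0..T} \<zeta>" "a 0 = 0" "s 0 = 0" "\<zeta> 0 = 0"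
      "\<And>t. t \<in> {0..T} \<Longrightarrow> \<xi> t = skorohod_map (\<lambda>r. x0 + a r - s r - \<zeta> r) t"
      "\<And>q b1 b2 b3. dual_cost T a (\<lambda>t. lam * t) q b1 + dual_cost T s (\<lambda>t. mu * t) q b2
         + dual_cost T \<zeta> (\<lambda>t. th * integral {0..t} \<xi>) q b3 \<le> m + e"
    show thesis by (rule that[OF f(1-7)]) (use f(8) in \<open>simp_all only: W_def[abs_def] m'_def\<close>)
  qed
  have Wincr: "incr T W q k = th * integral {tgrid T q k..tgrid T q (Suc k)} \<xi>" if "k < 2 ^ q" for q k
  proof -
    have l: "tgrid T q k \<in> {0..T}" "tgrid T q (Suc k) \<in> {0..T}" "tgrid T q k \<le> tgrid T q (Suc k)"
      using tgrid_mem[OF T] tgrid_mono[OF T] that by auto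
    have "\<xi> integrable_on {0..tgrid T q (Suc k)}"
      using l by (intro integrable_continuous_real continuous_on_subset[OF cont(1)]) auto
    then have "integral {0..tgrid T q k} \<xi> + integral {tgrid T q k..tgrid T q (Suc k)} \<xi> = integral {0..tgrid T q (Suc k)} \<xi>"
      using l by (intro Henstock_Kurzweil_Integration.integral_combine) auto
    then show ?thesis unfolding incr_def W_def by (simp add: right_diff_distrib[symmetric])
  qed
  have Wbound: "th * (T / 2 ^ q) * lo \<le> incr T W q k \<and> incr T W q k \<le> th * (T / 2 ^ q) * hi"
    if k: "k < 2 ^ q" and b: "\<And>t. t \<in> {tgrid T q k..tgrid T q (Suc k)} \<Longrightarrow> lo \<le> \<xi> t \<and> \<xi> t \<le> hi" for q k lo hi
  proof -
    let ?I = "{tgrid T q k..tgrid T q (Suc k)}"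
    have l: "?I \<subseteq> {0..T}" "tgrid T q k \<le> tgrid T q (Suc k)"
      using tgrid_mem[OF T, of k q] tgrid_mem[OF T, of "Suc k" q] tgrid_mono[OF T] k by auto
    have i: "\<xi> integrable_on ?I" using l by (intro integrable_continuous_real continuous_on_subset[OF cont(1)])
    have "integral ?I (\<lambda>_. lo) \<le> integral ?I \<xi>" "integral ?I \<xi> \<le> integral ?I (\<lambda>_. hi)"
      using b i by (intro integral_le; auto)+
    moreover have "integral ?I (\<lambda>_. v) = T / 2 ^ q * v" for v :: real using l by (simp add: tgrid_Suc)
    ultimately have "T / 2 ^ q * lo \<le> integral ?I \<xi>" "integral ?I \<xi> \<le> T / 2 ^ q * hi" by simp_all
    then show ?thesis unfolding Wincr[OF k] mult.assoc using pos by (intro conjI mult_left_mono) auto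
  qed
  have Wm: "mono_on {0..T} W"
  proof (rule mono_onI)
    fix u v assume uv: "u \<in> {0..T}" "v \<in> {0..T}" "u \<le> v"
    have "integral {0..u} \<xi> \<le> integral {0..v} \<xi>"
      using uv xi_nn by (intro integral_subset_le integrable_continuous_real continuous_on_subset[OF cont(1)]) auto
    then show "W u \<le> W v" unfolding W_def using pos by (intro mult_left_mono) auto
  qed
  have "bounded (\<xi> ` {0..T})" using cont by (intro compact_imp_bounded compact_continuous_image) auto
  then obtain V where V: "0 < V" "\<And>t. t \<in> {0..T} \<Longrightarrow> \<xi> t \<le> V" unfolding bounded_pos by (auto simp: abs_le_iff)
  have zT: "0 \<le> \<zeta> T" using mono_onD[OF as(3), of 0 T] as(6) T by simp
  \<comment> \<open>The relative loss of intensity allowed in a lower box; over the whole path it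
    costs at most \<open>\<rho> * \<zeta> T\<close>.\<close>
  define \<rho> where "\<rho> = e / (\<zeta> T + 1)"
  have \<rho>: "0 < \<rho>" "\<rho> * \<zeta> T \<le> e" using e zT by (auto simp: \<rho>_def field_simps)
  \<comment> \<open>The first bound keeps the path in the ball of radius \<open>r\<close>; the
    second limits the part of the strip cost that is due to \<open>2 * Z\<close> to
    \<open>e / 2\<close>.\<close>
  define Z where "Z = min (r / 12) (e / (4 * (th * T)))"
  have thT: "0 < th * T" using pos by simp
  have Z: "0 < Z" "Z \<le> r / 12" "th * T * Z \<le> e / 4"
  proof -
    show "0 < Z" "Z \<le> r / 12" using r e thT by (auto simp: Z_def)
    have "th * T * Z \<le> th * T * (e / (4 * (th * T)))" using thT by (intro mult_left_mono) (auto simp: Z_def)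
    also have "\<dots> = e / 4" using pos by simp
    finally show "th * T * Z \<le> e / 4" .
  qed
  \<comment> \<open>The slope to be tested on the cells below the threshold. With
    \<open>\<beta> * Z = m' + 1\<close> their reneging mass is at most \<open>Z\<close> once
    \<open>exp \<beta>\<close> times their weight is at most 1.\<close>
  define \<beta> where "\<beta> = (m' + 1) / Z"
  have \<beta>: "0 < \<beta>" "\<beta> * Z = m' + 1" using Z m' by (auto simp: \<beta>_def)
  \<comment> \<open>Makes \<open>\<delta> - 3 * \<eta>\<close> equal to
    \<open>4 * \<eta> / \<rho>\<close>: the intensity of a cell exceeds that of its lower box by at
    most \<open>4 * \<eta>\<close> in height, which is then a relative error of at most
    \<open>\<rho>\<close>.\<close>
  define c where "c = 3 + 4 / \<rho>"
  have c: "3 < c" using \<rho> by (simp add: c_def)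
  \<comment> \<open>The three bounds serve the ball around \<open>z\<close>, the cost of the strips,
    and the weight of the cells below the threshold when multiplied by
    \<open>exp \<beta>\<close>.\<close>
  define \<eta> where "\<eta> = min (r / 8) (min (e / (2 * (th * T * (c + 5)))) (1 / (exp \<beta> * (th * T * (c + 1)))))"
  have \<eta>: "0 < \<eta>" "\<eta> \<le> r / 8" "th * T * ((c + 5) * \<eta>) \<le> e / 2" "exp \<beta> * (th * T * ((c + 1) * \<eta>)) \<le> 1"
  proof -
    have p: "0 < th * T * (c + 5)" "0 < exp \<beta> * (th * T * (c + 1))" using thT c by (auto intro!: mult_pos_pos)
    have half: "y * (e / (2 * y)) = e / 2" and inv: "y * (1 / y) = 1" if "0 < y" for y :: real using that by simp_all
    show "0 < \<eta>" using r e p by (simp add: \<eta>_def)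
    show "\<eta> \<le> r / 8" unfolding \<eta>_def by (rule min.cobounded1)
    have "th * T * (c + 5) * \<eta> \<le> th * T * (c + 5) * (e / (2 * (th * T * (c + 5))))" using p by (intro mult_left_mono) (auto simp: \<eta>_def)
    also have "\<dots> = e / 2" by (rule half[OF p(1)])
    finally show "th * T * ((c + 5) * \<eta>) \<le> e / 2" by (simp only: mult.assoc)
    have "exp \<beta> * (th * T * (c + 1)) * \<eta> \<le> exp \<beta> * (th * T * (c + 1)) * (1 / (exp \<beta> * (th * T * (c + 1))))"
      using p by (intro mult_left_mono) (auto simp: \<eta>_def)
    also have "\<dots> = 1" by (rule inv[OF p(2)])
    finally show "exp \<beta> * (th * T * ((c + 1) * \<eta>)) \<le> 1" by (simp only: mult.assoc)
  qed
  define \<delta> where "\<delta> = c * \<eta>"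
  have \<delta>: "3 * \<eta> < \<delta>" "\<delta> - 3 * \<eta> = 4 * \<eta> / \<rho>" using c \<eta>(1) by (auto simp: \<delta>_def c_def algebra_simps)
  define \<kappa> where "\<kappa> = 2 * Z + \<eta>"
  define \<epsilon> where "\<epsilon> = \<eta> / 16"
  have \<epsilon>: "0 < \<epsilon>" using \<eta> by (simp add: \<epsilon>_def)
  have "uniformly_continuous_on {0..T} \<xi>" using cont by (intro compact_uniformly_continuous) auto
  then obtain d where d: "0 < d" "\<And>u v. u \<in> {0..T} \<Longrightarrow> v \<in> {0..T} \<Longrightarrow> \<bar>v - u\<bar> < d \<Longrightarrow> \<bar>\<xi> v - \<xi> u\<bar> < \<eta>"
    unfolding uniformly_continuous_on_def dist_real_def using \<eta>(1) by metis
  \<comment> \<open>A common bound for the three intensities, so that one grid level makes all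
    increments at most \<open>\<epsilon>\<close>.\<close>
  define v where "v = lam + mu + th * V"
  have v: "0 \<le> v" "lam \<le> v" "mu \<le> v" "th * V \<le> v" using pos V by (auto simp: v_def)
  obtain b q where b: "0 < b" "\<And>q'. q' \<ge> q \<Longrightarrow> m' + exp b * (v * (T / 2 ^ q')) \<le> b * \<epsilon>"
    using choose_level[OF \<epsilon> m' v(1) T] by blast
  have "(\<lambda>q. T / 2 ^ q) \<longlonglongrightarrow> 0" by real_asymp
  then have "\<forall>\<^sub>F q in sequentially. T / 2 ^ q < d" using d(1) by (rule order_tendstoD)
  then obtain q1 where q1: "\<And>q'. q' \<ge> q1 \<Longrightarrow> T / 2 ^ q' < d" unfolding eventually_sequentially by blast
  define p where "p = max q q1"
  have p: "m' + exp b * (v * (T / 2 ^ p)) \<le> b * \<epsilon>" "T / 2 ^ p < d" using b(2)[of p] q1[of p] by (auto simp: p_def)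
  have osc: "\<bar>\<xi> t - \<xi> (tgrid T p k)\<bar> \<le> \<eta>" if k: "k < 2 ^ p" and t: "t \<in> {tgrid T p k..tgrid T p (Suc k)}" for k t
  proof -
    have "tgrid T p k \<in> {0..T}" "tgrid T p (Suc k) \<in> {0..T}" using tgrid_mem[OF T] k by auto
    then have "\<bar>\<xi> t - \<xi> (tgrid T p k)\<bar> < \<eta>" using t p(2) by (intro d(2)) (auto simp: tgrid_Suc)
    then show ?thesis by simp
  qed
  have lin: "incr T (\<lambda>t. u * t) p k = u * (T / 2 ^ p)" for u k
    by (simp add: incr_def tgrid_Suc right_diff_distrib[symmetric])
  have small: "incr T F p k \<le> \<epsilon>"
    if k: "k < 2 ^ p" and D: "\<And>b. dual_cost T F U p b \<le> m'" and U: "0 \<le> incr T U p k" "incr T U p k \<le> v * (T / 2 ^ p)" for F U k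
  proof -
    have "b * incr T F p k - (exp b - 1) * incr T U p k \<le> m'"
      using D[of "\<lambda>j. if j = k then b else 0"] unfolding dual_cost_single[OF k] .
    moreover have "(exp b - 1) * incr T U p k \<le> exp b * (v * (T / 2 ^ p))" using U b(1) by (intro mult_mono) auto
    ultimately have "b * incr T F p k \<le> b * \<epsilon>" using p(1) by linarith
    then show ?thesis using b(1) by simp
  qed
  have sc: "0 \<le> u * (T / 2 ^ p)" "u * (T / 2 ^ p) \<le> v * (T / 2 ^ p)" if "0 < u" "u \<le> v" for u
    using that T by (auto intro: mult_right_mono divide_right_mono)
  have inc1: "incr T a p k \<le> \<epsilon>" if "k < 2 ^ p" for k
    using that dual[of p _ "\<lambda>_. 0" "\<lambda>_. 0"] sc[OF pos(1) v(2)] by (intro small[of k a "\<lambda>t. lam * t"]) (auto simp: lin)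
  have inc2: "incr T s p k \<le> \<epsilon>" if "k < 2 ^ p" for k
    using that dual[of p "\<lambda>_. 0" _ "\<lambda>_. 0"] sc[OF pos(2) v(3)] by (intro small[of k s "\<lambda>t. mu * t"]) (auto simp: lin)
  have inc3: "incr T \<zeta> p k \<le> \<epsilon>" if k: "k < 2 ^ p" for k
  proof (rule small[OF k, of \<zeta> W])
    show "dual_cost T \<zeta> W p b \<le> m'" for b using dual[of p "\<lambda>_. 0" "\<lambda>_. 0" b] by simp
    show "0 \<le> incr T W p k" by (rule incr_nonneg[OF Wm T k])
    have "incr T W p k \<le> th * (T / 2 ^ p) * V"
      using Wbound[OF k, of 0 V] xi_nn V(2) tgrid_mem[OF T, of k p] tgrid_mem[OF T, of "Suc k" p] k by auto
    also have "\<dots> = th * V * (T / 2 ^ p)" by simp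
    also have "\<dots> \<le> v * (T / 2 ^ p)" using v(4) T by (intro mult_right_mono) auto
    finally show "incr T W p k \<le> v * (T / 2 ^ p)" .
  qed
  let ?big = "\<lambda>k. \<delta> \<le> \<xi> (tgrid T p k)"
  have Wk: "th * (T / 2 ^ p) * (\<xi> (tgrid T p k) - \<eta>) \<le> incr T W p k \<and> incr T W p k \<le> th * (T / 2 ^ p) * (\<xi> (tgrid T p k) + \<eta>)" if k: "k < 2 ^ p" for k
    using osc[OF k] by (intro Wbound[OF k]) (auto simp: abs_le_iff algebra_simps)
  have hp: "0 < th * (T / 2 ^ p)" using pos by simp
  \<comment> \<open>Where the target is below \<open>\<delta> = c * \<eta>\<close> at the grid
    point, the reneging weight is tiny. Finite cost, tested with slope \<open>\<beta>\<close> on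
    these cells, shows that the target itself has little reneging there.\<close>
  have Zsum: "(\<Sum>k<2 ^ p. if ?big k then 0 else incr T \<zeta> p k) \<le> Z"
  proof -
    define b3 where "b3 k = (if ?big k then 0 else \<beta>)" for k
    have "\<beta> * (\<Sum>k<2 ^ p. if ?big k then 0 else incr T \<zeta> p k) = dual_cost T \<zeta> W p b3 + (\<Sum>k<2 ^ p. (exp (b3 k) - 1) * incr T W p k)"
      unfolding dual_cost_def sum.distrib[symmetric] sum_distrib_left by (intro sum.cong refl) (simp add: b3_def)
    also have "(\<Sum>k<2 ^ p. (exp (b3 k) - 1) * incr T W p k) \<le> (\<Sum>k<(2::nat) ^ p. exp \<beta> * (th * (T / 2 ^ p) * ((c + 1) * \<eta>)))"
    proof (intro sum_mono)
      fix k :: nat assume "k \<in> {..<2 ^ p}"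
      then have k: "k < 2 ^ p" by simp
      have W0: "0 \<le> incr T W p k" by (rule incr_nonneg[OF Wm T k])
      show "(exp (b3 k) - 1) * incr T W p k \<le> exp \<beta> * (th * (T / 2 ^ p) * ((c + 1) * \<eta>))"
      proof (cases "?big k")
        case True
        have "0 \<le> exp \<beta> * (th * (T / 2 ^ p) * ((c + 1) * \<eta>))" using pos c \<eta>(1) by (intro mult_nonneg_nonneg) auto
        then show ?thesis using True by (simp only: b3_def if_True exp_zero diff_self mult_zero_left)
      next
        case False
        have "\<xi> (tgrid T p k) + \<eta> \<le> (c + 1) * \<eta>" using False by (simp add: \<delta>_def algebra_simps)
        then have "th * (T / 2 ^ p) * (\<xi> (tgrid T p k) + \<eta>) \<le> th * (T / 2 ^ p) * ((c + 1) * \<eta>)" using hp by (intro mult_left_mono) auto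
        then have "incr T W p k \<le> th * (T / 2 ^ p) * ((c + 1) * \<eta>)" using Wk[OF k] by linarith
        then have "exp \<beta> * incr T W p k \<le> exp \<beta> * (th * (T / 2 ^ p) * ((c + 1) * \<eta>))" by (intro mult_left_mono) auto
        moreover have "(exp (b3 k) - 1) * incr T W p k \<le> exp \<beta> * incr T W p k"
          using False W0 by (intro mult_right_mono) (auto simp: b3_def)
        ultimately show ?thesis by (rule order_trans[rotated])
      qed
    qed
    also have "\<dots> = exp \<beta> * (th * T * ((c + 1) * \<eta>))" by simp
    finally have "\<beta> * (\<Sum>k<2 ^ p. if ?big k then 0 else incr T \<zeta> p k) \<le> \<beta> * Z"
      using dual[of p "\<lambda>_. 0" "\<lambda>_. 0" b3] \<eta>(4) \<beta>(2) by simp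
    then show ?thesis using \<beta>(1) by simp
  qed
  have GZ: "z' \<in> G" if z': "z' \<in> cadlag_space T ({0..} \<times> {0..})"
    and cl: "\<And>t. t \<in> {0..T} \<Longrightarrow> \<xi> t - \<eta> \<le> fst (z' t) \<and> fst (z' t) \<le> \<xi> t + \<kappa> \<and> \<bar>snd (z' t) - \<zeta> t\<bar> \<le> \<eta> + Z" for z'
  proof -
    have "skorohod_dist T z z' \<le> r / 2"
    proof (rule skorohod_dist_le)
      fix t assume t: "t \<in> {0..T}"
      have "dist (z t) (z' t) = dist (\<xi> t, \<zeta> t) (fst (z' t), snd (z' t))" by (simp add: \<xi>_def \<zeta>_def)
      also have "\<dots> \<le> \<bar>\<xi> t - fst (z' t)\<bar> + \<bar>\<zeta> t - snd (z' t)\<bar>" by (rule dist_pair_le)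
      also have "\<dots> \<le> \<kappa> + (\<eta> + Z)" using cl[OF t] Z(1) unfolding \<kappa>_def by linarith
      also have "\<dots> \<le> r / 2" using Z(2) \<eta>(2) unfolding \<kappa>_def by linarith
      finally show "dist (z t) (z' t) \<le> r / 2" .
    qed (use r in simp)
    then have "z' \<in> S.mball z r" using zc z' r by (simp add: S.in_mball)
    then show ?thesis using r by blast
  qed
  have core: "ereal (- ((\<Sum>k<2 ^ p. relent (incr T a p k) (lam * (T / 2 ^ p))) + (\<Sum>k<2 ^ p. relent (incr T s p k) (mu * (T / 2 ^ p)))
     + (\<Sum>k<2 ^ p. if ?big k then relent (incr T \<zeta> p k) (th * (T / 2 ^ p) * (\<xi> (tgrid T p k) - 3 * \<eta>)) else 0)
     + (\<Sum>k<2 ^ p. th * (T / 2 ^ p) * (if ?big k then 4 * \<eta> + \<kappa> else \<xi> (tgrid T p k) + \<eta> + \<kappa>))))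
     \<le> liminf (\<lambda>n. ereal (1 / real n) * elog (measure (M n) {\<omega> \<in> space (M n). qpath n \<omega> \<in> G}))"
    by (rule lower_core[OF \<eta>(1) _ \<delta>(1) _ _ _ as(1-6) cont(1) xi_nn xi_eq osc inc1 inc2 inc3 Zsum G GZ])
      (use \<epsilon> Z \<eta> in \<open>auto simp: \<kappa>_def \<epsilon>_def\<close>)
  have cost1: "(\<Sum>k<2 ^ p. relent (incr T a p k) (lam * (T / 2 ^ p))) + (\<Sum>k<2 ^ p. relent (incr T s p k) (mu * (T / 2 ^ p)))
     + (\<Sum>k<2 ^ p. if ?big k then relent (incr T \<zeta> p k) (th * (T / 2 ^ p) * (\<xi> (tgrid T p k) - 3 * \<eta>)) else 0) \<le> m' + \<rho> * \<zeta> T + e"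
  proof (rule cell_cost_le[OF pos as(1-3) as(6) dual _ _ Wm e])
    fix k assume k: "k < (2::nat) ^ p" and big: "?big k"
    let ?h = "th * (T / 2 ^ p)" and ?x = "\<xi> (tgrid T p k)"
    have g0: "0 < ?x - 3 * \<eta>" using big \<delta> by simp
    have "4 * \<eta> / \<rho> \<le> ?x - 3 * \<eta>" using big \<delta>(2) by simp
    then have x: "4 * \<eta> \<le> \<rho> * (?x - 3 * \<eta>)" using \<rho>(1) by (simp add: field_simps)
    have arith: "0 < u \<and> u \<le> i \<and> i - u \<le> q"
      if "u \<le> v" "w - u = f" "f \<le> g" "g = q" "v \<le> i \<and> i \<le> w" "0 < u" for u v w f g q i :: real
      using that by linarith
    have "?h * (?x - 3 * \<eta>) \<le> ?h * (?x - \<eta>)" using hp \<eta>(1) by (intro mult_left_mono) auto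
    moreover have "?h * (?x + \<eta>) - ?h * (?x - 3 * \<eta>) = ?h * (4 * \<eta>)" unfolding right_diff_distrib[symmetric] by simp
    moreover have "?h * (4 * \<eta>) \<le> ?h * (\<rho> * (?x - 3 * \<eta>))" using x hp by (intro mult_left_mono) auto
    moreover have "?h * (\<rho> * (?x - 3 * \<eta>)) = \<rho> * (?h * (?x - 3 * \<eta>))" by (rule mult.left_commute)
    ultimately show "0 < ?h * (?x - 3 * \<eta>) \<and> ?h * (?x - 3 * \<eta>) \<le> incr T W p k \<and> incr T W p k - ?h * (?x - 3 * \<eta>) \<le> \<rho> * (?h * (?x - 3 * \<eta>))"
      using Wk[OF k] mult_pos_pos[OF hp g0] by (rule arith)
  qed (use \<rho> in simp)
  have cost2: "(\<Sum>k<2 ^ p. th * (T / 2 ^ p) * (if ?big k then 4 * \<eta> + \<kappa> else \<xi> (tgrid T p k) + \<eta> + \<kappa>)) \<le> e"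
  proof -
    have "(\<Sum>k<2 ^ p. th * (T / 2 ^ p) * (if ?big k then 4 * \<eta> + \<kappa> else \<xi> (tgrid T p k) + \<eta> + \<kappa>)) \<le> (\<Sum>k<(2::nat) ^ p. th * (T / 2 ^ p) * ((c + 5) * \<eta> + 2 * Z))"
    proof (intro sum_mono mult_left_mono)
      fix k
      have "0 \<le> c * \<eta>" using c \<eta>(1) by simp
      then show "(if ?big k then 4 * \<eta> + \<kappa> else \<xi> (tgrid T p k) + \<eta> + \<kappa>) \<le> (c + 5) * \<eta> + 2 * Z"
        using \<eta>(1) by (auto simp: \<kappa>_def \<delta>_def distrib_right)
    qed (use hp in simp)
    also have "\<dots> = th * T * ((c + 5) * \<eta>) + 2 * (th * T * Z)" by (simp add: algebra_simps)
    also have "\<dots> \<le> e" using \<eta>(3) Z(3) by linarith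
    finally show ?thesis .
  qed
  have "ereal (- (m + 4 * e)) \<le> ereal (- ((\<Sum>k<2 ^ p. relent (incr T a p k) (lam * (T / 2 ^ p))) + (\<Sum>k<2 ^ p. relent (incr T s p k) (mu * (T / 2 ^ p)))
     + (\<Sum>k<2 ^ p. if ?big k then relent (incr T \<zeta> p k) (th * (T / 2 ^ p) * (\<xi> (tgrid T p k) - 3 * \<eta>)) else 0)
     + (\<Sum>k<2 ^ p. th * (T / 2 ^ p) * (if ?big k then 4 * \<eta> + \<kappa> else \<xi> (tgrid T p k) + \<eta> + \<kappa>))))"
    unfolding ereal_less_eq using cost1 cost2 \<rho>(2) unfolding m'_def by linarith
  then show ?thesis using core by (rule order_trans)
qed

theorem ldp_lower:
  assumes G: "openin (skorohod_topology T ({0..} \<times> {0..})) G"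
  shows "- (INF z\<in>G. enn2ereal (mm1m_rate lam mu th x0 T z))
     \<le> liminf (\<lambda>n. ereal (1 / real n) * elog (measure (M n) {\<omega> \<in> space (M n). qpath n \<omega> \<in> G}))" (is "_ \<le> ?L")
proof -
  have "- ?L \<le> enn2ereal (mm1m_rate lam mu th x0 T z)" if z: "z \<in> G" for z
  proof (cases "mm1m_rate lam mu th x0 T z")
    case (real m)
    have "- ereal m \<le> ?L"
    proof (rule ereal_le_epsilon2)
      fix e :: real assume e: "0 < e"
      have "ereal (- (m + 4 * (e / 4))) \<le> ?L" using real e by (intro lower_at[OF G z]) auto
      then have "ereal (- m - e) \<le> ?L" by simp
      then have "ereal (- m - e) + ereal e \<le> ?L + ereal e" by (rule add_right_mono)
      then show "- ereal m \<le> ?L + ereal e" by simp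
    qed
    then have "- ?L \<le> ereal m" by (rule ereal_uminus_le_reorder[THEN iffD1])
    then show ?thesis using real by (simp add: enn2ereal_ennreal)
  qed simp
  then have "- ?L \<le> (INF z\<in>G. enn2ereal (mm1m_rate lam mu th x0 T z))" by (rule INF_greatest)
  then show ?thesis by (rule ereal_uminus_le_reorder[THEN iffD1])
qed

end

theorem theorem2p1:
  fixes lam mu th T x0 :: real
    and x :: "nat \<Rightarrow> real"
    and M :: "nat \<Rightarrow> 'w measure"
    and N1 N2 :: "nat \<Rightarrow> 'w \<Rightarrow> real measure"
    and N3 :: "nat \<Rightarrow> 'w \<Rightarrow> (real \<times> real) measure"
    and X Y :: "nat \<Rightarrow> 'w \<Rightarrow> real \<Rightarrow> real"
  assumes "0 < lam" "0 < mu" "0 < th" "0 < T"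
    and "\<And>n. 0 < n \<Longrightarrow> 0 \<le> x n \<and> real n * x n \<in> \<nat>"
    and "x \<longlonglongrightarrow> x0"
    and "\<And>n. 0 < n \<Longrightarrow> prob_space (M n)"
    and "\<And>n. 0 < n \<Longrightarrow> mm1m_noise (M n) lam mu th T n (N1 n) (N2 n) (N3 n)"
    and "\<And>n. 0 < n \<Longrightarrow>
           (\<lambda>\<omega>. path_pair T (X n \<omega>) (Y n \<omega>)) \<in> M n \<rightarrow>\<^sub>M borel_of (skorohod_topology T ({0..} \<times> {0..}))"
    and "\<And>n. 0 < n \<Longrightarrow>
           AE \<omega> in M n. mm1m_equations T n (x n) (N1 n \<omega>) (N2 n \<omega>) (N3 n \<omega>) (X n \<omega>) (Y n \<omega>)"
  shows "large_deviation_principle (skorohod_topology T ({0..} \<times> {0..})) M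
           (\<lambda>n \<omega>. path_pair T (X n \<omega>) (Y n \<omega>)) (mm1m_rate lam mu th x0 T)"
proof -
  interpret mm1m_system lam mu th T x0 x M N1 N2 N3 X Y
  proof (rule mm1m_system.intro)
    show "0 \<le> x n" if "0 < n" for n using assms(5)[OF that] by (rule conjunct1)
  qed (fact assms)+
  show ?thesis
    unfolding large_deviation_principle_def
    by (intro conjI allI impI rate_function_mm1m[OF pos x0_nonneg] ldp_upper[unfolded qpath_def] ldp_lower[unfolded qpath_def])
qed

end
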